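(* Let $\mathcal B=(B_g)_{g\in G}$ be a unital crossed product bundle over a discrete group $G$ with unitary section $u$ and associated twisted action $(\alpha,\sigma)$ of $G$ on $B_e$. Assume that $\mathcal B$ is $C^*$-amenable and that there exists an $\alpha$-invariant state $\psi$ on $B_e$ such that $(B_e,\psi)$ has the Haagerup property. Then $G$ is amenable, $(\mathcal B,\psi)$ has the Haagerup property and $(C_r^*(\mathcal B),\psi\circ E_e)$ has the Haagerup property.
   Context: **Fell bundles.** A Fell bundle $\mathcal B=(B_g)_{g\in G}$ over a discrete group $G$ (with unit $e$) is a family of Banach spaces (their disjoint union is also denoted $\mathcal B$) with an associative multiplication $\mathcal B\times\mathcal B\to\mathcal B$ such that $B_gB_h\subseteq B_{gh}$, bilinear on each $B_g\times B_h$, $\|ab\|\le\|a\|\|b\|$, and an involutive anti-multiplicative map $b\mapsto b^*$ which is conjugate-linear and isometric from $B_g$ onto $B_{g^{-1}}$, such that $\|b^*b\|=\|b\|^2$ and $b^*b\ge 0$ in the $C^*$-algebra $B_e$ for all $b\in\mathcal B$. $\mathcal B$ is unital if $B_e$ is unital. **Crossed product bundles.** A unital Fell bundle $\mathcal B$ over $G$ is a (unital, twisted) crossed product bundle if there is a section $u:G\to\mathcal B$ ($u(g)\in B_g$) which is unitary: $u(g)u(g)^*=u(g)^*u(g)=1_{B_e}$ for all $g$; one takes $u(e)=1_{B_e}$. The associated twisted action $(\alpha,\sigma)$ of $G$ on $B_e$ is $\alpha_g(b)=u(g)bu(g)^*$ ($b\in B_e$), $\sigma(g,h)=u(g)u(h)u(gh)^*\in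 B_e$. A state $\psi$ on $B_e$ is $\alpha$-invariant if $\psi\circ\alpha_g=\psi$ for all $g\in G$. **$C^*$-amenability.** $\mathcal B$ is $C^*$-amenable if it has Exel's approximation property: there is a net $\{\xi_i\}_{i\in I}$ of finitely supported functions $G\to B_e$ such that $\sup_i\|\sum_{h\in G}\xi_i(h)^*\xi_i(h)\|<\infty$ and $\lim_i\|\sum_{h\in G}\xi_i(gh)^*b\,\xi_i(h)-b\|=0$ for every $g\in G$, $b\in B_g$. **Reduced cross-sectional algebra.** $C_c(\mathcal B)$ is the space of finitely supported sections of $\mathcal B$; $\ell^2(\mathcal B)$ is the right Hilbert $B_e$-module completion of $C_c(\mathcal B)$ for $\langle\xi,\eta\rangle_{B_e}=\sum_g\xi(g)^*\eta(g)$, $(\xi\cdot b)(g)=\xi(g)b$. For $b\in B_g$, $\lambda_g^{\mathcal B}(b)$ is the adjointable operator on $\ell^2(\mathcal B)$ with $(\lambda^{\mathcal B}_g(b)\xi)(h)=b\,\xi(g^{-1}h)$. $C_r^*(\mathcal B)$ is the $C^*$-algebra generated by all $\lambda_g^{\mathcal B}(b)$, $g\in G$, $b\in B_g$. $B_e$ is identified with $\lambda_e^{\mathcal B}(B_e)$, and $E_e:C_r^*(\mathcal B)\to B_e$ is the faithful conditional expectation satisfying $E_e(\lambda_g^{\mathcal B}(b))=b$ if $g=e$ and $=0$ if $g\ne e$. **Bundle maps.** A $\mathcal B$-bundle map is a family $T=(T_g)_{g\in G}$ of bounded linear maps $T_g:B_g\to B_g$. It is positive definite if $\sum_{i,j=1}^n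 b_i\,T_{g_i^{-1}g_j}(a_i^*a_j)\,b_j^*\ge 0$ in $B_e$ for all $n\in\mathbb N$, $g_1,\dots,g_n\in G$ and $a_i,b_i\in B_{g_i}$. **Haagerup property of $(\mathcal B,\psi)$.** For $g\in G$, $\|b\|_{g,\psi}:=\psi(b^*b)^{1/2}$ for $b\in B_g$, $N_{g,\psi}=\{b\in B_g:\psi(b^*b)=0\}$, and $H_{g,\psi}$ is the Hilbert space completion of $B_g/N_{g,\psi}$ for the inner product induced by $\langle b,c\rangle=\psi(b^*c)$. If $T$ is a positive definite $\mathcal B$-bundle map with $\psi\circ T_e\le M\psi$ (on positive elements) for some $M>0$, then for each $g$ the assignment $b+N_{g,\psi}\mapsto T_g(b)+N_{g,\psi}$ extends to a bounded operator $\widetilde{T_g}$ on $H_{g,\psi}$; $T$ is compact w.r.t. $\psi$ if every $\widetilde{T_g}$ is a compact operator. The pair $(\mathcal B,\psi)$ has the Haagerup property if there is a net $\{T^i\}_{i\in I}$ of positive definite $\mathcal B$-bundle maps such that: (i) $T^i_e$ is contractive and $\psi\circ T^i_e\le\psi$ for every $i$; (ii) $T^i$ is compact w.r.t. $\psi$ for every $i$; (iii) $g\mapsto\|\widetilde{T^i_g}\|$ vanishes at infinity on $G$ for each $i$; (iv) $\lim_i\|T_g^i(b)-b\|_{g,\psi}=0$ for every $g\in G$, $b\in B_g$. **Haagerup property of $(A,\varphi)$.** Let $\varphi$ be a state on a $C^*$-algebra $A$, $H_\varphi$ its GNS Hilbert space (completion of $A/\{a:\varphi(a^*a)=0\}$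 for $\langle a,b\rangle=\varphi(a^*b)$), $[a]_\varphi$ the class of $a$. For a contractive completely positive $\Phi:A\to A$ with $\varphi\circ\Phi\le\varphi$, $S_\Phi$ is the contraction on $H_\varphi$ with $S_\Phi[a]_\varphi=[\Phi(a)]_\varphi$. $(A,\varphi)$ has the Haagerup property if there is a net $\{\Phi_i\}$ of contractive completely positive maps on $A$ with (a) $\varphi\circ\Phi_i\le\varphi$; (b) each $S_{\Phi_i}$ is compact; (c) $S_{\Phi_i}\to I$ in the strong operator topology. *)

theory Defs
  imports
    "HOL-Analysis.Abstract_Metric_Spaces"
    "HOL-Algebra.Module"
begin

section \<open>Complex normed spaces on carrier sets\<close>

text \<open>The fibres of a Fell bundle form a dependent family of Banach spaces, and the reduced
  algebra depends on the bundle. All spaces are therefore records with an explicit carrier that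
  extend the modules of HOL-Algebra (whose fields \<open>mult\<close> and \<open>one\<close> are irrelevant for a
  mere module).\<close>

definition complex_field :: "complex ring" where
  "complex_field = \<lparr>carrier = UNIV, mult = (*), one = 1, zero = 0, add = (+)\<rparr>"

record 'a cnormed = "(complex, 'a) module" +
  nrm :: "'a \<Rightarrow> real" (\<open>\<parallel>_\<parallel>\<index>\<close>)

text \<open>The totalisation by 0 outside the carrier makes this a metric in the sense of
  \<^locale>\<open>Metric_space\<close>, which constrains the distance function on the whole type.\<close>

definition ndist :: "('a, 'm) cnormed_scheme \<Rightarrow> 'a \<Rightarrow> 'a \<Rightarrow> real" where
  "ndist V x y = (if x \<in> carrier V \<and> y \<in> carrier V then \<parallel>x \<ominus>\<^bsub>V\<^esub> y\<parallel>\<^bsub>V\<^esub> else 0)"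

definition cauchy_seqs :: "('a, 'm) cnormed_scheme \<Rightarrow> (nat \<Rightarrow> 'a) set" where
  "cauchy_seqs V = {x. (\<forall>n. x n \<in> carrier V) \<and>
     (\<forall>\<epsilon>>0. \<exists>N. \<forall>m\<ge>N. \<forall>n\<ge>N. ndist V (x m) (x n) < \<epsilon>)}"

locale banach_space = module complex_field V for V :: "('a, 'm) cnormed_scheme" (structure) +
  assumes nrm_eq_0: "x \<in> carrier V \<Longrightarrow> \<parallel>x\<parallel> = 0 \<longleftrightarrow> x = \<zero>"
    and nrm_triangle: "\<lbrakk>x \<in> carrier V; y \<in> carrier V\<rbrakk> \<Longrightarrow> \<parallel>x \<oplus> y\<parallel> \<le> \<parallel>x\<parallel> + \<parallel>y\<parallel>"
    and nrm_smult: "x \<in> carrier V \<Longrightarrow> \<parallel>c \<odot> x\<parallel> = cmod c * \<parallel>x\<parallel>"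
    and complete: "s \<in> cauchy_seqs V \<Longrightarrow>
      \<exists>l\<in>carrier V. (\<lambda>n. ndist V (s n) l) \<longlonglongrightarrow> 0"

definition clinear_map ::
    "('a, 'm) cnormed_scheme \<Rightarrow> ('b, 'k) cnormed_scheme \<Rightarrow> ('a \<Rightarrow> 'b) \<Rightarrow> bool" where
  "clinear_map V W f \<longleftrightarrow> f \<in> carrier V \<rightarrow> carrier W \<and>
     (\<forall>x\<in>carrier V. \<forall>y\<in>carrier V. f (x \<oplus>\<^bsub>V\<^esub> y) = f x \<oplus>\<^bsub>W\<^esub> f y) \<and>
     (\<forall>c. \<forall>x\<in>carrier V. f (c \<odot>\<^bsub>V\<^esub> x) = c \<odot>\<^bsub>W\<^esub> f x)"

definition bounded_map ::
    "('a, 'm) cnormed_scheme \<Rightarrow> ('b, 'k) cnormed_scheme \<Rightarrow> ('a \<Rightarrow> 'b) \<Rightarrow> bool" where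
  "bounded_map V W f \<longleftrightarrow> (\<exists>C. \<forall>x\<in>carrier V. \<parallel>f x\<parallel>\<^bsub>W\<^esub> \<le> C * \<parallel>x\<parallel>\<^bsub>V\<^esub>)"

definition contractive_map ::
    "('a, 'm) cnormed_scheme \<Rightarrow> ('b, 'k) cnormed_scheme \<Rightarrow> ('a \<Rightarrow> 'b) \<Rightarrow> bool" where
  "contractive_map V W f \<longleftrightarrow> (\<forall>x\<in>carrier V. \<parallel>f x\<parallel>\<^bsub>W\<^esub> \<le> \<parallel>x\<parallel>\<^bsub>V\<^esub>)"

definition op_norm :: "('a, 'm) cnormed_scheme \<Rightarrow> ('a \<Rightarrow> 'a) \<Rightarrow> real" where
  "op_norm V T = (SUP x\<in>{x \<in> carrier V. \<parallel>x\<parallel>\<^bsub>V\<^esub> \<le> 1}. \<parallel>T x\<parallel>\<^bsub>V\<^esub>)"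

definition norm_topology :: "('a, 'm) cnormed_scheme \<Rightarrow> 'a topology" where
  "norm_topology V = Metric_space.mtopology (carrier V) (ndist V)"

definition compact_op :: "('a, 'm) cnormed_scheme \<Rightarrow> ('a \<Rightarrow> 'a) \<Rightarrow> bool" where
  "compact_op V T \<longleftrightarrow> compactin (norm_topology V)
     (norm_topology V closure_of (T ` {x \<in> carrier V. \<parallel>x\<parallel>\<^bsub>V\<^esub> \<le> 1}))"

subsection \<open>Completion of a seminormed space\<close>

text \<open>Cauchy sequences modulo sequences tending to 0 in seminorm. If \<open>nrm\<close> is only a seminorm
  with null space \<open>N\<close>, this is the completion of the quotient by \<open>N\<close>.\<close>

definition seq_class :: "('a, 'm) cnormed_scheme \<Rightarrow> (nat \<Rightarrow> 'a) \<Rightarrow> (nat \<Rightarrow> 'a) set" where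
  "seq_class V x = {y \<in> cauchy_seqs V. (\<lambda>n. ndist V (x n) (y n)) \<longlonglongrightarrow> 0}"

definition rep :: "(nat \<Rightarrow> 'a) set \<Rightarrow> nat \<Rightarrow> 'a" where
  "rep X = (SOME x. x \<in> X)"

definition completion :: "('a, 'm) cnormed_scheme \<Rightarrow> (nat \<Rightarrow> 'a) set cnormed" where
  "completion V = \<lparr>carrier = seq_class V ` cauchy_seqs V,
     mult = undefined, one = undefined,
     zero = seq_class V (\<lambda>n. \<zero>\<^bsub>V\<^esub>),
     add = (\<lambda>X Y. seq_class V (\<lambda>n. rep X n \<oplus>\<^bsub>V\<^esub> rep Y n)),
     smult = (\<lambda>c X. seq_class V (\<lambda>n. c \<odot>\<^bsub>V\<^esub> rep X n)),
     nrm = (\<lambda>X. lim (\<lambda>n. \<parallel>rep X n\<parallel>\<^bsub>V\<^esub>))\<rparr>"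

text \<open>The continuous extension of a bounded linear map to the completion.\<close>

definition ext_op ::
    "('a, 'm) cnormed_scheme \<Rightarrow> ('a \<Rightarrow> 'a) \<Rightarrow> (nat \<Rightarrow> 'a) set \<Rightarrow> (nat \<Rightarrow> 'a) set" where
  "ext_op V T = (\<lambda>X\<in>carrier (completion V). seq_class V (\<lambda>n. T (rep X n)))"

section \<open>C*-algebras\<close>

record 'a cstar = "'a cnormed" +
  star :: "'a \<Rightarrow> 'a"

definition positive :: "('a, 'm) cstar_scheme \<Rightarrow> 'a \<Rightarrow> bool" where
  "positive A a \<longleftrightarrow> (\<exists>c\<in>carrier A. a = star A c \<otimes>\<^bsub>A\<^esub> c)"

text \<open>\<open>a\<close> is of the form \<open>c\<^sup>* c\<close> in the C*-algebra of \<open>n \<times> n\<close> matrices over \<open>A\<close>.\<close>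

definition mat_positive :: "('a, 'm) cstar_scheme \<Rightarrow> nat \<Rightarrow> (nat \<Rightarrow> nat \<Rightarrow> 'a) \<Rightarrow> bool" where
  "mat_positive A n a \<longleftrightarrow> (\<exists>c. (\<forall>i<n. \<forall>j<n. c i j \<in> carrier A) \<and>
     (\<forall>i<n. \<forall>j<n. a i j = (\<Oplus>\<^bsub>A\<^esub>k\<in>{..<n}. star A (c k i) \<otimes>\<^bsub>A\<^esub> c k j)))"

definition completely_positive :: "('a, 'm) cstar_scheme \<Rightarrow> ('a \<Rightarrow> 'a) \<Rightarrow> bool" where
  "completely_positive A \<Phi> \<longleftrightarrow> clinear_map A A \<Phi> \<and>
     (\<forall>n a. mat_positive A n a \<longrightarrow> mat_positive A n (\<lambda>i j. \<Phi> (a i j)))"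

definition state :: "('a, 'm) cstar_scheme \<Rightarrow> ('a \<Rightarrow> complex) \<Rightarrow> bool" where
  "state A \<phi> \<longleftrightarrow>
     (\<forall>x\<in>carrier A. \<forall>y\<in>carrier A. \<phi> (x \<oplus>\<^bsub>A\<^esub> y) = \<phi> x + \<phi> y) \<and>
     (\<forall>c. \<forall>x\<in>carrier A. \<phi> (c \<odot>\<^bsub>A\<^esub> x) = c * \<phi> x) \<and>
     (\<forall>x\<in>carrier A. positive A x \<longrightarrow> Im (\<phi> x) = 0 \<and> Re (\<phi> x) \<ge> 0) \<and>
     (\<exists>C. \<forall>x\<in>carrier A. cmod (\<phi> x) \<le> C * \<parallel>x\<parallel>\<^bsub>A\<^esub>) \<and>
     (SUP x\<in>{x \<in> carrier A. \<parallel>x\<parallel>\<^bsub>A\<^esub> \<le> 1}. cmod (\<phi> x)) = 1"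

definition closed_star_subalgebra :: "('a, 'm) cstar_scheme \<Rightarrow> 'a set \<Rightarrow> bool" where
  "closed_star_subalgebra A S \<longleftrightarrow> S \<subseteq> carrier A \<and> \<zero>\<^bsub>A\<^esub> \<in> S \<and>
     (\<forall>x\<in>S. \<forall>y\<in>S. x \<oplus>\<^bsub>A\<^esub> y \<in> S \<and> x \<otimes>\<^bsub>A\<^esub> y \<in> S) \<and>
     (\<forall>c. \<forall>x\<in>S. c \<odot>\<^bsub>A\<^esub> x \<in> S) \<and> (\<forall>x\<in>S. star A x \<in> S) \<and>
     (\<forall>x l. (\<forall>n. x n \<in> S) \<and> l \<in> carrier A \<and> (\<lambda>n. ndist A (x n) l) \<longlonglongrightarrow> 0 \<longrightarrow> l \<in> S)"

definition generated_cstar :: "('a, 'm) cstar_scheme \<Rightarrow> 'a set \<Rightarrow> ('a, 'm) cstar_scheme" where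
  "generated_cstar A X = A\<lparr>carrier := \<Inter>{S. X \<subseteq> S \<and> closed_star_subalgebra A S}\<rparr>"

text \<open>\<open>D\<close> is regarded as a subalgebra of \<open>A\<close> via the embedding \<open>\<iota>\<close>.\<close>

definition faithful_cond_exp ::
    "('a, 'm) cstar_scheme \<Rightarrow> ('b, 'k) cstar_scheme \<Rightarrow> ('b \<Rightarrow> 'a) \<Rightarrow> ('a \<Rightarrow> 'b) \<Rightarrow> bool" where
  "faithful_cond_exp A D \<iota> E \<longleftrightarrow> clinear_map A D E \<and> contractive_map A D E \<and>
     (\<forall>x\<in>carrier A. positive A x \<longrightarrow> positive D (E x)) \<and>
     (\<forall>b\<in>carrier D. E (\<iota> b) = b) \<and>
     (\<forall>b\<in>carrier D. \<forall>c\<in>carrier D. \<forall>x\<in>carrier A.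
        E (\<iota> b \<otimes>\<^bsub>A\<^esub> x \<otimes>\<^bsub>A\<^esub> \<iota> c) = b \<otimes>\<^bsub>D\<^esub> E x \<otimes>\<^bsub>D\<^esub> c) \<and>
     (\<forall>x\<in>carrier A. E (star A x \<otimes>\<^bsub>A\<^esub> x) = \<zero>\<^bsub>D\<^esub> \<longrightarrow> x = \<zero>\<^bsub>A\<^esub>)"

subsection \<open>The Haagerup property of a C*-algebra with a state\<close>

definition gns_seminormed :: "('a, 'm) cstar_scheme \<Rightarrow> ('a \<Rightarrow> complex) \<Rightarrow> ('a, 'm) cstar_scheme" where
  "gns_seminormed A \<phi> = A\<lparr>nrm := (\<lambda>a. sqrt (Re (\<phi> (star A a \<otimes>\<^bsub>A\<^esub> a))))\<rparr>"

definition gns_space :: "('a, 'm) cstar_scheme \<Rightarrow> ('a \<Rightarrow> complex) \<Rightarrow> (nat \<Rightarrow> 'a) set cnormed" where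
  "gns_space A \<phi> = completion (gns_seminormed A \<phi>)"

definition gns_op :: "('a, 'm) cstar_scheme \<Rightarrow> ('a \<Rightarrow> complex) \<Rightarrow> ('a \<Rightarrow> 'a) \<Rightarrow>
    (nat \<Rightarrow> 'a) set \<Rightarrow> (nat \<Rightarrow> 'a) set" where
  "gns_op A \<phi> \<Phi> = ext_op (gns_seminormed A \<phi>) \<Phi>"

text \<open>Here and below, a net of maps is represented by a proper filter \<open>F\<close> on the set of maps:
  a net gives the filter generated by its tails, and every proper filter is the tail filter of
  some net. A property of all members of the net becomes a property holding eventually in \<open>F\<close>.\<close>

definition cstar_haagerup :: "('a, 'm) cstar_scheme \<Rightarrow> ('a \<Rightarrow> complex) \<Rightarrow> bool" where
  "cstar_haagerup A \<phi> \<longleftrightarrow> (\<exists>F :: ('a \<Rightarrow> 'a) filter. F \<noteq> bot \<and>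
     (\<forall>\<^sub>F \<Phi> in F. completely_positive A \<Phi> \<and> contractive_map A A \<Phi> \<and>
        (\<forall>a\<in>carrier A. positive A a \<longrightarrow> Re (\<phi> (\<Phi> a)) \<le> Re (\<phi> a)) \<and>
        compact_op (gns_space A \<phi>) (gns_op A \<phi> \<Phi>)) \<and>
     (\<forall>X\<in>carrier (gns_space A \<phi>).
        ((\<lambda>\<Phi>. ndist (gns_space A \<phi>) (gns_op A \<phi> \<Phi> X) X) \<longlongrightarrow> 0) F))"

section \<open>Fell bundles\<close>

text \<open>Multiplication and involution are operations on the total space of the bundle. The
  fibres are not required to be disjoint subsets of the type \<open>'b\<close>, so disjoint fibres are a
  special case.\<close>

record ('g, 'b) bundle_data =
  fibre :: "'g \<Rightarrow> 'b cnormed"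
  bmult :: "'b \<Rightarrow> 'b \<Rightarrow> 'b"
  bstar :: "'b \<Rightarrow> 'b"

definition unit_fibre :: "('g, 'm) monoid_scheme \<Rightarrow> ('g, 'b) bundle_data \<Rightarrow> 'b cstar" where
  "unit_fibre G B = (let V = fibre B \<one>\<^bsub>G\<^esub> in
     \<lparr>carrier = carrier V, mult = bmult B, one = one V, zero = zero V, add = add V,
      smult = smult V, nrm = nrm V, star = bstar B\<rparr>)"

locale fell_bundle = group G for G :: "('g, 'm) monoid_scheme" (structure) +
  fixes B :: "('g, 'b) bundle_data"
  assumes fibre_banach: "g \<in> carrier G \<Longrightarrow> banach_space (fibre B g)"
    and bmult_closed: "\<lbrakk>g \<in> carrier G; h \<in> carrier G; a \<in> carrier (fibre B g); b \<in> carrier (fibre B h)\<rbrakk>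
      \<Longrightarrow> bmult B a b \<in> carrier (fibre B (g \<otimes> h))"
    and bmult_assoc: "\<lbrakk>g \<in> carrier G; h \<in> carrier G; k \<in> carrier G; a \<in> carrier (fibre B g);
        b \<in> carrier (fibre B h); c \<in> carrier (fibre B k)\<rbrakk>
      \<Longrightarrow> bmult B (bmult B a b) c = bmult B a (bmult B b c)"
    and bmult_linear_right: "\<lbrakk>g \<in> carrier G; h \<in> carrier G; a \<in> carrier (fibre B g)\<rbrakk>
      \<Longrightarrow> clinear_map (fibre B h) (fibre B (g \<otimes> h)) (\<lambda>b. bmult B a b)"
    and bmult_linear_left: "\<lbrakk>g \<in> carrier G; h \<in> carrier G; b \<in> carrier (fibre B h)\<rbrakk>
      \<Longrightarrow> clinear_map (fibre B g) (fibre B (g \<otimes> h)) (\<lambda>a. bmult B a b)"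
    and nrm_bmult: "\<lbrakk>g \<in> carrier G; h \<in> carrier G; a \<in> carrier (fibre B g); b \<in> carrier (fibre B h)\<rbrakk>
      \<Longrightarrow> \<parallel>bmult B a b\<parallel>\<^bsub>fibre B (g \<otimes> h)\<^esub> \<le> \<parallel>a\<parallel>\<^bsub>fibre B g\<^esub> * \<parallel>b\<parallel>\<^bsub>fibre B h\<^esub>"
    and bstar_closed: "\<lbrakk>g \<in> carrier G; b \<in> carrier (fibre B g)\<rbrakk>
      \<Longrightarrow> bstar B b \<in> carrier (fibre B (inv g))"
    and bstar_bstar: "\<lbrakk>g \<in> carrier G; b \<in> carrier (fibre B g)\<rbrakk> \<Longrightarrow> bstar B (bstar B b) = b"
    and bstar_bmult: "\<lbrakk>g \<in> carrier G; h \<in> carrier G; a \<in> carrier (fibre B g); b \<in> carrier (fibre B h)\<rbrakk>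
      \<Longrightarrow> bstar B (bmult B a b) = bmult B (bstar B b) (bstar B a)"
    and bstar_add: "\<lbrakk>g \<in> carrier G; a \<in> carrier (fibre B g); b \<in> carrier (fibre B g)\<rbrakk>
      \<Longrightarrow> bstar B (a \<oplus>\<^bsub>fibre B g\<^esub> b) = bstar B a \<oplus>\<^bsub>fibre B (inv g)\<^esub> bstar B b"
    and bstar_smult: "\<lbrakk>g \<in> carrier G; b \<in> carrier (fibre B g)\<rbrakk>
      \<Longrightarrow> bstar B (z \<odot>\<^bsub>fibre B g\<^esub> b) = cnj z \<odot>\<^bsub>fibre B (inv g)\<^esub> bstar B b"
    and nrm_bstar: "\<lbrakk>g \<in> carrier G; b \<in> carrier (fibre B g)\<rbrakk>
      \<Longrightarrow> \<parallel>bstar B b\<parallel>\<^bsub>fibre B (inv g)\<^esub> = \<parallel>b\<parallel>\<^bsub>fibre B g\<^esub>"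
    and cstar_identity: "\<lbrakk>g \<in> carrier G; b \<in> carrier (fibre B g)\<rbrakk>
      \<Longrightarrow> \<parallel>bmult B (bstar B b) b\<parallel>\<^bsub>fibre B \<one>\<^esub> = \<parallel>b\<parallel>\<^bsub>fibre B g\<^esub>\<^sup>2"
    and bstar_bmult_positive: "\<lbrakk>g \<in> carrier G; b \<in> carrier (fibre B g)\<rbrakk>
      \<Longrightarrow> positive (unit_fibre G B) (bmult B (bstar B b) b)"

text \<open>The unit of \<open>B\<^sub>e\<close> is recorded in the field \<open>one\<close> of the fibre over the neutral element.\<close>

locale unital_fell_bundle = fell_bundle +
  assumes unit_closed: "\<one>\<^bsub>unit_fibre G B\<^esub> \<in> carrier (unit_fibre G B)"
    and unit_left: "b \<in> carrier (unit_fibre G B) \<Longrightarrow> bmult B \<one>\<^bsub>unit_fibre G B\<^esub> b = b"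
    and unit_right: "b \<in> carrier (unit_fibre G B) \<Longrightarrow> bmult B b \<one>\<^bsub>unit_fibre G B\<^esub> = b"

text \<open>A unital Fell bundle with such a section is a unital twisted crossed product bundle.\<close>

definition unitary_section :: "('g, 'm) monoid_scheme \<Rightarrow> ('g, 'b) bundle_data \<Rightarrow> ('g \<Rightarrow> 'b) \<Rightarrow> bool" where
  "unitary_section G B u \<longleftrightarrow> u \<one>\<^bsub>G\<^esub> = \<one>\<^bsub>unit_fibre G B\<^esub> \<and>
     (\<forall>g\<in>carrier G. u g \<in> carrier (fibre B g) \<and>
        bmult B (u g) (bstar B (u g)) = \<one>\<^bsub>unit_fibre G B\<^esub> \<and>
        bmult B (bstar B (u g)) (u g) = \<one>\<^bsub>unit_fibre G B\<^esub>)"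

definition section_action :: "('g, 'b) bundle_data \<Rightarrow> ('g \<Rightarrow> 'b) \<Rightarrow> 'g \<Rightarrow> 'b \<Rightarrow> 'b" where
  "section_action B u g b = bmult B (bmult B (u g) b) (bstar B (u g))"

definition section_cocycle ::
    "('g, 'm) monoid_scheme \<Rightarrow> ('g, 'b) bundle_data \<Rightarrow> ('g \<Rightarrow> 'b) \<Rightarrow> 'g \<Rightarrow> 'g \<Rightarrow> 'b" where
  "section_cocycle G B u g h = bmult B (bmult B (u g) (u h)) (bstar B (u (g \<otimes>\<^bsub>G\<^esub> h)))"

definition invariant_state ::
    "('g, 'm) monoid_scheme \<Rightarrow> ('g, 'b) bundle_data \<Rightarrow> ('g \<Rightarrow> 'b \<Rightarrow> 'b) \<Rightarrow> ('b \<Rightarrow> complex) \<Rightarrow> bool" where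
  "invariant_state G B \<alpha> \<psi> \<longleftrightarrow> state (unit_fibre G B) \<psi> \<and>
     (\<forall>g\<in>carrier G. \<forall>b\<in>carrier (unit_fibre G B). \<psi> (\<alpha> g b) = \<psi> b)"

subsection \<open>Exel's approximation property\<close>

definition supp :: "('g, 'm) monoid_scheme \<Rightarrow> ('g \<Rightarrow> 'b cnormed) \<Rightarrow> ('g \<Rightarrow> 'b) \<Rightarrow> 'g set" where
  "supp G V \<xi> = {g \<in> carrier G. \<xi> g \<noteq> \<zero>\<^bsub>V g\<^esub>}"

definition cstar_amenable :: "('g, 'm) monoid_scheme \<Rightarrow> ('g, 'b) bundle_data \<Rightarrow> bool" where
  "cstar_amenable G B \<longleftrightarrow> (let S = supp G (\<lambda>g. fibre B \<one>\<^bsub>G\<^esub>) in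
     \<exists>F :: ('g \<Rightarrow> 'b) filter. F \<noteq> bot \<and>
       (\<forall>\<^sub>F \<xi> in F. \<xi> \<in> carrier G \<rightarrow> carrier (unit_fibre G B) \<and> finite (S \<xi>)) \<and>
       (\<exists>C. \<forall>\<^sub>F \<xi> in F.
          \<parallel>\<Oplus>\<^bsub>unit_fibre G B\<^esub>h\<in>S \<xi>. bmult B (bstar B (\<xi> h)) (\<xi> h)\<parallel>\<^bsub>unit_fibre G B\<^esub> \<le> C) \<and>
       (\<forall>g\<in>carrier G. \<forall>b\<in>carrier (fibre B g).
          ((\<lambda>\<xi>. ndist (fibre B g)
              (\<Oplus>\<^bsub>fibre B g\<^esub>h\<in>S \<xi>. bmult B (bmult B (bstar B (\<xi> (g \<otimes>\<^bsub>G\<^esub> h))) b) (\<xi> h)) b) \<longlongrightarrow> 0) F))"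

subsection \<open>The reduced cross-sectional algebra\<close>

definition section_inner ::
    "('g, 'm) monoid_scheme \<Rightarrow> ('g, 'b) bundle_data \<Rightarrow> ('g \<Rightarrow> 'b) \<Rightarrow> ('g \<Rightarrow> 'b) \<Rightarrow> 'b" where
  "section_inner G B \<xi> \<eta> =
     (\<Oplus>\<^bsub>unit_fibre G B\<^esub>g\<in>supp G (fibre B) \<xi>. bmult B (bstar B (\<xi> g)) (\<eta> g))"

definition sections :: "('g, 'm) monoid_scheme \<Rightarrow> ('g, 'b) bundle_data \<Rightarrow> ('g \<Rightarrow> 'b) cnormed" where
  "sections G B =
     \<lparr>carrier = {\<xi> \<in> (\<Pi>\<^sub>E g\<in>carrier G. carrier (fibre B g)). finite (supp G (fibre B) \<xi>)},
      mult = undefined, one = undefined,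
      zero = (\<lambda>g\<in>carrier G. \<zero>\<^bsub>fibre B g\<^esub>),
      add = (\<lambda>\<xi> \<eta>. \<lambda>g\<in>carrier G. \<xi> g \<oplus>\<^bsub>fibre B g\<^esub> \<eta> g),
      smult = (\<lambda>c \<xi>. \<lambda>g\<in>carrier G. c \<odot>\<^bsub>fibre B g\<^esub> \<xi> g),
      nrm = (\<lambda>\<xi>. sqrt \<parallel>section_inner G B \<xi> \<xi>\<parallel>\<^bsub>unit_fibre G B\<^esub>)\<rparr>"

type_synonym ('g, 'b) l2vec = "(nat \<Rightarrow> 'g \<Rightarrow> 'b) set"

definition l2 :: "('g, 'm) monoid_scheme \<Rightarrow> ('g, 'b) bundle_data \<Rightarrow> ('g, 'b) l2vec cnormed" where
  "l2 G B = completion (sections G B)"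

text \<open>The extension by continuity of \<^const>\<open>section_inner\<close>, with values in \<open>B\<^sub>e\<close>.\<close>

definition l2_inner ::
    "('g, 'm) monoid_scheme \<Rightarrow> ('g, 'b) bundle_data \<Rightarrow> ('g, 'b) l2vec \<Rightarrow> ('g, 'b) l2vec \<Rightarrow> 'b" where
  "l2_inner G B X Y = (THE c. c \<in> carrier (unit_fibre G B) \<and>
     (\<lambda>n. ndist (unit_fibre G B) (section_inner G B (rep X n) (rep Y n)) c) \<longlonglongrightarrow> 0)"

definition is_adjoint :: "('g, 'm) monoid_scheme \<Rightarrow> ('g, 'b) bundle_data \<Rightarrow>
    (('g, 'b) l2vec \<Rightarrow> ('g, 'b) l2vec) \<Rightarrow> (('g, 'b) l2vec \<Rightarrow> ('g, 'b) l2vec) \<Rightarrow> bool" where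
  "is_adjoint G B T S \<longleftrightarrow> S \<in> carrier (l2 G B) \<rightarrow>\<^sub>E carrier (l2 G B) \<and>
     (\<forall>X\<in>carrier (l2 G B). \<forall>Y\<in>carrier (l2 G B). l2_inner G B (T X) Y = l2_inner G B X (S Y))"

text \<open>Linearity and boundedness of adjointable operators are automatic; they are listed here so
  that the operator norm is visibly finite.\<close>

definition adjointable :: "('g, 'm) monoid_scheme \<Rightarrow> ('g, 'b) bundle_data \<Rightarrow>
    (('g, 'b) l2vec \<Rightarrow> ('g, 'b) l2vec) cstar" where
  "adjointable G B = (let H = l2 G B in
     \<lparr>carrier = {T \<in> carrier H \<rightarrow>\<^sub>E carrier H. clinear_map H H T \<and> bounded_map H H T \<and>
                   (\<exists>S. is_adjoint G B T S)},
      mult = (\<lambda>S T. \<lambda>X\<in>carrier H. S (T X)),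
      one = (\<lambda>X\<in>carrier H. X),
      zero = (\<lambda>X\<in>carrier H. \<zero>\<^bsub>H\<^esub>),
      add = (\<lambda>S T. \<lambda>X\<in>carrier H. S X \<oplus>\<^bsub>H\<^esub> T X),
      smult = (\<lambda>c T. \<lambda>X\<in>carrier H. c \<odot>\<^bsub>H\<^esub> T X),
      nrm = op_norm H,
      star = (\<lambda>T. THE S. is_adjoint G B T S)\<rparr>)"

definition regular_rep :: "('g, 'm) monoid_scheme \<Rightarrow> ('g, 'b) bundle_data \<Rightarrow> 'g \<Rightarrow> 'b \<Rightarrow>
    ('g, 'b) l2vec \<Rightarrow> ('g, 'b) l2vec" where
  "regular_rep G B g b = ext_op (sections G B)
     (\<lambda>\<xi>. \<lambda>h\<in>carrier G. bmult B b (\<xi> (inv\<^bsub>G\<^esub> g \<otimes>\<^bsub>G\<^esub> h)))"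

definition reduced_algebra :: "('g, 'm) monoid_scheme \<Rightarrow> ('g, 'b) bundle_data \<Rightarrow>
    (('g, 'b) l2vec \<Rightarrow> ('g, 'b) l2vec) cstar" where
  "reduced_algebra G B = generated_cstar (adjointable G B)
     {regular_rep G B g b | g b. g \<in> carrier G \<and> b \<in> carrier (fibre B g)}"

text \<open>The conditions determine the expectation on the reduced algebra, since the linear span of
  the operators \<open>regular_rep G B g b\<close> is dense there.\<close>

definition expectation :: "('g, 'm) monoid_scheme \<Rightarrow> ('g, 'b) bundle_data \<Rightarrow>
    (('g, 'b) l2vec \<Rightarrow> ('g, 'b) l2vec) \<Rightarrow> 'b" where
  "expectation G B = (SOME E.
     faithful_cond_exp (reduced_algebra G B) (unit_fibre G B) (regular_rep G B \<one>\<^bsub>G\<^esub>) E \<and>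
     (\<forall>g\<in>carrier G. \<forall>b\<in>carrier (fibre B g). E (regular_rep G B g b) =
        (if g = \<one>\<^bsub>G\<^esub> then b else \<zero>\<^bsub>unit_fibre G B\<^esub>)))"

subsection \<open>The Haagerup property of a Fell bundle with a state on the unit fibre\<close>

definition bundle_map :: "('g, 'm) monoid_scheme \<Rightarrow> ('g, 'b) bundle_data \<Rightarrow> ('g \<Rightarrow> 'b \<Rightarrow> 'b) \<Rightarrow> bool" where
  "bundle_map G B T \<longleftrightarrow> (\<forall>g\<in>carrier G.
     clinear_map (fibre B g) (fibre B g) (T g) \<and> bounded_map (fibre B g) (fibre B g) (T g))"

definition positive_definite ::
    "('g, 'm) monoid_scheme \<Rightarrow> ('g, 'b) bundle_data \<Rightarrow> ('g \<Rightarrow> 'b \<Rightarrow> 'b) \<Rightarrow> bool" where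
  "positive_definite G B T \<longleftrightarrow> (\<forall>(n::nat) \<gamma> a b.
     (\<forall>i<n. \<gamma> i \<in> carrier G \<and> a i \<in> carrier (fibre B (\<gamma> i)) \<and> b i \<in> carrier (fibre B (\<gamma> i))) \<longrightarrow>
     positive (unit_fibre G B)
       (\<Oplus>\<^bsub>unit_fibre G B\<^esub>i\<in>{..<n}. \<Oplus>\<^bsub>unit_fibre G B\<^esub>j\<in>{..<n}.
          bmult B (bmult B (b i)
            (T (inv\<^bsub>G\<^esub> (\<gamma> i) \<otimes>\<^bsub>G\<^esub> \<gamma> j) (bmult B (bstar B (a i)) (a j)))) (bstar B (b j))))"

definition fibre_seminormed :: "('g, 'b) bundle_data \<Rightarrow> ('b \<Rightarrow> complex) \<Rightarrow> 'g \<Rightarrow> 'b cnormed" where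
  "fibre_seminormed B \<psi> g = (fibre B g)\<lparr>nrm := (\<lambda>b. sqrt (Re (\<psi> (bmult B (bstar B b) b))))\<rparr>"

definition fibre_hilbert ::
    "('g, 'b) bundle_data \<Rightarrow> ('b \<Rightarrow> complex) \<Rightarrow> 'g \<Rightarrow> (nat \<Rightarrow> 'b) set cnormed" where
  "fibre_hilbert B \<psi> g = completion (fibre_seminormed B \<psi> g)"

definition fibre_op :: "('g, 'b) bundle_data \<Rightarrow> ('b \<Rightarrow> complex) \<Rightarrow> ('g \<Rightarrow> 'b \<Rightarrow> 'b) \<Rightarrow> 'g \<Rightarrow>
    (nat \<Rightarrow> 'b) set \<Rightarrow> (nat \<Rightarrow> 'b) set" where
  "fibre_op B \<psi> T g = ext_op (fibre_seminormed B \<psi> g) (T g)"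

definition vanishes_at_infinity :: "('g, 'm) monoid_scheme \<Rightarrow> ('g \<Rightarrow> real) \<Rightarrow> bool" where
  "vanishes_at_infinity G f \<longleftrightarrow> (\<forall>\<epsilon>>0. finite {g \<in> carrier G. \<bar>f g\<bar> \<ge> \<epsilon>})"

definition bundle_haagerup ::
    "('g, 'm) monoid_scheme \<Rightarrow> ('g, 'b) bundle_data \<Rightarrow> ('b \<Rightarrow> complex) \<Rightarrow> bool" where
  "bundle_haagerup G B \<psi> \<longleftrightarrow> (\<exists>F :: ('g \<Rightarrow> 'b \<Rightarrow> 'b) filter. F \<noteq> bot \<and>
     (\<forall>\<^sub>F T in F. bundle_map G B T \<and> positive_definite G B T \<and>
        contractive_map (unit_fibre G B) (unit_fibre G B) (T \<one>\<^bsub>G\<^esub>) \<and>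
        (\<forall>b\<in>carrier (unit_fibre G B). positive (unit_fibre G B) b \<longrightarrow>
           Re (\<psi> (T \<one>\<^bsub>G\<^esub> b)) \<le> Re (\<psi> b)) \<and>
        (\<forall>g\<in>carrier G. compact_op (fibre_hilbert B \<psi> g) (fibre_op B \<psi> T g)) \<and>
        vanishes_at_infinity G (\<lambda>g. op_norm (fibre_hilbert B \<psi> g) (fibre_op B \<psi> T g))) \<and>
     (\<forall>g\<in>carrier G. \<forall>b\<in>carrier (fibre B g).
        ((\<lambda>T. ndist (fibre_seminormed B \<psi> g) (T g b) b) \<longlongrightarrow> 0) F))"

section \<open>Amenable discrete groups\<close>

text \<open>Existence of a left-invariant mean on the bounded real functions on the group.\<close>

definition amenable_group :: "('g, 'm) monoid_scheme \<Rightarrow> bool" where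
  "amenable_group G \<longleftrightarrow> (\<exists>\<mu> :: ('g \<Rightarrow> real) \<Rightarrow> real.
     (\<forall>f k. bounded (f ` carrier G) \<and> bounded (k ` carrier G) \<longrightarrow>
        \<mu> (\<lambda>g. f g + k g) = \<mu> f + \<mu> k) \<and>
     (\<forall>c f. bounded (f ` carrier G) \<longrightarrow> \<mu> (\<lambda>g. c * f g) = c * \<mu> f) \<and>
     (\<forall>f. bounded (f ` carrier G) \<and> (\<forall>g\<in>carrier G. f g \<ge> 0) \<longrightarrow> \<mu> f \<ge> 0) \<and>
     \<mu> (\<lambda>g. 1) = 1 \<and>
     (\<forall>h\<in>carrier G. \<forall>f. bounded (f ` carrier G) \<longrightarrow> \<mu> (\<lambda>g. f (h \<otimes>\<^bsub>G\<^esub> g)) = \<mu> f))"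

end

theory Submission
  imports Defs "HOL-Analysis.Convex" "HOL-Analysis.Function_Topology"
begin

text \<open>By the Cauchy--Schwarz inequality for \<open>\<psi> \<circ> E\<^sub>e\<close>, the approximation property at \<open>b = u(g)\<close> makes
  the normalised functions \<open>h \<mapsto> \<psi>(\<xi>(h)\<^sup>* \<xi>(h))\<^sup>1\<^sup>/\<^sup>2\<close> almost invariant unit vectors in \<open>\<ell>\<^sup>2(G)\<close>. So \<open>G\<close> is
  amenable, and there are finitely supported unit vectors \<open>f \<ge> 0\<close> with \<open>\<Sum>\<^sub>h f(gh) f(h)\<close> close to 1. For such an
  \<open>f\<close> and a completely positive map \<open>\<Phi>\<close> from the Haagerup property of \<open>(B\<^sub>e, \<psi>)\<close> consider
  \<open>\<Psi>(x) = \<Sum>\<^sub>s\<^sub>,\<^sub>t f(s) f(t) u(s) \<Phi>(E\<^sub>e(u(s)\<^sup>* x u(t))) u(t)\<^sup>*\<close>. It is completely positive with \<open>\<parallel>\<Psi>(1)\<parallel> \<le> 1\<close>, does not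
  increase \<open>\<psi> \<circ> E\<^sub>e\<close> because \<open>\<psi>\<close> is invariant, and is compact on the GNS space, being a finite sum of
  isometric translates of \<open>\<Phi>\<close>. It maps the image of each fibre \<open>B\<^sub>g\<close> to itself, vanishes there unless
  \<open>g = s t\<^sup>-\<^sup>1\<close> with \<open>s, t\<close> in the support of \<open>f\<close>, and moves \<open>\<lambda>\<^sub>g(b)\<close> little if \<open>\<Phi>\<close> moves the finitely many
  coefficients \<open>u(gt)\<^sup>* b u(t)\<close> little. The maps \<open>\<Psi>\<close> give the Haagerup property of the reduced algebra, and
  their restrictions to the fibres give that of the bundle.\<close>

\<comment> \<open>The values \<xi>(h) of the approximating functions lie in \<open>B_e\<close>, and
  \<psi> is not assumed tracial, so compressions by them need not decrease \<psi>. They are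
  therefore used only through their norms in the GNS space of \<psi>, which gives scalar weights f.
  Scalars commute with everything, and under E only the pairs s = t survive; since the squares
  f(s)^2 sum to 1, invariance makes \<Psi> decrease \<psi> \<circ> E. On the image of
  \<open>B_g\<close> only the pairs s = g t matter. Their weights f(s) f(t) add up to
  \<open>overlap\<close>, so with the identity in place of \<Phi> the map \<Psi> would be
  multiplication by a number close to 1. The weights must be fixed before \<Phi>, because they
  determine which coefficients \<Phi> has to approximate.

  No spectral theory is used. Positivity becomes a norm inequality, square roots come from an
  iteration, and positivity of matrices over A is positivity of operators on the Hilbert module of
  columns. Norm and GNS bounds for completely positive maps come from Kadison's inequality.\<close>
text \<open>Allows \<open>x \<oplus>\<^sub>V y\<close> for \<open>x \<oplus>\<^bsub>V\<^esub> y\<close>.\<close>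

syntax "_index" :: "logic \<Rightarrow> index" (\<open>\<^sub>_\<close> [1000] 1000)
notation nrm (\<open>||_||\<index>\<close>)

section \<open>Complex vector spaces as modules over the field of complex numbers\<close>

lemma complex_field_simps [simp]:
  "carrier complex_field = UNIV" "x \<otimes>\<^sub>complex_field y = x * y"
  "\<one>\<^sub>complex_field = 1" "\<zero>\<^sub>complex_field = 0" "x \<oplus>\<^sub>complex_field y = x + y" by (simp_all add: complex_field_def)

lemma cring_complex_field: "cring complex_field"
proof (rule cringI)
  show "abelian_group complex_field"
  proof (rule abelian_groupI)
    fix x :: complex
    have "- x \<oplus>\<^sub>complex_field x = \<zero>\<^sub>complex_field" by simp
    then show "\<exists>y\<in>carrier complex_field. y \<oplus>\<^sub>complex_field x = \<zero>\<^sub>complex_field"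
      by (intro bexI[of _ "- x"]) simp_all
  qed simp_all
qed (auto intro!: Group.comm_monoidI simp: algebra_simps)

lemma complex_field_minus [simp]: "\<ominus>\<^sub>complex_field x = - x"
proof -
  interpret cring complex_field by (rule cring_complex_field)
  show ?thesis by (rule minus_equality) auto
qed

text \<open>Module laws are equations, so they can be checked after a jointly injective family of
  maps that preserve the operations. These maps are coordinates for sections, evaluations at vectors
  for operators, and one inclusion for subalgebras.\<close>

lemma module_of_evaluations:
  assumes V: "\<And>i. i \<in> I \<Longrightarrow> module complex_field (V i)"
    and e: "\<And>i x. \<lbrakk>i \<in> I; x \<in> carrier W\<rbrakk> \<Longrightarrow> e i x \<in> carrier (V i)"
    and zero: "\<zero>\<^sub>W \<in> carrier W" "\<And>i. i \<in> I \<Longrightarrow> e i \<zero>\<^sub>W = \<zero>\<^sub>(V i)"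
    and add: "\<And>x y. \<lbrakk>x \<in> carrier W; y \<in> carrier W\<rbrakk> \<Longrightarrow> x \<oplus>\<^sub>W y \<in> carrier W"
      "\<And>i x y. \<lbrakk>i \<in> I; x \<in> carrier W; y \<in> carrier W\<rbrakk> \<Longrightarrow> e i (x \<oplus>\<^sub>W y) = e i x \<oplus>\<^sub>(V i) e i y"
    and smult: "\<And>c x. x \<in> carrier W \<Longrightarrow> c \<odot>\<^sub>W x \<in> carrier W"
      "\<And>i c x. \<lbrakk>i \<in> I; x \<in> carrier W\<rbrakk> \<Longrightarrow> e i (c \<odot>\<^sub>W x) = c \<odot>\<^sub>(V i) e i x"
    and inj: "\<And>x y. \<lbrakk>x \<in> carrier W; y \<in> carrier W; \<And>i. i \<in> I \<Longrightarrow> e i x = e i y\<rbrakk> \<Longrightarrow> x = y"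
  shows "module complex_field W"
proof -
  have M: "\<zero>\<^sub>(V i) \<oplus>\<^sub>(V i) x = x" "(-1) \<odot>\<^sub>(V i) x \<oplus>\<^sub>(V i) x = \<zero>\<^sub>(V i)" "1 \<odot>\<^sub>(V i) x = x" "c \<odot>\<^sub>(V i) x \<in> carrier (V i)"
    "(c + d) \<odot>\<^sub>(V i) x = c \<odot>\<^sub>(V i) x \<oplus>\<^sub>(V i) d \<odot>\<^sub>(V i) x" "(c * d) \<odot>\<^sub>(V i) x = c \<odot>\<^sub>(V i) (d \<odot>\<^sub>(V i) x)"
    if "i \<in> I" "x \<in> carrier (V i)" for i x c d
  proof -
    interpret M: module complex_field "V i" by (rule V[OF that(1)])
    show "\<zero>\<^sub>(V i) \<oplus>\<^sub>(V i) x = x" "1 \<odot>\<^sub>(V i) x = x" "c \<odot>\<^sub>(V i) x \<in> carrier (V i)"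
      "(c + d) \<odot>\<^sub>(V i) x = c \<odot>\<^sub>(V i) x \<oplus>\<^sub>(V i) d \<odot>\<^sub>(V i) x" "(c * d) \<odot>\<^sub>(V i) x = c \<odot>\<^sub>(V i) (d \<odot>\<^sub>(V i) x)"
      using that M.smult_one[of x] M.smult_closed[of c x] M.smult_l_distr[of c d x] M.smult_assoc1[of c d x] by simp_all
    show "(-1) \<odot>\<^sub>(V i) x \<oplus>\<^sub>(V i) x = \<zero>\<^sub>(V i)"
      using that M.smult_one[of x] M.smult_l_distr[of "-1" 1 x] M.smult_l_null[of x] by simp
  qed
  have N: "x \<oplus>\<^sub>(V i) y = y \<oplus>\<^sub>(V i) x" "c \<odot>\<^sub>(V i) (x \<oplus>\<^sub>(V i) y) = c \<odot>\<^sub>(V i) x \<oplus>\<^sub>(V i) c \<odot>\<^sub>(V i) y"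
    "z \<in> carrier (V i) \<Longrightarrow> (x \<oplus>\<^sub>(V i) y) \<oplus>\<^sub>(V i) z = x \<oplus>\<^sub>(V i) (y \<oplus>\<^sub>(V i) z)"
    if "i \<in> I" "x \<in> carrier (V i)" "y \<in> carrier (V i)" for i x y z c
  proof -
    interpret M: module complex_field "V i" by (rule V[OF that(1)])
    show "x \<oplus>\<^sub>(V i) y = y \<oplus>\<^sub>(V i) x" "c \<odot>\<^sub>(V i) (x \<oplus>\<^sub>(V i) y) = c \<odot>\<^sub>(V i) x \<oplus>\<^sub>(V i) c \<odot>\<^sub>(V i) y"
      "z \<in> carrier (V i) \<Longrightarrow> (x \<oplus>\<^sub>(V i) y) \<oplus>\<^sub>(V i) z = x \<oplus>\<^sub>(V i) (y \<oplus>\<^sub>(V i) z)"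
      using that M.smult_r_distr[of c x y] by (simp_all add: M.a_ac)
  qed
  have ag: "abelian_group W"
  proof (rule abelian_groupI)
    fix x y z assume c: "x \<in> carrier W" "y \<in> carrier W" "z \<in> carrier W"
    show "x \<oplus>\<^sub>W y \<oplus>\<^sub>W z = x \<oplus>\<^sub>W (y \<oplus>\<^sub>W z)" by (rule inj) (use c N(3) in \<open>simp_all add: e add\<close>)
    show "x \<oplus>\<^sub>W y = y \<oplus>\<^sub>W x" by (rule inj) (use c N(1) in \<open>simp_all add: e add\<close>)
  next
    fix x assume x: "x \<in> carrier W"
    show "\<zero>\<^sub>W \<oplus>\<^sub>W x = x" by (rule inj) (use x in \<open>simp_all add: e add zero M\<close>)
    \<comment> \<open>Negatives are the multiples by -1, so the evaluations need only respect sums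
      and scalar multiples.\<close>
    show "\<exists>y\<in>carrier W. y \<oplus>\<^sub>W x = \<zero>\<^sub>W"
      by (rule bexI[OF inj smult(1)[OF x, of "-1"]]) (use x in \<open>simp_all add: e add smult zero M\<close>)
  qed (use zero add in auto)
  show ?thesis
  proof (rule moduleI[OF cring_complex_field ag])
    fix c d x assume x: "x \<in> carrier W"
    show "(c \<oplus>\<^sub>complex_field d) \<odot>\<^sub>W x = c \<odot>\<^sub>W x \<oplus>\<^sub>W d \<odot>\<^sub>W x"
      by (rule inj) (use x in \<open>simp_all add: e add smult M\<close>)
    show "(c \<otimes>\<^sub>complex_field d) \<odot>\<^sub>W x = c \<odot>\<^sub>W (d \<odot>\<^sub>W x)" by (rule inj) (use x in \<open>simp_all add: e smult M\<close>)
    show "\<one>\<^sub>complex_field \<odot>\<^sub>W x = x" by (rule inj) (use x in \<open>simp_all add: e smult M\<close>)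
    fix y assume "y \<in> carrier W"
    then show "c \<odot>\<^sub>W (x \<oplus>\<^sub>W y) = c \<odot>\<^sub>W x \<oplus>\<^sub>W c \<odot>\<^sub>W y" by (intro inj) (use x N(2) in \<open>simp_all add: e add smult\<close>)
  qed (rule smult)
qed

text \<open>Another norm on the same vector space, or another record type around it, gives a
  different term; the module laws and subtraction carry over. Needed for the GNS seminorms and for
  \<open>unit_fibre\<close>.\<close>

lemma module_cong:
  assumes m: "module complex_field V"
    and e: "carrier W = carrier V" "add W = add V" "zero W = zero V" "smult W = smult V"
  shows "module complex_field W" and "a_minus W = a_minus V"
proof -
  interpret module complex_field V by fact
  show "module complex_field W"
    by (rule module_of_evaluations[where I = "UNIV :: unit set" and V = "\<lambda>_. V" and e = "\<lambda>_ x. x"])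
      (use smult_closed in \<open>auto simp: e m\<close>)
  show "a_minus W = a_minus V" by (simp add: a_minus_def[abs_def] a_inv_def m_inv_def e)
qed

lemma tendsto_0_le_add:
  fixes a b c :: "'i \<Rightarrow> real"
  assumes "(a \<longlongrightarrow> 0) F" "(b \<longlongrightarrow> 0) F" "\<And>n. 0 \<le> c n" "\<And>n. c n \<le> a n + b n"
  shows "(c \<longlongrightarrow> 0) F" using assms(3,4) tendsto_add[OF assms(1,2)]
  by (intro tendsto_sandwich[of "\<lambda>_. 0" c F "\<lambda>n. a n + b n" 0] always_eventually) auto

section \<open>Seminormed spaces and their completions\<close>

text \<open>A nonzero vector may have norm 0: the spaces to be completed are the algebras and fibres
  with the seminorms that \<psi> defines, and null vectors are not divided out beforehand.\<close>

locale seminormed = module complex_field V for V :: "('a, 'm) cnormed_scheme" (structure) +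
  assumes nrm_triangle: "\<lbrakk>x \<in> carrier V; y \<in> carrier V\<rbrakk> \<Longrightarrow> ||x \<oplus> y|| \<le> ||x|| + ||y||"
    and nrm_smult: "x \<in> carrier V \<Longrightarrow> ||c \<odot> x|| = cmod c * ||x||"
begin

lemma smultC [simp, intro]: "x \<in> carrier V \<Longrightarrow> c \<odot> x \<in> carrier V" by simp

lemma smult_add_l: "x \<in> carrier V \<Longrightarrow> (c + d) \<odot> x = c \<odot> x \<oplus> d \<odot> x" using smult_l_distr[of c d x] by simp

lemma smult_add_r: "\<lbrakk>x \<in> carrier V; y \<in> carrier V\<rbrakk> \<Longrightarrow> c \<odot> (x \<oplus> y) = c \<odot> x \<oplus> c \<odot> y"
  using smult_r_distr[of c x y] by simp

lemma smult_mult: "x \<in> carrier V \<Longrightarrow> c \<odot> (d \<odot> x) = (c * d) \<odot> x" using smult_assoc1[of c d x] by simp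

lemma smult_1 [simp]: "x \<in> carrier V \<Longrightarrow> 1 \<odot> x = x" using smult_one[of x] by simp

lemma smult_0 [simp]: "x \<in> carrier V \<Longrightarrow> 0 \<odot> x = \<zero>" using smult_l_null[of x] by simp

lemma smult_zero [simp]: "c \<odot> \<zero> = \<zero>" using smult_r_null[of c] by simp

lemma smult_neg_l: "x \<in> carrier V \<Longrightarrow> (- c) \<odot> x = \<ominus> (c \<odot> x)" using smult_l_minus[of c x] by simp

lemma smult_neg_r: "x \<in> carrier V \<Longrightarrow> c \<odot> (\<ominus> x) = \<ominus> (c \<odot> x)" using smult_r_minus[of c x] by simp

lemma neg_eq: "x \<in> carrier V \<Longrightarrow> \<ominus> x = (-1) \<odot> x" by (simp add: smult_neg_l)

lemma smult_diff_r: "\<lbrakk>x \<in> carrier V; y \<in> carrier V\<rbrakk> \<Longrightarrow> c \<odot> (x \<ominus> y) = c \<odot> x \<ominus> c \<odot> y"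
  by (simp add: minus_eq smult_add_r smult_neg_r)

lemma smult_diff_l: "x \<in> carrier V \<Longrightarrow> (c - d) \<odot> x = c \<odot> x \<ominus> d \<odot> x"
  using smult_add_l[of x c "- d"] by (simp add: minus_eq smult_neg_l)

lemma nrm_0 [simp]: "||\<zero>|| = 0" using nrm_smult[of \<zero> 0] by simp

lemma nrm_neg [simp]: "x \<in> carrier V \<Longrightarrow> ||\<ominus> x|| = ||x||" using nrm_smult[of x "-1"] by (simp add: neg_eq)

lemma nrm_nonneg [simp]: "x \<in> carrier V \<Longrightarrow> 0 \<le> ||x||" using nrm_triangle[of x "\<ominus> x"] by (simp add: r_neg)

lemma diff_add_cancel: "\<lbrakk>x \<in> carrier V; y \<in> carrier V\<rbrakk> \<Longrightarrow> (x \<ominus> y) \<oplus> y = x" by (simp add: minus_eq a_assoc l_neg)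

lemma diff_self [simp]: "x \<in> carrier V \<Longrightarrow> x \<ominus> x = \<zero>" by (simp add: minus_eq r_neg)

lemma diff_eq_0_iff: "\<lbrakk>x \<in> carrier V; y \<in> carrier V\<rbrakk> \<Longrightarrow> x \<ominus> y = \<zero> \<longleftrightarrow> x = y"
  by (metis diff_add_cancel diff_self l_zero)

lemma neg_diff: "\<lbrakk>x \<in> carrier V; y \<in> carrier V\<rbrakk> \<Longrightarrow> \<ominus> (x \<ominus> y) = y \<ominus> x" by (simp add: minus_eq minus_add a_comm)

lemma diff_trans: "\<lbrakk>x \<in> carrier V; y \<in> carrier V; z \<in> carrier V\<rbrakk> \<Longrightarrow> (x \<ominus> y) \<oplus> (y \<ominus> z) = x \<ominus> z"
  by (metis a_assoc diff_add_cancel minus_closed minus_eq a_inv_closed)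

lemma add_diff_add: "\<lbrakk>x \<in> carrier V; y \<in> carrier V; z \<in> carrier V; w \<in> carrier V\<rbrakk>
    \<Longrightarrow> (x \<oplus> y) \<ominus> (z \<oplus> w) = (x \<ominus> z) \<oplus> (y \<ominus> w)" by (simp add: minus_eq minus_add a_ac)

lemma nrm_diff_sym: "\<lbrakk>x \<in> carrier V; y \<in> carrier V\<rbrakk> \<Longrightarrow> ||x \<ominus> y|| = ||y \<ominus> x||"
  by (metis neg_diff nrm_neg minus_closed)

lemma nrm_diff_triangle:
  "\<lbrakk>x \<in> carrier V; y \<in> carrier V; z \<in> carrier V\<rbrakk> \<Longrightarrow> ||x \<ominus> z|| \<le> ||x \<ominus> y|| + ||y \<ominus> z||"
  by (metis diff_trans nrm_triangle minus_closed)

lemma nrm_diff_ge: "\<lbrakk>x \<in> carrier V; y \<in> carrier V\<rbrakk> \<Longrightarrow> \<bar>||x|| - ||y||\<bar> \<le> ||x \<ominus> y||"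
  using nrm_triangle[of "x \<ominus> y" y] nrm_triangle[of "y \<ominus> x" x]
  by (simp add: diff_add_cancel nrm_diff_sym[of y x])

lemma nrm_finsum_le:
  "\<lbrakk>finite I; f \<in> I \<rightarrow> carrier V\<rbrakk> \<Longrightarrow> ||\<Oplus>i\<in>I. f i|| \<le> (\<Sum>i\<in>I. ||f i||)"
proof (induction I rule: finite_induct)
  case (insert i I)
  then have "||\<Oplus>i\<in>insert i I. f i|| = ||f i \<oplus> (\<Oplus>i\<in>I. f i)||" by (subst finsum_insert) auto
  also have "\<dots> \<le> ||f i|| + ||\<Oplus>i\<in>I. f i||" using insert by (intro nrm_triangle finsum_closed) auto
  also have "\<dots> \<le> ||f i|| + (\<Sum>i\<in>I. ||f i||)" using insert by auto
  finally show ?case using insert by auto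
qed simp

lemma smult_finsum:
  "\<lbrakk>finite I; f \<in> I \<rightarrow> carrier V\<rbrakk> \<Longrightarrow> c \<odot> (\<Oplus>i\<in>I. f i) = (\<Oplus>i\<in>I. c \<odot> f i)"
  using finsum_smult_ldistr[of I c f] by simp

lemma ndist_eq: "\<lbrakk>x \<in> carrier V; y \<in> carrier V\<rbrakk> \<Longrightarrow> ndist V x y = ||x \<ominus> y||" by (simp add: ndist_def)

lemma ndist_nonneg [simp]: "0 \<le> ndist V x y" by (simp add: ndist_def)

lemma ndist_self [simp]: "ndist V x x = 0" by (simp add: ndist_def)

lemma ndist_sym: "ndist V x y = ndist V y x" by (simp add: ndist_def nrm_diff_sym)

lemma ndist_triangle:
  "\<lbrakk>x \<in> carrier V; y \<in> carrier V; z \<in> carrier V\<rbrakk> \<Longrightarrow> ndist V x z \<le> ndist V x y + ndist V y z"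
  by (simp add: ndist_def nrm_diff_triangle)

lemma clinear_map_zero:
  assumes "clinear_map V W f" "seminormed W" shows "f \<zero> = \<zero>\<^sub>W"
proof -
  interpret W: seminormed W by fact
  have "f (0 \<odot> \<zero>) = 0 \<odot>\<^sub>W f \<zero>" using assms by (simp only: clinear_map_def zero_closed)
  then show ?thesis using assms by (auto simp: clinear_map_def Pi_iff)
qed

lemma clinear_map_diff:
  assumes "clinear_map V W f" "seminormed W" "x \<in> carrier V" "y \<in> carrier V"
  shows "f (x \<ominus> y) = f x \<ominus>\<^sub>W f y"
proof -
  interpret W: seminormed W by fact
  have fc: "f x \<in> carrier W" "f y \<in> carrier W" using assms by (auto simp: clinear_map_def Pi_iff)
  have "f (x \<oplus> (-1) \<odot> y) = f x \<oplus>\<^sub>W (-1) \<odot>\<^sub>W f y" using assms by (simp add: clinear_map_def)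
  then show ?thesis using assms fc by (simp add: minus_eq neg_eq W.minus_eq W.neg_eq)
qed

lemma clinear_map_finsum:
  assumes "clinear_map V W f" "seminormed W" "finite I" "g \<in> I \<rightarrow> carrier V"
  shows "f (\<Oplus>i\<in>I. g i) = (\<Oplus>\<^sub>W i\<in>I. f (g i))" using assms(3,4)
proof (induction I rule: finite_induct)
  case empty
  interpret W: seminormed W by fact
  show ?case using clinear_map_zero[OF assms(1,2)] by simp
next
  case (insert i I)
  interpret W: seminormed W by fact
  have "f \<in> carrier V \<rightarrow> carrier W" using assms by (auto simp: clinear_map_def)
  moreover have "f (g i \<oplus> (\<Oplus>i\<in>I. g i)) = f (g i) \<oplus>\<^sub>W f (\<Oplus>i\<in>I. g i)"
    using insert assms by (auto simp: clinear_map_def Pi_iff)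
  ultimately show ?case using insert by (subst finsum_insert W.finsum_insert; auto simp: Pi_iff)+
qed

lemma cauchy_closed: "x \<in> cauchy_seqs V \<Longrightarrow> x n \<in> carrier V" by (simp add: cauchy_seqs_def)

lemma cauchyD: "\<lbrakk>x \<in> cauchy_seqs V; \<epsilon> > 0\<rbrakk> \<Longrightarrow> \<exists>N. \<forall>m\<ge>N. \<forall>n\<ge>N. ndist V (x m) (x n) < \<epsilon>"
  by (simp add: cauchy_seqs_def)

lemma cauchy_const: "v \<in> carrier V \<Longrightarrow> (\<lambda>n. v) \<in> cauchy_seqs V" by (auto simp: cauchy_seqs_def)

lemma cauchy_Lipschitz:
  assumes x: "x \<in> cauchy_seqs V" and W: "seminormed W" and f: "\<And>n. f (x n) \<in> carrier W"
    and L: "\<And>m n. ndist W (f (x m)) (f (x n)) \<le> L * ndist V (x m) (x n)"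
  shows "(\<lambda>n. f (x n)) \<in> cauchy_seqs W" unfolding cauchy_seqs_def
proof (safe)
  fix \<epsilon> :: real assume e: "\<epsilon> > 0"
  \<comment> \<open>L may be 0 or negative; L' can be divided by.\<close>
  define L' where "L' = max L 1"
  have L': "L' > 0" "L \<le> L'" by (auto simp: L'_def)
  obtain N where N: "\<forall>m\<ge>N. \<forall>n\<ge>N. ndist V (x m) (x n) < \<epsilon> / L'" using cauchyD[OF x, of "\<epsilon> / L'"] e L' by auto
  have "ndist W (f (x m)) (f (x n)) < \<epsilon>" if "m \<ge> N" "n \<ge> N" for m n
  proof -
    have "ndist W (f (x m)) (f (x n)) \<le> L' * ndist V (x m) (x n)"
      using L[of m n] mult_right_mono[OF L'(2), of "ndist V (x m) (x n)"] by simp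
    also have "\<dots> < \<epsilon>" using N that L' by (simp add: field_simps)
    finally show ?thesis .
  qed
  then show "\<exists>N. \<forall>m\<ge>N. \<forall>n\<ge>N. ndist W (f (x m)) (f (x n)) < \<epsilon>" by blast
qed (use f in auto)

lemma cauchy_add:
  assumes x: "x \<in> cauchy_seqs V" and y: "y \<in> cauchy_seqs V"
  shows "(\<lambda>n. x n \<oplus> y n) \<in> cauchy_seqs V" unfolding cauchy_seqs_def
proof safe
  fix \<epsilon> :: real assume e: "\<epsilon> > 0"
  note c = cauchy_closed[OF x] cauchy_closed[OF y]
  obtain N where N: "\<forall>m\<ge>N. \<forall>n\<ge>N. ndist V (x m) (x n) < \<epsilon> / 2" using cauchyD[OF x, of "\<epsilon>/2"] e by auto
  obtain M where M: "\<forall>m\<ge>M. \<forall>n\<ge>M. ndist V (y m) (y n) < \<epsilon> / 2" using cauchyD[OF y, of "\<epsilon>/2"] e by auto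
  have "ndist V (x m \<oplus> y m) (x n \<oplus> y n) < \<epsilon>" if "m \<ge> max M N" "n \<ge> max M N" for m n
  proof -
    have "ndist V (x m \<oplus> y m) (x n \<oplus> y n) \<le> ndist V (x m) (x n) + ndist V (y m) (y n)"
      using c by (simp add: ndist_eq add_diff_add nrm_triangle)
    also have "\<dots> < \<epsilon>/2 + \<epsilon>/2" using N M that by (intro add_strict_mono) auto
    finally show ?thesis by simp
  qed
  then show "\<exists>N. \<forall>m\<ge>N. \<forall>n\<ge>N. ndist V (x m \<oplus> y m) (x n \<oplus> y n) < \<epsilon>" by blast
qed (use cauchy_closed[OF x] cauchy_closed[OF y] in auto)

lemma cauchy_smult: "x \<in> cauchy_seqs V \<Longrightarrow> (\<lambda>n. c \<odot> x n) \<in> cauchy_seqs V"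
  by (rule cauchy_Lipschitz[where L = "cmod c"])
    (auto intro: seminormed_axioms simp: cauchy_closed ndist_eq smult_diff_r[symmetric] nrm_smult)

lemma cauchy_diff:
  assumes x: "x \<in> cauchy_seqs V" and y: "y \<in> cauchy_seqs V"
  shows "(\<lambda>n. x n \<ominus> y n) \<in> cauchy_seqs V" using cauchy_add[OF x cauchy_smult[OF y, of "-1"]]
  by (simp add: minus_eq neg_eq cauchy_closed[OF x] cauchy_closed[OF y])

lemma cauchy_nrm_convergent: "x \<in> cauchy_seqs V \<Longrightarrow> convergent (\<lambda>n. ||x n||)"
proof -
  assume x: "x \<in> cauchy_seqs V"
  have "Cauchy (\<lambda>n. ||x n||)"
  proof (rule metric_CauchyI)
    fix e :: real assume "e > 0"
    then obtain N where N: "\<forall>m\<ge>N. \<forall>n\<ge>N. ndist V (x m) (x n) < e" using cauchyD[OF x] by blast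
    have "dist ||x m|| ||x n|| < e" if "m \<ge> N" "n \<ge> N" for m n
      using N that nrm_diff_ge[of "x m" "x n"] cauchy_closed[OF x] by (fastforce simp: dist_real_def ndist_eq)
    then show "\<exists>M. \<forall>m\<ge>M. \<forall>n\<ge>M. dist ||x m|| ||x n|| < e" by blast
  qed
  then show ?thesis by (simp add: Cauchy_convergent)
qed

lemma cauchy_bounded: "x \<in> cauchy_seqs V \<Longrightarrow> \<exists>K>0. \<forall>n. ||x n|| \<le> K"
proof -
  assume x: "x \<in> cauchy_seqs V"
  have "Bseq (\<lambda>n. ||x n||)" using cauchy_nrm_convergent[OF x] by (rule convergent_imp_Bseq)
  then obtain K where "K > 0" "\<forall>n. norm ||x n|| \<le> K" unfolding Bseq_def by auto
  then show ?thesis using cauchy_closed[OF x] by (auto intro!: exI[of _ K])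
qed

lemma seq_class_eq_iff:
  assumes x: "x \<in> cauchy_seqs V" and y: "y \<in> cauchy_seqs V"
  shows "seq_class V x = seq_class V y \<longleftrightarrow> (\<lambda>n. ndist V (x n) (y n)) \<longlonglongrightarrow> 0"
proof
  assume "seq_class V x = seq_class V y"
  moreover have "y \<in> seq_class V y" using y by (simp add: seq_class_def)
  ultimately have "y \<in> seq_class V x" by (rule ssubst)
  then show "(\<lambda>n. ndist V (x n) (y n)) \<longlonglongrightarrow> 0" by (simp add: seq_class_def)
next
  assume xy: "(\<lambda>n. ndist V (x n) (y n)) \<longlonglongrightarrow> 0"
  have "(\<lambda>n. ndist V (a n) (c n)) \<longlonglongrightarrow> 0"
    if "(\<lambda>n. ndist V (a n) (b n)) \<longlonglongrightarrow> 0" "(\<lambda>n. ndist V (b n) (c n)) \<longlonglongrightarrow> 0"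
      "\<And>n. a n \<in> carrier V" "\<And>n. b n \<in> carrier V" "\<And>n. c n \<in> carrier V" for a b c
    by (rule tendsto_0_le_add[OF that(1,2)]) (use that(3-5) in \<open>auto simp: ndist_triangle\<close>)
  note tr = this
  have yx: "(\<lambda>n. ndist V (y n) (x n)) \<longlonglongrightarrow> 0" using xy by (simp add: ndist_sym)
  show "seq_class V x = seq_class V y"
  proof -
    have "(\<lambda>n. ndist V (x n) (z n)) \<longlonglongrightarrow> 0 \<longleftrightarrow> (\<lambda>n. ndist V (y n) (z n)) \<longlonglongrightarrow> 0" if z: "z \<in> cauchy_seqs V" for z
      using tr[OF yx, of z] tr[OF xy, of z] cauchy_closed[OF x] cauchy_closed[OF y] cauchy_closed[OF z] by metis
    then show ?thesis unfolding seq_class_def by blast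
  qed
qed

text \<open>The operations of \<open>completion\<close> are defined on chosen representatives. A
  chosen one differs from any other by a null sequence, so the lemmas below may compute with
  arbitrary representatives.\<close>

lemma rep_seq_class:
  assumes "x \<in> cauchy_seqs V"
  shows "rep (seq_class V x) \<in> cauchy_seqs V"
    and "(\<lambda>n. ndist V (x n) (rep (seq_class V x) n)) \<longlonglongrightarrow> 0"
    and "seq_class V (rep (seq_class V x)) = seq_class V x"
proof -
  have "x \<in> seq_class V x" using assms by (simp add: seq_class_def)
  then have "rep (seq_class V x) \<in> seq_class V x" unfolding rep_def by (rule someI[of "\<lambda>z. z \<in> seq_class V x"])
  then show 1: "rep (seq_class V x) \<in> cauchy_seqs V"
    and 2: "(\<lambda>n. ndist V (x n) (rep (seq_class V x) n)) \<longlonglongrightarrow> 0" by (auto simp: seq_class_def)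
  show "seq_class V (rep (seq_class V x)) = seq_class V x"
    using 2 by (simp add: seq_class_eq_iff 1 assms ndist_sym)
qed

lemma completionE:
  assumes "X \<in> carrier (completion V)"
  obtains x where "x \<in> cauchy_seqs V" "X = seq_class V x" using assms by (auto simp: completion_def)

lemma seq_class_closed [simp]: "x \<in> cauchy_seqs V \<Longrightarrow> seq_class V x \<in> carrier (completion V)"
  by (auto simp: completion_def)

lemma rep_completion:
  assumes "X \<in> carrier (completion V)"
  shows "rep X \<in> cauchy_seqs V" "seq_class V (rep X) = X" using assms rep_seq_class by (auto elim!: completionE)

lemma completion_add:
  assumes x: "x \<in> cauchy_seqs V" and y: "y \<in> cauchy_seqs V"
  shows "seq_class V x \<oplus>\<^sub>(completion V) seq_class V y = seq_class V (\<lambda>n. x n \<oplus> y n)"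
proof -
  note rx = rep_seq_class[OF x] and ry = rep_seq_class[OF y]
  note cl = cauchy_closed[OF x] cauchy_closed[OF y] cauchy_closed[OF rx(1)] cauchy_closed[OF ry(1)]
  have "(\<lambda>n. ndist V (x n \<oplus> y n) (rep (seq_class V x) n \<oplus> rep (seq_class V y) n)) \<longlonglongrightarrow> 0"
    by (rule tendsto_0_le_add[OF rx(2) ry(2)])
      (use cl in \<open>auto simp: ndist_eq add_diff_add nrm_triangle\<close>)
  then have "seq_class V (\<lambda>n. x n \<oplus> y n) = seq_class V (\<lambda>n. rep (seq_class V x) n \<oplus> rep (seq_class V y) n)"
    by (subst seq_class_eq_iff) (auto intro: cauchy_add x y rx ry)
  then show ?thesis by (simp add: completion_def)
qed

lemma completion_smult:
  assumes x: "x \<in> cauchy_seqs V"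
  shows "c \<odot>\<^sub>(completion V) seq_class V x = seq_class V (\<lambda>n. c \<odot> x n)"
proof -
  note rx = rep_seq_class[OF x]
  note cl = cauchy_closed[OF x] cauchy_closed[OF rx(1)]
  have "(\<lambda>n. ndist V (c \<odot> x n) (c \<odot> rep (seq_class V x) n)) \<longlonglongrightarrow> 0"
    using tendsto_mult_left[OF rx(2), of "cmod c"] cl by (simp add: ndist_eq smult_diff_r[symmetric] nrm_smult)
  then have "seq_class V (\<lambda>n. c \<odot> x n) = seq_class V (\<lambda>n. c \<odot> rep (seq_class V x) n)"
    by (subst seq_class_eq_iff) (auto intro: cauchy_smult x rx)
  then show ?thesis by (simp add: completion_def)
qed

lemma completion_zero: "\<zero>\<^sub>(completion V) = seq_class V (\<lambda>n. \<zero>)" by (simp add: completion_def)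

lemma completion_nrm:
  assumes x: "x \<in> cauchy_seqs V"
  shows "(\<lambda>n. ||x n||) \<longlonglongrightarrow> ||seq_class V x||\<^sub>(completion V)"
proof -
  note rx = rep_seq_class[OF x]
  have 1: "(\<lambda>n. ||rep (seq_class V x) n||) \<longlonglongrightarrow> ||seq_class V x||\<^sub>(completion V)"
    using cauchy_nrm_convergent[OF rx(1)] by (simp add: completion_def convergent_LIMSEQ_iff)
  have "(\<lambda>n. ||x n|| - ||rep (seq_class V x) n||) \<longlonglongrightarrow> 0" by (rule Lim_null_comparison[OF _ rx(2)])
      (use nrm_diff_ge cauchy_closed x rx in \<open>auto simp: ndist_eq\<close>)
  from tendsto_add[OF this 1] show ?thesis by simp
qed

lemma module_completion: "module complex_field (completion V)"
proof (rule moduleI)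
  show "abelian_group (completion V)"
  proof (rule abelian_groupI)
    show "\<zero>\<^sub>(completion V) \<in> carrier (completion V)" by (simp add: completion_zero cauchy_const)
    fix X Y assume X: "X \<in> carrier (completion V)" and Y: "Y \<in> carrier (completion V)"
    obtain x where x: "x \<in> cauchy_seqs V" "X = seq_class V x" using X by (rule completionE)
    obtain y where y: "y \<in> cauchy_seqs V" "Y = seq_class V y" using Y by (rule completionE)
    note [simp] = cauchy_closed[OF x(1)] cauchy_closed[OF y(1)]
    show "X \<oplus>\<^sub>(completion V) Y \<in> carrier (completion V)" by (simp add: x y completion_add cauchy_add)
    show "X \<oplus>\<^sub>(completion V) Y = Y \<oplus>\<^sub>(completion V) X" by (simp add: x y completion_add a_comm)
    show "\<zero>\<^sub>(completion V) \<oplus>\<^sub>(completion V) X = X" by (simp add: x completion_zero completion_add cauchy_const)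
    show "\<exists>Z\<in>carrier (completion V). Z \<oplus>\<^sub>(completion V) X = \<zero>\<^sub>(completion V)"
    proof
      show "seq_class V (\<lambda>n. (-1) \<odot> x n) \<in> carrier (completion V)" by (simp add: x cauchy_smult)
      show "seq_class V (\<lambda>n. (-1) \<odot> x n) \<oplus>\<^sub>(completion V) X = \<zero>\<^sub>(completion V)"
      proof -
        have "(-1) \<odot> x n \<oplus> x n = \<zero>" for n by (simp add: smult_neg_l l_neg)
        then show ?thesis using x(1) by (simp only: x(2) completion_add cauchy_smult completion_zero)
      qed
    qed
    fix Z assume Z: "Z \<in> carrier (completion V)"
    obtain z where z: "z \<in> cauchy_seqs V" "Z = seq_class V z" using Z by (rule completionE)
    note [simp] = cauchy_closed[OF z(1)]
    show "(X \<oplus>\<^sub>(completion V) Y) \<oplus>\<^sub>(completion V) Z = X \<oplus>\<^sub>(completion V) (Y \<oplus>\<^sub>(completion V) Z)"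
      by (simp add: x y z completion_add cauchy_add a_assoc)
  qed
next
  fix c d X Y assume X: "X \<in> carrier (completion V)" and Y: "Y \<in> carrier (completion V)"
  obtain x where x: "x \<in> cauchy_seqs V" "X = seq_class V x" using X by (rule completionE)
  obtain y where y: "y \<in> cauchy_seqs V" "Y = seq_class V y" using Y by (rule completionE)
  note [simp] = cauchy_closed[OF x(1)] cauchy_closed[OF y(1)]
  show "c \<odot>\<^sub>(completion V) (X \<oplus>\<^sub>(completion V) Y) =
      c \<odot>\<^sub>(completion V) X \<oplus>\<^sub>(completion V) c \<odot>\<^sub>(completion V) Y"
    by (simp add: x y completion_add completion_smult cauchy_add cauchy_smult smult_add_r)
next
  fix c d X assume X: "X \<in> carrier (completion V)"
  obtain x where x: "x \<in> cauchy_seqs V" "X = seq_class V x" using X by (rule completionE)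
  note [simp] = cauchy_closed[OF x(1)]
  show "c \<odot>\<^sub>(completion V) X \<in> carrier (completion V)" by (simp add: x completion_smult cauchy_smult)
  show "(c \<oplus>\<^sub>complex_field d) \<odot>\<^sub>(completion V) X =
      c \<odot>\<^sub>(completion V) X \<oplus>\<^sub>(completion V) d \<odot>\<^sub>(completion V) X"
    by (simp add: x completion_smult completion_add cauchy_smult smult_add_l)
  show "(c \<otimes>\<^sub>complex_field d) \<odot>\<^sub>(completion V) X =
      c \<odot>\<^sub>(completion V) (d \<odot>\<^sub>(completion V) X)" by (simp add: x completion_smult cauchy_smult smult_mult)
  show "\<one>\<^sub>complex_field \<odot>\<^sub>(completion V) X = X" by (simp add: x completion_smult)
qed (rule cring_complex_field)

lemma seminormed_completion: "seminormed (completion V)"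
proof -
  interpret C: module complex_field "completion V" by (rule module_completion)
  show ?thesis
  proof
    fix X Y assume X: "X \<in> carrier (completion V)" and Y: "Y \<in> carrier (completion V)"
    obtain x where x: "x \<in> cauchy_seqs V" "X = seq_class V x" using X by (rule completionE)
    obtain y where y: "y \<in> cauchy_seqs V" "Y = seq_class V y" using Y by (rule completionE)
    note [simp] = cauchy_closed[OF x(1)] cauchy_closed[OF y(1)]
    show "||X \<oplus>\<^sub>(completion V) Y||\<^sub>(completion V) \<le> ||X||\<^sub>(completion V) + ||Y||\<^sub>(completion V)"
      using completion_nrm[OF cauchy_add[OF x(1) y(1)]]
        tendsto_add[OF completion_nrm[OF x(1)] completion_nrm[OF y(1)]]
      by (simp add: x y completion_add) (rule LIMSEQ_le, assumption+, auto simp: nrm_triangle)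
  next
    fix c X assume X: "X \<in> carrier (completion V)"
    obtain x where x: "x \<in> cauchy_seqs V" "X = seq_class V x" using X by (rule completionE)
    note [simp] = cauchy_closed[OF x(1)]
    show "||c \<odot>\<^sub>(completion V) X||\<^sub>(completion V) = cmod c * ||X||\<^sub>(completion V)"
      using completion_nrm[OF cauchy_smult[OF x(1), of c]]
        tendsto_mult_left[OF completion_nrm[OF x(1)], of "cmod c"]
      by (simp add: x completion_smult nrm_smult) (rule LIMSEQ_unique)
  qed
qed

lemma completion_diff:
  assumes x: "x \<in> cauchy_seqs V" and y: "y \<in> cauchy_seqs V"
  shows "seq_class V x \<ominus>\<^sub>(completion V) seq_class V y = seq_class V (\<lambda>n. x n \<ominus> y n)"
proof -
  interpret C: seminormed "completion V" by (rule seminormed_completion)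
  note [simp] = cauchy_closed[OF x] cauchy_closed[OF y]
  show ?thesis
    using x y by (simp add: C.minus_eq C.neg_eq completion_smult completion_add cauchy_smult minus_eq neg_eq)
qed

lemma completion_ndist:
  assumes x: "x \<in> cauchy_seqs V" and y: "y \<in> cauchy_seqs V"
  shows "(\<lambda>n. ndist V (x n) (y n)) \<longlonglongrightarrow> ndist (completion V) (seq_class V x) (seq_class V y)"
  using completion_nrm[OF cauchy_diff[OF x y]] x y by (simp add: ndist_def completion_diff cauchy_closed)

lemma completion_dense:
  assumes X: "X \<in> carrier (completion V)" and e: "\<epsilon> > 0"
  shows "\<exists>v\<in>carrier V. ndist (completion V) X (seq_class V (\<lambda>n. v)) < \<epsilon>"
proof -
  obtain x where x: "x \<in> cauchy_seqs V" "X = seq_class V x" using X by (rule completionE)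
  obtain N where N: "\<forall>m\<ge>N. \<forall>n\<ge>N. ndist V (x m) (x n) < \<epsilon> / 2" using cauchyD[OF x(1), of "\<epsilon> / 2"] e by auto
  have "(\<lambda>n. ndist V (x n) (x N)) \<longlonglongrightarrow> ndist (completion V) X (seq_class V (\<lambda>n. x N))"
    using completion_ndist[OF x(1) cauchy_const[OF cauchy_closed[OF x(1)]]] x(2) by simp
  then have "ndist (completion V) X (seq_class V (\<lambda>n. x N)) \<le> \<epsilon> / 2"
    by (rule LIMSEQ_le_const2) (use N in \<open>auto intro!: exI[of _ N] less_imp_le\<close>)
  then show ?thesis using e cauchy_closed[OF x(1)] by (intro bexI[of _ "x N"]) auto
qed

lemma banach_completion: "banach_space (completion V)"
proof -
  interpret C: seminormed "completion V" by (rule seminormed_completion)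
  show ?thesis
  proof
    fix X assume X: "X \<in> carrier (completion V)"
    obtain x where x: "x \<in> cauchy_seqs V" "X = seq_class V x" using X by (rule completionE)
    note [simp] = cauchy_closed[OF x(1)]
    show "||X||\<^sub>(completion V) = 0 \<longleftrightarrow> X = \<zero>\<^sub>(completion V)"
    proof
      assume "||X||\<^sub>(completion V) = 0"
      then have "(\<lambda>n. ||x n||) \<longlonglongrightarrow> 0" using completion_nrm[OF x(1)] x(2) by simp
      then show "X = \<zero>\<^sub>(completion V)"
        using x(1) by (simp add: x(2) completion_zero seq_class_eq_iff cauchy_const ndist_eq minus_eq neg_eq)
    qed simp
  next
    fix s assume s: "s \<in> cauchy_seqs (completion V)"
    \<comment> \<open>Diagonal argument: constant sequences approximate the members of s, the n-th
      one within 1/(n+1). The approximants d form a Cauchy sequence of V, and its class is the limit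
      of s.\<close>
    have "\<forall>n. \<exists>v\<in>carrier V. ndist (completion V) (s n) (seq_class V (\<lambda>k. v)) < 1 / Suc n"
      using completion_dense C.cauchy_closed[OF s] by auto
    then obtain d where d: "\<And>n. d n \<in> carrier V"
      "\<And>n. ndist (completion V) (s n) (seq_class V (\<lambda>k. d n)) < 1 / Suc n" by metis
    note dc = seq_class_closed[OF cauchy_const[OF d(1)]]
    note sc = C.cauchy_closed[OF s]
    have dd: "ndist V (d m) (d n) = ndist (completion V) (seq_class V (\<lambda>k. d m)) (seq_class V (\<lambda>k. d n))" for m n
      using completion_ndist[OF cauchy_const[OF d(1)] cauchy_const[OF d(1)]] by (simp add: LIMSEQ_const_iff)
    have dC: "d \<in> cauchy_seqs V" unfolding cauchy_seqs_def
    proof safe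
      fix \<epsilon> :: real assume e: "\<epsilon> > 0"
      obtain N where N: "\<forall>m\<ge>N. \<forall>n\<ge>N. ndist (completion V) (s m) (s n) < \<epsilon> / 3"
        using C.cauchyD[OF s, of "\<epsilon>/3"] e by auto
      obtain M where M: "1 / real (Suc M) < \<epsilon> / 3" using e nat_approx_posE[of "\<epsilon>/3"] by auto
      have "ndist V (d m) (d n) < \<epsilon>" if "m \<ge> max M N" "n \<ge> max M N" for m n
      proof -
        have "1 / real (Suc m) \<le> 1 / real (Suc M)" "1 / real (Suc n) \<le> 1 / real (Suc M)"
          using that by (auto simp: frac_le)
        then have "ndist (completion V) (s m) (seq_class V (\<lambda>k. d m)) < \<epsilon>/3"
          "ndist (completion V) (s n) (seq_class V (\<lambda>k. d n)) < \<epsilon>/3" using d(2)[of m] d(2)[of n] M by linarith+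
        moreover have "ndist (completion V) (s m) (s n) < \<epsilon>/3" using N that by auto
        moreover have "ndist V (d m) (d n) \<le> ndist (completion V) (seq_class V (\<lambda>k. d m)) (s m)
            + (ndist (completion V) (s m) (s n) + ndist (completion V) (s n) (seq_class V (\<lambda>k. d n)))"
          unfolding dd using C.ndist_triangle[OF dc[of m] sc[of m] dc[of n]]
            C.ndist_triangle[OF sc[of m] sc[of n] dc[of n]] by linarith
        ultimately show ?thesis by (simp add: C.ndist_sym)
      qed
      then show "\<exists>N. \<forall>m\<ge>N. \<forall>n\<ge>N. ndist V (d m) (d n) < \<epsilon>" by blast
    qed (rule d(1))
    show "\<exists>l\<in>carrier (completion V). (\<lambda>n. ndist (completion V) (s n) l) \<longlonglongrightarrow> 0"
    proof (intro bexI[of _ "seq_class V d"] LIMSEQ_I)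
      fix r :: real assume r: "r > 0"
      obtain N where N: "\<forall>m\<ge>N. \<forall>n\<ge>N. ndist V (d m) (d n) < r / 3" using cauchyD[OF dC, of "r/3"] r by auto
      obtain M where M: "1 / real (Suc M) < r / 3" using r nat_approx_posE[of "r/3"] by auto
      have "ndist (completion V) (s n) (seq_class V d) < r" if "n \<ge> max M N" for n
      proof -
        have "1 / real (Suc n) \<le> 1 / real (Suc M)" using that by (auto simp: frac_le)
        then have 1: "ndist (completion V) (s n) (seq_class V (\<lambda>k. d n)) < r/3" using d(2)[of n] M by linarith
        have "ndist (completion V) (seq_class V (\<lambda>k. d n)) (seq_class V d) \<le> r / 3"
          by (rule LIMSEQ_le_const2[OF completion_ndist[OF cauchy_const[OF d(1)] dC]])
            (use N that in \<open>auto intro!: exI[of _ N] less_imp_le\<close>)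
        then show ?thesis using 1 r C.ndist_triangle[OF sc[of n] dc[of n] seq_class_closed[OF dC]] by linarith
      qed
      then show "\<exists>no. \<forall>n\<ge>no. norm (ndist (completion V) (s n) (seq_class V d) - 0) < r"
        by (intro exI[of _ "max M N"]) auto
    qed (simp add: dC)
  qed (simp_all add: C.nrm_triangle C.nrm_smult)
qed

lemma seq_class_const_isometric:
  assumes "v \<in> carrier V" "w \<in> carrier V"
  shows "ndist (completion V) (seq_class V (\<lambda>n. v)) (seq_class V (\<lambda>n. w)) = ndist V v w"
    "||seq_class V (\<lambda>n. v)||\<^sub>(completion V) = ||v||"
  using completion_ndist[OF cauchy_const[OF assms(1)] cauchy_const[OF assms(2)]]
    completion_nrm[OF cauchy_const[OF assms(1)]] by (simp_all add: LIMSEQ_const_iff)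

end

sublocale banach_space \<subseteq> seminormed
  by unfold_locales (auto simp: nrm_triangle nrm_smult)

section \<open>Compact operators and total boundedness\<close>

lemma (in banach_space) Metric_space_ndist: "Metric_space (carrier V) (ndist V)"
proof
  fix x y assume "x \<in> carrier V" "y \<in> carrier V"
  then show "ndist V x y = 0 \<longleftrightarrow> x = y" by (simp add: ndist_eq nrm_eq_0 diff_eq_0_iff)
qed (auto simp: ndist_sym ndist_triangle)

text \<open>Completeness turns relative compactness into total boundedness, which can be tested on a
  dense subspace.\<close>

lemma (in banach_space) compact_op_iff:
  assumes T: "T \<in> carrier V \<rightarrow> carrier V"
  shows "compact_op V T \<longleftrightarrow> Metric_space.mtotally_bounded (carrier V) (ndist V)
    (T ` {x \<in> carrier V. ||x|| \<le> 1})"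
proof -
  interpret M: Metric_space "carrier V" "ndist V" by (rule Metric_space_ndist)
  have "M.mcomplete" unfolding M.mcomplete_def
  proof safe
    fix \<sigma> assume "M.MCauchy \<sigma>"
    then have M: "range \<sigma> \<subseteq> carrier V"
      "\<And>\<epsilon>. \<epsilon> > 0 \<Longrightarrow> \<exists>N. \<forall>n n'. N \<le> n \<longrightarrow> N \<le> n' \<longrightarrow> ndist V (\<sigma> n) (\<sigma> n') < \<epsilon>" unfolding M.MCauchy_def by simp_all
    have "\<sigma> \<in> cauchy_seqs V" unfolding cauchy_seqs_def
    proof (safe)
      fix n show "\<sigma> n \<in> carrier V" using M(1) by (rule subsetD) simp
    next
      fix \<epsilon> :: real assume "\<epsilon> > 0"
      from M(2)[OF this] show "\<exists>N. \<forall>m\<ge>N. \<forall>n\<ge>N. ndist V (\<sigma> m) (\<sigma> n) < \<epsilon>" by meson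
    qed
    from complete[OF this] obtain l where "l \<in> carrier V" "(\<lambda>n. ndist V (\<sigma> n) l) \<longlonglongrightarrow> 0" by blast
    moreover have "\<sigma> n \<in> carrier V" for n using M(1) by (rule subsetD) simp
    ultimately show "\<exists>x. limitin M.mtopology \<sigma> x sequentially"
      by (auto simp: M.limitin_metric_dist_null intro!: exI[of _ l])
  qed
  moreover have "T ` {x \<in> carrier V. ||x|| \<le> 1} \<subseteq> carrier V" using T by auto
  ultimately show ?thesis
    unfolding compact_op_def norm_topology_def by (simp add: M.mtotally_bounded_eq_compact_closure_of)
qed

text \<open>Stated for the seminormed space itself; by \<open>compact_op_completion_iff\<close> it
  amounts to compactness of the operator extended to the completion. The net consists of images of
  vectors of the unit ball, in line with \<open>mtotally_bounded\<close>.\<close>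

definition totally_bounded_op :: "('a, 'm) cnormed_scheme \<Rightarrow> ('a \<Rightarrow> 'a) \<Rightarrow> bool" where
  "totally_bounded_op V T \<longleftrightarrow> (\<forall>\<epsilon>>0. \<exists>K. finite K \<and> K \<subseteq> {x \<in> carrier V. ||x||\<^sub>V \<le> 1} \<and>
     (\<forall>x\<in>carrier V. ||x||\<^sub>V \<le> 1 \<longrightarrow> (\<exists>k\<in>K. ndist V (T x) (T k) < \<epsilon>)))"

context seminormed begin

lemma seq_class_const_nrm [simp]:
  "v \<in> carrier V \<Longrightarrow> ||seq_class V (\<lambda>n. v)||\<^sub>(completion V) = ||v||"
  using seq_class_const_isometric(2)[of v v] by simp

lemma bounded_mapE:
  assumes "bounded_map V W T"
  obtains C where "C \<ge> 0" "\<And>x. x \<in> carrier V \<Longrightarrow> ||T x||\<^sub>W \<le> C * ||x||"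
proof -
  obtain C where C: "\<And>x. x \<in> carrier V \<Longrightarrow> ||T x||\<^sub>W \<le> C * ||x||" using assms by (auto simp: bounded_map_def)
  have "||T x||\<^sub>W \<le> max C 0 * ||x||" if "x \<in> carrier V" for x
    using C[OF that] mult_right_mono[of C "max C 0" "||x||"] that by simp
  then show ?thesis using that[of "max C 0"] by simp
qed

lemma bounded_ndist:
  assumes T: "clinear_map V W T" and W: "seminormed W"
    and C: "\<And>x. x \<in> carrier V \<Longrightarrow> ||T x||\<^sub>W \<le> C * ||x||"
    and x: "x \<in> carrier V" "y \<in> carrier V"
  shows "ndist W (T x) (T y) \<le> C * ndist V x y"
proof -
  interpret W: seminormed W by fact
  have "T x \<in> carrier W" "T y \<in> carrier W" using T x by (auto simp: clinear_map_def)
  then show ?thesis using C[of "x \<ominus> y"] x by (simp add: ndist_eq W.ndist_eq clinear_map_diff[OF T W x])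
qed

text \<open>The net K may lie anywhere in a space W that contains V isometrically. Each point of K
  that is \<epsilon>/2-close to the image is replaced by an image point close to it, at the price of
  a factor 2.\<close>

lemma totally_bounded_opI:
  assumes T: "T \<in> carrier V \<rightarrow> carrier V"
    and W: "seminormed W" and j: "j \<in> carrier V \<rightarrow> carrier W"
      "\<And>x y. \<lbrakk>x \<in> carrier V; y \<in> carrier V\<rbrakk> \<Longrightarrow> ndist W (j x) (j y) = ndist V x y"
    and K: "\<And>\<epsilon>. \<epsilon> > 0 \<Longrightarrow> \<exists>K. finite K \<and> K \<subseteq> carrier W \<and>
      (\<forall>x\<in>carrier V. ||x|| \<le> 1 \<longrightarrow> (\<exists>k\<in>K. ndist W (j (T x)) k < \<epsilon>))"
  shows "totally_bounded_op V T" unfolding totally_bounded_op_def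
proof (intro allI impI)
  fix \<epsilon> :: real assume "\<epsilon> > 0"
  then obtain K where K: "finite K" "K \<subseteq> carrier W"
    "\<And>x. \<lbrakk>x \<in> carrier V; ||x|| \<le> 1\<rbrakk> \<Longrightarrow> \<exists>k\<in>K. ndist W (j (T x)) k < \<epsilon> / 2" using K[of "\<epsilon> / 2"] by auto
  define P where "P k x \<longleftrightarrow> x \<in> carrier V \<and> ||x|| \<le> 1 \<and> ndist W (j (T x)) k < \<epsilon> / 2" for k x
  define L where "L = (\<lambda>k. SOME x. P k x) ` {k\<in>K. \<exists>x. P k x}"
  have "\<exists>l\<in>L. ndist V (T x) (T l) < \<epsilon>" if x: "x \<in> carrier V" "||x|| \<le> 1" for x
  proof -
    obtain k where k: "k \<in> K" "ndist W (j (T x)) k < \<epsilon> / 2" using K(3) x by blast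
    define l where "l = (SOME x. P k x)"
    have ex: "\<exists>x. P k x" using k x by (auto simp: P_def)
    then have "P k l" unfolding l_def by (rule someI_ex)
    moreover have "l \<in> L" using k ex by (auto simp: L_def l_def)
    moreover have "k \<in> carrier W" "T x \<in> carrier V" using k K T x by auto
    moreover have "T l \<in> carrier V" using \<open>P k l\<close> T by (auto simp: P_def)
    moreover from calculation j(1) have "j (T x) \<in> carrier W" "j (T l) \<in> carrier W" by auto
    ultimately show ?thesis
      using k seminormed.ndist_triangle[OF W, of "j (T x)" k "j (T l)"] seminormed.ndist_sym[OF W, of k "j (T l)"]
        j(2)[of "T x" "T l"] by (intro bexI[of _ l]) (auto simp: P_def)
  qed
  moreover have "L \<subseteq> {x \<in> carrier V. ||x|| \<le> 1}"
  proof
    fix l assume "l \<in> L"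
    then obtain k where "\<exists>x. P k x" "l = (SOME x. P k x)" by (auto simp: L_def)
    then have "P k l" by (simp add: someI_ex)
    then show "l \<in> {x \<in> carrier V. ||x|| \<le> 1}" by (simp add: P_def)
  qed
  moreover have "finite L" using K by (simp add: L_def)
  ultimately show "\<exists>K. finite K \<and> K \<subseteq> {x \<in> carrier V. ||x|| \<le> 1} \<and>
     (\<forall>x\<in>carrier V. ||x|| \<le> 1 \<longrightarrow> (\<exists>k\<in>K. ndist V (T x) (T k) < \<epsilon>))" by (intro exI[of _ L]) blast
qed

text \<open>Every f p maps the unit ball into that of W, where a single finite net K serves for
  \<Phi>. Choosing a net point for each p gives finitely many functions from P to K, and since the g
  p do not increase distances, these yield a net for the sum.\<close>

lemma totally_bounded_op_finsum:
  assumes W: "seminormed W" and \<Phi>: "totally_bounded_op W \<Phi>" "\<Phi> \<in> carrier W \<rightarrow> carrier W"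
    and P: "finite P"
    and f: "\<And>p x. \<lbrakk>p \<in> P; x \<in> carrier V; ||x|| \<le> 1\<rbrakk> \<Longrightarrow> f p x \<in> carrier W \<and> ||f p x||\<^sub>W \<le> 1"
    and g: "\<And>p x. \<lbrakk>p \<in> P; x \<in> carrier W\<rbrakk> \<Longrightarrow> g p x \<in> carrier V"
    and gL: "\<And>p x y. \<lbrakk>p \<in> P; x \<in> carrier W; y \<in> carrier W\<rbrakk> \<Longrightarrow> ndist V (g p x) (g p y) \<le> ndist W x y"
    and R: "R \<in> carrier V \<rightarrow> carrier V" "\<And>x. x \<in> carrier V \<Longrightarrow> R x = (\<Oplus>p\<in>P. g p (\<Phi> (f p x)))"
  shows "totally_bounded_op V R"
proof (rule totally_bounded_opI[OF _ seminormed_axioms, of _ "\<lambda>x. x"])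
  fix \<epsilon> :: real assume e: "\<epsilon> > 0"
  interpret W: seminormed W by fact
  \<comment> \<open>Each of the \<open>card P\<close> summands may be off by \<delta>; the added 1
    keeps the total strictly below \<epsilon> and covers an empty P.\<close>
  define \<delta> where "\<delta> = \<epsilon> / (1 + real (card P))"
  have d: "\<delta> > 0" using e by (simp add: \<delta>_def add_pos_nonneg)
  obtain K where K: "finite K" "K \<subseteq> {x \<in> carrier W. ||x||\<^sub>W \<le> 1}"
    "\<And>x. \<lbrakk>x \<in> carrier W; ||x||\<^sub>W \<le> 1\<rbrakk> \<Longrightarrow> \<exists>k\<in>K. ndist W (\<Phi> x) (\<Phi> k) < \<delta>"
    using \<Phi>(1) d unfolding totally_bounded_op_def by meson
  define L where "L = (\<lambda>\<kappa>. \<Oplus>p\<in>P. g p (\<Phi> (\<kappa> p))) ` (PiE P (\<lambda>_. K))"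
  have gP: "(\<lambda>p. g p (\<Phi> (\<kappa> p))) \<in> P \<rightarrow> carrier V" if "\<kappa> \<in> P \<rightarrow> carrier W" for \<kappa>
    using that g \<Phi>(2) by (auto simp: Pi_iff)
  have "\<exists>l\<in>L. ndist V (R x) l < \<epsilon>" if x: "x \<in> carrier V" "||x|| \<le> 1" for x
  proof -
    have "\<forall>p\<in>P. \<exists>k\<in>K. ndist W (\<Phi> (f p x)) (\<Phi> k) < \<delta>" using f x K(3) by blast
    then obtain \<kappa>0 where k0: "\<And>p. p \<in> P \<Longrightarrow> \<kappa>0 p \<in> K \<and> ndist W (\<Phi> (f p x)) (\<Phi> (\<kappa>0 p)) < \<delta>" by metis
    define \<kappa> where "\<kappa> = restrict \<kappa>0 P"
    have \<kappa>: "\<kappa> \<in> PiE P (\<lambda>_. K)" "\<And>p. p \<in> P \<Longrightarrow> ndist W (\<Phi> (f p x)) (\<Phi> (\<kappa> p)) < \<delta>" using k0 by (auto simp: \<kappa>_def)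
    have \<kappa>W: "\<kappa> \<in> P \<rightarrow> carrier W" using \<kappa>(1) K(2) by (auto simp: PiE_iff)
    have fW: "(\<lambda>p. f p x) \<in> P \<rightarrow> carrier W" using f x by auto
    note c1 = gP[OF fW] note c2 = gP[OF \<kappa>W]
    have c3: "(\<lambda>p. g p (\<Phi> (f p x)) \<ominus> g p (\<Phi> (\<kappa> p))) \<in> P \<rightarrow> carrier V" using c1 c2 by (auto simp: Pi_iff)
    have "R x \<ominus> (\<Oplus>p\<in>P. g p (\<Phi> (\<kappa> p))) = (\<Oplus>p\<in>P. g p (\<Phi> (f p x)) \<ominus> g p (\<Phi> (\<kappa> p)))"
    proof -
      have "R x = (\<Oplus>p\<in>P. (g p (\<Phi> (f p x)) \<ominus> g p (\<Phi> (\<kappa> p))) \<oplus> g p (\<Phi> (\<kappa> p)))"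
        unfolding R(2)[OF x(1)] using c1 c2 by (intro finsum_cong') (auto simp: diff_add_cancel Pi_iff)
      also have "\<dots> = (\<Oplus>p\<in>P. g p (\<Phi> (f p x)) \<ominus> g p (\<Phi> (\<kappa> p))) \<oplus> (\<Oplus>p\<in>P. g p (\<Phi> (\<kappa> p)))"
        by (rule finsum_addf[OF c3 c2])
      finally show ?thesis using finsum_closed[OF c3] finsum_closed[OF c2] by (simp add: minus_eq a_assoc r_neg)
    qed
    then have "ndist V (R x) (\<Oplus>p\<in>P. g p (\<Phi> (\<kappa> p))) = ||\<Oplus>p\<in>P. g p (\<Phi> (f p x)) \<ominus> g p (\<Phi> (\<kappa> p))||"
      using ndist_eq[OF funcset_mem[OF R(1) x(1)] finsum_closed[OF c2]] by simp
    also have "\<dots> \<le> (\<Sum>p\<in>P. ||g p (\<Phi> (f p x)) \<ominus> g p (\<Phi> (\<kappa> p))||)" by (rule nrm_finsum_le[OF P c3])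
    also have "\<dots> \<le> (\<Sum>p\<in>P. \<delta>)"
    proof (rule sum_mono)
      fix p assume p: "p \<in> P"
      have "\<Phi> (f p x) \<in> carrier W" "\<Phi> (\<kappa> p) \<in> carrier W" using \<Phi>(2) f p x \<kappa>W by auto
      from gL[OF p this] g[OF p this(1)] g[OF p this(2)] \<kappa>(2)[OF p]
      show "||g p (\<Phi> (f p x)) \<ominus> g p (\<Phi> (\<kappa> p))|| \<le> \<delta>" by (simp add: ndist_eq)
    qed
    also have "\<dots> < \<epsilon>" using e by (simp add: \<delta>_def field_simps add_pos_nonneg)
    finally show ?thesis using \<kappa>(1) by (auto simp: L_def)
  qed
  moreover have "finite L" using P K by (auto simp: L_def intro!: finite_PiE)
  moreover have "L \<subseteq> carrier V"
  proof
    fix l assume "l \<in> L"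
    then obtain \<kappa> where "\<kappa> \<in> PiE P (\<lambda>_. K)" "l = (\<Oplus>p\<in>P. g p (\<Phi> (\<kappa> p)))" by (auto simp: L_def)
    moreover from this K(2) have "\<kappa> \<in> P \<rightarrow> carrier W" by (auto simp: PiE_iff)
    ultimately show "l \<in> carrier V" using finsum_closed[OF gP] by simp
  qed
  ultimately show "\<exists>K. finite K \<and> K \<subseteq> carrier V \<and>
      (\<forall>x\<in>carrier V. ||x|| \<le> 1 \<longrightarrow> (\<exists>k\<in>K. ndist V (R x) k < \<epsilon>))" by (intro exI[of _ L]) blast
qed (use R in auto)

lemma cauchy_map:
  assumes "clinear_map V V T" "bounded_map V V T" "x \<in> cauchy_seqs V"
  shows "(\<lambda>n. T (x n)) \<in> cauchy_seqs V"
proof -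
  obtain C where C: "C \<ge> 0" "\<And>x. x \<in> carrier V \<Longrightarrow> ||T x|| \<le> C * ||x||"
    using assms(2) by (rule bounded_mapE) blast
  note cl = cauchy_closed[OF assms(3)]
  show ?thesis using assms(1) cl bounded_ndist[OF assms(1) seminormed_axioms C(2) cl cl]
    by (intro cauchy_Lipschitz[OF assms(3) seminormed_axioms, where L = C]) (auto simp: clinear_map_def)
qed

lemma ext_op_seq_class:
  assumes T: "clinear_map V V T" "bounded_map V V T" and x: "x \<in> cauchy_seqs V"
  shows "ext_op V T (seq_class V x) = seq_class V (\<lambda>n. T (x n))"
proof -
  obtain C where C: "C \<ge> 0" "\<And>x. x \<in> carrier V \<Longrightarrow> ||T x|| \<le> C * ||x||" using T(2) by (rule bounded_mapE) blast
  note r = rep_seq_class[OF x]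
  note b = bounded_ndist[OF T(1) seminormed_axioms C(2) cauchy_closed[OF r(1)] cauchy_closed[OF x]]
  have "(\<lambda>n. C * ndist V (rep (seq_class V x) n) (x n)) \<longlonglongrightarrow> 0"
    using tendsto_mult_left[OF r(2), of C] by (simp add: ndist_sym)
  then have "(\<lambda>n. ndist V (T (rep (seq_class V x) n)) (T (x n))) \<longlonglongrightarrow> 0"
    by (rule Lim_null_comparison[rotated]) (use b in auto)
  then have "seq_class V (\<lambda>n. T (rep (seq_class V x) n)) = seq_class V (\<lambda>n. T (x n))"
    using seq_class_eq_iff cauchy_map[OF T] r(1) x by blast
  then show ?thesis using x by (simp add: ext_op_def)
qed

lemma ext_op_PiE:
  assumes "clinear_map V V T" "bounded_map V V T"
  shows "ext_op V T \<in> carrier (completion V) \<rightarrow>\<^sub>E carrier (completion V)"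
  using cauchy_map[OF assms] rep_completion(1) by (auto simp: ext_op_def)

lemma ext_op_linear:
  assumes T: "clinear_map V V T" "bounded_map V V T"
  shows "clinear_map (completion V) (completion V) (ext_op V T)" unfolding clinear_map_def
proof (intro conjI ballI allI)
  show "ext_op V T \<in> carrier (completion V) \<rightarrow> carrier (completion V)" using ext_op_PiE[OF T] by auto
  fix X assume X: "X \<in> carrier (completion V)"
  obtain x where x: "x \<in> cauchy_seqs V" "X = seq_class V x" using X by (rule completionE)
  { fix Y assume Y: "Y \<in> carrier (completion V)"
    obtain y where y: "y \<in> cauchy_seqs V" "Y = seq_class V y" using Y by (rule completionE)
    show "ext_op V T (X \<oplus>\<^sub>(completion V) Y) = ext_op V T X \<oplus>\<^sub>(completion V) ext_op V T Y" using T(1) x(1) y(1)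
      by (simp add: x(2) y(2) completion_add ext_op_seq_class[OF T] cauchy_add cauchy_map[OF T])
        (simp add: clinear_map_def cauchy_closed) }
  fix c
  show "ext_op V T (c \<odot>\<^sub>(completion V) X) = c \<odot>\<^sub>(completion V) ext_op V T X" using T(1) x(1)
    by (simp add: x(2) completion_smult ext_op_seq_class[OF T] cauchy_smult cauchy_map[OF T])
      (simp add: clinear_map_def cauchy_closed)
qed

lemma ext_op_bound:
  assumes T: "clinear_map V V T" and C: "\<And>x. x \<in> carrier V \<Longrightarrow> ||T x|| \<le> C * ||x||"
    and X: "X \<in> carrier (completion V)"
  shows "||ext_op V T X||\<^sub>(completion V) \<le> C * ||X||\<^sub>(completion V)"
proof -
  have Tb: "bounded_map V V T" using C by (auto simp: bounded_map_def)
  obtain x where x: "x \<in> cauchy_seqs V" "X = seq_class V x" using X by (rule completionE)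
  show ?thesis unfolding x(2) ext_op_seq_class[OF T Tb x(1)]
    by (rule LIMSEQ_le[OF completion_nrm[OF cauchy_map[OF T Tb x(1)]]
          tendsto_mult_left[OF completion_nrm[OF x(1)], of C]])
      (use C cauchy_closed[OF x(1)] in auto)
qed

text \<open>A vector v of V close to X may have norm up to 1 + \<epsilon>/2. Dividing it by the
  maximum of 1 and its norm moves it by at most another \<epsilon>/2.\<close>

lemma completion_unit_ball_dense:
  assumes X: "X \<in> carrier (completion V)" "||X||\<^sub>(completion V) \<le> 1" and e: "\<epsilon> > 0"
  shows "\<exists>v\<in>carrier V. ||v|| \<le> 1 \<and> ndist (completion V) X (seq_class V (\<lambda>n. v)) < \<epsilon>"
proof -
  interpret C: banach_space "completion V" by (rule banach_completion)
  obtain v where v: "v \<in> carrier V" "ndist (completion V) X (seq_class V (\<lambda>n. v)) < \<epsilon> / 2"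
    using completion_dense[OF X(1), of "\<epsilon> / 2"] e by auto
  note vc = seq_class_closed[OF cauchy_const[OF v(1)]]
  define m where "m = max 1 ||v||"
  have m: "m \<ge> 1" "||v|| \<le> m" by (auto simp: m_def)
  have "||v|| - ||X||\<^sub>(completion V) \<le> ndist (completion V) X (seq_class V (\<lambda>n. v))"
    using C.nrm_diff_ge[OF X(1) vc] X vc by (simp add: C.ndist_eq seq_class_const_isometric v)
  then have nv: "||v|| \<le> 1 + \<epsilon> / 2" using v X by linarith
  define w where "w = of_real (1 / m) \<odot> v"
  have w: "w \<in> carrier V" "||w|| \<le> 1" using v m by (auto simp: w_def nrm_smult norm_divide divide_simps)
  have "v \<ominus> w = of_real (1 - 1 / m) \<odot> v" using v by (simp add: w_def smult_diff_l[of v 1])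
  then have "||v \<ominus> w|| = (1 - 1 / m) * ||v||" using v m by (simp only: nrm_smult norm_of_real) simp
  also have "\<dots> \<le> (1 - 1 / m) * m" using m by (intro mult_left_mono) auto
  also have "\<dots> = m - 1" using m by (simp add: field_simps)
  also have "\<dots> \<le> \<epsilon> / 2" using nv e by (auto simp: m_def)
  finally have "ndist (completion V) (seq_class V (\<lambda>n. v)) (seq_class V (\<lambda>n. w)) \<le> \<epsilon> / 2"
    using v w by (simp add: seq_class_const_isometric ndist_eq)
  then have "ndist (completion V) X (seq_class V (\<lambda>n. w)) < \<epsilon>"
    using v C.ndist_triangle[OF X(1) vc seq_class_closed[OF cauchy_const[OF w(1)]]] by linarith
  then show ?thesis using w by blast
qed

text \<open>Constant sequences from the unit ball of V are dense in the unit ball of the completion,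
  and the extended operator is Lipschitz, so a net for one image serves for the other.\<close>

lemma compact_op_completion_iff:
  assumes T: "clinear_map V V T" "bounded_map V V T"
  shows "compact_op (completion V) (ext_op V T) \<longleftrightarrow> totally_bounded_op V T"
proof -
  interpret C: banach_space "completion V" by (rule banach_completion)
  interpret M: Metric_space "carrier (completion V)" "ndist (completion V)" by (rule C.Metric_space_ndist)
  let ?H = "completion V" and ?B = "{X \<in> carrier (completion V). ||X||\<^sub>(completion V) \<le> 1}"
  let ?c = "\<lambda>v. seq_class V (\<lambda>n. v)"
  let ?b = "{x \<in> carrier V. ||x|| \<le> 1}"
  have TV: "T x \<in> carrier V" if "x \<in> carrier V" for x using T that by (auto simp: clinear_map_def)
  have Tc: "ext_op V T (?c v) = ?c (T v)" if "v \<in> carrier V" for v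
    using ext_op_seq_class[OF T cauchy_const[OF that]] .
  have cb: "?c v \<in> ?B" if "v \<in> ?b" for v using that by (simp add: cauchy_const seq_class_const_isometric)
  have TP: "ext_op V T \<in> carrier ?H \<rightarrow> carrier ?H" using ext_op_PiE[OF T] by auto
  obtain L where L: "L \<ge> 0" "\<And>x. x \<in> carrier V \<Longrightarrow> ||T x|| \<le> L * ||x||" using T(2) by (rule bounded_mapE) blast
  have "M.mtotally_bounded (ext_op V T ` ?B) \<longleftrightarrow> totally_bounded_op V T"
  proof
    assume "M.mtotally_bounded (ext_op V T ` ?B)"
    moreover have "(\<lambda>v. ?c (T v)) ` ?b \<subseteq> ext_op V T ` ?B"
    proof
      fix Y assume "Y \<in> (\<lambda>v. ?c (T v)) ` ?b"
      then obtain v where "v \<in> ?b" "Y = ext_op V T (?c v)" using Tc by auto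
      then show "Y \<in> ext_op V T ` ?B" using cb by blast
    qed
    ultimately have tb: "M.mtotally_bounded ((\<lambda>v. ?c (T v)) ` ?b)" by (rule M.mtotally_bounded_subset)
    show "totally_bounded_op V T" unfolding totally_bounded_op_def
    proof (intro allI impI)
      fix \<epsilon> :: real assume "\<epsilon> > 0"
      from tb[unfolded M.mtotally_bounded_def, rule_format, OF this]
      obtain K where K: "finite K" "K \<subseteq> (\<lambda>v. ?c (T v)) ` ?b"
        "(\<lambda>v. ?c (T v)) ` ?b \<subseteq> (\<Union>x\<in>K. M.mball x \<epsilon>)" by (elim exE conjE)
      from finite_subset_image[OF K(1,2)]
      obtain K' where K': "K' \<subseteq> ?b" "finite K'" "K = (\<lambda>v. ?c (T v)) ` K'" by (elim exE conjE)
      have "\<exists>k\<in>K'. ndist V (T x) (T k) < \<epsilon>" if x: "x \<in> carrier V" "||x|| \<le> 1" for x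
      proof -
        have "?c (T x) \<in> (\<Union>x\<in>K. M.mball x \<epsilon>)" using K(3) x by blast
        then obtain k where k: "k \<in> K'" "ndist ?H (?c (T k)) (?c (T x)) < \<epsilon>" using K'(3) by auto
        then have "ndist V (T k) (T x) < \<epsilon>" using K' x TV by (auto simp: seq_class_const_isometric)
        then show ?thesis using k by (auto simp: ndist_sym)
      qed
      then show "\<exists>K. finite K \<and> K \<subseteq> ?b \<and> (\<forall>x\<in>carrier V. ||x|| \<le> 1 \<longrightarrow> (\<exists>k\<in>K. ndist V (T x) (T k) < \<epsilon>))"
        using K' by (intro exI[of _ K']) blast
    qed
  next
    assume tb: "totally_bounded_op V T"
    show "M.mtotally_bounded (ext_op V T ` ?B)" unfolding M.mtotally_bounded_def
    proof (intro allI impI)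
      fix \<epsilon> :: real assume e: "\<epsilon> > 0"
      then have "\<epsilon> / 2 > 0" by simp
      from tb[unfolded totally_bounded_op_def, rule_format, OF this]
      obtain K where K: "finite K" "K \<subseteq> ?b"
        "\<forall>x\<in>carrier V. ||x|| \<le> 1 \<longrightarrow> (\<exists>k\<in>K. ndist V (T x) (T k) < \<epsilon> / 2)" by (elim exE conjE)
      have "\<exists>k\<in>K. ndist ?H (?c (T k)) (ext_op V T X) < \<epsilon>" if X: "X \<in> ?B" for X
      proof -
        \<comment> \<open>The distance from X to v is multiplied by at most L. Dividing by L + 1
          rather than L covers L = 0.\<close>
        obtain v where v: "v \<in> carrier V" "||v|| \<le> 1" "ndist ?H X (?c v) < \<epsilon> / (2 * (L + 1))"
          using completion_unit_ball_dense[of X "\<epsilon> / (2 * (L + 1))"] X e L by auto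
        then have Lv: "L * ndist ?H X (?c v) \<le> L * (\<epsilon> / (2 * (L + 1)))" using L by (intro mult_left_mono) auto
        have "L * (\<epsilon> / (2 * (L + 1))) < \<epsilon> / 2" using L e by (simp add: field_simps)
        moreover have "ndist ?H (ext_op V T X) (ext_op V T (?c v)) \<le> L * ndist ?H X (?c v)"
          using X v ext_op_bound[OF T(1) L(2)]
          by (intro C.bounded_ndist ext_op_linear T seminormed_completion) (auto simp: cauchy_const)
        ultimately have 1: "ndist ?H (ext_op V T X) (?c (T v)) < \<epsilon> / 2"
          using Lv unfolding Tc[OF v(1)] by linarith
        obtain k where k: "k \<in> K" "ndist V (T v) (T k) < \<epsilon> / 2" using K(3) v by blast
        have kV: "k \<in> carrier V" using k K by auto
        have 2: "ndist ?H (?c (T v)) (?c (T k)) < \<epsilon> / 2"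
          using k kV v TV by (simp add: seq_class_const_isometric)
        have "ext_op V T X \<in> carrier ?H" using TP X by auto
        then have "ndist ?H (ext_op V T X) (?c (T k)) < \<epsilon>"
          using 1 2 C.ndist_triangle[of "ext_op V T X" "?c (T v)" "?c (T k)"] kV v TV
          by (auto simp: cauchy_const)
        then show ?thesis using k by (auto simp: C.ndist_sym)
      qed
      note ap = this
      have "ext_op V T ` ?B \<subseteq> (\<Union>x\<in>(\<lambda>k. ?c (T k)) ` K. M.mball x \<epsilon>)"
      proof
        fix Y assume "Y \<in> ext_op V T ` ?B"
        then obtain X where X: "X \<in> ?B" "Y = ext_op V T X" by blast
        obtain k where k: "k \<in> K" "ndist ?H (?c (T k)) Y < \<epsilon>" using ap[OF X(1)] X(2) by blast
        have "Y \<in> carrier ?H" using X TP by auto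
        moreover have "?c (T k) \<in> carrier ?H" using k K TV by (auto simp: cauchy_const)
        ultimately show "Y \<in> (\<Union>x\<in>(\<lambda>k. ?c (T k)) ` K. M.mball x \<epsilon>)" using k by auto
      qed
      moreover have "(\<lambda>k. ?c (T k)) ` K \<subseteq> ext_op V T ` ?B"
      proof
        fix Y assume "Y \<in> (\<lambda>k. ?c (T k)) ` K"
        then obtain k where k: "k \<in> K" "Y = ?c (T k)" by blast
        then have "k \<in> ?b" using K by blast
        then show "Y \<in> ext_op V T ` ?B" using k cb[of k] Tc[of k] by (auto intro!: image_eqI[of _ _ "?c k"])
      qed
      ultimately show "\<exists>K. finite K \<and> K \<subseteq> ext_op V T ` ?B \<and> ext_op V T ` ?B \<subseteq> (\<Union>x\<in>K. M.mball x \<epsilon>)"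
        using K(1) by (intro exI[of _ "(\<lambda>k. ?c (T k)) ` K"]) blast
    qed
  qed
  then show ?thesis using C.compact_op_iff[OF TP] by simp
qed

text \<open>The operators are eventually contractive, so strong convergence need only be tested on
  the dense image of V: replacing X by a nearby v costs e/3 twice, uniformly in the
  operator.\<close>

lemma tendsto_ext_op:
  assumes F: "\<forall>\<^sub>F T in F. clinear_map V V T \<and> (\<forall>x\<in>carrier V. ||T x|| \<le> ||x||)"
    and lim: "\<And>v. v \<in> carrier V \<Longrightarrow> ((\<lambda>T. ndist V (T v) v) \<longlongrightarrow> 0) F"
    and X: "X \<in> carrier (completion V)"
  shows "((\<lambda>T. ndist (completion V) (ext_op V T X) X) \<longlongrightarrow> 0) F"
proof (rule tendstoI)
  interpret C: banach_space "completion V" by (rule banach_completion)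
  let ?H = "completion V" and ?c = "\<lambda>v. seq_class V (\<lambda>n. v)"
  fix e :: real assume e: "e > 0"
  obtain v where v: "v \<in> carrier V" "ndist ?H X (?c v) < e / 3" using completion_dense[OF X, of "e/3"] e by auto
  have vc: "?c v \<in> carrier ?H" using v by (simp add: cauchy_const)
  have "\<forall>\<^sub>F T in F. dist (ndist V (T v) v) 0 < e / 3" using tendstoD[OF lim[OF v(1)], of "e/3"] e by simp
  with F show "\<forall>\<^sub>F T in F. dist (ndist ?H (ext_op V T X) X) 0 < e"
  proof eventually_elim
    case (elim T)
    then have T: "clinear_map V V T" "\<And>x. x \<in> carrier V \<Longrightarrow> ||T x|| \<le> 1 * ||x||" by auto
    then have Tb: "bounded_map V V T" unfolding bounded_map_def by blast
    have TX: "ext_op V T X \<in> carrier ?H" "ext_op V T (?c v) \<in> carrier ?H"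
      using ext_op_PiE[OF T(1) Tb] X vc by auto
    have Tv: "T v \<in> carrier V" using T v by (auto simp: clinear_map_def)
    have "ndist ?H (ext_op V T X) (ext_op V T (?c v)) \<le> 1 * ndist ?H X (?c v)" using ext_op_bound[OF T]
      by (intro C.bounded_ndist ext_op_linear T Tb seminormed_completion X vc) auto
    moreover have "ndist ?H (ext_op V T (?c v)) (?c v) = ndist V (T v) v"
      using v Tv by (simp add: ext_op_seq_class[OF T(1) Tb] cauchy_const seq_class_const_isometric)
    moreover have "ndist ?H (?c v) X = ndist ?H X (?c v)" by (rule C.ndist_sym)
    moreover have "ndist ?H (ext_op V T X) X \<le> ndist ?H (ext_op V T X) (ext_op V T (?c v)) +
        (ndist ?H (ext_op V T (?c v)) (?c v) + ndist ?H (?c v) X)"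
      using C.ndist_triangle[OF TX(1) TX(2) X] C.ndist_triangle[OF TX(2) vc X] by linarith
    ultimately show ?case using v elim by (simp add: dist_real_def)
  qed
qed

lemma ndist_ext_op_const:
  assumes T: "clinear_map V V T" "bounded_map V V T" and v: "v \<in> carrier V"
  shows "ndist (completion V) (ext_op V T (seq_class V (\<lambda>n. v))) (seq_class V (\<lambda>n. v)) = ndist V (T v) v"
proof -
  have "T v \<in> carrier V" using T v by (auto simp: clinear_map_def)
  then show ?thesis using v by (simp add: ext_op_seq_class[OF T] cauchy_const seq_class_const_isometric)
qed

end

section \<open>Unital C*-algebras\<close>

context seminormed begin

abbreviation tends :: "('i \<Rightarrow> 'a) \<Rightarrow> 'a \<Rightarrow> 'i filter \<Rightarrow> bool" where
  "tends s l F \<equiv> ((\<lambda>n. ndist V (s n) l) \<longlongrightarrow> 0) F"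

lemma tends_Lipschitz:
  assumes "tends s l F" "\<And>n. ndist W (f n) m \<le> C * ndist V (s n) l" "seminormed W"
  shows "((\<lambda>n. ndist W (f n) m) \<longlongrightarrow> 0) F"
proof -
  interpret W: seminormed W by fact
  show ?thesis using tendsto_mult_left[OF assms(1), of C] assms(2)
    by (intro Lim_null_comparison[of "\<lambda>n. ndist W (f n) m" "\<lambda>n. C * ndist V (s n) l"]) auto
qed

lemma tends_add:
  assumes "tends s l F" "tends t m F" "\<And>n. s n \<in> carrier V" "\<And>n. t n \<in> carrier V"
    "l \<in> carrier V" "m \<in> carrier V"
  shows "tends (\<lambda>n. s n \<oplus> t n) (l \<oplus> m) F" by (rule tendsto_0_le_add[OF assms(1,2)])
    (use assms(3-) in \<open>auto simp: ndist_eq add_diff_add nrm_triangle\<close>)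

lemma tends_smult:
  assumes "tends s l F" "\<And>n. s n \<in> carrier V" "l \<in> carrier V"
  shows "tends (\<lambda>n. c \<odot> s n) (c \<odot> l) F" by (rule tends_Lipschitz[OF assms(1), where C = "cmod c"])
    (use assms(2,3) seminormed_axioms in \<open>auto simp: ndist_eq smult_diff_r[symmetric] nrm_smult\<close>)

lemma tends_diff:
  assumes "tends s l F" "tends t m F" "\<And>n. s n \<in> carrier V" "\<And>n. t n \<in> carrier V"
    "l \<in> carrier V" "m \<in> carrier V"
  shows "tends (\<lambda>n. s n \<ominus> t n) (l \<ominus> m) F"
  using tends_add[OF assms(1) tends_smult[OF assms(2,4,6)], of "-1"] assms(3-) by (simp add: minus_eq neg_eq)

lemma tends_nrm:
  assumes "tends s l F" "\<And>n. s n \<in> carrier V" "l \<in> carrier V"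
  shows "((\<lambda>n. ||s n||) \<longlongrightarrow> ||l||) F"
proof -
  have "((\<lambda>n. ||s n|| - ||l||) \<longlongrightarrow> 0) F"
    by (rule Lim_null_comparison[OF _ assms(1)]) (use nrm_diff_ge assms(2,3) in \<open>auto simp: ndist_eq\<close>)
  then show ?thesis by (simp add: LIM_zero_iff)
qed

end

lemma (in banach_space) tends_unique:
  assumes "tends s l F" "tends s m F" "\<And>n. s n \<in> carrier V" "l \<in> carrier V" "m \<in> carrier V" "F \<noteq> bot"
  shows "l = m"
proof -
  have "((\<lambda>n. ndist V l m) \<longlongrightarrow> 0) F" by (rule tendsto_0_le_add[OF assms(1,2)])
      (use assms(3-5) ndist_triangle ndist_sym in \<open>auto, metis\<close>)
  then have "ndist V l m = 0" using assms(6) tendsto_unique[OF _ tendsto_const] by blast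
  then show ?thesis using assms by (simp add: ndist_eq nrm_eq_0 diff_eq_0_iff)
qed

locale ucstar = banach_space A + ring A for A :: "('a, 'm) cstar_scheme" (structure) +
  assumes smult_mult_l: "\<lbrakk>x \<in> carrier A; y \<in> carrier A\<rbrakk> \<Longrightarrow> (c \<odot> x) \<otimes> y = c \<odot> (x \<otimes> y)"
    and smult_mult_r: "\<lbrakk>x \<in> carrier A; y \<in> carrier A\<rbrakk> \<Longrightarrow> x \<otimes> (c \<odot> y) = c \<odot> (x \<otimes> y)"
    and nrm_mult: "\<lbrakk>x \<in> carrier A; y \<in> carrier A\<rbrakk> \<Longrightarrow> ||x \<otimes> y|| \<le> ||x|| * ||y||"
    and star_closed [simp, intro]: "x \<in> carrier A \<Longrightarrow> star A x \<in> carrier A"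
    and star_star [simp]: "x \<in> carrier A \<Longrightarrow> star A (star A x) = x"
    and star_mult: "\<lbrakk>x \<in> carrier A; y \<in> carrier A\<rbrakk> \<Longrightarrow> star A (x \<otimes> y) = star A y \<otimes> star A x"
    and star_add: "\<lbrakk>x \<in> carrier A; y \<in> carrier A\<rbrakk> \<Longrightarrow> star A (x \<oplus> y) = star A x \<oplus> star A y"
    and star_smult: "x \<in> carrier A \<Longrightarrow> star A (c \<odot> x) = cnj c \<odot> star A x"
    and cstar: "x \<in> carrier A \<Longrightarrow> ||star A x \<otimes> x|| = ||x||\<^sup>2"
begin

abbreviation st :: "'a \<Rightarrow> 'a" where "st \<equiv> star A"

lemma star_zero [simp]: "st \<zero> = \<zero>" using star_smult[of \<zero> 0] by simp

lemma star_one [simp]: "st \<one> = \<one>" by (metis star_star star_mult star_closed one_closed l_one r_one)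

lemma star_neg: "x \<in> carrier A \<Longrightarrow> st (\<ominus> x) = \<ominus> st x" by (simp add: neg_eq star_smult)

lemma star_diff: "\<lbrakk>x \<in> carrier A; y \<in> carrier A\<rbrakk> \<Longrightarrow> st (x \<ominus> y) = st x \<ominus> st y"
  by (simp add: minus_eq star_add star_neg)

lemma star_finsum: "\<lbrakk>finite I; f \<in> I \<rightarrow> carrier A\<rbrakk> \<Longrightarrow> st (\<Oplus>i\<in>I. f i) = (\<Oplus>i\<in>I. st (f i))"
proof (induction I rule: finite_induct)
  case (insert i I)
  then show ?case by (subst finsum_insert; (auto simp: Pi_iff)?)+ (auto simp: star_add Pi_iff finsum_closed)
qed simp

lemma nrm_star [simp]: "x \<in> carrier A \<Longrightarrow> ||st x|| = ||x||"
proof -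
  have le: "||x|| \<le> ||st x||" if x: "x \<in> carrier A" for x
  proof (cases "||x|| = 0")
    case False
    have "||x|| * ||x|| \<le> ||st x|| * ||x||" using cstar[OF x] nrm_mult[of "st x" x] x by (simp add: power2_eq_square)
    moreover have "||x|| > 0" using False nrm_nonneg[OF x] by linarith
    ultimately show ?thesis by simp
  qed (use x in simp)
  show "x \<in> carrier A \<Longrightarrow> ?thesis" using le[of x] le[of "st x"] by simp
qed

text \<open>The zero algebra is allowed, so only an inequality can hold. By the C*-identity ||1|| is
  equal to its own square.\<close>

lemma nrm_one_le: "||\<one>|| \<le> 1"
proof (rule ccontr)
  assume "\<not> ||\<one>|| \<le> 1"
  moreover have "||\<one>|| = ||\<one>|| * ||\<one>||" using cstar[of \<one>] by (simp add: power2_eq_square)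
  ultimately show False by simp
qed

lemma nrm_sq_eq_0: "x \<in> carrier A \<Longrightarrow> st x \<otimes> x = \<zero> \<Longrightarrow> x = \<zero>" using cstar[of x] nrm_eq_0[of x] by simp

lemma nrm_sa_square: "x \<in> carrier A \<Longrightarrow> st x = x \<Longrightarrow> ||x \<otimes> x|| = ||x||\<^sup>2" using cstar[of x] by simp

lemma tends_mult:
  assumes s: "tends s l F" "tends t m F" "\<And>n. s n \<in> carrier A" "\<And>n. t n \<in> carrier A"
    "l \<in> carrier A" "m \<in> carrier A"
  shows "tends (\<lambda>n. s n \<otimes> t n) (l \<otimes> m) F"
proof -
  have "((\<lambda>n. ndist A (s n) l * ||t n|| + ||l|| * ndist A (t n) m) \<longlongrightarrow> 0 * ||m|| + ||l|| * 0) F"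
    by (intro tendsto_add tendsto_mult s tends_nrm tendsto_const)
  then have "((\<lambda>n. ndist A (s n) l * ||t n|| + ||l|| * ndist A (t n) m) \<longlongrightarrow> 0) F" by simp
  then show ?thesis
  proof (rule Lim_null_comparison[rotated], intro always_eventually allI)
    fix n
    have "s n \<otimes> t n \<ominus> l \<otimes> m = (s n \<ominus> l) \<otimes> t n \<oplus> l \<otimes> (t n \<ominus> m)" using s(3)[of n] s(4)[of n] s(5,6) by algebra
    also have "||\<dots>|| \<le> ||s n \<ominus> l|| * ||t n|| + ||l|| * ||t n \<ominus> m||"
      using s(3-6) by (intro order_trans[OF nrm_triangle] add_mono nrm_mult) auto
    finally show "norm (ndist A (s n \<otimes> t n) (l \<otimes> m)) \<le> ndist A (s n) l * ||t n|| + ||l|| * ndist A (t n) m"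
      using s(3-6) by (simp add: ndist_eq)
  qed
qed

lemma tends_star:
  assumes "tends s l F" "\<And>n. s n \<in> carrier A" "l \<in> carrier A"
  shows "tends (\<lambda>n. st (s n)) (st l) F" by (rule tends_Lipschitz[OF assms(1), where C = 1])
    (use assms(2,3) seminormed_axioms in \<open>auto simp: ndist_eq star_diff[symmetric]\<close>)

subsection \<open>Square roots\<close>

text \<open>The iteration \<open>b \<mapsto> (y + b\<^sup>2)/2\<close>; its increments are dominated by those of the same scalar
  iteration with \<open>y = 1\<close>, so it converges even for \<open>||y|| = 1\<close>.\<close>

lemma sqrt_one_minus:
  assumes y: "y \<in> carrier A" "st y = y" "||y|| \<le> 1"
  obtains b where "b \<in> carrier A" "st b = b" "||b|| \<le> 1" "(\<one> \<ominus> b) \<otimes> (\<one> \<ominus> b) = \<one> \<ominus> y"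
    "\<And>z. \<lbrakk>z \<in> carrier A; z \<otimes> y = y \<otimes> z\<rbrakk> \<Longrightarrow> z \<otimes> b = b \<otimes> z"
proof -
  define s where "s = rec_nat \<zero> (\<lambda>n x. (1/2) \<odot> (y \<oplus> x \<otimes> x))"
  define \<beta> :: "nat \<Rightarrow> real" where "\<beta> = rec_nat 0 (\<lambda>n x. (1 + x * x) / 2)"
  have s0: "s 0 = \<zero>" and sS: "s (Suc n) = (1/2) \<odot> (y \<oplus> s n \<otimes> s n)" for n by (simp_all add: s_def)
  have b0: "\<beta> 0 = 0" and bS: "\<beta> (Suc n) = (1 + \<beta> n * \<beta> n) / 2" for n by (simp_all add: \<beta>_def)
  have sc [simp]: "s n \<in> carrier A" for n by (induction n) (use y in \<open>auto simp: s0 sS\<close>)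
  have ss: "st (s n) = s n" for n by (induction n) (use y in \<open>auto simp: s0 sS star_smult star_add star_mult\<close>)
  \<comment> \<open>Every iterate is a polynomial in y, hence commutes with whatever commutes with
    y; this passes to the limit b.\<close>
  have comm: "z \<otimes> s n = s n \<otimes> z" if "z \<in> carrier A" "z \<otimes> y = y \<otimes> z" for z n
  proof (induction n)
    case (Suc n)
    have "z \<otimes> (s n \<otimes> s n) = (s n \<otimes> s n) \<otimes> z" by (metis Suc m_assoc sc that(1))
    then show ?case using that y by (simp add: sS smult_mult_l smult_mult_r l_distr r_distr)
  qed (use that in \<open>simp add: s0\<close>)
  have ys: "y \<otimes> s n = s n \<otimes> y" for n using comm[of y n] y by simp
  have scomm: "s m \<otimes> s n = s n \<otimes> s m" for m n using comm[of "s m" n] ys by simp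
  have b01: "0 \<le> \<beta> n \<and> \<beta> n \<le> 1" for n
  proof (induction n)
    case (Suc n)
    then have "\<beta> n * \<beta> n \<le> 1" by (simp add: mult_le_one)
    then show ?case using Suc by (simp add: bS)
  qed (simp add: b0)
  have nb: "||s n|| \<le> \<beta> n" for n
  proof (induction n)
    case (Suc n)
    have "||s (Suc n)|| = ||y \<oplus> s n \<otimes> s n|| / 2" using y by (simp add: sS nrm_smult)
    also have "\<dots> \<le> (1 + ||s n|| * ||s n||) / 2"
      using nrm_triangle[of y "s n \<otimes> s n"] nrm_mult[of "s n" "s n"] y by simp
    also have "\<dots> \<le> \<beta> (Suc n)" using mult_mono[OF Suc Suc] b01[of n] by (simp add: bS)
    finally show ?case .
  qed (simp add: s0 b0)
  have bm: "\<beta> n \<le> \<beta> (Suc n)" for n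
  proof -
    have "0 \<le> (1 - \<beta> n) * (1 - \<beta> n)" by simp
    then show ?thesis by (simp add: bS algebra_simps)
  qed
  have inc: "||s (Suc n) \<ominus> s n|| \<le> \<beta> (Suc n) - \<beta> n" for n
  proof (induction n)
    case 0
    then show ?case using nb[of "Suc 0"] by (simp add: s0 b0 minus_eq neg_eq)
  next
    case (Suc n)
    let ?p = "s (Suc n)" and ?q = "s n"
    \<comment> \<open>The iterates commute, so their squares differ by (p - q)(p + q). The
      increments of \<beta> factor in the same way, which carries the comparison from n to n +
      1.\<close>
    have "(?p \<ominus> ?q) \<otimes> (?p \<oplus> ?q) = (y \<oplus> ?p \<otimes> ?p) \<ominus> (y \<oplus> ?q \<otimes> ?q)"
    proof -
      have "(?p \<ominus> ?q) \<otimes> (?p \<oplus> ?q) = ?p \<otimes> ?p \<oplus> (?p \<otimes> ?q \<ominus> ?q \<otimes> ?p) \<ominus> ?q \<otimes> ?q"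
        using sc[of "Suc n"] sc[of n] by algebra
      also have "?p \<otimes> ?q \<ominus> ?q \<otimes> ?p = \<zero>" using scomm[of "Suc n" n] by simp
      finally show ?thesis using sc[of "Suc n"] sc[of n] y(1) by (simp add: add_diff_add)
    qed
    then have "s (Suc (Suc n)) \<ominus> ?p = (1/2) \<odot> ((?p \<ominus> ?q) \<otimes> (?p \<oplus> ?q))"
      using y by (simp add: sS[of "Suc n"] sS[of n] smult_diff_r)
    then have "||s (Suc (Suc n)) \<ominus> ?p|| \<le> (1/2) * ( ||?p \<ominus> ?q|| * ||?p \<oplus> ?q||)"
      using nrm_mult[of "?p \<ominus> ?q" "?p \<oplus> ?q"] by (simp add: nrm_smult)
    also have "\<dots> \<le> (1/2) * ((\<beta> (Suc n) - \<beta> n) * (\<beta> (Suc n) + \<beta> n))"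
      using Suc nb[of n] nb[of "Suc n"] bm[of n] order_trans[OF nrm_triangle[OF sc sc]]
      by (intro mult_left_mono mult_mono) (auto intro!: order_trans[OF nrm_triangle[OF sc sc]])
    also have "\<dots> = \<beta> (Suc (Suc n)) - \<beta> (Suc n)" by (simp add: bS[of "Suc n"] bS[of n]) (simp add: field_simps)
    finally show ?case .
  qed
  have incm: "||s (n + k) \<ominus> s n|| \<le> \<beta> (n + k) - \<beta> n" for n k
  proof (induction k)
    case (Suc k)
    show ?case using Suc inc[of "n + k"] nrm_diff_triangle[of "s (Suc (n + k))" "s (n + k)" "s n"] by simp
  qed simp
  have "convergent \<beta>"
    by (rule Bseq_mono_convergent) (use b01 bm in \<open>auto simp: Bseq_def incseq_SucI incseq_def lift_Suc_mono_le intro!: exI[of _ 1]\<close>)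
  then have "Cauchy \<beta>" by (simp add: Cauchy_convergent_iff)
  have "s \<in> cauchy_seqs A" unfolding cauchy_seqs_def
  proof safe
    fix \<epsilon> :: real assume "\<epsilon> > 0"
    then obtain N where N: "\<And>m n. \<lbrakk>m \<ge> N; n \<ge> N\<rbrakk> \<Longrightarrow> \<bar>\<beta> m - \<beta> n\<bar> < \<epsilon>"
      using \<open>Cauchy \<beta>\<close> unfolding Cauchy_def dist_real_def by meson
    have "ndist A (s m) (s n) < \<epsilon>" if "m \<ge> N" "n \<ge> N" for m n
    proof (cases "n \<le> m")
      case True
      then show ?thesis using incm[of n "m - n"] N[OF that] by (simp add: ndist_eq)
    next
      case False
      then show ?thesis using incm[of m "n - m"] N[OF that] by (subst ndist_sym) (simp add: ndist_eq)
    qed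
    then show "\<exists>N. \<forall>m\<ge>N. \<forall>n\<ge>N. ndist A (s m) (s n) < \<epsilon>" by blast
  qed simp
  from complete[OF this] obtain b where b: "b \<in> carrier A" "tends s b sequentially" by blast
  \<comment> \<open>The limit satisfies 2 b = y + b^2, which is a rearrangement of (1 - b)^2 = 1 -
    y.\<close>
  have fix_b: "b = (1/2) \<odot> (y \<oplus> b \<otimes> b)"
  proof (rule tends_unique)
    show "tends (\<lambda>n. s (Suc n)) b sequentially" using b(2) by (rule LIMSEQ_Suc)
    show "tends (\<lambda>n. s (Suc n)) ((1/2) \<odot> (y \<oplus> b \<otimes> b)) sequentially"
      unfolding sS using b y by (intro tends_smult tends_add tends_mult) auto
  qed (use b y in auto)
  have bb: "b \<oplus> b = y \<oplus> b \<otimes> b"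
  proof -
    have "b \<oplus> b = 2 \<odot> b" using b smult_add_l[of b 1 1] by simp
    also have "\<dots> = y \<oplus> b \<otimes> b" using b y by (subst fix_b) (simp add: smult_mult)
    finally show ?thesis .
  qed
  show ?thesis
  proof (rule that)
    show "b \<in> carrier A" by fact
    show "st b = b" using tends_star[OF b(2) sc b(1)] b by (intro tends_unique[of s]) (auto simp: ss)
    show "||b|| \<le> 1" by (rule LIMSEQ_le_const2[OF tends_nrm[OF b(2) sc b(1)]])
        (meson b01 nb order_trans)
    show "(\<one> \<ominus> b) \<otimes> (\<one> \<ominus> b) = \<one> \<ominus> y"
    proof -
      have "(\<one> \<ominus> b) \<otimes> (\<one> \<ominus> b) = \<one> \<ominus> (b \<oplus> b) \<oplus> b \<otimes> b"
        using b(1) by (simp add: minus_eq l_distr r_distr l_minus r_minus minus_add a_ac)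
      also have "\<dots> = \<one> \<ominus> y" unfolding bb using b(1) y(1) by algebra
      finally show ?thesis .
    qed
    fix z assume z: "z \<in> carrier A" "z \<otimes> y = y \<otimes> z"
    show "z \<otimes> b = b \<otimes> z"
    proof (rule tends_unique)
      show "tends (\<lambda>n. z \<otimes> s n) (z \<otimes> b) sequentially" using z b by (intro tends_mult) auto
      have "tends (\<lambda>n. s n \<otimes> z) (b \<otimes> z) sequentially" using z b by (intro tends_mult) auto
      then show "tends (\<lambda>n. z \<otimes> s n) (b \<otimes> z) sequentially" using comm[OF z] by simp
    qed (use z b in auto)
  qed
qed

text \<open>Since s and r commute, w = s + i r satisfies w* w = s^2 + r^2 = 1, hence ||w|| \<le> 1;
  and s is the mean of w and its adjoint. This replaces the comparison of spectra in several places
  below.\<close>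

lemma nrm_le_one_of_squares:
  assumes s: "s \<in> carrier A" "st s = s" and r: "r \<in> carrier A" "st r = r"
    and c: "s \<otimes> r = r \<otimes> s" and e: "s \<otimes> s \<oplus> r \<otimes> r = \<one>"
  shows "||s|| \<le> 1"
proof -
  define w where "w = s \<oplus> \<i> \<odot> r"
  have w: "w \<in> carrier A" using s r by (simp add: w_def)
  have sw: "st w = s \<ominus> \<i> \<odot> r" using s r by (simp add: w_def star_add star_smult minus_eq smult_neg_l)
  have "st w \<otimes> w = s \<otimes> s \<oplus> (s \<otimes> (\<i> \<odot> r) \<ominus> (\<i> \<odot> r) \<otimes> s) \<ominus> (\<i> \<odot> r) \<otimes> (\<i> \<odot> r)"
    unfolding sw unfolding w_def using s(1) smultC[OF r(1), of \<i>] by algebra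
  also have "\<dots> = s \<otimes> s \<ominus> (\<i> \<odot> r) \<otimes> (\<i> \<odot> r)" using s r c by (simp add: smult_mult_l smult_mult_r)
  also have "\<dots> = \<one>" using s r e by (simp add: smult_mult_l smult_mult_r smult_mult minus_eq smult_neg_l)
  finally have "||w||\<^sup>2 \<le> 1" using cstar[OF w] nrm_one_le by simp
  then have w1: "||w|| \<le> 1" by (simp add: abs_square_le_1[symmetric] power2_le_imp_le)
  have "w \<oplus> st w = s \<oplus> s" unfolding sw unfolding w_def using s(1) smultC[OF r(1), of \<i>] by algebra
  also have "\<dots> = 2 \<odot> s" using s smult_add_l[of s 1 1] by simp
  finally have "2 * ||s|| = ||w \<oplus> st w||" using s by (simp add: nrm_smult)
  also have "\<dots> \<le> 2" using nrm_triangle[of w "st w"] w w1 by simp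
  finally show ?thesis by simp
qed

subsection \<open>Positive elements\<close>

text \<open>A norm criterion for positivity that is visibly closed under sums and limits. It agrees with
  \<^const>\<open>positive\<close> by the theorem on \<open>x\<^sup>* x\<close> below.\<close>

definition npos :: "'a \<Rightarrow> bool" where
  "npos a \<longleftrightarrow> a \<in> carrier A \<and> st a = a \<and> (\<exists>t\<ge>0. ||of_real t \<odot> \<one> \<ominus> a|| \<le> t)"

lemma npos_closed: "npos a \<Longrightarrow> a \<in> carrier A" and npos_sa: "npos a \<Longrightarrow> st a = a" by (auto simp: npos_def)

lemma npos_add: assumes "npos a" "npos b" shows "npos (a \<oplus> b)"
proof -
  obtain t r where t: "t \<ge> 0" "||of_real t \<odot> \<one> \<ominus> a|| \<le> t" "r \<ge> 0" "||of_real r \<odot> \<one> \<ominus> b|| \<le> r"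
    using assms by (auto simp: npos_def)
  have c: "a \<in> carrier A" "b \<in> carrier A" using assms npos_closed by auto
  have "of_real (t + r) \<odot> \<one> \<ominus> (a \<oplus> b) = (of_real t \<odot> \<one> \<ominus> a) \<oplus> (of_real r \<odot> \<one> \<ominus> b)"
    using c by (simp add: smult_add_l add_diff_add)
  also have "||\<dots>|| \<le> t + r" using c t by (intro order_trans[OF nrm_triangle] add_mono) auto
  finally show ?thesis using assms c t by (auto simp: npos_def star_add intro!: exI[of _ "t + r"])
qed

lemma npos_smult: assumes "npos a" "c \<ge> 0" shows "npos (of_real c \<odot> a)"
proof -
  obtain t where t: "t \<ge> 0" "||of_real t \<odot> \<one> \<ominus> a|| \<le> t" using assms by (auto simp: npos_def)
  have a: "a \<in> carrier A" using assms npos_closed by auto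
  have "of_real (c * t) \<odot> \<one> \<ominus> of_real c \<odot> a = of_real c \<odot> (of_real t \<odot> \<one> \<ominus> a)"
    using a by (simp add: smult_diff_r smult_mult)
  also have "||\<dots>|| \<le> c * t" using a t assms by (simp add: nrm_smult mult_left_mono)
  finally show ?thesis using assms a t by (auto simp: npos_def star_smult intro!: exI[of _ "c * t"])
qed

lemma npos_zero: "npos \<zero>" by (auto simp: npos_def intro!: exI[of _ 0])

text \<open>The number t is its own witness, because t - (t - c) = c.\<close>

lemma npos_nrm_minus:
  assumes "c \<in> carrier A" "st c = c" "||c|| \<le> t" shows "npos (of_real t \<odot> \<one> \<ominus> c)"
proof -
  have "of_real t \<odot> \<one> \<ominus> (of_real t \<odot> \<one> \<ominus> c) = c" using assms(1) smultC[OF one_closed, of "of_real t"] by algebra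
  moreover have "t \<ge> 0" using assms nrm_nonneg[of c] by linarith
  ultimately show ?thesis using assms by (auto simp: npos_def star_diff star_smult intro!: exI[of _ t])
qed

text \<open>For a witness t > 0 the element y = 1 - a/t has norm at most 1, and a = t (1 - y) has
  the root sqrt t (1 - b) with b from \<open>sqrt_one_minus\<close>. The commutation clause is
  inherited from b; later proofs rely on it to make several roots commute.\<close>

lemma npos_sqrt:
  assumes a: "npos a"
  obtains r where "npos r" "r \<otimes> r = a" "\<And>z. \<lbrakk>z \<in> carrier A; z \<otimes> a = a \<otimes> z\<rbrakk> \<Longrightarrow> z \<otimes> r = r \<otimes> z"
proof -
  obtain t where t: "t \<ge> 0" "||of_real t \<odot> \<one> \<ominus> a|| \<le> t" and ac: "a \<in> carrier A" and sa: "st a = a"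
    using a by (auto simp: npos_def)
  show ?thesis
  proof (cases "t = 0")
    case True
    have "||\<zero> \<ominus> a|| = 0" using t True ac by (intro antisym) simp_all
    then have "a = \<zero>" using ac nrm_eq_0[of "\<zero> \<ominus> a"] diff_eq_0_iff[of \<zero> a] by simp
    then show ?thesis using npos_zero by (intro that[of \<zero>]) auto
  next
    case False
    then have tp: "t > 0" using t by simp
    define y where "y = \<one> \<ominus> of_real (1/t) \<odot> a"
    have y: "y \<in> carrier A" "st y = y" using ac sa by (simp_all add: y_def star_diff star_smult)
    have "y = of_real (1/t) \<odot> (of_real t \<odot> \<one> \<ominus> a)" using ac tp by (simp add: y_def smult_diff_r smult_mult)
    then have "||y|| = (1/t) * ||of_real t \<odot> \<one> \<ominus> a||" using ac tp by (simp add: nrm_smult norm_divide)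
    then have "t * ||y|| \<le> t * 1" using t tp by (simp add: field_simps)
    then have y1: "||y|| \<le> 1" using tp mult_le_cancel_left_pos by blast
    obtain b where b: "b \<in> carrier A" "st b = b" "||b|| \<le> 1" "(\<one> \<ominus> b) \<otimes> (\<one> \<ominus> b) = \<one> \<ominus> y"
      "\<And>z. \<lbrakk>z \<in> carrier A; z \<otimes> y = y \<otimes> z\<rbrakk> \<Longrightarrow> z \<otimes> b = b \<otimes> z" using sqrt_one_minus[OF y y1] by blast
    define r where "r = of_real (sqrt t) \<odot> (\<one> \<ominus> b)"
    show ?thesis
    proof (rule that)
      have "of_real (sqrt t) \<odot> \<one> \<ominus> r = of_real (sqrt t) \<odot> b"
      proof -
        have "of_real (sqrt t) \<odot> \<one> \<ominus> r = of_real (sqrt t) \<odot> (\<one> \<ominus> (\<one> \<ominus> b))"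
          unfolding r_def by (rule smult_diff_r[symmetric]) (use b in auto)
        also have "\<one> \<ominus> (\<one> \<ominus> b) = b" using b(1) by algebra
        finally show ?thesis .
      qed
      then have "||of_real (sqrt t) \<odot> \<one> \<ominus> r|| \<le> sqrt t" using b tp by (simp add: nrm_smult mult_left_le)
      then show "npos r" using b tp by (auto simp: npos_def r_def star_smult star_diff intro!: exI[of _ "sqrt t"])
      have "r \<otimes> r = (of_real (sqrt t) * of_real (sqrt t)) \<odot> ((\<one> \<ominus> b) \<otimes> (\<one> \<ominus> b))"
        using b y(1) by (simp add: r_def smult_mult_l smult_mult_r smult_mult)
      also have "of_real (sqrt t) * of_real (sqrt t) = of_real t" using tp by (simp flip: of_real_mult)
      also have "(\<one> \<ominus> b) \<otimes> (\<one> \<ominus> b) = of_real (1/t) \<odot> a"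
        unfolding b(4) y_def using ac smultC[OF ac, of "of_real (1/t)"] one_closed by algebra
      finally show "r \<otimes> r = a" using ac tp by (simp add: smult_mult)
      fix z assume z: "z \<in> carrier A" "z \<otimes> a = a \<otimes> z"
      have "z \<otimes> y = y \<otimes> z" using z ac
        by (simp add: y_def minus_eq l_distr r_distr l_minus r_minus smult_mult_l smult_mult_r)
      then have "z \<otimes> b = b \<otimes> z" using b(5) z by blast
      then show "z \<otimes> r = r \<otimes> z" using z b(1)
        by (simp add: r_def minus_eq l_distr r_distr l_minus r_minus smult_mult_l smult_mult_r)
    qed
  qed
qed

text \<open>Scale h to an element k of norm 1. The root r of 1 - k^2 commutes with k, so
  \<open>nrm_le_one_of_squares\<close> gives ||r|| \<le> 1. Then ||1 - k^2|| = ||r||^2 \<le> 1,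
  which is the criterion for k^2 with t = 1.\<close>

lemma npos_square: assumes h: "h \<in> carrier A" "st h = h" shows "npos (h \<otimes> h)"
proof (cases "||h|| = 0")
  case True
  then show ?thesis using h nrm_eq_0[of h] npos_zero by simp
next
  case False
  define n where "n = ||h||"
  have n: "n > 0" using False h nrm_nonneg[of h] unfolding n_def by linarith
  define k where "k = of_real (1/n) \<odot> h"
  have k: "k \<in> carrier A" "st k = k" using h by (simp_all add: k_def star_smult)
  have k1: "||k|| = 1" using h n by (simp add: k_def nrm_smult norm_divide n_def[symmetric])
  have kk: "k \<otimes> k \<in> carrier A" "st (k \<otimes> k) = k \<otimes> k" "||k \<otimes> k|| \<le> 1"
    using k k1 by (simp_all add: star_mult nrm_sa_square)
  obtain b where b: "b \<in> carrier A" "st b = b" "||b|| \<le> 1" "(\<one> \<ominus> b) \<otimes> (\<one> \<ominus> b) = \<one> \<ominus> k \<otimes> k"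
    "\<And>z. \<lbrakk>z \<in> carrier A; z \<otimes> (k \<otimes> k) = k \<otimes> k \<otimes> z\<rbrakk> \<Longrightarrow> z \<otimes> b = b \<otimes> z" using sqrt_one_minus[OF kk] by blast
  define r where "r = \<one> \<ominus> b"
  have r: "r \<in> carrier A" "st r = r" using b by (simp_all add: r_def star_diff)
  have "k \<otimes> b = b \<otimes> k" using b(5)[of k] k by (simp add: m_assoc)
  then have kr: "r \<otimes> k = k \<otimes> r" using k b(1) by (simp add: r_def minus_eq l_distr r_distr l_minus r_minus)
  have "r \<otimes> r \<oplus> k \<otimes> k = \<one>" unfolding r_def b(4) using k kk(1) by (simp add: diff_add_cancel)
  from nrm_le_one_of_squares[OF r k kr this] have "||r|| \<le> 1" .
  then have "||r \<otimes> r|| \<le> 1" using r nrm_sa_square[OF r] by (simp add: power_le_one)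
  then have "npos (k \<otimes> k)" unfolding npos_def using kk b(4) r_def by (auto intro!: exI[of _ 1])
  then have "npos (of_real (n * n) \<odot> (k \<otimes> k))" by (rule npos_smult) simp
  moreover have "of_real (n * n) \<odot> (k \<otimes> k) = h \<otimes> h"
    using h n by (simp add: k_def smult_mult_l smult_mult_r smult_mult)
  ultimately show ?thesis by simp
qed

text \<open>The roots s of a/t and r of 1 - a/t commute and their squares add up to 1, so ||s||
  \<le> 1 and ||a|| = t ||s||^2 \<le> t. Division by t excludes t = 0, which is reached through t +
  e for all e > 0.\<close>

lemma npos_nrm_le:
  assumes a: "npos a" and ta: "npos (of_real t \<odot> \<one> \<ominus> a)" and t: "t \<ge> 0"
  shows "||a|| \<le> t"
proof -
  have pos: "||a|| \<le> t" if t: "t > 0" and ta: "npos (of_real t \<odot> \<one> \<ominus> a)" for t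
  proof -
    have ac: "a \<in> carrier A" using a npos_closed by simp
    define a' where "a' = of_real (1/t) \<odot> a"
    have a': "a' \<in> carrier A" using ac by (simp add: a'_def)
    have "npos a'" unfolding a'_def using a t by (intro npos_smult) auto
    then obtain s where s: "npos s" "s \<otimes> s = a'" "\<And>z. \<lbrakk>z \<in> carrier A; z \<otimes> a' = a' \<otimes> z\<rbrakk> \<Longrightarrow> z \<otimes> s = s \<otimes> z"
      using npos_sqrt by blast
    note sc = npos_closed[OF s(1)]
    have "npos (of_real (1/t) \<odot> (of_real t \<odot> \<one> \<ominus> a))" using ta t by (intro npos_smult) auto
    moreover have "of_real (1/t) \<odot> (of_real t \<odot> \<one> \<ominus> a) = \<one> \<ominus> a'"
      using ac t by (simp add: smult_diff_r smult_mult a'_def)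
    ultimately have "npos (\<one> \<ominus> a')" by simp
    then obtain r where r: "npos r" "r \<otimes> r = \<one> \<ominus> a'"
      "\<And>z. \<lbrakk>z \<in> carrier A; z \<otimes> (\<one> \<ominus> a') = (\<one> \<ominus> a') \<otimes> z\<rbrakk> \<Longrightarrow> z \<otimes> r = r \<otimes> z" using npos_sqrt by blast
    note rc = npos_closed[OF r(1)]
    have sa': "s \<otimes> a' = a' \<otimes> s" unfolding s(2)[symmetric] using sc by (simp add: m_assoc)
    then have "s \<otimes> (\<one> \<ominus> a') = (\<one> \<ominus> a') \<otimes> s" using sc a' by (simp add: minus_eq l_distr r_distr l_minus r_minus)
    then have sr: "s \<otimes> r = r \<otimes> s" using r(3) sc by blast
    have "s \<otimes> s \<oplus> r \<otimes> r = \<one>" unfolding s(2) r(2) using a' by algebra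
    then have "||s|| \<le> 1" using nrm_le_one_of_squares[OF sc npos_sa[OF s(1)] rc npos_sa[OF r(1)] sr] by simp
    then have "||a'|| \<le> 1" using s(2) nrm_sa_square[OF sc npos_sa[OF s(1)]] sc by (auto simp: power_le_one)
    then show ?thesis using ac t by (simp add: a'_def nrm_smult norm_divide field_simps)
  qed
  show ?thesis
  proof (rule field_le_epsilon)
    fix e :: real assume e: "e > 0"
    have "npos (of_real e \<odot> \<one>)" using npos_smult[of \<one> e] npos_square[of \<one>] e by simp
    from npos_add[OF ta this] have "npos (of_real (t + e) \<odot> \<one> \<ominus> a)"
      using npos_closed[OF a] smultC[OF one_closed, of "of_real t"] smultC[OF one_closed, of "of_real e"]
      by (simp add: smult_add_l minus_eq a_ac)
    then show "||a|| \<le> t + e" using pos[of "t + e"] e t by simp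
  qed
qed

text \<open>From a + b \<le> ||a + b|| and b \<ge> 0 follows a \<le> ||a + b||, and
  \<open>npos_nrm_le\<close> turns this into a norm bound.\<close>

lemma npos_nrm_mono:
  assumes a: "npos a" and b: "npos b" shows "||a|| \<le> ||a \<oplus> b||"
proof (rule npos_nrm_le[OF a])
  have c: "a \<in> carrier A" "b \<in> carrier A" using a b npos_closed by auto
  let ?t = "of_real ||a \<oplus> b||"
  have "npos (?t \<odot> \<one> \<ominus> (a \<oplus> b))" using npos_sa[OF npos_add[OF a b]] c by (intro npos_nrm_minus) auto
  from npos_add[OF this b] have "npos ((?t \<odot> \<one> \<ominus> (a \<oplus> b)) \<oplus> b)" .
  moreover have "(?t \<odot> \<one> \<ominus> (a \<oplus> b)) \<oplus> b = ?t \<odot> \<one> \<ominus> a" using c smultC[OF one_closed, of ?t] by algebra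
  ultimately show "npos (?t \<odot> \<one> \<ominus> a)" by simp
  show "0 \<le> ||a \<oplus> b||" using c by simp
qed

text \<open>Any witness in the criterion can be replaced by ||a||. This one depends continuously on
  a, which is what limits require.\<close>

lemma npos_criterion: assumes "npos a" shows "||of_real ||a|| \<odot> \<one> \<ominus> a|| \<le> ||a||"
proof (rule npos_nrm_le)
  have c: "a \<in> carrier A" using assms npos_closed by auto
  show "npos (of_real ||a|| \<odot> \<one> \<ominus> a)" using c npos_sa[OF assms] by (intro npos_nrm_minus) auto
  have "of_real ||a|| \<odot> \<one> \<ominus> (of_real ||a|| \<odot> \<one> \<ominus> a) = a"
    using c smultC[OF one_closed, of "of_real ||a||"] by algebra
  then show "npos (of_real ||a|| \<odot> \<one> \<ominus> (of_real ||a|| \<odot> \<one> \<ominus> a))" using assms by simp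
  show "0 \<le> ||a||" using c by simp
qed

text \<open>With \<open>P = p\<^sup>2\<close> and \<open>N = ||y||\<^sup>2\<close>, the element \<open>y y\<^sup>* = 2 (Re y)\<^sup>2 + 2 (Im y)\<^sup>2 + P\<close> is positive, so
  \<open>P (N + P)\<^sup>2 = - y\<^sup>* (N - y y\<^sup>*)\<^sup>2 y\<close> has norm at most \<open>N\<^sup>3\<close>; but it dominates \<open>2 N P\<^sup>2\<close>.\<close>

lemma zero_if_star_mult_neg:
  assumes y: "y \<in> carrier A" and p: "p \<in> carrier A" "st p = p" and e: "st y \<otimes> y = \<ominus> (p \<otimes> p)"
  shows "y = \<zero>"
proof -
  define P where "P = p \<otimes> p"
  define q where "q = y \<otimes> st y"
  define N where "N = ||y||\<^sup>2"
  let ?N = "of_real N \<odot> \<one>"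
  have P: "P \<in> carrier A" "npos P" "st P = P" using p npos_square[OF p] by (simp_all add: P_def star_mult)
  have q: "q \<in> carrier A" "st q = q" using y by (simp_all add: q_def star_mult)
  have nP: "||P|| = N" using cstar[OF y] e P by (simp add: P_def N_def)
  have nq: "||q|| = N" using cstar[of "st y"] y by (simp add: q_def N_def)
  have eP: "st y \<otimes> y = \<ominus> P" using e by (simp add: P_def)
  \<comment> \<open>Up to sign, h and k are twice the real and imaginary parts of y.\<close>
  define h where "h = y \<oplus> st y"
  define k where "k = \<i> \<odot> (y \<ominus> st y)"
  have h: "h \<in> carrier A" "st h = h" using y by (simp_all add: h_def star_add a_comm)
  have k: "k \<in> carrier A" "st k = k"
  proof -
    show "k \<in> carrier A" using y by (simp add: k_def)
    have "st k = \<ominus> (\<i> \<odot> (st y \<ominus> y))" using y by (simp add: k_def star_smult star_diff smult_neg_l)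
    also have "\<dots> = k" using y by (simp add: k_def smult_neg_r[symmetric] neg_diff)
    finally show "st k = k" .
  qed
  have "k \<otimes> k = (-1) \<odot> ((y \<ominus> st y) \<otimes> (y \<ominus> st y))"
    using y by (simp add: k_def smult_mult_l smult_mult_r smult_mult)
  then have "h \<otimes> h \<oplus> k \<otimes> k = h \<otimes> h \<ominus> (y \<ominus> st y) \<otimes> (y \<ominus> st y)" using y h by (simp add: minus_eq smult_neg_l)
  also have "\<dots> = (q \<oplus> st y \<otimes> y) \<oplus> (q \<oplus> st y \<otimes> y)" unfolding h_def q_def using y star_closed[OF y] by algebra
  finally have hk: "h \<otimes> h \<oplus> k \<otimes> k \<oplus> (P \<oplus> P) = q \<oplus> q" unfolding eP using P q by algebra
  have "npos (q \<oplus> q)" unfolding hk[symmetric] by (intro npos_add npos_square h k P)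
  then have "npos (of_real (1/2) \<odot> (q \<oplus> q))" by (rule npos_smult) simp
  moreover have "of_real (1/2) \<odot> (q \<oplus> q) = q" using q smult_add_l[of q "1/2" "1/2"] by (simp add: smult_add_r)
  ultimately have "npos q" by simp
  define d where "d = ?N \<ominus> q"
  have d: "d \<in> carrier A" "||d|| \<le> N" using npos_criterion[OF \<open>npos q\<close>] q by (simp_all add: d_def nq)
  have Nc: "?N \<in> carrier A" by simp
  \<comment> \<open>Because y y* y = - y P, the factor N - q on the left of y becomes N + P on its
    right.\<close>
  have dy: "d \<otimes> y = y \<otimes> (?N \<oplus> P)"
  proof -
    have "d \<otimes> y = ?N \<otimes> y \<ominus> y \<otimes> (st y \<otimes> y)" using y by (simp add: d_def q_def minus_eq l_distr l_minus m_assoc)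
    also have "\<dots> = y \<otimes> (?N \<oplus> P)"
      unfolding eP using y P(1) by (simp add: smult_mult_l smult_mult_r r_distr minus_eq r_minus)
    finally show ?thesis .
  qed
  have "st y \<otimes> (d \<otimes> (d \<otimes> y)) = st y \<otimes> y \<otimes> ((?N \<oplus> P) \<otimes> (?N \<oplus> P))"
  proof -
    have "d \<otimes> (d \<otimes> y) = (d \<otimes> y) \<otimes> (?N \<oplus> P)" using d y P dy by (simp add: m_assoc[symmetric])
    also have "\<dots> = y \<otimes> ((?N \<oplus> P) \<otimes> (?N \<oplus> P))" unfolding dy using y P by (simp add: m_assoc)
    finally show ?thesis using y P by (simp add: m_assoc)
  qed
  also have "\<dots> = \<ominus> (P \<otimes> (?N \<otimes> ?N) \<oplus> (P \<otimes> P) \<otimes> P \<oplus> (P \<otimes> ?N \<otimes> P \<oplus> P \<otimes> P \<otimes> ?N))"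
    unfolding eP using P(1) Nc by algebra
  also have "P \<otimes> ?N \<otimes> P \<oplus> P \<otimes> P \<otimes> ?N = of_real (2 * N) \<odot> (P \<otimes> P)"
    using P smult_add_l[of "P \<otimes> P" "of_real N" "of_real N"] by (simp add: smult_mult_l smult_mult_r)
  also have "P \<otimes> (?N \<otimes> ?N) = of_real (N * N) \<odot> P" using P by (simp add: smult_mult_l smult_mult_r smult_mult)
  finally have E: "st y \<otimes> (d \<otimes> (d \<otimes> y)) = \<ominus> (of_real (N * N) \<odot> P \<oplus> P \<otimes> P \<otimes> P \<oplus> of_real (2 * N) \<odot> (P \<otimes> P))" .
  have N0: "N \<ge> 0" by (simp add: N_def)
  have "npos (P \<otimes> P \<otimes> P)"
  proof -
    have "st (p \<otimes> P) = p \<otimes> P" using p by (simp add: P_def star_mult m_assoc)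
    then have "npos ((p \<otimes> P) \<otimes> (p \<otimes> P))" using p P by (intro npos_square) auto
    moreover have "(p \<otimes> P) \<otimes> (p \<otimes> P) = P \<otimes> P \<otimes> P" using p by (simp add: P_def m_assoc)
    ultimately show ?thesis by simp
  qed
  then have n1: "npos (of_real (N * N) \<odot> P \<oplus> P \<otimes> P \<otimes> P)" using P N0 by (intro npos_add npos_smult) auto
  have n2: "npos (of_real (2 * N) \<odot> (P \<otimes> P))" using P N0 by (intro npos_smult npos_square) auto
  have "2 * N * N\<^sup>2 = ||of_real (2 * N) \<odot> (P \<otimes> P)||"
    using P N0 nrm_sa_square[OF P(1,3)] by (simp add: nrm_smult nP norm_mult)
  also have "\<dots> \<le> ||of_real (2 * N) \<odot> (P \<otimes> P) \<oplus> (of_real (N * N) \<odot> P \<oplus> P \<otimes> P \<otimes> P)||"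
    by (rule npos_nrm_mono[OF n2 n1])
  also have "\<dots> = ||st y \<otimes> (d \<otimes> (d \<otimes> y))||" unfolding E using P by (simp add: a_comm)
  also have "\<dots> \<le> ||y|| * (N * (N * ||y||))"
  proof -
    have "||d \<otimes> y|| \<le> N * ||y||" using d y by (intro order_trans[OF nrm_mult] mult_right_mono) auto
    then have "||d \<otimes> (d \<otimes> y)|| \<le> N * (N * ||y||)" using d y N0 by (intro order_trans[OF nrm_mult] mult_mono) auto
    then show ?thesis using d y N0 by (intro order_trans[OF nrm_mult] mult_mono) auto
  qed
  also have "\<dots> = N * N\<^sup>2" by (simp add: N_def power2_eq_square)
  finally have "N * N\<^sup>2 \<le> 0" by simp
  then have "N = 0" using N0 by (simp add: mult_le_0_iff)
  then show ?thesis using y nrm_eq_0 by (simp add: N_def)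
qed

text \<open>Let r be the root of a^2, that is the modulus of a, and m = r - a twice the negative
  part. With s the root of r, one finds (x m)* (x m) = m a m = - r m^2 = - (s m)^2, so x m = 0 by
  \<open>zero_if_star_mult_neg\<close>. Hence r m^2 = 0, and m^2 = 2 r m forces the fourth power of
  m, then m itself, to vanish. So a = r is positive.\<close>

theorem npos_star_mult: assumes x: "x \<in> carrier A" shows "npos (st x \<otimes> x)"
proof -
  define a where "a = st x \<otimes> x"
  have a: "a \<in> carrier A" "st a = a" using x by (simp_all add: a_def star_mult)
  obtain r where r: "npos r" "r \<otimes> r = a \<otimes> a" "\<And>z. \<lbrakk>z \<in> carrier A; z \<otimes> (a \<otimes> a) = a \<otimes> a \<otimes> z\<rbrakk> \<Longrightarrow> z \<otimes> r = r \<otimes> z"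
    using npos_sqrt[OF npos_square[OF a]] by blast
  note rc = npos_closed[OF r(1)] npos_sa[OF r(1)]
  have ar: "a \<otimes> r = r \<otimes> a" using r(3)[of a] a by (simp add: m_assoc)
  obtain s where s: "npos s" "s \<otimes> s = r" "\<And>z. \<lbrakk>z \<in> carrier A; z \<otimes> r = r \<otimes> z\<rbrakk> \<Longrightarrow> z \<otimes> s = s \<otimes> z"
    using npos_sqrt[OF r(1)] by blast
  note sc = npos_closed[OF s(1)] npos_sa[OF s(1)]
  define m where "m = r \<ominus> a"
  have m: "m \<in> carrier A" "st m = m" using a rc by (simp_all add: m_def star_diff)
  have mr: "m \<otimes> r = r \<otimes> m" unfolding m_def using a(1) rc(1) ar
    by (simp add: minus_eq l_distr r_distr l_minus r_minus)
  then have ms: "m \<otimes> s = s \<otimes> m" using s(3) m by blast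
  have ma: "m \<otimes> a = \<ominus> (r \<otimes> m)"
  proof -
    have "m \<otimes> a = r \<otimes> a \<ominus> a \<otimes> a" unfolding m_def using a(1) rc(1) by algebra
    moreover have "\<ominus> (r \<otimes> m) = r \<otimes> a \<ominus> r \<otimes> r" unfolding m_def using a(1) rc(1) by algebra
    ultimately show ?thesis by (simp add: r(2))
  qed
  have pp: "(s \<otimes> m) \<otimes> (s \<otimes> m) = r \<otimes> m \<otimes> m"
  proof -
    have "(s \<otimes> m) \<otimes> (s \<otimes> m) = s \<otimes> (m \<otimes> s) \<otimes> m" using sc m by (simp add: m_assoc)
    also have "\<dots> = (s \<otimes> s) \<otimes> m \<otimes> m" unfolding ms using sc m by (simp add: m_assoc)
    finally show ?thesis by (simp add: s(2))
  qed
  have yy: "st (x \<otimes> m) \<otimes> (x \<otimes> m) = \<ominus> (r \<otimes> m \<otimes> m)"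
  proof -
    have "st (x \<otimes> m) \<otimes> (x \<otimes> m) = m \<otimes> a \<otimes> m" using x m by (simp add: star_mult a_def m_assoc)
    then show ?thesis unfolding ma using rc m by (simp add: l_minus)
  qed
  have sm: "s \<otimes> m \<in> carrier A" "st (s \<otimes> m) = s \<otimes> m" using sc m ms by (simp_all add: star_mult)
  have "x \<otimes> m = \<zero>" using zero_if_star_mult_neg[of "x \<otimes> m" "s \<otimes> m"] x m sm pp yy by simp
  then have "\<ominus> (r \<otimes> m \<otimes> m) = \<zero>" using yy x by simp
  then have rmm: "r \<otimes> m \<otimes> m = \<zero>" by (metis minus_minus minus_zero m_closed m(1) rc(1))
  have mm: "m \<otimes> m = r \<otimes> m \<oplus> r \<otimes> m"
  proof -
    have "m \<otimes> m = m \<otimes> r \<ominus> m \<otimes> a" unfolding m_def using a(1) rc(1) by algebra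
    then show ?thesis unfolding ma mr using rc m by (simp add: minus_eq)
  qed
  have "(m \<otimes> m) \<otimes> (m \<otimes> m) = (r \<otimes> m \<otimes> m) \<otimes> m \<oplus> (r \<otimes> m \<otimes> m) \<otimes> m"
    apply (subst (1) mm) using rc m by (simp add: l_distr m_assoc)
  then have "(m \<otimes> m) \<otimes> (m \<otimes> m) = \<zero>" unfolding rmm using m by simp
  then have "m \<otimes> m = \<zero>" using nrm_sq_eq_0[of "m \<otimes> m"] m by (simp add: star_mult)
  then have "m = \<zero>" using nrm_sq_eq_0[of m] m by simp
  then have "r = a" using diff_eq_0_iff[of r a] a rc by (simp add: m_def)
  then show ?thesis using r(1) by (simp add: a_def)
qed

lemma positive_iff_npos: "positive A a \<longleftrightarrow> npos a"
proof
  assume "npos a"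
  then obtain r where "npos r" "r \<otimes> r = a" using npos_sqrt by blast
  then show "positive A a" unfolding positive_def using npos_closed[of r] npos_sa[of r] by metis
qed (auto simp: positive_def npos_star_mult)

lemma positive_closed: "positive A a \<Longrightarrow> a \<in> carrier A"
  and positive_sa: "positive A a \<Longrightarrow> st a = a" by (simp_all add: positive_iff_npos npos_closed npos_sa)

lemma positive_star_mult [intro]: "x \<in> carrier A \<Longrightarrow> positive A (st x \<otimes> x)" by (auto simp: positive_def)

lemma positive_zero [simp]: "positive A \<zero>" by (simp add: positive_iff_npos npos_zero)

lemma positive_one [simp]: "positive A \<one>" using positive_star_mult[of \<one>] by simp

lemma positive_add: "\<lbrakk>positive A a; positive A b\<rbrakk> \<Longrightarrow> positive A (a \<oplus> b)"
  by (simp add: positive_iff_npos npos_add)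

lemma positive_smult: "\<lbrakk>positive A a; c \<ge> 0\<rbrakk> \<Longrightarrow> positive A (of_real c \<odot> a)"
  by (simp add: positive_iff_npos npos_smult)

lemma positive_finsum: "\<lbrakk>finite I; \<And>i. i \<in> I \<Longrightarrow> positive A (f i)\<rbrakk> \<Longrightarrow> positive A (\<Oplus>i\<in>I. f i)"
proof (induction I rule: finite_induct)
  case (insert i I)
  then show ?case by (subst finsum_insert) (auto simp: positive_closed intro: positive_add)
qed simp

lemma positive_conj: assumes "positive A a" "x \<in> carrier A" shows "positive A (st x \<otimes> a \<otimes> x)"
proof -
  obtain c where c: "c \<in> carrier A" "a = st c \<otimes> c" using assms by (auto simp: positive_def)
  then have "st x \<otimes> a \<otimes> x = st (c \<otimes> x) \<otimes> (c \<otimes> x)" using assms by (simp add: star_mult m_assoc)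
  then show ?thesis using c assms by auto
qed

lemma positive_nrm_minus:
  "\<lbrakk>c \<in> carrier A; st c = c; ||c|| \<le> t\<rbrakk> \<Longrightarrow> positive A (of_real t \<odot> \<one> \<ominus> c)"
  by (simp add: positive_iff_npos npos_nrm_minus)

lemma positive_nrm_mono:
  assumes "positive A a" "positive A (b \<ominus> a)" "b \<in> carrier A" shows "||a|| \<le> ||b||"
proof -
  have "a \<oplus> (b \<ominus> a) = b" using assms positive_closed[OF assms(1)] diff_add_cancel[of b a] a_comm[of a "b \<ominus> a"] by simp
  then show ?thesis using npos_nrm_mono[of a "b \<ominus> a"] assms by (simp add: positive_iff_npos)
qed

text \<open>The norms of s n converge to that of l, so the inequality of
  \<open>npos_criterion\<close> passes to the limit.\<close>

lemma positive_tends: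
  assumes s: "\<And>n. positive A (s n)" and l: "tends s l F" "l \<in> carrier A" and F: "F \<noteq> bot"
  shows "positive A l"
proof -
  have sc: "s n \<in> carrier A" for n using s positive_closed by blast
  have sa: "st l = l"
    using tends_star[OF l(1) sc l(2)] l F sc positive_sa[OF s] by (intro tends_unique[of s l F "st l", symmetric]) auto
  have n: "((\<lambda>n. ||s n||) \<longlongrightarrow> ||l||) F" by (rule tends_nrm[OF l(1) sc l(2)])
  have "((\<lambda>n. \<bar>||s n|| - ||l||\<bar> * ||\<one>||) \<longlongrightarrow> \<bar>||l|| - ||l||\<bar> * ||\<one>||) F" by (intro tendsto_intros n)
  then have "tends (\<lambda>n. of_real ||s n|| \<odot> \<one>) (of_real ||l|| \<odot> \<one>) F"
    by (simp add: ndist_eq smult_diff_l[symmetric] nrm_smult flip: of_real_diff)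
  then have "tends (\<lambda>n. of_real ||s n|| \<odot> \<one> \<ominus> s n) (of_real ||l|| \<odot> \<one> \<ominus> l) F"
    using l sc by (intro tends_diff) auto
  then have "((\<lambda>n. ||of_real ||s n|| \<odot> \<one> \<ominus> s n||) \<longlongrightarrow> ||of_real ||l|| \<odot> \<one> \<ominus> l||) F"
    using l sc by (intro tends_nrm) auto
  then have "||of_real ||l|| \<odot> \<one> \<ominus> l|| \<le> ||l||"
    by (rule tendsto_le[OF F n]) (use s npos_criterion in \<open>auto simp: positive_iff_npos\<close>)
  then show ?thesis using l sa by (auto simp: positive_iff_npos npos_def intro!: exI[of _ "||l||"])
qed

text \<open>The algebraic core of the Cauchy--Schwarz inequality for Hilbert modules, with
  \<open>a = \<langle>x, x\<rangle>\<close>, \<open>b = \<langle>x, y\<rangle>\<close>, \<open>c = \<langle>y, y\<rangle>\<close>: expand \<open>\<langle>x d - y, x d - y\<rangle> \<ge> 0\<close> and take \<open>d\<close> a multiple of \<open>b\<close>.\<close>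

lemma cauchy_schwarz_core:
  assumes a: "positive A a" and b: "b \<in> carrier A" and c: "c \<in> carrier A"
    and d: "\<And>d. d \<in> carrier A \<Longrightarrow> positive A ((st d \<otimes> a \<otimes> d \<ominus> st d \<otimes> b) \<ominus> (st b \<otimes> d \<ominus> c))"
  shows "||b||\<^sup>2 \<le> ||a|| * ||c||"
proof -
  have ac: "a \<in> carrier A" using a positive_closed by simp
  define B where "B = st b \<otimes> b"
  have B: "B \<in> carrier A" "positive A B" "||B|| = ||b||\<^sup>2" using b cstar by (auto simp: B_def)
  let ?r = complex_of_real
  \<comment> \<open>M stands for ||a||. It is taken strictly larger so that 1/M exists also when a =
    0; the excess is removed at the end.\<close>
  have ineq: "||b||\<^sup>2 \<le> M * ||c||" if M: "||a|| < M" for M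
  proof -
    have M0: "M > 0" using M nrm_nonneg[OF ac] by linarith
    \<comment> \<open>The choice d = b/M. Since a \<le> M, the term d* a d is at most t^2 M b* b = t
      b* b; this cancels one of the two mixed terms and leaves t b* b \<le> c.\<close>
    define t where "t = 1 / M"
    define Y where "Y = ?r (t\<^sup>2) \<odot> (st b \<otimes> a \<otimes> b)"
    define Z where "Z = ?r t \<odot> B"
    have t: "t > 0" "t\<^sup>2 * M = t" using M0 by (simp_all add: t_def power2_eq_square)
    have YZ: "Y \<in> carrier A" "Z \<in> carrier A" using B b ac by (simp_all add: Y_def Z_def)
    have "positive A (?r (t\<^sup>2) \<odot> (st b \<otimes> (?r M \<odot> \<one> \<ominus> a) \<otimes> b))"
      using positive_nrm_minus[OF ac positive_sa[OF a], of M] M b by (intro positive_smult positive_conj) auto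
    also have "st b \<otimes> (?r M \<odot> \<one> \<ominus> a) \<otimes> b = ?r M \<odot> B \<ominus> st b \<otimes> a \<otimes> b"
      using b ac by (simp add: B_def minus_eq l_distr r_distr l_minus r_minus smult_mult_l smult_mult_r)
    also have "?r (t\<^sup>2) \<odot> (?r M \<odot> B \<ominus> st b \<otimes> a \<otimes> b) = Z \<ominus> Y"
      using b ac B arg_cong[OF t(2), of ?r] by (simp add: smult_diff_r smult_mult Y_def Z_def)
    finally have p1: "positive A (Z \<ominus> Y)" .
    have "positive A ((st (?r t \<odot> b) \<otimes> a \<otimes> (?r t \<odot> b) \<ominus> st (?r t \<odot> b) \<otimes> b) \<ominus> (st b \<otimes> (?r t \<odot> b) \<ominus> c))"
      using b by (intro d) auto
    also have "st (?r t \<odot> b) \<otimes> a \<otimes> (?r t \<odot> b) = Y"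
      using b ac by (simp add: Y_def star_smult smult_mult_l smult_mult_r smult_mult power2_eq_square)
    also have "st (?r t \<odot> b) \<otimes> b = Z" using b by (simp add: Z_def star_smult smult_mult_l B_def)
    also have "st b \<otimes> (?r t \<odot> b) = Z" using b by (simp add: Z_def smult_mult_r B_def)
    finally have "positive A ((Z \<ominus> Y) \<oplus> ((Y \<ominus> Z) \<ominus> (Z \<ominus> c)))" by (rule positive_add[OF p1])
    moreover have "(Z \<ominus> Y) \<oplus> ((Y \<ominus> Z) \<ominus> (Z \<ominus> c)) = c \<ominus> Z" using YZ c by algebra
    moreover have "positive A Z" using t B unfolding Z_def by (intro positive_smult) auto
    ultimately have "||Z|| \<le> ||c||" using c by (intro positive_nrm_mono) auto
    then have "t * ||b||\<^sup>2 \<le> ||c||" using t B by (simp add: Z_def nrm_smult)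
    then show ?thesis using M0 by (simp add: t_def field_simps)
  qed
  show ?thesis
  proof (rule field_le_epsilon)
    fix e :: real assume e: "e > 0"
    have "||a|| < ||a|| + e / ( ||c|| + 1)" using e nrm_nonneg[OF c] by simp
    from ineq[OF this] have "||b||\<^sup>2 \<le> ||a|| * ||c|| + e * ( ||c|| / ( ||c|| + 1))" by (simp add: distrib_right)
    also have "e * ( ||c|| / ( ||c|| + 1)) \<le> e" using e nrm_nonneg[OF c] by (intro mult_left_le) auto
    finally show "||b||\<^sup>2 \<le> ||a|| * ||c|| + e" by simp
  qed
qed

end

section \<open>Hilbert modules and adjointable operators\<close>

context seminormed begin

lemma op_norm_le:
  assumes "\<And>x. x \<in> carrier V \<Longrightarrow> ||T x|| \<le> C * ||x||" "C \<ge> 0"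
  shows "op_norm V T \<le> C" unfolding op_norm_def
proof (rule cSUP_least)
  show "{x \<in> carrier V. ||x|| \<le> 1} \<noteq> {}" by (auto intro!: exI[of _ \<zero>])
  fix x assume "x \<in> {x \<in> carrier V. ||x|| \<le> 1}"
  then show "||T x|| \<le> C" using assms(1)[of x] mult_left_mono[of "||x||" 1 C] assms(2) by simp
qed

lemma bdd_above_op_norm:
  assumes "bounded_map V V T" shows "bdd_above ((\<lambda>x. ||T x||) ` {x \<in> carrier V. ||x|| \<le> 1})"
proof -
  obtain C where C: "C \<ge> 0" "\<And>x. x \<in> carrier V \<Longrightarrow> ||T x|| \<le> C * ||x||" using assms by (rule bounded_mapE) blast
  have "||T x|| \<le> C" if "x \<in> carrier V" "||x|| \<le> 1" for x
    using C(2)[OF that(1)] mult_left_mono[OF that(2) C(1)] by simp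
  then show ?thesis by (auto intro!: bdd_aboveI2)
qed

lemma op_norm_nonneg: assumes "clinear_map V V T" "bounded_map V V T" shows "0 \<le> op_norm V T"
proof -
  have "T \<zero> \<in> carrier V" using assms by (auto simp: clinear_map_def)
  then have "0 \<le> ||T \<zero>||" by simp
  also have "\<dots> \<le> op_norm V T" unfolding op_norm_def
    by (rule cSUP_upper[OF _ bdd_above_op_norm[OF assms(2)]]) auto
  finally show ?thesis .
qed

lemma op_norm_bound:
  assumes T: "clinear_map V V T" "bounded_map V V T" and x: "x \<in> carrier V"
  shows "||T x|| \<le> op_norm V T * ||x||"
proof -
  obtain C where C: "C \<ge> 0" "\<And>x. x \<in> carrier V \<Longrightarrow> ||T x|| \<le> C * ||x||" using T(2) by (rule bounded_mapE) blast
  have Tx: "T x \<in> carrier V" using T x by (auto simp: clinear_map_def)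
  show ?thesis
  proof (cases "||x|| = 0")
    case True
    then show ?thesis using C(2)[OF x] by simp
  next
    case False
    then have n: "||x|| > 0" using nrm_nonneg[OF x] by linarith
    define y where "y = of_real (1 / ||x||) \<odot> x"
    have y: "y \<in> {x \<in> carrier V. ||x|| \<le> 1}" using x n by (simp add: y_def nrm_smult norm_divide)
    have "T y = of_real (1 / ||x||) \<odot> T x" using T x unfolding y_def clinear_map_def by blast
    then have "||T x|| / ||x|| = ||T y||" using Tx n by (simp add: nrm_smult norm_divide)
    also have "\<dots> \<le> op_norm V T" unfolding op_norm_def by (rule cSUP_upper[OF y bdd_above_op_norm[OF T(2)]])
    finally show ?thesis using n by (simp add: field_simps)
  qed
qed

end

text \<open>The right action of D is not part of the structure. Where it matters, in
  \<open>prehilbI\<close> and \<open>positive_adjI\<close>, it enters as the hypothesis that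
  suitable vectors exist, so the locale covers modules of sections, columns over an algebra, and GNS
  spaces with D the complex numbers.\<close>

locale prehilb = D: ucstar D + H: seminormed H
  for D :: "('d, 'k) cstar_scheme" and H :: "('h, 'l) cnormed_scheme" +
  fixes ip :: "'h \<Rightarrow> 'h \<Rightarrow> 'd"
  assumes ip_closed [simp, intro]: "\<lbrakk>x \<in> carrier H; y \<in> carrier H\<rbrakk> \<Longrightarrow> ip x y \<in> carrier D"
    and ip_add: "\<lbrakk>x \<in> carrier H; y \<in> carrier H; z \<in> carrier H\<rbrakk> \<Longrightarrow> ip x (y \<oplus>\<^sub>H z) = ip x y \<oplus>\<^sub>D ip x z"
    and ip_smult: "\<lbrakk>x \<in> carrier H; y \<in> carrier H\<rbrakk> \<Longrightarrow> ip x (c \<odot>\<^sub>H y) = c \<odot>\<^sub>D ip x y"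
    and ip_star: "\<lbrakk>x \<in> carrier H; y \<in> carrier H\<rbrakk> \<Longrightarrow> star D (ip x y) = ip y x"
    and ip_pos: "x \<in> carrier H \<Longrightarrow> positive D (ip x x)"
    and nrm_ip: "x \<in> carrier H \<Longrightarrow> ||x||\<^sub>H\<^sup>2 = ||ip x x||\<^sub>D"
    and ip_CS: "\<lbrakk>x \<in> carrier H; y \<in> carrier H\<rbrakk> \<Longrightarrow> ||ip x y||\<^sub>D \<le> ||x||\<^sub>H * ||y||\<^sub>H"
begin

lemma ip_diff: "\<lbrakk>x \<in> carrier H; y \<in> carrier H; z \<in> carrier H\<rbrakk> \<Longrightarrow> ip x (y \<ominus>\<^sub>H z) = ip x y \<ominus>\<^sub>D ip x z"
  by (simp add: H.minus_eq H.neg_eq D.minus_eq D.neg_eq ip_add ip_smult)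

lemma ip_zero [simp]: "x \<in> carrier H \<Longrightarrow> ip x \<zero>\<^sub>H = \<zero>\<^sub>D" using ip_smult[of x "\<zero>\<^sub>H" 0] by simp

lemma ip_add_left: "\<lbrakk>x \<in> carrier H; y \<in> carrier H; z \<in> carrier H\<rbrakk> \<Longrightarrow> ip (x \<oplus>\<^sub>H y) z = ip x z \<oplus>\<^sub>D ip y z"
  by (metis D.star_add H.a_closed ip_add ip_closed ip_star)

lemma ip_smult_left: "\<lbrakk>x \<in> carrier H; y \<in> carrier H\<rbrakk> \<Longrightarrow> ip (c \<odot>\<^sub>H x) y = cnj c \<odot>\<^sub>D ip x y"
  by (metis D.star_smult H.smultC ip_closed ip_smult ip_star)

lemma ip_diff_left: "\<lbrakk>x \<in> carrier H; y \<in> carrier H; z \<in> carrier H\<rbrakk> \<Longrightarrow> ip (x \<ominus>\<^sub>H y) z = ip x z \<ominus>\<^sub>D ip y z"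
  by (simp add: H.minus_eq H.neg_eq D.minus_eq D.neg_eq ip_add_left ip_smult_left)

lemma ip_ndist:
  assumes "x \<in> carrier H" "y \<in> carrier H" "x' \<in> carrier H" "y' \<in> carrier H"
  shows "ndist D (ip x y) (ip x' y') \<le> ndist H x x' * ||y||\<^sub>H + ||x'||\<^sub>H * ndist H y y'"
proof -
  have "ip x y \<ominus>\<^sub>D ip x' y' = ip (x \<ominus>\<^sub>H x') y \<oplus>\<^sub>D ip x' (y \<ominus>\<^sub>H y')"
    using assms by (simp add: ip_diff ip_diff_left D.diff_trans)
  also have "||\<dots>||\<^sub>D \<le> ||x \<ominus>\<^sub>H x'||\<^sub>H * ||y||\<^sub>H + ||x'||\<^sub>H * ||y \<ominus>\<^sub>H y'||\<^sub>H"
    using assms by (intro order_trans[OF D.nrm_triangle] add_mono ip_CS) auto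
  finally show ?thesis using assms by (simp add: D.ndist_eq H.ndist_eq)
qed

lemma tends_ip:
  assumes s: "H.tends s l F" "H.tends t m F" "\<And>n. s n \<in> carrier H" "\<And>n. t n \<in> carrier H"
    "l \<in> carrier H" "m \<in> carrier H"
  shows "D.tends (\<lambda>n. ip (s n) (t n)) (ip l m) F"
proof -
  have "((\<lambda>n. ndist H (s n) l * ||t n||\<^sub>H + ||l||\<^sub>H * ndist H (t n) m) \<longlongrightarrow> 0 * ||m||\<^sub>H + ||l||\<^sub>H * 0) F"
    by (intro tendsto_add tendsto_mult s H.tends_nrm tendsto_const)
  then have "((\<lambda>n. ndist H (s n) l * ||t n||\<^sub>H + ||l||\<^sub>H * ndist H (t n) m) \<longlongrightarrow> 0) F" by simp
  then show ?thesis by (rule Lim_null_comparison[rotated]) (use s(3-) ip_ndist in auto)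
qed

lemma cauchy_ip:
  assumes x: "x \<in> cauchy_seqs H" and y: "y \<in> cauchy_seqs H"
  shows "(\<lambda>n. ip (x n) (y n)) \<in> cauchy_seqs D" unfolding cauchy_seqs_def
proof safe
  note c = H.cauchy_closed[OF x] H.cauchy_closed[OF y]
  fix n show "ip (x n) (y n) \<in> carrier D" using c by simp
next
  note c = H.cauchy_closed[OF x] H.cauchy_closed[OF y]
  fix \<epsilon> :: real assume e: "\<epsilon> > 0"
  obtain K where K: "K > 0" "\<And>n. ||x n||\<^sub>H \<le> K" using H.cauchy_bounded[OF x] by blast
  obtain L where L: "L > 0" "\<And>n. ||y n||\<^sub>H \<le> L" using H.cauchy_bounded[OF y] by blast
  obtain M where M: "\<forall>m\<ge>M. \<forall>n\<ge>M. ndist H (x m) (x n) < \<epsilon> / (2 * L)"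
    using H.cauchyD[OF x, of "\<epsilon> / (2 * L)"] e L by auto
  obtain N where N: "\<forall>m\<ge>N. \<forall>n\<ge>N. ndist H (y m) (y n) < \<epsilon> / (2 * K)"
    using H.cauchyD[OF y, of "\<epsilon> / (2 * K)"] e K by auto
  have "ndist D (ip (x m) (y m)) (ip (x n) (y n)) < \<epsilon>" if "m \<ge> max M N" "n \<ge> max M N" for m n
  proof -
    have "ndist D (ip (x m) (y m)) (ip (x n) (y n)) \<le> ndist H (x m) (x n) * ||y m||\<^sub>H + ||x n||\<^sub>H * ndist H (y m) (y n)"
      using c by (intro ip_ndist) auto
    also have "\<dots> \<le> ndist H (x m) (x n) * L + K * ndist H (y m) (y n)"
      using K L by (intro add_mono mult_left_mono mult_right_mono) auto
    also have "\<dots> < \<epsilon> / (2 * L) * L + K * (\<epsilon> / (2 * K))"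
      using M N K L that by (intro add_strict_mono mult_strict_right_mono mult_strict_left_mono) auto
    also have "\<dots> = \<epsilon>" using K L by simp
    finally show ?thesis .
  qed
  then show "\<exists>N. \<forall>m\<ge>N. \<forall>n\<ge>N. ndist D (ip (x m) (y m)) (ip (x n) (y n)) < \<epsilon>" by blast
qed

end

text \<open>This is \<open>l2_inner\<close> with an arbitrary inner product in place of
  \<open>section_inner\<close>.\<close>

definition completion_ip ::
    "('d, 'k) cstar_scheme \<Rightarrow> ('h \<Rightarrow> 'h \<Rightarrow> 'd) \<Rightarrow> (nat \<Rightarrow> 'h) set \<Rightarrow> (nat \<Rightarrow> 'h) set \<Rightarrow> 'd" where
  "completion_ip D ip X Y = (THE c. c \<in> carrier D \<and> (\<lambda>n. ndist D (ip (rep X n) (rep Y n)) c) \<longlonglongrightarrow> 0)"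

context prehilb begin

lemma completion_ip_seq_class:
  assumes x: "x \<in> cauchy_seqs H" and y: "y \<in> cauchy_seqs H"
  shows "completion_ip D ip (seq_class H x) (seq_class H y) \<in> carrier D"
    and "D.tends (\<lambda>n. ip (x n) (y n)) (completion_ip D ip (seq_class H x) (seq_class H y)) sequentially"
proof -
  note rx = H.rep_seq_class[OF x] and ry = H.rep_seq_class[OF y]
  let ?x = "rep (seq_class H x)" and ?y = "rep (seq_class H y)"
  note c = H.cauchy_closed[OF x] H.cauchy_closed[OF y] H.cauchy_closed[OF rx(1)] H.cauchy_closed[OF ry(1)]
  obtain l where l: "l \<in> carrier D" "D.tends (\<lambda>n. ip (?x n) (?y n)) l sequentially"
    using D.complete[OF cauchy_ip[OF rx(1) ry(1)]] by blast
  have e: "completion_ip D ip (seq_class H x) (seq_class H y) = l" unfolding completion_ip_def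
  proof (rule the_equality)
    fix m assume m: "m \<in> carrier D \<and> D.tends (\<lambda>n. ip (?x n) (?y n)) m sequentially"
    show "m = l" by (rule D.tends_unique[of "\<lambda>n. ip (?x n) (?y n)" _ sequentially]) (use m l c in auto)
  qed (use l in auto)
  show "completion_ip D ip (seq_class H x) (seq_class H y) \<in> carrier D" using e l by simp
  obtain K where K: "K > 0" "\<And>n. ||?x n||\<^sub>H \<le> K" using H.cauchy_bounded[OF rx(1)] by blast
  obtain L where L: "L > 0" "\<And>n. ||y n||\<^sub>H \<le> L" using H.cauchy_bounded[OF y] by blast
  have 0: "(\<lambda>n. ndist H (x n) (?x n) * L + K * ndist H (y n) (?y n)) \<longlonglongrightarrow> 0"
    using tendsto_add[OF tendsto_mult_right[OF rx(2), of L] tendsto_mult_left[OF ry(2), of K]] by simp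
  have "D.tends (\<lambda>n. ip (x n) (y n)) l sequentially"
  proof (rule tendsto_0_le_add[OF 0 l(2)])
    fix n
    have "ndist D (ip (x n) (y n)) (ip (?x n) (?y n)) \<le> ndist H (x n) (?x n) * ||y n||\<^sub>H + ||?x n||\<^sub>H * ndist H (y n) (?y n)"
      using c by (intro ip_ndist) auto
    also have "\<dots> \<le> ndist H (x n) (?x n) * L + K * ndist H (y n) (?y n)"
      using K L by (intro add_mono mult_left_mono mult_right_mono) auto
    finally show "ndist D (ip (x n) (y n)) l \<le>
        ndist H (x n) (?x n) * L + K * ndist H (y n) (?y n) + ndist D (ip (?x n) (?y n)) l"
      using D.ndist_triangle[of "ip (x n) (y n)" "ip (?x n) (?y n)" l] c l by (auto intro: order_trans)
  qed simp
  then show "D.tends (\<lambda>n. ip (x n) (y n)) (completion_ip D ip (seq_class H x) (seq_class H y)) sequentially"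
    using e by simp
qed

lemma completion_ip_const [simp]:
  assumes "x \<in> carrier H" "y \<in> carrier H"
  shows "completion_ip D ip (seq_class H (\<lambda>n. x)) (seq_class H (\<lambda>n. y)) = ip x y"
  using completion_ip_seq_class[OF H.cauchy_const[OF assms(1)] H.cauchy_const[OF assms(2)]] assms
  by (intro D.tends_unique[of "\<lambda>n. ip x y" _ sequentially]) auto

lemma prehilb_completion: "prehilb D (completion H) (completion_ip D ip)"
proof -
  interpret C: banach_space "completion H" by (rule H.banach_completion)
  show ?thesis
  proof
    fix X Y Z c
    assume X: "X \<in> carrier (completion H)"
    obtain x where x: "x \<in> cauchy_seqs H" "X = seq_class H x" using X by (rule H.completionE)
    note xc [simp] = H.cauchy_closed[OF x(1)]
    note xx = completion_ip_seq_class[OF x(1) x(1)]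
    show "positive D (completion_ip D ip X X)"
      unfolding x(2) by (rule D.positive_tends[OF _ xx(2) xx(1)]) (simp_all add: ip_pos)
    have "(\<lambda>n. ||ip (x n) (x n)||\<^sub>D) \<longlonglongrightarrow> ||completion_ip D ip X X||\<^sub>D"
      using xx by (intro D.tends_nrm) (auto simp: x)
    moreover have "(\<lambda>n. ||ip (x n) (x n)||\<^sub>D) \<longlonglongrightarrow> ||X||\<^sub>(completion H)\<^sup>2"
      using tendsto_power[OF H.completion_nrm[OF x(1)], of 2] by (simp add: x nrm_ip)
    ultimately show "||X||\<^sub>(completion H)\<^sup>2 = ||completion_ip D ip X X||\<^sub>D" by (rule LIMSEQ_unique[symmetric])
    assume Y: "Y \<in> carrier (completion H)"
    obtain y where y: "y \<in> cauchy_seqs H" "Y = seq_class H y" using Y by (rule H.completionE)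
    note yc [simp] = H.cauchy_closed[OF y(1)]
    note xy = completion_ip_seq_class[OF x(1) y(1)] note yx = completion_ip_seq_class[OF y(1) x(1)]
    show "completion_ip D ip X Y \<in> carrier D" using xy by (simp add: x y)
    show "star D (completion_ip D ip X Y) = completion_ip D ip Y X"
    proof (rule D.tends_unique)
      show "D.tends (\<lambda>n. star D (ip (x n) (y n))) (star D (completion_ip D ip X Y)) sequentially"
        using xy by (intro D.tends_star) (auto simp: x y)
      show "D.tends (\<lambda>n. star D (ip (x n) (y n))) (completion_ip D ip Y X) sequentially"
        using yx by (simp add: x y ip_star)
    qed (use xy yx in \<open>auto simp: x y\<close>)
    show "completion_ip D ip X (c \<odot>\<^sub>(completion H) Y) = c \<odot>\<^sub>D completion_ip D ip X Y"
    proof (rule D.tends_unique)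
      show "D.tends (\<lambda>n. c \<odot>\<^sub>D ip (x n) (y n)) (c \<odot>\<^sub>D completion_ip D ip X Y) sequentially"
        using xy by (intro D.tends_smult) (auto simp: x y)
      show "D.tends (\<lambda>n. c \<odot>\<^sub>D ip (x n) (y n)) (completion_ip D ip X (c \<odot>\<^sub>(completion H) Y)) sequentially"
        using completion_ip_seq_class[OF x(1) H.cauchy_smult[OF y(1)], of c] x y
        by (simp add: H.completion_smult ip_smult)
    qed (use xy completion_ip_seq_class[OF x(1) H.cauchy_smult[OF y(1)], of c] in \<open>auto simp: x y H.completion_smult\<close>)
    show "||completion_ip D ip X Y||\<^sub>D \<le> ||X||\<^sub>(completion H) * ||Y||\<^sub>(completion H)"
    proof (rule LIMSEQ_le)
      show "(\<lambda>n. ||ip (x n) (y n)||\<^sub>D) \<longlonglongrightarrow> ||completion_ip D ip X Y||\<^sub>D"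
        using xy by (intro D.tends_nrm) (auto simp: x y)
      show "(\<lambda>n. ||x n||\<^sub>H * ||y n||\<^sub>H) \<longlonglongrightarrow> ||X||\<^sub>(completion H) * ||Y||\<^sub>(completion H)"
        unfolding x(2) y(2) by (intro tendsto_mult H.completion_nrm x y)
    qed (auto intro!: ip_CS)
    assume Z: "Z \<in> carrier (completion H)"
    obtain z where z: "z \<in> cauchy_seqs H" "Z = seq_class H z" using Z by (rule H.completionE)
    note zc [simp] = H.cauchy_closed[OF z(1)]
    note xz = completion_ip_seq_class[OF x(1) z(1)]
    show "completion_ip D ip X (Y \<oplus>\<^sub>(completion H) Z) = completion_ip D ip X Y \<oplus>\<^sub>D completion_ip D ip X Z"
    proof (rule D.tends_unique)
      show "D.tends (\<lambda>n. ip (x n) (y n) \<oplus>\<^sub>D ip (x n) (z n)) (completion_ip D ip X Y \<oplus>\<^sub>D completion_ip D ip X Z) sequentially"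
        using xy xz by (intro D.tends_add) (auto simp: x y z)
      show "D.tends (\<lambda>n. ip (x n) (y n) \<oplus>\<^sub>D ip (x n) (z n)) (completion_ip D ip X (Y \<oplus>\<^sub>(completion H) Z)) sequentially"
        using completion_ip_seq_class[OF x(1) H.cauchy_add[OF y(1) z(1)]] x y z
        by (simp add: H.completion_add ip_add)
    qed (use xy xz completion_ip_seq_class[OF x(1) H.cauchy_add[OF y(1) z(1)]] in \<open>auto simp: x y z H.completion_add\<close>)
  qed
qed

end

section \<open>The C*-algebra of adjointable operators\<close>

definition is_adj :: "('h, 'l) cnormed_scheme \<Rightarrow> ('h \<Rightarrow> 'h \<Rightarrow> 'd) \<Rightarrow> ('h \<Rightarrow> 'h) \<Rightarrow> ('h \<Rightarrow> 'h) \<Rightarrow> bool" where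
  "is_adj H ip T S \<longleftrightarrow> S \<in> carrier H \<rightarrow>\<^sub>E carrier H \<and>
     (\<forall>X\<in>carrier H. \<forall>Y\<in>carrier H. ip (T X) Y = ip X (S Y))"

text \<open>The construction of \<open>adjointable\<close> for an arbitrary module. Besides the
  operators on \<open>l2 G B\<close> it also provides those on the column modules of
  \<open>gpos_gram\<close>.\<close>

definition adj_alg :: "('h, 'l) cnormed_scheme \<Rightarrow> ('h \<Rightarrow> 'h \<Rightarrow> 'd) \<Rightarrow> ('h \<Rightarrow> 'h) cstar" where
  "adj_alg H ip =
     \<lparr>carrier = {T \<in> carrier H \<rightarrow>\<^sub>E carrier H. clinear_map H H T \<and> bounded_map H H T \<and>
                   (\<exists>S. is_adj H ip T S)},
      mult = (\<lambda>S T. \<lambda>X\<in>carrier H. S (T X)),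
      one = (\<lambda>X\<in>carrier H. X),
      zero = (\<lambda>X\<in>carrier H. \<zero>\<^sub>H),
      add = (\<lambda>S T. \<lambda>X\<in>carrier H. S X \<oplus>\<^sub>H T X),
      smult = (\<lambda>c T. \<lambda>X\<in>carrier H. c \<odot>\<^sub>H T X),
      nrm = op_norm H,
      star = (\<lambda>T. THE S. is_adj H ip T S)\<rparr>"

lemma adj_alg_simps [simp]:
  "S \<otimes>\<^sub>(adj_alg H ip) T = (\<lambda>X\<in>carrier H. S (T X))"
  "\<one>\<^sub>(adj_alg H ip) = (\<lambda>X\<in>carrier H. X)" "\<zero>\<^sub>(adj_alg H ip) = (\<lambda>X\<in>carrier H. \<zero>\<^sub>H)"
  "S \<oplus>\<^sub>(adj_alg H ip) T = (\<lambda>X\<in>carrier H. S X \<oplus>\<^sub>H T X)"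
  "c \<odot>\<^sub>(adj_alg H ip) T = (\<lambda>X\<in>carrier H. c \<odot>\<^sub>H T X)"
  "||T||\<^sub>(adj_alg H ip) = op_norm H T" by (simp_all add: adj_alg_def)

locale hilb = prehilb D H ip + banach_space H
  for D :: "('d, 'k) cstar_scheme" and H :: "('h, 'l) cnormed_scheme" and ip
begin

lemma ip_eqI:
  assumes "a \<in> carrier H" "b \<in> carrier H" "\<And>y. y \<in> carrier H \<Longrightarrow> ip y a = ip y b"
  shows "a = b"
proof -
  have "ip (a \<ominus>\<^sub>H b) (a \<ominus>\<^sub>H b) = \<zero>\<^sub>D" using assms by (simp add: ip_diff)
  then have "||a \<ominus>\<^sub>H b||\<^sub>H\<^sup>2 = 0" using assms nrm_ip[of "a \<ominus>\<^sub>H b"] by simp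
  then show ?thesis using assms nrm_eq_0[of "a \<ominus>\<^sub>H b"] by (simp add: H.diff_eq_0_iff)
qed

abbreviation Adj where "Adj \<equiv> adj_alg H ip"

lemma adjD:
  assumes "T \<in> carrier Adj"
  shows "T \<in> carrier H \<rightarrow>\<^sub>E carrier H" "clinear_map H H T" "bounded_map H H T"
    "x \<in> carrier H \<Longrightarrow> T x \<in> carrier H"
    "\<lbrakk>x \<in> carrier H; y \<in> carrier H\<rbrakk> \<Longrightarrow> T (x \<oplus>\<^sub>H y) = T x \<oplus>\<^sub>H T y"
    "x \<in> carrier H \<Longrightarrow> T (c \<odot>\<^sub>H x) = c \<odot>\<^sub>H T x"
    "x \<in> carrier H \<Longrightarrow> ||T x||\<^sub>H \<le> ||T||\<^sub>Adj * ||x||\<^sub>H"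
  using assms H.op_norm_bound by (auto simp: adj_alg_def clinear_map_def)

lemma adj_eqI:
  assumes "S \<in> carrier Adj" "T \<in> carrier Adj" "\<And>x. x \<in> carrier H \<Longrightarrow> S x = T x"
  shows "S = T" using adjD(1)[OF assms(1)] adjD(1)[OF assms(2)] assms(3) by (rule PiE_ext)

lemma is_adj_unique: "\<lbrakk>is_adj H ip T S; is_adj H ip T S'; T \<in> carrier H \<rightarrow> carrier H\<rbrakk> \<Longrightarrow> S = S'"
  unfolding is_adj_def
  by (rule PiE_ext[of S "carrier H" "\<lambda>_. carrier H" S'], simp, simp, rule ip_eqI) (auto simp: PiE_iff)

text \<open>Linearity of both maps follows from the pairing because ip separates points. The bound C
  of T carries over to S through ||S x||^2 = ||ip (T (S x)) x|| \<le> C ||S x|| ||x||.\<close>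

lemma adj_of_pair:
  assumes T: "T \<in> carrier H \<rightarrow>\<^sub>E carrier H" and S: "S \<in> carrier H \<rightarrow>\<^sub>E carrier H"
    and e: "\<And>x y. \<lbrakk>x \<in> carrier H; y \<in> carrier H\<rbrakk> \<Longrightarrow> ip (T x) y = ip x (S y)"
    and b: "bounded_map H H T"
  shows "T \<in> carrier Adj" "S \<in> carrier Adj" "star Adj T = S" "star Adj S = T"
proof -
  have Tc: "T x \<in> carrier H" "S x \<in> carrier H" if "x \<in> carrier H" for x using T S that by auto
  have e': "ip (S x) y = ip x (T y)" if "x \<in> carrier H" "y \<in> carrier H" for x y
    using e[OF that(2,1)] that Tc by (metis ip_star)
  have lin: "clinear_map H H R" if R: "\<And>x. x \<in> carrier H \<Longrightarrow> R x \<in> carrier H"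
    "\<And>x. x \<in> carrier H \<Longrightarrow> Q x \<in> carrier H"
    and q: "\<And>x y. \<lbrakk>x \<in> carrier H; y \<in> carrier H\<rbrakk> \<Longrightarrow> ip x (R y) = ip (Q x) y" for R Q unfolding clinear_map_def
  proof (intro conjI ballI allI)
    show "R \<in> carrier H \<rightarrow> carrier H" using R by auto
    fix x assume x: "x \<in> carrier H"
    show "R (c \<odot>\<^sub>H x) = c \<odot>\<^sub>H R x" for c using x R by (intro ip_eqI) (auto simp: q ip_smult)
    fix y assume y: "y \<in> carrier H"
    show "R (x \<oplus>\<^sub>H y) = R x \<oplus>\<^sub>H R y" using x y R by (intro ip_eqI) (auto simp: q ip_add)
  qed
  have l: "clinear_map H H T" "clinear_map H H S" using lin[of T S] lin[of S T] Tc e e' by auto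
  obtain C where C: "C \<ge> 0" "\<And>x. x \<in> carrier H \<Longrightarrow> ||T x||\<^sub>H \<le> C * ||x||\<^sub>H" using b by (rule H.bounded_mapE) blast
  have "||S x||\<^sub>H \<le> C * ||x||\<^sub>H" if x: "x \<in> carrier H" for x
  proof (cases "||S x||\<^sub>H = 0")
    case False
    then have p: "||S x||\<^sub>H > 0" using H.nrm_nonneg[OF Tc(2)[OF x]] by linarith
    have "||S x||\<^sub>H\<^sup>2 = ||ip (T (S x)) x||\<^sub>D" using x Tc by (simp add: nrm_ip e)
    also have "\<dots> \<le> ||T (S x)||\<^sub>H * ||x||\<^sub>H" using x Tc by (intro ip_CS) auto
    also have "\<dots> \<le> C * ||S x||\<^sub>H * ||x||\<^sub>H" using C x Tc by (intro mult_right_mono) auto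
    finally have "||S x||\<^sub>H * ||S x||\<^sub>H \<le> ||S x||\<^sub>H * (C * ||x||\<^sub>H)" by (simp add: power2_eq_square mult_ac)
    then show ?thesis using p by (rule mult_left_le_imp_le)
  qed (use C x in simp)
  then have b': "bounded_map H H S" by (auto simp: bounded_map_def)
  have a: "is_adj H ip T S" "is_adj H ip S T" using T S e e' by (auto simp: is_adj_def)
  show "T \<in> carrier Adj" "S \<in> carrier Adj" using T S l b b' a by (auto simp: adj_alg_def)
  have "T \<in> carrier H \<rightarrow> carrier H" "S \<in> carrier H \<rightarrow> carrier H" using Tc by auto
  then show "star Adj T = S" "star Adj S = T" using a is_adj_unique
    by (auto simp: adj_alg_def intro!: the_equality)
qed

lemma adj_star:
  assumes T: "T \<in> carrier Adj"
  shows "star Adj T \<in> carrier Adj" "star Adj (star Adj T) = T"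
    "\<lbrakk>x \<in> carrier H; y \<in> carrier H\<rbrakk> \<Longrightarrow> ip (T x) y = ip x (star Adj T y)"
    "\<lbrakk>x \<in> carrier H; y \<in> carrier H\<rbrakk> \<Longrightarrow> ip (star Adj T x) y = ip x (T y)"
proof -
  obtain S where S: "is_adj H ip T S" using T by (auto simp: adj_alg_def)
  have s: "S \<in> carrier Adj" "star Adj T = S" "star Adj S = T"
    using adj_of_pair[OF adjD(1)[OF T], of S] S adjD[OF T] by (auto simp: is_adj_def)
  show "star Adj T \<in> carrier Adj" "star Adj (star Adj T) = T" using s by auto
  show 1: "ip (T x) y = ip x (star Adj T y)" if "x \<in> carrier H" "y \<in> carrier H" for x y
    using S s that by (auto simp: is_adj_def)
  show "ip (star Adj T x) y = ip x (T y)" if "x \<in> carrier H" "y \<in> carrier H" for x y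
    using 1[OF that(2,1)] that adjD(4)[OF T] adjD(4)[OF s(1)] s by (metis ip_star)
qed

lemma adj_bounded: assumes "\<And>x. x \<in> carrier H \<Longrightarrow> ||T x||\<^sub>H \<le> C * ||x||\<^sub>H" shows "bounded_map H H T"
  using assms by (auto simp: bounded_map_def)

lemma adj_one: "\<one>\<^sub>Adj \<in> carrier Adj" by (rule adj_of_pair[of _ "\<one>\<^sub>Adj"]) (auto intro!: adj_bounded[of _ 1])

lemma adj_zero: "\<zero>\<^sub>Adj \<in> carrier Adj"
proof (rule adj_of_pair[of _ "\<zero>\<^sub>Adj"])
  fix x y assume "x \<in> carrier H" "y \<in> carrier H"
  then show "ip (\<zero>\<^sub>Adj x) y = ip x (\<zero>\<^sub>Adj y)" using ip_smult_left[of "\<zero>\<^sub>H" y 0] by simp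
qed (auto intro!: adj_bounded[of _ 0])

lemma adj_add: assumes S: "S \<in> carrier Adj" and T: "T \<in> carrier Adj"
  shows "S \<oplus>\<^sub>Adj T \<in> carrier Adj" "star Adj (S \<oplus>\<^sub>Adj T) = star Adj S \<oplus>\<^sub>Adj star Adj T"
proof -
  note a = adj_star[OF S] adj_star[OF T]
  note [simp] = adjD(4)[OF S] adjD(4)[OF T] adjD(4)[OF a(1)] adjD(4)[OF a(5)]
  have b: "bounded_map H H (S \<oplus>\<^sub>Adj T)"
  proof (rule adj_bounded)
    fix x assume "x \<in> carrier H"
    then show "||(S \<oplus>\<^sub>Adj T) x||\<^sub>H \<le> ( ||S||\<^sub>Adj + ||T||\<^sub>Adj) * ||x||\<^sub>H"
      using H.nrm_triangle[of "S x" "T x"] adjD(7)[OF S] adjD(7)[OF T] by (simp add: distrib_right) (smt (verit))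
  qed
  show "S \<oplus>\<^sub>Adj T \<in> carrier Adj" "star Adj (S \<oplus>\<^sub>Adj T) = star Adj S \<oplus>\<^sub>Adj star Adj T"
    by (rule adj_of_pair[where S = "star Adj S \<oplus>\<^sub>Adj star Adj T", OF _ _ _ b];
        auto simp: ip_add ip_add_left a)+
qed

lemma adj_smult: assumes T: "T \<in> carrier Adj"
  shows "c \<odot>\<^sub>Adj T \<in> carrier Adj" "star Adj (c \<odot>\<^sub>Adj T) = cnj c \<odot>\<^sub>Adj star Adj T"
proof -
  note a = adj_star[OF T]
  note [simp] = adjD(4)[OF T] adjD(4)[OF a(1)]
  have b: "bounded_map H H (c \<odot>\<^sub>Adj T)"
  proof (rule adj_bounded)
    fix x assume "x \<in> carrier H"
    then show "||(c \<odot>\<^sub>Adj T) x||\<^sub>H \<le> (cmod c * ||T||\<^sub>Adj) * ||x||\<^sub>H"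
      using mult_left_mono[OF adjD(7)[OF T], of x "cmod c"] by (simp add: H.nrm_smult)
  qed
  show "c \<odot>\<^sub>Adj T \<in> carrier Adj" "star Adj (c \<odot>\<^sub>Adj T) = cnj c \<odot>\<^sub>Adj star Adj T"
    by (rule adj_of_pair[where S = "cnj c \<odot>\<^sub>Adj star Adj T", OF _ _ _ b];
        auto simp: ip_smult ip_smult_left a)+
qed

lemma adj_nrm_nonneg: "T \<in> carrier Adj \<Longrightarrow> 0 \<le> ||T||\<^sub>Adj" using H.op_norm_nonneg adjD by simp

lemma adj_nrm_le:
  assumes "\<And>x. x \<in> carrier H \<Longrightarrow> ||T x||\<^sub>H \<le> C * ||x||\<^sub>H" "C \<ge> 0" shows "||T||\<^sub>Adj \<le> C"
  using H.op_norm_le[OF assms] by simp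

lemma adj_mult: assumes S: "S \<in> carrier Adj" and T: "T \<in> carrier Adj"
  shows "S \<otimes>\<^sub>Adj T \<in> carrier Adj" "star Adj (S \<otimes>\<^sub>Adj T) = star Adj T \<otimes>\<^sub>Adj star Adj S"
    "||S \<otimes>\<^sub>Adj T||\<^sub>Adj \<le> ||S||\<^sub>Adj * ||T||\<^sub>Adj"
proof -
  note a = adj_star[OF S] adj_star[OF T]
  note [simp] = adjD(4)[OF S] adjD(4)[OF T] adjD(4)[OF a(1)] adjD(4)[OF a(5)]
  have b: "||(S \<otimes>\<^sub>Adj T) x||\<^sub>H \<le> ( ||S||\<^sub>Adj * ||T||\<^sub>Adj) * ||x||\<^sub>H" if "x \<in> carrier H" for x
  proof -
    have "||S (T x)||\<^sub>H \<le> ||S||\<^sub>Adj * ||T x||\<^sub>H" using that by (intro adjD(7)[OF S]) auto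
    also have "\<dots> \<le> ||S||\<^sub>Adj * ( ||T||\<^sub>Adj * ||x||\<^sub>H)"
      using adjD(7)[OF T that] adj_nrm_nonneg[OF S] by (rule mult_left_mono)
    finally show ?thesis using that by simp
  qed
  show "||S \<otimes>\<^sub>Adj T||\<^sub>Adj \<le> ||S||\<^sub>Adj * ||T||\<^sub>Adj" by (rule adj_nrm_le[OF b]) (use adj_nrm_nonneg S T in auto)
  show "S \<otimes>\<^sub>Adj T \<in> carrier Adj" "star Adj (S \<otimes>\<^sub>Adj T) = star Adj T \<otimes>\<^sub>Adj star Adj S"
    by (rule adj_of_pair[where S = "star Adj T \<otimes>\<^sub>Adj star Adj S", OF _ _ _ adj_bounded[OF b]];
        auto simp: a)+
qed

text \<open>Cauchy--Schwarz for ip x (T* T x) bounds ||T||^2 by ||T* T||. This inequality also shows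
  that taking adjoints does not increase the norm, and with submultiplicativity the converse
  follows.\<close>

lemma adj_cstar: assumes T: "T \<in> carrier Adj" shows "||star Adj T \<otimes>\<^sub>Adj T||\<^sub>Adj = ||T||\<^sub>Adj\<^sup>2"
proof -
  have le: "||T||\<^sub>Adj\<^sup>2 \<le> ||star Adj T \<otimes>\<^sub>Adj T||\<^sub>Adj" if T: "T \<in> carrier Adj" for T
  proof -
    note a = adj_star[OF T]
    note m = adj_mult[OF a(1) T]
    define C where "C = ||star Adj T \<otimes>\<^sub>Adj T||\<^sub>Adj"
    have C: "C \<ge> 0" using adj_nrm_nonneg[OF m(1)] by (simp add: C_def)
    have "||T||\<^sub>Adj \<le> sqrt C"
    proof (rule adj_nrm_le)
      fix x assume x: "x \<in> carrier H"
      have Tx: "T x \<in> carrier H" "(star Adj T \<otimes>\<^sub>Adj T) x \<in> carrier H" using x adjD(4)[OF T] adjD(4)[OF m(1)] by auto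
      have "||T x||\<^sub>H\<^sup>2 = ||ip x ((star Adj T \<otimes>\<^sub>Adj T) x)||\<^sub>D" using x Tx a by (simp add: nrm_ip)
      also have "\<dots> \<le> ||x||\<^sub>H * (C * ||x||\<^sub>H)"
        using ip_CS[OF x Tx(2)] mult_left_mono[OF adjD(7)[OF m(1) x] H.nrm_nonneg[OF x]] unfolding C_def by linarith
      also have "\<dots> = (sqrt C * ||x||\<^sub>H)\<^sup>2" using C by (simp add: power_mult_distrib power2_eq_square)
      finally show "||T x||\<^sub>H \<le> sqrt C * ||x||\<^sub>H" by (rule power2_le_imp_le) (use C x in simp)
    qed (use C in simp)
    then have "||T||\<^sub>Adj\<^sup>2 \<le> (sqrt C)\<^sup>2" using adj_nrm_nonneg[OF T] by (rule power_mono)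
    then show ?thesis using C by (simp add: C_def)
  qed
  have "||T||\<^sub>Adj \<le> ||star Adj T||\<^sub>Adj" if T: "T \<in> carrier Adj" for T
  proof (cases "||T||\<^sub>Adj = 0")
    case False
    have "||T||\<^sub>Adj * ||T||\<^sub>Adj \<le> ||star Adj T||\<^sub>Adj * ||T||\<^sub>Adj"
      using le[OF T] adj_mult(3)[OF adj_star(1)[OF T] T] by (simp add: power2_eq_square)
    moreover have "||T||\<^sub>Adj > 0" using False adj_nrm_nonneg[OF T] by linarith
    ultimately show ?thesis by (rule mult_right_le_imp_le)
  qed (use adj_nrm_nonneg[OF adj_star(1)[OF T]] in simp)
  from this[OF adj_star(1)[OF T]] have "||star Adj T||\<^sub>Adj \<le> ||T||\<^sub>Adj" using adj_star(2)[OF T] by simp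
  then have "||star Adj T \<otimes>\<^sub>Adj T||\<^sub>Adj \<le> ||T||\<^sub>Adj * ||T||\<^sub>Adj"
    using adj_mult(3)[OF adj_star(1)[OF T] T] mult_right_mono[OF _ adj_nrm_nonneg[OF T]] order_trans by blast
  then show ?thesis using le[OF T] by (simp add: power2_eq_square)
qed

lemma seminormed_adj: "seminormed Adj"
proof -
  have m: "module complex_field Adj"
    by (rule module_of_evaluations[where I = "carrier H" and V = "\<lambda>_. H" and e = "\<lambda>x T. T x", OF H.module_axioms])
      (use adjD(4) adj_zero adj_add(1) adj_smult(1) adj_eqI in \<open>simp_all only: adj_alg_simps restrict_apply'\<close>)
  have sm: "||c \<odot>\<^sub>Adj T||\<^sub>Adj \<le> cmod c * ||T||\<^sub>Adj" if T: "T \<in> carrier Adj" for c T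
  proof (rule adj_nrm_le)
    fix x assume "x \<in> carrier H"
    then show "||(c \<odot>\<^sub>Adj T) x||\<^sub>H \<le> cmod c * ||T||\<^sub>Adj * ||x||\<^sub>H"
      using mult_left_mono[OF adjD(7)[OF T], of x "cmod c"] adjD(4)[OF T] by (simp add: H.nrm_smult)
  qed (use adj_nrm_nonneg[OF T] in simp)
  show ?thesis
  proof (rule seminormed.intro[OF m], unfold_locales)
    fix S T assume S: "S \<in> carrier Adj" and T: "T \<in> carrier Adj"
    show "||S \<oplus>\<^sub>Adj T||\<^sub>Adj \<le> ||S||\<^sub>Adj + ||T||\<^sub>Adj"
    proof (rule adj_nrm_le)
      fix x assume x: "x \<in> carrier H"
      show "||(S \<oplus>\<^sub>Adj T) x||\<^sub>H \<le> ( ||S||\<^sub>Adj + ||T||\<^sub>Adj) * ||x||\<^sub>H"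
        using H.nrm_triangle[OF adjD(4)[OF S x] adjD(4)[OF T x]] adjD(7)[OF S x] adjD(7)[OF T x] x
        by (simp add: distrib_right)
    qed (use adj_nrm_nonneg S T in auto)
  next
    fix c T assume T: "T \<in> carrier Adj"
    show "||c \<odot>\<^sub>Adj T||\<^sub>Adj = cmod c * ||T||\<^sub>Adj"
    proof (cases "c = 0")
      case True
      then show ?thesis using sm[OF T, of c] adj_nrm_nonneg[OF adj_smult(1)[OF T, of c]] by simp
    next
      case False
      \<comment> \<open>Scaling back by 1/c turns the inequality \<open>sm\<close> into an
        equality.\<close>
      have "(1/c) \<odot>\<^sub>Adj (c \<odot>\<^sub>Adj T) = T" by (rule adj_eqI[OF adj_smult(1)[OF adj_smult(1)[OF T]] T])
          (use False adjD(4)[OF T] in \<open>simp add: H.smult_mult\<close>)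
      then have "||T||\<^sub>Adj \<le> cmod (1/c) * ||c \<odot>\<^sub>Adj T||\<^sub>Adj"
        using sm[OF adj_smult(1)[OF T, of c], of "1/c"] by simp
      then show ?thesis using sm[OF T, of c] False by (simp add: norm_divide field_simps)
    qed
  qed
qed

theorem ucstar_adj: "ucstar Adj"
proof -
  interpret S: seminormed Adj by (rule seminormed_adj)
  have dapp: "(S \<ominus>\<^sub>Adj T) x = S x \<ominus>\<^sub>H T x" if "S \<in> carrier Adj" "T \<in> carrier Adj" "x \<in> carrier H" for S T x
    using that adjD(4) by (simp add: S.minus_eq S.neg_eq H.minus_eq H.neg_eq)
  have b: "banach_space Adj"
  proof
    fix T assume T: "T \<in> carrier Adj"
    show "( ||T||\<^sub>Adj = 0) = (T = \<zero>\<^sub>Adj)"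
    proof
      assume n: "||T||\<^sub>Adj = 0"
      show "T = \<zero>\<^sub>Adj"
      proof (rule adj_eqI[OF T adj_zero])
        fix x assume x: "x \<in> carrier H"
        have "||T x||\<^sub>H \<le> 0" using adjD(7)[OF T x] n by simp
        then have "||T x||\<^sub>H = 0" using H.nrm_nonneg[OF adjD(4)[OF T x]] by linarith
        then show "T x = \<zero>\<^sub>Adj x" using nrm_eq_0[OF adjD(4)[OF T x]] x by simp
      qed
    qed (use S.nrm_0 in simp)
  next
    fix s assume s: "s \<in> cauchy_seqs Adj"
    note sc = S.cauchy_closed[OF s]
    have dist: "ndist H (r m x) (r n x) \<le> ||x||\<^sub>H * ndist Adj (r m) (r n)"
      if r: "r \<in> cauchy_seqs Adj" and x: "x \<in> carrier H" for r m n x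
      using adjD(7)[OF S.minus_closed[OF S.cauchy_closed[OF r] S.cauchy_closed[OF r]] x, of m n] x
        adjD(4)[OF S.cauchy_closed[OF r] x] S.cauchy_closed[OF r]
      by (simp add: H.ndist_eq S.ndist_eq dapp mult.commute del: adj_alg_simps)
    have limex: "\<exists>l\<in>carrier H. H.tends (\<lambda>n. r n x) l sequentially"
      if "r \<in> cauchy_seqs Adj" "x \<in> carrier H" for r x
      using dist[OF that] that adjD(4)[OF S.cauchy_closed[OF that(1)] that(2)]
      by (intro complete S.cauchy_Lipschitz[where f = "\<lambda>T. T x"] H.seminormed_axioms) auto
    \<comment> \<open>Adjoints do not increase the norm, so the adjoints of a Cauchy sequence
      converge pointwise as well. Their limit L' is the adjoint of the limit L of the operators,
      which puts L into the algebra.\<close>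
    have ss: "(\<lambda>n. star Adj (s n)) \<in> cauchy_seqs Adj"
    proof (rule S.cauchy_Lipschitz[OF s seminormed_adj, where L = 1])
      have ns: "||star Adj T||\<^sub>Adj \<le> ||T||\<^sub>Adj" if T: "T \<in> carrier Adj" for T
      proof -
        have "||star Adj T||\<^sub>Adj\<^sup>2 \<le> ||T||\<^sub>Adj * ||star Adj T||\<^sub>Adj"
          using adj_cstar[OF adj_star(1)[OF T]] adj_mult(3)[OF T adj_star(1)[OF T]] adj_star(2)[OF T] by simp
        then show ?thesis using adj_nrm_nonneg[OF T] adj_nrm_nonneg[OF adj_star(1)[OF T]]
          by (cases "0 < op_norm H (star Adj T)") (simp_all add: power2_eq_square mult_le_cancel_right)
      qed
      fix m n
      have "star Adj (s m \<ominus>\<^sub>Adj s n) = star Adj (s m) \<ominus>\<^sub>Adj star Adj (s n)"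
        using adj_add(2)[OF sc[of m] adj_smult(1)[OF sc[of n], of "-1"]] adj_smult(2)[OF sc[of n], of "-1"]
          sc adj_star(1) by (simp add: S.minus_eq S.neg_eq del: adj_alg_simps)
      then show "ndist Adj (star Adj (s m)) (star Adj (s n)) \<le> 1 * ndist Adj (s m) (s n)"
        using ns[OF S.minus_closed[OF sc[of m] sc[of n]]] sc adj_star(1) by (simp add: S.ndist_eq del: adj_alg_simps)
    qed (use sc adj_star in auto)
    define L where "L = (\<lambda>x\<in>carrier H. SOME l. l \<in> carrier H \<and> H.tends (\<lambda>n. s n x) l sequentially)"
    define L' where "L' = (\<lambda>x\<in>carrier H. SOME l. l \<in> carrier H \<and> H.tends (\<lambda>n. star Adj (s n) x) l sequentially)"
    have L: "L x \<in> carrier H \<and> H.tends (\<lambda>n. s n x) (L x) sequentially" if "x \<in> carrier H" for x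
      using someI_ex[of "\<lambda>l. l \<in> carrier H \<and> H.tends (\<lambda>n. s n x) l sequentially"] limex[OF s that] that
      by (auto simp: L_def)
    have L': "L' x \<in> carrier H \<and> H.tends (\<lambda>n. star Adj (s n) x) (L' x) sequentially" if "x \<in> carrier H" for x
      using someI_ex[of "\<lambda>l. l \<in> carrier H \<and> H.tends (\<lambda>n. star Adj (s n) x) l sequentially"] limex[OF ss that] that
      by (auto simp: L'_def)
    obtain K where K: "K > 0" "\<And>n. ||s n||\<^sub>Adj \<le> K" using S.cauchy_bounded[OF s] by blast
    have LA: "L \<in> carrier Adj"
    proof (rule adj_of_pair)
      show "L \<in> carrier H \<rightarrow>\<^sub>E carrier H" "L' \<in> carrier H \<rightarrow>\<^sub>E carrier H" using L L' by (auto simp: L_def L'_def)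
      fix x y assume x: "x \<in> carrier H" and y: "y \<in> carrier H"
      show "ip (L x) y = ip x (L' y)"
      proof (rule D.tends_unique)
        show "D.tends (\<lambda>n. ip (s n x) y) (ip (L x) y) sequentially"
          using L x y adjD(4)[OF sc] by (intro tends_ip) auto
        have "D.tends (\<lambda>n. ip x (star Adj (s n) y)) (ip x (L' y)) sequentially"
          using L' x y adjD(4)[OF adj_star(1)[OF sc]] by (intro tends_ip) auto
        then show "D.tends (\<lambda>n. ip (s n x) y) (ip x (L' y)) sequentially" using adj_star(3)[OF sc x y] by simp
      qed (use L L' x y adjD(4)[OF sc] in auto)
    next
      show "bounded_map H H L"
      proof (rule adj_bounded)
        fix x assume x: "x \<in> carrier H"
        have "(\<lambda>n. ||s n x||\<^sub>H) \<longlonglongrightarrow> ||L x||\<^sub>H" using L x adjD(4)[OF sc] by (intro H.tends_nrm) auto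
        then show "||L x||\<^sub>H \<le> K * ||x||\<^sub>H"
        proof (rule LIMSEQ_le_const2, intro exI allI impI)
          fix n show "||s n x||\<^sub>H \<le> K * ||x||\<^sub>H"
            using adjD(7)[OF sc x, of n] mult_right_mono[OF K(2)[of n] H.nrm_nonneg[OF x]] by linarith
        qed
      qed
    qed
    show "\<exists>l\<in>carrier Adj. (\<lambda>n. ndist Adj (s n) l) \<longlonglongrightarrow> 0"
    proof (intro bexI[OF _ LA] LIMSEQ_I)
      fix r :: real assume r: "r > 0"
      obtain N where N: "\<forall>m\<ge>N. \<forall>n\<ge>N. ndist Adj (s m) (s n) < r / 2" using S.cauchyD[OF s, of "r/2"] r by auto
      have "ndist Adj (s n) L \<le> r / 2" if n: "n \<ge> N" for n
      proof -
        have "||s n \<ominus>\<^sub>Adj L||\<^sub>Adj \<le> r / 2"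
        proof (rule adj_nrm_le)
          fix x assume x: "x \<in> carrier H"
          have Lx: "L x \<in> carrier H" "H.tends (\<lambda>n. s n x) (L x) sequentially" using L x by auto
          \<comment> \<open>Let m tend to infinity in the Cauchy estimate at x. The resulting bound
            is uniform over the unit ball, so convergence is in operator norm.\<close>
          have "(\<lambda>m. ||s n x \<ominus>\<^sub>H s m x||\<^sub>H) \<longlonglongrightarrow> ||s n x \<ominus>\<^sub>H L x||\<^sub>H"
            using Lx adjD(4)[OF sc x] by (intro H.tends_nrm H.tends_diff) auto
          then have "||s n x \<ominus>\<^sub>H L x||\<^sub>H \<le> r / 2 * ||x||\<^sub>H"
          proof (rule LIMSEQ_le_const2, intro exI allI impI)
            fix m assume m: "N \<le> m"
            have "||s n x \<ominus>\<^sub>H s m x||\<^sub>H \<le> ||x||\<^sub>H * ndist Adj (s n) (s m)"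
              using dist[OF s x, of n m] adjD(4)[OF sc x] by (simp add: H.ndist_eq)
            also have "\<dots> \<le> ||x||\<^sub>H * (r / 2)" using N n m x by (intro mult_left_mono) (auto intro: less_imp_le)
            finally show "||s n x \<ominus>\<^sub>H s m x||\<^sub>H \<le> r / 2 * ||x||\<^sub>H" by (simp add: mult.commute)
          qed
          then show "||(s n \<ominus>\<^sub>Adj L) x||\<^sub>H \<le> r / 2 * ||x||\<^sub>H" using dapp[OF sc LA x] by simp
        qed (use r in simp)
        then show ?thesis using sc LA by (simp add: S.ndist_eq del: adj_alg_simps)
      qed
      then have "norm (ndist Adj (s n) L - 0) < r" if "n \<ge> N" for n using that r by fastforce
      then show "\<exists>no. \<forall>n\<ge>no. norm (ndist Adj (s n) L - 0) < r" by blast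
    qed
  qed (use S.nrm_triangle S.nrm_smult in \<open>simp_all del: adj_alg_simps\<close>)
  have r: "ring Adj"
  proof (rule ringI)
    show "abelian_group Adj" by (rule S.abelian_group_axioms)
    show "monoid Adj"
    proof (rule monoidI)
      fix S T assume S: "S \<in> carrier Adj" and T: "T \<in> carrier Adj"
      show "S \<otimes>\<^sub>Adj T \<in> carrier Adj" by (rule adj_mult(1)[OF S T])
      fix U assume U: "U \<in> carrier Adj"
      show "S \<otimes>\<^sub>Adj T \<otimes>\<^sub>Adj U = S \<otimes>\<^sub>Adj (T \<otimes>\<^sub>Adj U)"
        unfolding adj_alg_simps by (rule restrict_ext) (use adjD(4)[OF U] in \<open>simp\<close>)
    next
      fix T assume T: "T \<in> carrier Adj"
      show "\<one>\<^sub>Adj \<otimes>\<^sub>Adj T = T" by (rule adj_eqI[OF adj_mult(1)[OF adj_one T] T]) (use adjD(4)[OF T] in simp)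
      show "T \<otimes>\<^sub>Adj \<one>\<^sub>Adj = T" by (rule adj_eqI[OF adj_mult(1)[OF T adj_one] T]) simp
    qed (rule adj_one)
    fix S T U assume S: "S \<in> carrier Adj" and T: "T \<in> carrier Adj" and U: "U \<in> carrier Adj"
    show "(S \<oplus>\<^sub>Adj T) \<otimes>\<^sub>Adj U = S \<otimes>\<^sub>Adj U \<oplus>\<^sub>Adj T \<otimes>\<^sub>Adj U"
      unfolding adj_alg_simps by (rule restrict_ext) (use adjD(4)[OF U] in \<open>simp\<close>)
    show "U \<otimes>\<^sub>Adj (S \<oplus>\<^sub>Adj T) = U \<otimes>\<^sub>Adj S \<oplus>\<^sub>Adj U \<otimes>\<^sub>Adj T"
      unfolding adj_alg_simps by (rule restrict_ext) (use adjD(4)[OF S] adjD(4)[OF T] adjD(5)[OF U] in \<open>simp\<close>)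
  qed
  show ?thesis
  proof (rule ucstar.intro[OF b r], unfold_locales)
    fix S T c assume S: "S \<in> carrier Adj" and T: "T \<in> carrier Adj"
    show "c \<odot>\<^sub>Adj S \<otimes>\<^sub>Adj T = c \<odot>\<^sub>Adj (S \<otimes>\<^sub>Adj T)"
      unfolding adj_alg_simps by (rule restrict_ext) (use adjD(4)[OF T] in \<open>simp\<close>)
    show "S \<otimes>\<^sub>Adj (c \<odot>\<^sub>Adj T) = c \<odot>\<^sub>Adj (S \<otimes>\<^sub>Adj T)"
      unfolding adj_alg_simps by (rule restrict_ext) (use adjD(4)[OF T] adjD(6)[OF S] in \<open>simp\<close>)
  qed (rule adj_mult adj_star adj_add adj_smult adj_cstar, assumption+)+
qed

end

section \<open>Closed star subalgebras\<close>

lemma (in ucstar) ucstar_subalgebra: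
  assumes S: "closed_star_subalgebra A S" and one: "\<one> \<in> S"
  shows "ucstar (A\<lparr>carrier := S\<rparr>)"
    and "\<And>x y. \<lbrakk>x \<in> S; y \<in> S\<rbrakk> \<Longrightarrow> x \<ominus>\<^sub>(A\<lparr>carrier := S\<rparr>) y = x \<ominus> y"
proof -
  let ?B = "A\<lparr>carrier := S\<rparr>"
  have sub: "x \<in> carrier A" if "x \<in> S" for x using S that by (auto simp: closed_star_subalgebra_def)
  have cl: "\<zero> \<in> S" "\<And>x y. \<lbrakk>x \<in> S; y \<in> S\<rbrakk> \<Longrightarrow> x \<oplus> y \<in> S" "\<And>x y. \<lbrakk>x \<in> S; y \<in> S\<rbrakk> \<Longrightarrow> x \<otimes> y \<in> S"
    "\<And>c x. x \<in> S \<Longrightarrow> c \<odot> x \<in> S" "\<And>x. x \<in> S \<Longrightarrow> st x \<in> S" using S by (simp_all add: closed_star_subalgebra_def)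
  note [simp] = sub
  have m: "module complex_field ?B"
    by (rule module_of_evaluations[where I = "UNIV :: unit set" and V = "\<lambda>_. A" and e = "\<lambda>_ x. x"])
      (auto simp: cl module_axioms)
  note ag = module.axioms(2)[OF m]
  have r: "ring ?B" by (rule ringI[OF ag]) (auto intro!: monoidI simp: cl one m_assoc l_distr r_distr)
  interpret B: seminormed ?B
    by (rule seminormed.intro[OF m]) (unfold_locales, auto simp: nrm_triangle nrm_smult)
  have diff: "x \<ominus>\<^sub>?B y = x \<ominus> y" if "x \<in> S" "y \<in> S" for x y
    using that by (simp add: B.minus_eq B.neg_eq minus_eq neg_eq)
  then show "\<And>x y. \<lbrakk>x \<in> S; y \<in> S\<rbrakk> \<Longrightarrow> x \<ominus>\<^sub>(A\<lparr>carrier := S\<rparr>) y = x \<ominus> y" .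
  have nd: "ndist ?B x y = ndist A x y" if "x \<in> S" "y \<in> S" for x y using that by (simp add: ndist_def diff)
  have b: "banach_space ?B"
  proof
    fix s assume s: "s \<in> cauchy_seqs ?B"
    then have sS: "s n \<in> S" for n by (simp add: cauchy_seqs_def)
    have "s \<in> cauchy_seqs A" using s sS by (simp add: cauchy_seqs_def nd)
    from complete[OF this] obtain l where l: "l \<in> carrier A" "(\<lambda>n. ndist A (s n) l) \<longlonglongrightarrow> 0" by blast
    then have "l \<in> S" using S sS unfolding closed_star_subalgebra_def by blast
    then show "\<exists>l\<in>carrier ?B. (\<lambda>n. ndist ?B (s n) l) \<longlonglongrightarrow> 0" using l sS by (intro bexI[of _ l]) (auto simp: nd)
  qed (auto simp: nrm_eq_0 nrm_triangle nrm_smult)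
  show "ucstar ?B" by (rule ucstar.intro[OF b r], unfold_locales)
      (auto simp: smult_mult_l smult_mult_r nrm_mult cl star_mult star_add star_smult cstar)
qed

lemma (in ucstar) closed_star_subalgebra_carrier: "closed_star_subalgebra A (carrier A)"
  by (simp add: closed_star_subalgebra_def)

lemma closed_star_subalgebra_Inter:
  assumes "\<S> \<noteq> {}" "\<And>S. S \<in> \<S> \<Longrightarrow> closed_star_subalgebra A S"
  shows "closed_star_subalgebra A (\<Inter>\<S>)" unfolding closed_star_subalgebra_def
proof (intro conjI ballI allI impI)
  obtain S where "S \<in> \<S>" using assms(1) by blast
  then show "\<Inter>\<S> \<subseteq> carrier A" using assms(2)[of S] unfolding closed_star_subalgebra_def by blast
  fix x l assume x: "(\<forall>n. x n \<in> \<Inter>\<S>) \<and> l \<in> carrier A \<and> (\<lambda>n. ndist A (x n) l) \<longlonglongrightarrow> 0"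
  show "l \<in> \<Inter>\<S>"
  proof
    fix S assume S: "S \<in> \<S>"
    then have "\<forall>n. x n \<in> S" using x by blast
    then show "l \<in> S" using assms(2)[OF S] x unfolding closed_star_subalgebra_def by blast
  qed
qed (use assms(2) in \<open>simp_all add: closed_star_subalgebra_def\<close>)

section \<open>Hilbert modules of finitely supported families\<close>

context ucstar begin

text \<open>The vector z provided by \<open>act\<close> plays the role of x d, so no action has to
  be fixed. The form f may be degenerate: the inequality is applied to inner products in
  \<open>prehilbI\<close> and to ip x (S y) in \<open>positive_adjI\<close>.\<close>

lemma semi_cauchy_schwarz:
  assumes H: "seminormed H"
    and cl: "\<And>x y. \<lbrakk>x \<in> carrier H; y \<in> carrier H\<rbrakk> \<Longrightarrow> f x y \<in> carrier A"
    and add: "\<And>x y z. \<lbrakk>x \<in> carrier H; y \<in> carrier H; z \<in> carrier H\<rbrakk> \<Longrightarrow> f x (y \<oplus>\<^sub>H z) = f x y \<oplus> f x z"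
    and smult: "\<And>x y c. \<lbrakk>x \<in> carrier H; y \<in> carrier H\<rbrakk> \<Longrightarrow> f x (c \<odot>\<^sub>H y) = c \<odot> f x y"
    and star: "\<And>x y. \<lbrakk>x \<in> carrier H; y \<in> carrier H\<rbrakk> \<Longrightarrow> st (f x y) = f y x"
    and pos: "\<And>x. x \<in> carrier H \<Longrightarrow> positive A (f x x)"
    and act: "\<And>x d. \<lbrakk>x \<in> carrier H; d \<in> carrier A\<rbrakk> \<Longrightarrow> \<exists>z\<in>carrier H. \<forall>y\<in>carrier H. f y z = f y x \<otimes> d"
    and x: "x \<in> carrier H" and y: "y \<in> carrier H"
  shows "||f x y||\<^sup>2 \<le> ||f x x|| * ||f y y||"
proof (rule cauchy_schwarz_core)
  interpret H: seminormed H by fact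
  fix d assume d: "d \<in> carrier A"
  from act[OF x d] obtain z where z: "z \<in> carrier H" "\<And>y. y \<in> carrier H \<Longrightarrow> f y z = f y x \<otimes> d" by blast
  have diff: "f a (b \<ominus>\<^sub>H c) = f a b \<ominus> f a c" if "a \<in> carrier H" "b \<in> carrier H" "c \<in> carrier H" for a b c
    using that cl by (simp add: H.minus_eq H.neg_eq minus_eq neg_eq add smult)
  have diffl: "f (b \<ominus>\<^sub>H c) a = f b a \<ominus> f c a" if "a \<in> carrier H" "b \<in> carrier H" "c \<in> carrier H" for a b c
  proof -
    have "f (b \<ominus>\<^sub>H c) a = st (f a b \<ominus> f a c)" using that by (simp add: diff[symmetric] star)
    then show ?thesis using that cl by (simp add: star_diff star)
  qed
  have fz: "f z w = st d \<otimes> f x w" if "w \<in> carrier H" for w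
  proof -
    have "f z w = st (f w z)" using star[OF that z(1)] by simp
    also have "\<dots> = st (f w x \<otimes> d)" using z(2)[OF that] by simp
    finally show ?thesis using that x d cl by (simp add: star_mult star)
  qed
  have "f (z \<ominus>\<^sub>H y) (z \<ominus>\<^sub>H y) = (f z z \<ominus> f z y) \<ominus> (f y z \<ominus> f y y)"
    using z(1) y by (simp only: diffl[of "z \<ominus>\<^sub>H y" z y] diff[of z z y] diff[of y z y] H.minus_closed)
  also have "\<dots> = (st d \<otimes> f x x \<otimes> d \<ominus> st d \<otimes> f x y) \<ominus> (st (f x y) \<otimes> d \<ominus> f y y)"
    using x y z d cl by (simp add: fz z(2) star m_assoc)
  finally show "positive A ((st d \<otimes> f x x \<otimes> d \<ominus> st d \<otimes> f x y) \<ominus> (st (f x y) \<otimes> d \<ominus> f y y))"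
    using pos[of "z \<ominus>\<^sub>H y"] z y by simp
qed (use cl pos x y in auto)

lemma prehilbI:
  fixes H (structure)
  assumes m: "module complex_field H"
    and cl: "\<And>x y. \<lbrakk>x \<in> carrier H; y \<in> carrier H\<rbrakk> \<Longrightarrow> f x y \<in> carrier A"
    and add: "\<And>x y z. \<lbrakk>x \<in> carrier H; y \<in> carrier H; z \<in> carrier H\<rbrakk> \<Longrightarrow> f x (y \<oplus>\<^sub>H z) = f x y \<oplus>\<^sub>A f x z"
    and smult: "\<And>x y c. \<lbrakk>x \<in> carrier H; y \<in> carrier H\<rbrakk> \<Longrightarrow> f x (c \<odot>\<^sub>H y) = c \<odot>\<^sub>A f x y"
    and star: "\<And>x y. \<lbrakk>x \<in> carrier H; y \<in> carrier H\<rbrakk> \<Longrightarrow> star A (f x y) = f y x"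
    and pos: "\<And>x. x \<in> carrier H \<Longrightarrow> positive A (f x x)"
    and act: "\<And>x d. \<lbrakk>x \<in> carrier H; d \<in> carrier A\<rbrakk> \<Longrightarrow> \<exists>z\<in>carrier H. \<forall>y\<in>carrier H. f y z = f y x \<otimes>\<^sub>A d"
    and nrm: "\<And>x. x \<in> carrier H \<Longrightarrow> ||x||\<^sub>H = sqrt ||f x x||\<^sub>A"
  shows "prehilb A H f"
proof -
  interpret m: module complex_field H by fact
  \<comment> \<open>Cauchy--Schwarz is available over a seminormed space, but the triangle
    inequality of H is to be derived from it. The zero seminorm breaks the circle.\<close>
  define H0 where "H0 = H\<lparr>nrm := \<lambda>_. 0\<rparr>"
  have H0: "carrier H0 = carrier H" "add H0 = add H" "smult H0 = smult H" "zero H0 = zero H" "||x||\<^sub>H0 = 0" for x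
    by (simp_all add: H0_def)
  have "module complex_field H0" by (rule module_cong(1)[OF m]) (simp_all add: H0)
  then have s0: "seminormed H0" by (rule seminormed.intro) (unfold_locales, simp_all add: H0)
  have CS2: "||f x y||\<^sub>A\<^sup>2 \<le> ||f x x||\<^sub>A * ||f y y||\<^sub>A" if "x \<in> carrier H" "y \<in> carrier H" for x y
    by (rule semi_cauchy_schwarz[OF s0]) (use assms that in \<open>auto simp: H0\<close>)
  have CS: "||f x y||\<^sub>A \<le> ||x||\<^sub>H * ||y||\<^sub>H" if xy: "x \<in> carrier H" "y \<in> carrier H" for x y
  proof (rule power2_le_imp_le)
    show "||f x y||\<^sub>A\<^sup>2 \<le> ( ||x||\<^sub>H * ||y||\<^sub>H)\<^sup>2" using CS2[OF xy] xy cl nrm by (simp add: power_mult_distrib)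
    show "0 \<le> ||x||\<^sub>H * ||y||\<^sub>H" using xy nrm cl by simp
  qed
  have addl: "f (x \<oplus>\<^sub>H y) z = f x z \<oplus>\<^sub>A f y z" if "x \<in> carrier H" "y \<in> carrier H" "z \<in> carrier H" for x y z
    using that by (metis star star_add cl add m.M.a_closed)
  have smultl: "f (c \<odot>\<^sub>H x) y = cnj c \<odot>\<^sub>A f x y" if "x \<in> carrier H" "y \<in> carrier H" for x y c
  proof -
    have "c \<odot>\<^sub>H x \<in> carrier H" using that m.smult_closed[of c x] by simp
    then have "f (c \<odot>\<^sub>H x) y = star A (c \<odot>\<^sub>A f y x)" using that by (simp add: smult[symmetric] star)
    then show ?thesis using that cl by (simp add: star_smult star)
  qed
  show ?thesis
  proof (rule prehilb.intro[OF ucstar_axioms])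
    show "seminormed H"
    proof (rule seminormed.intro[OF m], unfold_locales)
      fix x y assume x: "x \<in> carrier H" and y: "y \<in> carrier H"
      have xy: "x \<oplus>\<^sub>H y \<in> carrier H" using x y by simp
      show "||x \<oplus>\<^sub>H y||\<^sub>H \<le> ||x||\<^sub>H + ||y||\<^sub>H"
      proof (rule power2_le_imp_le)
        have "f (x \<oplus>\<^sub>H y) (x \<oplus>\<^sub>H y) = (f x x \<oplus>\<^sub>A f y x) \<oplus>\<^sub>A (f x y \<oplus>\<^sub>A f y y)"
          using x y xy by (simp add: add addl)
        also have "||\<dots>||\<^sub>A \<le> ( ||f x x||\<^sub>A + ||f y x||\<^sub>A) + ( ||f x y||\<^sub>A + ||f y y||\<^sub>A)"
          using x y cl by (intro order_trans[OF nrm_triangle] add_mono nrm_triangle) auto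
        finally show "||x \<oplus>\<^sub>H y||\<^sub>H\<^sup>2 \<le> ( ||x||\<^sub>H + ||y||\<^sub>H)\<^sup>2"
          using CS[OF x y] CS[OF y x, unfolded mult.commute[of "||y||\<^sub>H"]] x y xy cl
          by (simp add: nrm power2_sum mult.assoc)
        show "0 \<le> ||x||\<^sub>H + ||y||\<^sub>H" using x y nrm cl by simp
      qed
    next
      fix c x assume x: "x \<in> carrier H"
      have cx: "c \<odot>\<^sub>H x \<in> carrier H" using x m.smult_closed[of c x] by simp
      have "f (c \<odot>\<^sub>H x) (c \<odot>\<^sub>H x) = (c * cnj c) \<odot>\<^sub>A f x x" using x cx cl by (simp add: smult smultl smult_mult)
      then have "||f (c \<odot>\<^sub>H x) (c \<odot>\<^sub>H x)||\<^sub>A = (cmod c)\<^sup>2 * ||f x x||\<^sub>A"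
        using x cl by (simp add: nrm_smult norm_mult power2_eq_square)
      then show "||c \<odot>\<^sub>H x||\<^sub>H = cmod c * ||x||\<^sub>H" using x cx by (simp add: nrm real_sqrt_mult)
    qed
    show "prehilb_axioms A H f" by unfold_locales (use cl add smult star pos CS nrm in simp_all)
  qed
qed

end

text \<open>\<open>fam_supp\<close>, \<open>fam_ip\<close> and \<open>fam_sections\<close> abstract
  \<open>supp\<close>, \<open>section_inner\<close> and \<open>sections\<close>, so that one
  development covers both the sections of the bundle and the finite column modules over an
  algebra.\<close>

definition fam_supp :: "'i set \<Rightarrow> ('i \<Rightarrow> ('v, 'm) cnormed_scheme) \<Rightarrow> ('i \<Rightarrow> 'v) \<Rightarrow> 'i set" where
  "fam_supp I V \<xi> = {i \<in> I. \<xi> i \<noteq> \<zero>\<^sub>(V i)}"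

definition fam_ip :: "('d, 'k) cstar_scheme \<Rightarrow> 'i set \<Rightarrow> ('i \<Rightarrow> ('v, 'm) cnormed_scheme) \<Rightarrow>
    ('v \<Rightarrow> 'v \<Rightarrow> 'd) \<Rightarrow> ('i \<Rightarrow> 'v) \<Rightarrow> ('i \<Rightarrow> 'v) \<Rightarrow> 'd" where
  "fam_ip D I V q \<xi> \<eta> = (\<Oplus>\<^sub>D i\<in>fam_supp I V \<xi>. q (\<xi> i) (\<eta> i))"

definition fam_sections :: "('d, 'k) cstar_scheme \<Rightarrow> 'i set \<Rightarrow> ('i \<Rightarrow> ('v, 'm) cnormed_scheme) \<Rightarrow>
    ('v \<Rightarrow> 'v \<Rightarrow> 'd) \<Rightarrow> ('i \<Rightarrow> 'v) cnormed" where
  "fam_sections D I V q =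
     \<lparr>carrier = {\<xi> \<in> (\<Pi>\<^sub>E i\<in>I. carrier (V i)). finite (fam_supp I V \<xi>)},
      mult = undefined, one = undefined,
      zero = (\<lambda>i\<in>I. \<zero>\<^sub>(V i)),
      add = (\<lambda>\<xi> \<eta>. \<lambda>i\<in>I. \<xi> i \<oplus>\<^sub>(V i) \<eta> i),
      smult = (\<lambda>c \<xi>. \<lambda>i\<in>I. c \<odot>\<^sub>(V i) \<xi> i),
      nrm = (\<lambda>\<xi>. sqrt ||fam_ip D I V q \<xi> \<xi>||\<^sub>D)\<rparr>"

locale hilb_family = D: ucstar D for D :: "('d, 'k) cstar_scheme" +
  fixes I :: "'i set" and V :: "'i \<Rightarrow> ('v, 'm) cnormed_scheme" and q :: "'v \<Rightarrow> 'v \<Rightarrow> 'd"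
    and act :: "'v \<Rightarrow> 'd \<Rightarrow> 'v"
  assumes fibre: "i \<in> I \<Longrightarrow> banach_space (V i)"
    and q_closed: "\<lbrakk>i \<in> I; a \<in> carrier (V i); b \<in> carrier (V i)\<rbrakk> \<Longrightarrow> q a b \<in> carrier D"
    and q_add: "\<lbrakk>i \<in> I; a \<in> carrier (V i); b \<in> carrier (V i); c \<in> carrier (V i)\<rbrakk> \<Longrightarrow>
      q a (b \<oplus>\<^sub>(V i) c) = q a b \<oplus>\<^sub>D q a c"
    and q_smult: "\<lbrakk>i \<in> I; a \<in> carrier (V i); b \<in> carrier (V i)\<rbrakk> \<Longrightarrow> q a (z \<odot>\<^sub>(V i) b) = z \<odot>\<^sub>D q a b"
    and q_star: "\<lbrakk>i \<in> I; a \<in> carrier (V i); b \<in> carrier (V i)\<rbrakk> \<Longrightarrow> star D (q a b) = q b a"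
    and q_pos: "\<lbrakk>i \<in> I; a \<in> carrier (V i)\<rbrakk> \<Longrightarrow> positive D (q a a)"
    and q_nrm: "\<lbrakk>i \<in> I; a \<in> carrier (V i)\<rbrakk> \<Longrightarrow> ||q a a||\<^sub>D = ||a||\<^sub>(V i)\<^sup>2"
    and act_closed: "\<lbrakk>i \<in> I; a \<in> carrier (V i); d \<in> carrier D\<rbrakk> \<Longrightarrow> act a d \<in> carrier (V i)"
    and q_act: "\<lbrakk>i \<in> I; a \<in> carrier (V i); b \<in> carrier (V i); d \<in> carrier D\<rbrakk> \<Longrightarrow> q a (act b d) = q a b \<otimes>\<^sub>D d"
begin

abbreviation "Sec \<equiv> fam_sections D I V q"
abbreviation "sip \<equiv> fam_ip D I V q"
abbreviation "sp \<equiv> fam_supp I V"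

lemma Sec_simps [simp]:
  "\<zero>\<^sub>Sec = (\<lambda>i\<in>I. \<zero>\<^sub>(V i))" "\<xi> \<oplus>\<^sub>Sec \<eta> = (\<lambda>i\<in>I. \<xi> i \<oplus>\<^sub>(V i) \<eta> i)"
  "c \<odot>\<^sub>Sec \<xi> = (\<lambda>i\<in>I. c \<odot>\<^sub>(V i) \<xi> i)" "||\<xi>||\<^sub>Sec = sqrt ||sip \<xi> \<xi>||\<^sub>D" by (simp_all add: fam_sections_def)

lemma Sec_iff: "\<xi> \<in> carrier Sec \<longleftrightarrow> \<xi> \<in> (\<Pi>\<^sub>E i\<in>I. carrier (V i)) \<and> finite (sp \<xi>)" by (simp add: fam_sections_def)

lemma SecD: "\<lbrakk>\<xi> \<in> carrier Sec; i \<in> I\<rbrakk> \<Longrightarrow> \<xi> i \<in> carrier (V i)" "\<xi> \<in> carrier Sec \<Longrightarrow> finite (sp \<xi>)"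
  by (auto simp: Sec_iff)

lemma Sec_eqI: "\<lbrakk>\<xi> \<in> carrier Sec; \<eta> \<in> carrier Sec; \<And>i. i \<in> I \<Longrightarrow> \<xi> i = \<eta> i\<rbrakk> \<Longrightarrow> \<xi> = \<eta>"
  unfolding Sec_iff by (blast intro: PiE_ext)

lemma SecI:
  assumes "\<And>i. i \<in> I \<Longrightarrow> f i \<in> carrier (V i)" "finite F" "\<And>i. \<lbrakk>i \<in> I; i \<notin> F\<rbrakk> \<Longrightarrow> f i = \<zero>\<^sub>(V i)"
  shows "(\<lambda>i\<in>I. f i) \<in> carrier Sec"
proof -
  have "sp (\<lambda>i\<in>I. f i) \<subseteq> F" using assms(3) by (auto simp: fam_supp_def)
  then show ?thesis using assms(1,2) by (auto simp: Sec_iff intro: finite_subset)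
qed

lemma fibre_seminormed: "i \<in> I \<Longrightarrow> seminormed (V i)"
  using fibre banach_space.axioms by (metis banach_space_def seminormed_def seminormed_axioms_def banach_space_axioms_def)

lemma q_zero_right: "\<lbrakk>i \<in> I; a \<in> carrier (V i)\<rbrakk> \<Longrightarrow> q a \<zero>\<^sub>(V i) = \<zero>\<^sub>D"
proof -
  assume i: "i \<in> I" "a \<in> carrier (V i)"
  interpret W: seminormed "V i" by (rule fibre_seminormed[OF i(1)])
  show ?thesis using q_smult[OF i W.zero_closed, of 0] q_closed[OF i W.zero_closed] by simp
qed

lemma q_zero_left: "\<lbrakk>i \<in> I; a \<in> carrier (V i)\<rbrakk> \<Longrightarrow> q \<zero>\<^sub>(V i) a = \<zero>\<^sub>D"
proof -
  assume i: "i \<in> I" "a \<in> carrier (V i)"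
  interpret W: seminormed "V i" by (rule fibre_seminormed[OF i(1)])
  show ?thesis using q_star[OF i(1,2) W.zero_closed] q_zero_right[OF i] by simp
qed

lemma sip_eq:
  assumes x: "\<xi> \<in> carrier Sec" and y: "\<eta> \<in> carrier Sec" and F: "finite F" "sp \<xi> \<subseteq> F" "F \<subseteq> I"
  shows "sip \<xi> \<eta> = (\<Oplus>\<^sub>D i\<in>F. q (\<xi> i) (\<eta> i))" unfolding fam_ip_def
proof (rule D.add.finprod_mono_neutral_cong_left[OF F(1,2)])
  fix i assume "i \<in> F - sp \<xi>"
  then have "i \<in> I" "\<xi> i = \<zero>\<^sub>(V i)" using F by (auto simp: fam_supp_def)
  then show "q (\<xi> i) (\<eta> i) = \<zero>\<^sub>D" using q_zero_left SecD[OF y] by simp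
qed (use F SecD[OF x] SecD[OF y] q_closed in auto)

lemma sip_eq2:
  assumes x: "\<xi> \<in> carrier Sec" and y: "\<eta> \<in> carrier Sec" and F: "finite F" "sp \<eta> \<subseteq> F" "F \<subseteq> I"
  shows "sip \<xi> \<eta> = (\<Oplus>\<^sub>D i\<in>F. q (\<xi> i) (\<eta> i))"
proof -
  have fu: "finite (F \<union> sp \<xi>)" "F \<union> sp \<xi> \<subseteq> I" using F SecD[OF x] by (auto simp: fam_supp_def)
  have "sip \<xi> \<eta> = (\<Oplus>\<^sub>D i\<in>F \<union> sp \<xi>. q (\<xi> i) (\<eta> i))" using fu by (intro sip_eq x y) auto
  also have "\<dots> = (\<Oplus>\<^sub>D i\<in>F. q (\<xi> i) (\<eta> i))"
  proof (rule D.add.finprod_mono_neutral_cong_left[symmetric, OF fu(1)])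
    show "\<And>i. i \<in> F \<union> sp \<xi> - F \<Longrightarrow> q (\<xi> i) (\<eta> i) = \<zero>\<^sub>D"
    proof -
      fix i assume i: "i \<in> F \<union> sp \<xi> - F"
      then have "i \<in> I" "\<eta> i = \<zero>\<^sub>(V i)" using F fu by (auto simp: fam_supp_def)
      then show "q (\<xi> i) (\<eta> i) = \<zero>\<^sub>D" using q_zero_right SecD[OF x] by simp
    qed
  qed (use fu SecD[OF x] SecD[OF y] q_closed in auto)
  finally show ?thesis .
qed

lemma module_Sec: "module complex_field Sec"
proof -
  have cl: "(\<lambda>i\<in>I. \<xi> i \<oplus>\<^sub>(V i) \<eta> i) \<in> carrier Sec" if x: "\<xi> \<in> carrier Sec" and y: "\<eta> \<in> carrier Sec" for \<xi> \<eta>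
  proof (rule SecI)
    show "finite (sp \<xi> \<union> sp \<eta>)" using SecD x y by blast
    fix i assume i: "i \<in> I"
    interpret W: seminormed "V i" by (rule fibre_seminormed[OF i])
    show "\<xi> i \<oplus>\<^sub>(V i) \<eta> i \<in> carrier (V i)" using SecD x y i by blast
    show "i \<notin> sp \<xi> \<union> sp \<eta> \<Longrightarrow> \<xi> i \<oplus>\<^sub>(V i) \<eta> i = \<zero>\<^sub>(V i)" using i by (auto simp: fam_supp_def)
  qed
  have scl: "(\<lambda>i\<in>I. c \<odot>\<^sub>(V i) \<xi> i) \<in> carrier Sec" if x: "\<xi> \<in> carrier Sec" for \<xi> c
  proof (rule SecI)
    show "finite (sp \<xi>)" using SecD x by blast
    fix i assume i: "i \<in> I"
    interpret W: seminormed "V i" by (rule fibre_seminormed[OF i])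
    show "c \<odot>\<^sub>(V i) \<xi> i \<in> carrier (V i)" using SecD(1)[OF x i] by simp
    show "i \<notin> sp \<xi> \<Longrightarrow> c \<odot>\<^sub>(V i) \<xi> i = \<zero>\<^sub>(V i)" using i by (auto simp: fam_supp_def)
  qed
  have m: "module complex_field (V i)" if "i \<in> I" for i using fibre_seminormed[OF that] by (simp add: seminormed_def)
  show ?thesis
  proof (rule module_of_evaluations[where I = I and V = V and e = "\<lambda>i x. x i", OF m])
    have "\<zero>\<^sub>(V i) \<in> carrier (V i)" if "i \<in> I" for i
      using m[OF that] by (simp add: module_def abelian_group_def abelian_monoid.zero_closed)
    then show "\<zero>\<^sub>Sec \<in> carrier Sec" unfolding Sec_simps by (intro SecI[where F = "{}"]) auto
  qed (use cl scl Sec_eqI in \<open>auto simp: SecD(1)\<close>)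
qed

lemma Sec_act:
  assumes "x \<in> carrier Sec" "d \<in> carrier D"
  shows "(\<lambda>i\<in>I. act (x i) d) \<in> carrier Sec"
    and "y \<in> carrier Sec \<Longrightarrow> sip y (\<lambda>i\<in>I. act (x i) d) = sip y x \<otimes>\<^sub>D d"
proof -
  show cl: "(\<lambda>i\<in>I. act (x i) d) \<in> carrier Sec"
  proof (rule SecI)
    show "finite (sp x)" using SecD assms by blast
    fix i assume i: "i \<in> I"
    interpret W: banach_space "V i" by (rule fibre[OF i])
    show ac: "act (x i) d \<in> carrier (V i)" using SecD(1) assms i act_closed by blast
    assume "i \<notin> sp x"
    then have x0: "x i = \<zero>\<^sub>(V i)" using i by (auto simp: fam_supp_def)
    \<comment> \<open>That \<open>act\<close> maps zero to zero is read off from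
      \<open>q_act\<close> and the norm.\<close>
    have "q (act (x i) d) (act (x i) d) = \<zero>\<^sub>D"
      using q_act[OF i ac _ assms(2), of "x i"] q_zero_right[OF i ac] x0 assms by simp
    then have "||act (x i) d||\<^sub>(V i)\<^sup>2 = 0" using q_nrm[OF i ac] by simp
    then show "act (x i) d = \<zero>\<^sub>(V i)" using W.nrm_eq_0[OF ac] by simp
  qed
  assume y: "y \<in> carrier Sec"
  have F: "finite (sp y)" "sp y \<subseteq> sp y" "sp y \<subseteq> I" using SecD[OF y] by (auto simp: fam_supp_def)
  have "sip y (\<lambda>i\<in>I. act (x i) d) = (\<Oplus>\<^sub>D i\<in>sp y. q (y i) (x i) \<otimes>\<^sub>D d)" unfolding sip_eq[OF y cl F]
  proof (rule D.finsum_cong')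
    fix i assume "i \<in> sp y"
    then have i: "i \<in> I" using F by auto
    show "q (y i) ((\<lambda>i\<in>I. act (x i) d) i) = q (y i) (x i) \<otimes>\<^sub>D d"
      using i q_act SecD(1)[OF y i] SecD(1)[OF assms(1) i] assms by simp
  qed (use F SecD(1) y assms q_closed in auto)
  also have "\<dots> = sip y x \<otimes>\<^sub>D d" unfolding sip_eq[OF y assms(1) F]
    using F SecD(1)[OF y] SecD(1)[OF assms(1)] q_closed assms by (intro D.finsum_ldistr[symmetric]) auto
  finally show "sip y (\<lambda>i\<in>I. act (x i) d) = sip y x \<otimes>\<^sub>D d" .
qed

theorem prehilb_Sec: "prehilb D Sec sip"
proof (rule D.prehilbI[OF module_Sec])
  interpret S: module complex_field Sec by (rule module_Sec)
  fix x y z c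
  assume x: "x \<in> carrier Sec"
  have F: "finite (sp x)" "sp x \<subseteq> sp x" "sp x \<subseteq> I" using SecD[OF x] by (auto simp: fam_supp_def)
  have FI: "\<And>i. i \<in> sp x \<Longrightarrow> i \<in> I" using F by blast
  show "positive D (sip x x)"
    unfolding sip_eq[OF x x F] by (rule D.positive_finsum[OF F(1)]) (rule q_pos[OF FI SecD(1)[OF x FI]])
  assume y: "y \<in> carrier Sec"
  have qxy: "(\<lambda>i. q (x i) (y i)) \<in> sp x \<rightarrow> carrier D" using FI SecD(1)[OF x] SecD(1)[OF y] q_closed by blast
  show "sip x y \<in> carrier D" unfolding sip_eq[OF x y F] by (rule D.finsum_closed[OF qxy])
  have cy: "c \<odot>\<^sub>Sec y \<in> carrier Sec" using S.smult_closed[of c y] y by simp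
  show "sip x (c \<odot>\<^sub>Sec y) = c \<odot>\<^sub>D sip x y"
    unfolding sip_eq[OF x y F] sip_eq[OF x cy F] D.smult_finsum[OF F(1) qxy] by (rule D.finsum_cong'[OF refl])
      (use FI SecD(1)[OF x] SecD(1)[OF y] q_smult qxy in \<open>auto simp: Pi_iff\<close>)
  show "star D (sip x y) = sip y x" unfolding sip_eq[OF x y F] sip_eq2[OF y x F] D.star_finsum[OF F(1) qxy]
    by (rule D.finsum_cong'[OF refl])
      (auto intro!: q_star q_closed SecD(1)[OF x] SecD(1)[OF y] dest: FI)
  assume z: "z \<in> carrier Sec"
  have qxz: "(\<lambda>i. q (x i) (z i)) \<in> sp x \<rightarrow> carrier D" using FI SecD(1)[OF x] SecD(1)[OF z] q_closed by blast
  have yz: "y \<oplus>\<^sub>Sec z \<in> carrier Sec" using y z by (rule S.M.a_closed)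
  show "sip x (y \<oplus>\<^sub>Sec z) = sip x y \<oplus>\<^sub>D sip x z"
    unfolding sip_eq[OF x y F] sip_eq[OF x z F] sip_eq[OF x yz F] D.finsum_addf[OF qxy qxz, symmetric]
    by (rule D.finsum_cong'[OF refl])
      (auto intro!: D.a_closed q_add q_closed SecD(1)[OF x] SecD(1)[OF y] SecD(1)[OF z] dest: FI)
next
  fix x d assume "x \<in> carrier Sec" "d \<in> carrier D"
  from Sec_act[OF this] show "\<exists>z\<in>carrier Sec. \<forall>y\<in>carrier Sec. sip y z = sip y x \<otimes>\<^sub>D d" by blast
qed simp

text \<open>The element q (x i) (x i) is one of the positive summands of sip x x, and the norm is
  monotone on positive elements.\<close>

lemma Sec_nrm_component:
  assumes x: "x \<in> carrier Sec" and i: "i \<in> I"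
  shows "||x i||\<^sub>(V i) \<le> ||x||\<^sub>Sec"
proof (rule power2_le_imp_le)
  interpret S: prehilb D Sec sip by (rule prehilb_Sec)
  let ?F = "insert i (sp x)"
  have F: "finite ?F" "sp x \<subseteq> ?F" "?F \<subseteq> I" using SecD[OF x] i by (auto simp: fam_supp_def)
  have qc: "(\<lambda>i. q (x i) (x i)) \<in> ?F \<rightarrow> carrier D" using F SecD(1)[OF x] q_closed by blast
  have "sip x x = q (x i) (x i) \<oplus>\<^sub>D (\<Oplus>\<^sub>D j\<in>?F - {i}. q (x j) (x j))" unfolding sip_eq[OF x x F]
    using qc F by (subst D.finsum_insert[symmetric]) (auto simp: insert_absorb)
  moreover have "positive D (\<Oplus>\<^sub>D j\<in>?F - {i}. q (x j) (x j))"
    using F SecD(1)[OF x] q_pos by (intro D.positive_finsum) auto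
  moreover have "positive D (q (x i) (x i))" using q_pos[OF i SecD(1)[OF x i]] .
  ultimately have "||q (x i) (x i)||\<^sub>D \<le> ||sip x x||\<^sub>D" using D.npos_nrm_mono by (simp add: D.positive_iff_npos)
  then show "||x i||\<^sub>(V i)\<^sup>2 \<le> ||x||\<^sub>Sec\<^sup>2" using q_nrm[OF i SecD(1)[OF x i]] S.nrm_ip[OF x] by simp
  show "0 \<le> ||x||\<^sub>Sec" by (rule S.H.nrm_nonneg[OF x])
qed

lemma Sec_nrm_le:
  assumes x: "x \<in> carrier Sec" and I: "finite I"
  shows "||x||\<^sub>Sec\<^sup>2 \<le> (\<Sum>i\<in>I. ||x i||\<^sub>(V i)\<^sup>2)"
proof -
  interpret S: prehilb D Sec sip by (rule prehilb_Sec)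
  have qc: "(\<lambda>i. q (x i) (x i)) \<in> I \<rightarrow> carrier D" using SecD(1)[OF x] q_closed by blast
  have "||x||\<^sub>Sec\<^sup>2 = ||\<Oplus>\<^sub>D i\<in>I. q (x i) (x i)||\<^sub>D"
    unfolding S.nrm_ip[OF x] using sip_eq[OF x x I] by (auto simp: fam_supp_def)
  also have "\<dots> \<le> (\<Sum>i\<in>I. ||q (x i) (x i)||\<^sub>D)" by (rule D.nrm_finsum_le[OF I qc])
  also have "\<dots> = (\<Sum>i\<in>I. ||x i||\<^sub>(V i)\<^sup>2)" using q_nrm SecD(1)[OF x] by (intro sum.cong) auto
  finally show ?thesis .
qed

lemma Sec_diff_apply:
  assumes "x \<in> carrier Sec" "y \<in> carrier Sec" "i \<in> I"
  shows "(x \<ominus>\<^sub>Sec y) i = x i \<ominus>\<^sub>(V i) y i"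
proof -
  interpret S: prehilb D Sec sip by (rule prehilb_Sec)
  interpret W: seminormed "V i" by (rule fibre_seminormed[OF assms(3)])
  show ?thesis using assms SecD(1)[OF assms(2,3)] by (simp add: S.H.minus_eq S.H.neg_eq W.minus_eq W.neg_eq del: S.H.smultC)
qed

text \<open>For finite I the norm is squeezed between the component norms and the root of the sum of
  their squares, so completeness is inherited componentwise.\<close>

theorem hilb_Sec:
  assumes I: "finite I" shows "hilb D Sec sip"
proof -
  interpret S: prehilb D Sec sip by (rule prehilb_Sec)
  have "banach_space_axioms Sec"
  proof
    fix x assume x: "x \<in> carrier Sec"
    show "||x||\<^sub>Sec = 0 \<longleftrightarrow> x = \<zero>\<^sub>Sec"
    proof
      assume n: "||x||\<^sub>Sec = 0"
      show "x = \<zero>\<^sub>Sec"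
      proof (rule Sec_eqI[OF x S.H.zero_closed])
        fix i assume i: "i \<in> I"
        interpret W: banach_space "V i" by (rule fibre[OF i])
        have "||x i||\<^sub>(V i) = 0" using Sec_nrm_component[OF x i] n W.nrm_nonneg[OF SecD(1)[OF x i]] by linarith
        then show "x i = \<zero>\<^sub>Sec i" using W.nrm_eq_0[OF SecD(1)[OF x i]] i by simp
      qed
    qed (use S.H.nrm_0 in simp)
  next
    fix s assume s: "s \<in> cauchy_seqs Sec"
    note sc = S.H.cauchy_closed[OF s]
    have comp: "ndist (V i) (s m i) (s n i) \<le> 1 * ndist Sec (s m) (s n)" if i: "i \<in> I" for i m n
    proof -
      interpret W: banach_space "V i" by (rule fibre[OF i])
      show ?thesis using Sec_nrm_component[OF S.H.minus_closed[OF sc[of m] sc[of n]] i] SecD(1)[OF sc i]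
        by (simp add: S.H.ndist_eq[OF sc sc] W.ndist_eq Sec_diff_apply[OF sc sc i] del: Sec_simps)
    qed
    have "\<exists>l\<in>carrier (V i). (\<lambda>n. ndist (V i) (s n i) l) \<longlonglongrightarrow> 0" if i: "i \<in> I" for i
    proof -
      interpret W: banach_space "V i" by (rule fibre[OF i])
      show ?thesis
        by (rule W.complete[OF S.H.cauchy_Lipschitz[OF s W.seminormed_axioms SecD(1)[OF sc i] comp[OF i]]])
    qed
    then obtain l where l: "\<And>i. i \<in> I \<Longrightarrow> l i \<in> carrier (V i)"
      "\<And>i. i \<in> I \<Longrightarrow> (\<lambda>n. ndist (V i) (s n i) (l i)) \<longlonglongrightarrow> 0" by metis
    let ?l = "\<lambda>i\<in>I. l i"
    have lc: "?l \<in> carrier Sec" using l I by (intro SecI[OF _ I]) auto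
    have "(\<lambda>n. \<Sum>i\<in>I. (ndist (V i) (s n i) (l i))\<^sup>2) \<longlonglongrightarrow> (\<Sum>i\<in>I. 0\<^sup>2)" by (intro tendsto_sum tendsto_power l)
    then have 0: "(\<lambda>n. sqrt (\<Sum>i\<in>I. (ndist (V i) (s n i) (l i))\<^sup>2)) \<longlonglongrightarrow> 0" using tendsto_real_sqrt by fastforce
    have "norm (ndist Sec (s n) ?l) \<le> sqrt (\<Sum>i\<in>I. (ndist (V i) (s n i) (l i))\<^sup>2)" for n
    proof -
      have "(ndist Sec (s n) ?l)\<^sup>2 \<le> (\<Sum>i\<in>I. ||(s n \<ominus>\<^sub>Sec ?l) i||\<^sub>(V i)\<^sup>2)"
        unfolding S.H.ndist_eq[OF sc lc] by (rule Sec_nrm_le[OF S.H.minus_closed[OF sc lc] I])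
      also have "\<dots> = (\<Sum>i\<in>I. (ndist (V i) (s n i) (l i))\<^sup>2)"
      proof (rule sum.cong[OF refl])
        fix i assume i: "i \<in> I"
        interpret W: banach_space "V i" by (rule fibre[OF i])
        show "||(s n \<ominus>\<^sub>Sec ?l) i||\<^sub>(V i)\<^sup>2 = (ndist (V i) (s n i) (l i))\<^sup>2"
          unfolding Sec_diff_apply[OF sc lc i] using SecD(1)[OF sc i] l(1)[OF i] i by (simp add: W.ndist_eq)
      qed
      finally show ?thesis by (simp add: real_le_rsqrt)
    qed
    then have "(\<lambda>n. ndist Sec (s n) ?l) \<longlonglongrightarrow> 0" by (intro Lim_null_comparison[OF _ 0]) auto
    then show "\<exists>l\<in>carrier Sec. (\<lambda>n. ndist Sec (s n) l) \<longlonglongrightarrow> 0" using lc by blast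
  qed (use S.H.nrm_triangle S.H.nrm_smult in \<open>auto simp del: Sec_simps\<close>)
  then show ?thesis by (intro hilb.intro prehilb_Sec banach_space.intro module_Sec)
qed

end

section \<open>Positive matrices and completely positive maps\<close>

lemma (in abelian_monoid) finsum_swap:
  assumes "finite I" "finite J" "\<And>i j. \<lbrakk>i \<in> I; j \<in> J\<rbrakk> \<Longrightarrow> f i j \<in> carrier G"
  shows "(\<Oplus>i\<in>I. \<Oplus>j\<in>J. f i j) = (\<Oplus>j\<in>J. \<Oplus>i\<in>I. f i j)" using assms(1,3)
proof (induction I rule: finite_induct)
  case (insert i I)
  have 1: "(\<lambda>i. \<Oplus>j\<in>J. f i j) \<in> I \<rightarrow> carrier G" "(\<Oplus>j\<in>J. f i j) \<in> carrier G"
    using insert by (auto intro!: finsum_closed)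
  have 2: "(\<lambda>j. \<Oplus>i\<in>I. f i j) \<in> J \<rightarrow> carrier G" "f i \<in> J \<rightarrow> carrier G" using insert by (auto intro!: finsum_closed)
  have "(\<Oplus>i\<in>insert i I. \<Oplus>j\<in>J. f i j) = (\<Oplus>j\<in>J. f i j) \<oplus> (\<Oplus>j\<in>J. \<Oplus>i\<in>I. f i j)"
    using insert 1 by (subst finsum_insert) auto
  also have "\<dots> = (\<Oplus>j\<in>J. f i j \<oplus> (\<Oplus>i\<in>I. f i j))" by (rule finsum_addf[symmetric, OF 2(2,1)])
  also have "\<dots> = (\<Oplus>j\<in>J. \<Oplus>i\<in>insert i I. f i j)"
  proof (rule finsum_cong'[OF refl])
    fix j assume j: "j \<in> J"
    show "f i j \<oplus> (\<Oplus>i\<in>I. f i j) = (\<Oplus>i\<in>insert i I. f i j)" using insert j by (subst finsum_insert) auto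
  qed (use insert in \<open>auto intro!: finsum_closed\<close>)
  finally show ?case .
qed simp

text \<open>With t = ||T|| the operator S = t - T has the form R* R. Positivity of the form of T
  bounds the form of S by t. Cauchy--Schwarz for ip x (S y), evaluated at x = S y, upgrades this to
  ||S|| \<le> t, which is the norm criterion for T.\<close>

lemma (in hilb) positive_adjI:
  assumes T: "T \<in> carrier Adj" "star Adj T = T"
    and pos: "\<And>x. x \<in> carrier H \<Longrightarrow> positive D (ip x (T x))"
    and act: "\<And>x d. \<lbrakk>x \<in> carrier H; d \<in> carrier D\<rbrakk> \<Longrightarrow> \<exists>z\<in>carrier H. \<forall>y\<in>carrier H. ip y z = ip y x \<otimes>\<^sub>D d"
  shows "positive Adj T"
proof -
  interpret A: ucstar Adj by (rule ucstar_adj)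
  define t where "t = ||T||\<^sub>Adj"
  have t0: "t \<ge> 0" unfolding t_def by (rule adj_nrm_nonneg[OF T(1)])
  define S where "S = of_real t \<odot>\<^sub>Adj \<one>\<^sub>Adj \<ominus>\<^sub>Adj T"
  have Sc: "S \<in> carrier Adj" unfolding S_def by (intro A.minus_closed A.smultC A.one_closed T)
  have "positive Adj S" unfolding S_def by (rule A.positive_nrm_minus) (use T t_def in auto)
  then obtain R where R: "R \<in> carrier Adj" "S = star Adj R \<otimes>\<^sub>Adj R" unfolding positive_def by blast
  have Sx: "S x \<in> carrier H" "T x \<in> carrier H" if "x \<in> carrier H" for x using adjD(4) Sc T that by auto
  have S1: "S x = of_real t \<odot>\<^sub>H x \<ominus>\<^sub>H T x" if x: "x \<in> carrier H" for x
    using x Sx[OF x] by (simp add: S_def A.minus_eq A.neg_eq[OF T(1)] H.minus_eq H.neg_eq)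
  have ipS: "ip x (S y) = ip (R x) (R y)" if "x \<in> carrier H" "y \<in> carrier H" for x y
    using adj_star(4)[OF adj_star(1)[OF R(1)]] adj_star(2)[OF R(1)] adj_star(3)[OF R(1) that(1), of "R y"]
      adjD(4)[OF R(1)] that by (simp add: R(2))
  have Rc: "R x \<in> carrier H" if "x \<in> carrier H" for x using adjD(4)[OF R(1)] that .
  have bound: "||ip x (S x)||\<^sub>D \<le> t * ||x||\<^sub>H\<^sup>2" if x: "x \<in> carrier H" for x
  proof -
    have "ip x (S x) = of_real t \<odot>\<^sub>D ip x x \<ominus>\<^sub>D ip x (T x)" using x Sx[OF x] by (simp add: S1 ip_diff ip_smult)
    moreover have "of_real t \<odot>\<^sub>D ip x x \<ominus>\<^sub>D (of_real t \<odot>\<^sub>D ip x x \<ominus>\<^sub>D ip x (T x)) = ip x (T x)"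
      using D.smultC[of "ip x x" "of_real t"] ip_closed[OF x x] ip_closed[OF x Sx(2)[OF x]]
      by (simp add: D.minus_eq D.minus_add D.a_assoc[symmetric] D.r_neg)
    moreover have "positive D (ip x (S x))" using ip_pos[OF Rc[OF x]] by (simp add: ipS x)
    ultimately have "||ip x (S x)||\<^sub>D \<le> ||of_real t \<odot>\<^sub>D ip x x||\<^sub>D"
      using pos[OF x] x by (intro D.positive_nrm_mono) auto
    also have "\<dots> = t * ||x||\<^sub>H\<^sup>2" using t0 x by (simp add: D.nrm_smult nrm_ip)
    finally show ?thesis .
  qed
  have CS: "||ip x (S y)||\<^sub>D\<^sup>2 \<le> ||ip x (S x)||\<^sub>D * ||ip y (S y)||\<^sub>D" if "x \<in> carrier H" "y \<in> carrier H" for x y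
  proof (rule D.semi_cauchy_schwarz[where f = "\<lambda>x y. ip x (S y)", OF H.seminormed_axioms])
    fix x d assume x: "x \<in> carrier H" and d: "d \<in> carrier D"
    from act[OF x d] obtain z where z: "z \<in> carrier H" "\<And>y. y \<in> carrier H \<Longrightarrow> ip y z = ip y x \<otimes>\<^sub>D d" by blast
    have sym: "ip y (S w) = ip (S y) w" if "y \<in> carrier H" "w \<in> carrier H" for y w
      using ipS[OF that] ipS[OF that(2,1)] Rc that Sx by (metis ip_star)
    show "\<exists>z\<in>carrier H. \<forall>y\<in>carrier H. ip y (S z) = ip y (S x) \<otimes>\<^sub>D d"
      using z x Sx by (intro bexI[of _ z]) (auto simp: sym)
  qed (use that Sx adjD(5,6)[OF Sc] ip_add ip_smult ipS ip_star ip_pos Rc in auto)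
  have "||S y||\<^sub>H \<le> t * ||y||\<^sub>H" if y: "y \<in> carrier H" for y
  proof -
    \<comment> \<open>The form bound is used at y and at S y; the latter contributes a factor ||S
      y||^2 that cancels.\<close>
    have "||S y||\<^sub>H\<^sup>2 * ||S y||\<^sub>H\<^sup>2 = ||ip (S y) (S y)||\<^sub>D\<^sup>2"
      using nrm_ip[OF Sx(1)[OF y]] by (simp add: power2_eq_square)
    also have "\<dots> \<le> ||ip (S y) (S (S y))||\<^sub>D * ||ip y (S y)||\<^sub>D" by (rule CS[OF Sx(1)[OF y] y])
    also have "\<dots> \<le> (t * ||S y||\<^sub>H\<^sup>2) * (t * ||y||\<^sub>H\<^sup>2)"
      using bound[OF y] bound[OF Sx(1)[OF y]] t0 y Sx by (intro mult_mono) auto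
    finally have le: "||S y||\<^sub>H\<^sup>2 * ||S y||\<^sub>H\<^sup>2 \<le> ||S y||\<^sub>H\<^sup>2 * (t * ||y||\<^sub>H)\<^sup>2"
      by (simp add: power2_eq_square mult_ac)
    show ?thesis
    proof (cases "||S y||\<^sub>H = 0")
      case False
      then have "||S y||\<^sub>H\<^sup>2 > 0" by simp
      then have "||S y||\<^sub>H\<^sup>2 \<le> (t * ||y||\<^sub>H)\<^sup>2" using le by (metis mult_left_le_imp_le)
      then show ?thesis by (rule power2_le_imp_le) (use t0 y in simp)
    qed (use t0 y in simp)
  qed
  then have "||S||\<^sub>Adj \<le> t" using t0 by (intro adj_nrm_le) auto
  then have "A.npos T" unfolding A.npos_def using T t0 by (auto simp: S_def simp del: adj_alg_simps)
  then show ?thesis by (simp add: A.positive_iff_npos)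
qed

text \<open>Positivity of a matrix through its quadratic form on columns, over any index set. It
  admits Gram factorisations with any finite number of rows (\<open>gram_gpos\<close>), whereas
  \<open>mat_positive\<close> asks for a square one; \<open>gpos_gram\<close> converts one into the
  other.\<close>

definition gpos :: "('a, 'm) cstar_scheme \<Rightarrow> 'i set \<Rightarrow> ('i \<Rightarrow> 'i \<Rightarrow> 'a) \<Rightarrow> bool" where
  "gpos A I a \<longleftrightarrow> (\<forall>i\<in>I. \<forall>j\<in>I. a i j \<in> carrier A \<and> star A (a i j) = a j i) \<and>
     (\<forall>x\<in>I \<rightarrow> carrier A. positive A (\<Oplus>\<^sub>A i\<in>I. \<Oplus>\<^sub>A j\<in>I. star A (x i) \<otimes>\<^sub>A (a i j \<otimes>\<^sub>A x j)))"

context ucstar begin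

lemma finsum_mult_finsum:
  assumes "finite I" "finite J" "f \<in> I \<rightarrow> carrier A" "g \<in> J \<rightarrow> carrier A"
  shows "(\<Oplus>i\<in>I. f i) \<otimes> (\<Oplus>j\<in>J. g j) = (\<Oplus>i\<in>I. \<Oplus>j\<in>J. f i \<otimes> g j)"
proof -
  have "(\<Oplus>i\<in>I. f i) \<otimes> (\<Oplus>j\<in>J. g j) = (\<Oplus>i\<in>I. f i \<otimes> (\<Oplus>j\<in>J. g j))"
    by (rule finsum_ldistr) (use assms in \<open>auto intro!: finsum_closed\<close>)
  also have "\<dots> = (\<Oplus>i\<in>I. \<Oplus>j\<in>J. f i \<otimes> g j)"
    using assms by (intro finsum_cong' finsum_rdistr) (auto intro!: finsum_closed)
  finally show ?thesis .
qed

text \<open>At the column x the form is the sum over k of z_k* z_k, where z_k is the sum over j of c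
  k j times x j.\<close>

lemma gram_gpos:
  assumes I: "finite I" and K: "finite K"
    and c: "\<And>k i. \<lbrakk>k \<in> K; i \<in> I\<rbrakk> \<Longrightarrow> c k i \<in> carrier A"
    and a: "\<And>i j. \<lbrakk>i \<in> I; j \<in> I\<rbrakk> \<Longrightarrow> a i j = (\<Oplus>k\<in>K. st (c k i) \<otimes> c k j)"
  shows "gpos A I a" unfolding gpos_def
proof (intro conjI ballI)
  fix i j assume ij: "i \<in> I" "j \<in> I"
  have cc: "(\<lambda>k. st (c k i) \<otimes> c k j) \<in> K \<rightarrow> carrier A" using c ij by auto
  show "a i j \<in> carrier A" unfolding a[OF ij] by (rule finsum_closed[OF cc])
  show "st (a i j) = a j i" unfolding a[OF ij] a[OF ij(2,1)] star_finsum[OF K cc]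
    using c ij by (intro finsum_cong') (auto simp: star_mult)
next
  fix x assume x: "x \<in> I \<rightarrow> carrier A"
  define z where "z k = (\<Oplus>j\<in>I. c k j \<otimes> x j)" for k
  define t where "t k i j = (st (x i) \<otimes> st (c k i)) \<otimes> (c k j \<otimes> x j)" for k i j
  have xc: "x i \<in> carrier A" if "i \<in> I" for i using x that by auto
  have tc: "t k i j \<in> carrier A" if "k \<in> K" "i \<in> I" "j \<in> I" for k i j using that c xc by (simp add: t_def)
  have cx: "(\<lambda>j. c k j \<otimes> x j) \<in> I \<rightarrow> carrier A" if "k \<in> K" for k using c xc that by auto
  have zc: "z k \<in> carrier A" if "k \<in> K" for k unfolding z_def by (rule finsum_closed[OF cx[OF that]])
  have zz: "st (z k) \<otimes> z k = (\<Oplus>i\<in>I. \<Oplus>j\<in>I. t k i j)" if k: "k \<in> K" for k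
  proof -
    have "st (z k) = (\<Oplus>i\<in>I. st (x i) \<otimes> st (c k i))"
      unfolding z_def star_finsum[OF I cx[OF k]] using c xc k by (intro finsum_cong') (auto simp: star_mult)
    then show ?thesis unfolding t_def using c xc k I by (simp add: z_def finsum_mult_finsum cx Pi_iff)
  qed
  have "(\<Oplus>i\<in>I. \<Oplus>j\<in>I. st (x i) \<otimes> (a i j \<otimes> x j)) = (\<Oplus>i\<in>I. \<Oplus>j\<in>I. \<Oplus>k\<in>K. t k i j)"
  proof (intro finsum_cong'[OF refl])
    fix i j assume ij: "i \<in> I" "j \<in> I"
    have cc: "(\<lambda>k. st (c k i) \<otimes> c k j) \<in> K \<rightarrow> carrier A" using c ij by auto
    have "st (x i) \<otimes> (a i j \<otimes> x j) = st (x i) \<otimes> (\<Oplus>k\<in>K. st (c k i) \<otimes> c k j \<otimes> x j)"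
      unfolding a[OF ij] using finsum_ldistr[OF K xc[OF ij(2)] cc] by simp
    also have "\<dots> = (\<Oplus>k\<in>K. st (x i) \<otimes> (st (c k i) \<otimes> c k j \<otimes> x j))"
      by (rule finsum_rdistr[OF K]) (use xc ij c in auto)
    also have "\<dots> = (\<Oplus>k\<in>K. t k i j)" using xc ij c tc by (intro finsum_cong') (auto simp: t_def m_assoc)
    finally show "st (x i) \<otimes> (a i j \<otimes> x j) = (\<Oplus>k\<in>K. t k i j)" .
  qed (use tc in \<open>auto intro!: finsum_closed\<close>)
  also have "\<dots> = (\<Oplus>i\<in>I. \<Oplus>k\<in>K. \<Oplus>j\<in>I. t k i j)"
    using tc I K by (intro finsum_cong' finsum_swap) (auto intro!: finsum_closed)
  also have "\<dots> = (\<Oplus>k\<in>K. \<Oplus>i\<in>I. \<Oplus>j\<in>I. t k i j)" using tc I K by (intro finsum_swap) (auto intro!: finsum_closed)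
  also have "\<dots> = (\<Oplus>k\<in>K. st (z k) \<otimes> z k)" using zz zc by (intro finsum_cong') auto
  finally have e: "(\<Oplus>i\<in>I. \<Oplus>j\<in>I. st (x i) \<otimes> (a i j \<otimes> x j)) = (\<Oplus>k\<in>K. st (z k) \<otimes> z k)" .
  show "positive A (\<Oplus>i\<in>I. \<Oplus>j\<in>I. st (x i) \<otimes> (a i j \<otimes> x j))"
    unfolding e using zc by (intro positive_finsum[OF K] positive_star_mult)
qed

lemma hilb_family_cols: "hilb_family A I (\<lambda>_. A) (\<lambda>a b. st a \<otimes> b) (\<otimes>)"
  by unfold_locales (auto simp: r_distr smult_mult_r star_mult cstar m_assoc banach_space_axioms)

text \<open>Square roots in the C*-algebra of adjointable operators on the Hilbert module \<open>A\<^sup>I\<close>.\<close>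

theorem gpos_gram:
  assumes I: "finite I" and a: "gpos A I a"
  shows "\<exists>c. (\<forall>k\<in>I. \<forall>i\<in>I. c k i \<in> carrier A) \<and> (\<forall>i\<in>I. \<forall>j\<in>I. a i j = (\<Oplus>k\<in>I. st (c k i) \<otimes> c k j))"
proof -
  interpret C: hilb_family A I "\<lambda>_. A" "\<lambda>a b. st a \<otimes> b" "(\<otimes>)" by (rule hilb_family_cols)
  interpret H: hilb A C.Sec C.sip by (rule C.hilb_Sec[OF I])
  interpret AA: ucstar H.Adj by (rule H.ucstar_adj)
  have ac: "a i j \<in> carrier A" "st (a i j) = a j i" if "i \<in> I" "j \<in> I" for i j using a that by (auto simp: gpos_def)
  note xc = C.SecD(1)
  have sec: "(\<lambda>i\<in>I. f i) \<in> carrier C.Sec" if "\<And>i. i \<in> I \<Longrightarrow> f i \<in> carrier A" for f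
    using that by (intro C.SecI[OF _ I]) auto
  have sip: "C.sip x y = (\<Oplus>i\<in>I. st (x i) \<otimes> y i)" if "x \<in> carrier C.Sec" "y \<in> carrier C.Sec" for x y
    using C.sip_eq[OF that I] by (auto simp: fam_supp_def)
  define T where "T = (\<lambda>x\<in>carrier C.Sec. \<lambda>i\<in>I. \<Oplus>j\<in>I. a i j \<otimes> x j)"
  have axc: "(\<lambda>j. a i j \<otimes> x j) \<in> I \<rightarrow> carrier A" if "x \<in> carrier C.Sec" "i \<in> I" for x i using ac xc that by auto
  have Tx: "T x \<in> carrier C.Sec" if "x \<in> carrier C.Sec" for x
    using that sec finsum_closed[OF axc[OF that]] by (simp add: T_def)
  have Tap: "T x i = (\<Oplus>j\<in>I. a i j \<otimes> x j)" if "x \<in> carrier C.Sec" "i \<in> I" for x i using that by (simp add: T_def)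
  have ipT: "C.sip x (T y) = (\<Oplus>i\<in>I. \<Oplus>j\<in>I. st (x i) \<otimes> (a i j \<otimes> y j))"
    if x: "x \<in> carrier C.Sec" and y: "y \<in> carrier C.Sec" for x y unfolding sip[OF x Tx[OF y]]
    using ac xc x y by (intro finsum_cong'[OF refl]) (auto simp: Tap y finsum_rdistr[OF I _ axc[OF y]] intro!: finsum_closed)
  have sym: "C.sip (T x) y = C.sip x (T y)" if x: "x \<in> carrier C.Sec" and y: "y \<in> carrier C.Sec" for x y
  proof -
    have "C.sip (T x) y = st (C.sip y (T x))" using x y Tx by (simp add: H.ip_star)
    also have "\<dots> = (\<Oplus>i\<in>I. \<Oplus>j\<in>I. st (st (y i) \<otimes> (a i j \<otimes> x j)))" unfolding ipT[OF y x] using ac xc x y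
      by (subst star_finsum[OF I]) (auto intro!: finsum_closed finsum_cong' star_finsum[OF I])
    also have "\<dots> = (\<Oplus>i\<in>I. \<Oplus>j\<in>I. st (x j) \<otimes> (a j i \<otimes> y i))"
      using ac xc x y by (intro finsum_cong'[OF refl]) (auto intro!: finsum_closed simp: star_mult m_assoc)
    also have "\<dots> = (\<Oplus>j\<in>I. \<Oplus>i\<in>I. st (x j) \<otimes> (a j i \<otimes> y i))" using ac xc x y by (intro finsum_swap I) auto
    finally show ?thesis by (simp add: ipT[OF x y])
  qed
  have bd: "bounded_map C.Sec C.Sec T"
  proof -
    \<comment> \<open>A crude bound for T by the sums of norms along the rows.\<close>
    define M where "M i = (\<Sum>j\<in>I. ||a i j||)" for i
    have "||T x||\<^sub>C.Sec \<le> sqrt (\<Sum>i\<in>I. (M i)\<^sup>2) * ||x||\<^sub>C.Sec" if x: "x \<in> carrier C.Sec" for x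
    proof (rule power2_le_imp_le)
      have ti: "||T x i|| \<le> M i * ||x||\<^sub>C.Sec" if i: "i \<in> I" for i
      proof -
        have "||T x i|| \<le> (\<Sum>j\<in>I. ||a i j \<otimes> x j||)"
          unfolding Tap[OF x i] by (rule nrm_finsum_le[OF I axc[OF x i]])
        also have "\<dots> \<le> (\<Sum>j\<in>I. ||a i j|| * ||x||\<^sub>C.Sec)"
        proof (rule sum_mono)
          fix j assume j: "j \<in> I"
          have "||a i j \<otimes> x j|| \<le> ||a i j|| * ||x j||" using ac[OF i j] xc[OF x j] by (simp add: nrm_mult)
          also have "\<dots> \<le> ||a i j|| * ||x||\<^sub>C.Sec"
            using C.Sec_nrm_component[OF x j] ac[OF i j] by (intro mult_left_mono) auto
          finally show "||a i j \<otimes> x j|| \<le> ||a i j|| * ||x||\<^sub>C.Sec" .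
        qed
        finally show ?thesis by (simp add: M_def sum_distrib_right)
      qed
      have "||T x||\<^sub>C.Sec\<^sup>2 \<le> (\<Sum>i\<in>I. ||T x i||\<^sup>2)" by (rule C.Sec_nrm_le[OF Tx[OF x] I])
      also have "\<dots> \<le> (\<Sum>i\<in>I. (M i * ||x||\<^sub>C.Sec)\<^sup>2)" by (intro sum_mono power_mono ti nrm_nonneg xc[OF Tx[OF x]])
      also have "\<dots> = (sqrt (\<Sum>i\<in>I. (M i)\<^sup>2) * ||x||\<^sub>C.Sec)\<^sup>2"
        by (simp only: power_mult_distrib sum_distrib_right[symmetric]) (simp add: sum_nonneg)
      finally show "||T x||\<^sub>C.Sec\<^sup>2 \<le> (sqrt (\<Sum>i\<in>I. (M i)\<^sup>2) * ||x||\<^sub>C.Sec)\<^sup>2" .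
      show "0 \<le> sqrt (\<Sum>i\<in>I. (M i)\<^sup>2) * ||x||\<^sub>C.Sec"
        using H.H.nrm_nonneg[OF x] by (simp add: sum_nonneg del: C.Sec_simps)
    qed
    then show ?thesis by (auto simp: bounded_map_def simp del: C.Sec_simps)
  qed
  have TE: "T \<in> carrier C.Sec \<rightarrow>\<^sub>E carrier C.Sec" using Tx by (auto simp: T_def)
  note TA = H.adj_of_pair[OF TE TE sym bd]
  have "positive H.Adj T"
  proof (rule H.positive_adjI[OF TA(1,3)])
    fix x assume x: "x \<in> carrier C.Sec"
    have "x \<in> I \<rightarrow> carrier A" using xc[OF x] by auto
    then show "positive A (C.sip x (T x))" unfolding ipT[OF x x] using a unfolding gpos_def by blast
  next
    fix x d assume xd: "x \<in> carrier C.Sec" "d \<in> carrier A"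
    show "\<exists>z\<in>carrier C.Sec. \<forall>y\<in>carrier C.Sec. C.sip y z = C.sip y x \<otimes> d" using C.Sec_act[OF xd] by blast
  qed
  then obtain R where R: "R \<in> carrier H.Adj" "T = star H.Adj R \<otimes>\<^sub>H.Adj R" unfolding positive_def by blast
  define e where "e j = (\<lambda>i\<in>I. if i = j then \<one> else \<zero>)" for j
  have ec: "e j \<in> carrier C.Sec" for j unfolding e_def by (rule sec) auto
  have Rc: "R (e j) \<in> carrier C.Sec" for j by (rule H.adjD(4)[OF R(1) ec])
  have pick: "(\<Oplus>j\<in>I. f j \<otimes> e i j) = f i" if "i \<in> I" "\<And>j. j \<in> I \<Longrightarrow> f j \<in> carrier A" for f i
  proof -
    have "(\<Oplus>j\<in>I. f j \<otimes> e i j) = (\<Oplus>j\<in>I. if i = j then f j else \<zero>)"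
      using that by (intro finsum_cong') (auto simp: e_def)
    also have "\<dots> = f i" using that I by (intro finsum_singleton) auto
    finally show ?thesis .
  qed
  have pick': "(\<Oplus>j\<in>I. st (e i j) \<otimes> f j) = f i" if "i \<in> I" "\<And>j. j \<in> I \<Longrightarrow> f j \<in> carrier A" for f i
  proof -
    have "(\<Oplus>j\<in>I. st (e i j) \<otimes> f j) = (\<Oplus>j\<in>I. if i = j then f j else \<zero>)"
      using that by (intro finsum_cong') (auto simp: e_def)
    also have "\<dots> = f i" using that I by (intro finsum_singleton) auto
    finally show ?thesis .
  qed
  show ?thesis
  \<comment> \<open>The witness is the matrix of R with respect to the unit columns: its i-th column
    is R (e i).\<close>
  proof (intro exI[of _ "\<lambda>k i. R (e i) k"] conjI ballI)
    fix k i assume "k \<in> I" "i \<in> I"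
    then show "R (e i) k \<in> carrier A" using xc[OF Rc] by simp
  next
    fix i j assume ij: "i \<in> I" "j \<in> I"
    have "a i j = T (e j) i" using ij ac pick[of j "a i"] by (simp add: Tap ec)
    also have "\<dots> = C.sip (e i) (T (e j))"
      using ij xc[OF Tx[OF ec]] pick'[of i "T (e j)"] by (simp add: sip[OF ec Tx[OF ec]])
    also have "\<dots> = C.sip (R (e i)) (R (e j))" using H.adj_star(3)[OF R(1) ec Rc, of i j] ec by (simp add: R(2))
    also have "\<dots> = (\<Oplus>k\<in>I. st (R (e i) k) \<otimes> R (e j) k)" by (rule sip[OF Rc Rc])
    finally show "a i j = (\<Oplus>k\<in>I. st (R (e i) k) \<otimes> R (e j) k)" .
  qed
qed

section \<open>Completely positive maps on matrices and Kadison's inequality\<close>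

lemma gpos_mat_positive: "gpos A {..<n} a \<Longrightarrow> mat_positive A n a"
proof -
  assume a: "gpos A {..<n} a"
  from gpos_gram[OF finite_lessThan a] obtain c where c: "\<forall>k\<in>{..<n}. \<forall>i\<in>{..<n}. c k i \<in> carrier A"
    "\<forall>i\<in>{..<n}. \<forall>j\<in>{..<n}. a i j = (\<Oplus>k\<in>{..<n}. st (c k i) \<otimes> c k j)" by (elim exE conjE)
  show ?thesis unfolding mat_positive_def by (rule exI[of _ c]) (use c in simp)
qed

text \<open>Complete positivity speaks of square matrices indexed by the numbers below n. An
  enumeration h of I transports it to other index sets, such as the pairs of a row and a group
  element in \<open>avg_gram\<close>.\<close>

lemma cp_gram:
  assumes \<Phi>: "completely_positive A \<Phi>" and I: "finite I" and a: "gpos A I a"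
  shows "\<exists>c. (\<forall>p<card I. \<forall>i\<in>I. c p i \<in> carrier A) \<and>
    (\<forall>i\<in>I. \<forall>j\<in>I. \<Phi> (a i j) = (\<Oplus>p\<in>{..<card I}. st (c p i) \<otimes> c p j))"
proof -
  let ?n = "card I"
  obtain c where c: "\<And>k i. \<lbrakk>k \<in> I; i \<in> I\<rbrakk> \<Longrightarrow> c k i \<in> carrier A"
    "\<And>i j. \<lbrakk>i \<in> I; j \<in> I\<rbrakk> \<Longrightarrow> a i j = (\<Oplus>k\<in>I. st (c k i) \<otimes> c k j)" using gpos_gram[OF I a] by blast
  obtain h where h: "bij_betw h {..<?n} I" using ex_bij_betw_nat_finite[OF I] by (auto simp: atLeast0LessThan)
  then have hI: "h ` {..<?n} = I" "inj_on h {..<?n}" "\<And>p. p < ?n \<Longrightarrow> h p \<in> I" by (auto simp: bij_betw_def)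
  define g where "g = inv_into {..<?n} h"
  have g: "g i < ?n" "h (g i) = i" if "i \<in> I" for i
    using that hI inv_into_into[of i h "{..<?n}"] f_inv_into_f[of i h "{..<?n}"] by (auto simp: g_def)
  have "mat_positive A ?n (\<lambda>p q. a (h p) (h q))" unfolding mat_positive_def
  proof (intro exI[of _ "\<lambda>p q. c (h p) (h q)"] conjI allI impI)
    fix p q assume "p < ?n" "q < ?n"
    then have pq: "h p \<in> I" "h q \<in> I" using hI by auto
    show "c (h p) (h q) \<in> carrier A" using c pq by simp
    have "a (h p) (h q) = (\<Oplus>k\<in>h ` {..<?n}. st (c k (h p)) \<otimes> c k (h q))" using c(2)[OF pq] hI(1) by simp
    also have "\<dots> = (\<Oplus>k\<in>{..<?n}. st (c (h k) (h p)) \<otimes> c (h k) (h q))"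
      using c(1) pq hI by (intro finsum_reindex) auto
    finally show "a (h p) (h q) = (\<Oplus>k\<in>{..<?n}. st (c (h k) (h p)) \<otimes> c (h k) (h q))" .
  qed
  then have "mat_positive A ?n (\<lambda>p q. \<Phi> (a (h p) (h q)))" using \<Phi> by (simp add: completely_positive_def)
  then obtain d where d: "\<And>p q. \<lbrakk>p < ?n; q < ?n\<rbrakk> \<Longrightarrow> d p q \<in> carrier A"
    "\<And>p q. \<lbrakk>p < ?n; q < ?n\<rbrakk> \<Longrightarrow> \<Phi> (a (h p) (h q)) = (\<Oplus>k\<in>{..<?n}. st (d k p) \<otimes> d k q)"
    unfolding mat_positive_def by blast
  show ?thesis
  proof (intro exI[of _ "\<lambda>p i. d p (g i)"] conjI allI ballI impI)
    fix i j assume "i \<in> I" "j \<in> I"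
    then show "\<Phi> (a i j) = (\<Oplus>p\<in>{..<?n}. st (d p (g i)) \<otimes> d p (g j))"
      using d(2)[OF g(1) g(1), of i j] g(2) by simp
  qed (use d g in auto)
qed

lemma gpos_rank_one:
  assumes "finite I" "v \<in> I \<rightarrow> carrier A" shows "gpos A I (\<lambda>i j. st (v i) \<otimes> v j)"
proof (rule gram_gpos[OF assms(1), of "{()}" "\<lambda>_. v"])
  fix i j assume "i \<in> I" "j \<in> I"
  then have "st (v i) \<otimes> v j \<in> carrier A" using assms by auto
  then show "st (v i) \<otimes> v j = (\<Oplus>k\<in>{()}. st (v i) \<otimes> v j)" by (subst finsum_insert) auto
qed (use assms in auto)

lemma cp_positive:
  assumes \<Phi>: "completely_positive A \<Phi>" and a: "positive A a" shows "positive A (\<Phi> a)"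
proof -
  obtain v where v: "v \<in> carrier A" "a = st v \<otimes> v" using a by (auto simp: positive_def)
  have "gpos A {()} (\<lambda>_ _. st v \<otimes> v)" using gpos_rank_one[of "{()}" "\<lambda>_. v"] v by auto
  from cp_gram[OF \<Phi> _ this] obtain c where c: "\<And>p. p < card {()} \<Longrightarrow> c p () \<in> carrier A"
    "\<Phi> a = (\<Oplus>p\<in>{..<card {()}}. st (c p ()) \<otimes> c p ())" using v by auto
  show ?thesis unfolding c(2) using c(1) by (intro positive_finsum) auto
qed

lemma cp_closed: "completely_positive A \<Phi> \<Longrightarrow> a \<in> carrier A \<Longrightarrow> \<Phi> a \<in> carrier A"
  by (auto simp: completely_positive_def clinear_map_def)

lemma cp_gpos:
  assumes \<Phi>: "completely_positive A \<Phi>" and I: "finite I" and a: "gpos A I a" shows "gpos A I (\<lambda>i j. \<Phi> (a i j))"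
proof -
  obtain c where "\<forall>p<card I. \<forall>i\<in>I. c p i \<in> carrier A"
    "\<forall>i\<in>I. \<forall>j\<in>I. \<Phi> (a i j) = (\<Oplus>p\<in>{..<card I}. st (c p i) \<otimes> c p j)" using cp_gram[OF assms] by (elim exE conjE)
  then show ?thesis by (intro gram_gpos[OF I finite_lessThan, of "card I" c]) auto
qed

text \<open>Evaluate the image of the positive matrix with entries \<open>1, a, a\<^sup>*, a\<^sup>* a\<close> at the vector \<open>(-\<Phi> a, 1)\<close>.\<close>

lemma kadison:
  assumes \<Phi>: "completely_positive A \<Phi>" and n: "||\<Phi> \<one>|| \<le> 1" and a: "a \<in> carrier A"
  shows "positive A (\<Phi> (st a \<otimes> a) \<ominus> st (\<Phi> a) \<otimes> \<Phi> a)"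
proof -
  define v where "v = (\<lambda>b. if b then a else \<one>)"
  define F where "F = \<Phi> a"
  define W where "W = \<Phi> (st a \<otimes> a)"
  define x where "x = (\<lambda>b. if b then \<one> else \<ominus> F)"
  have c: "F \<in> carrier A" "W \<in> carrier A" "\<Phi> \<one> \<in> carrier A" using cp_closed[OF \<Phi>] a by (simp_all add: F_def W_def)
  have g: "gpos A {False, True} (\<lambda>i j. \<Phi> (st (v i) \<otimes> v j))" using a by (intro cp_gpos[OF \<Phi>] gpos_rank_one) (auto simp: v_def)
  have "x \<in> {False, True} \<rightarrow> carrier A" using c by (auto simp: x_def)
  then have g2: "positive A (\<Oplus>i\<in>{False, True}. \<Oplus>j\<in>{False, True}. st (x i) \<otimes> (\<Phi> (st (v i) \<otimes> v j) \<otimes> x j))"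
    using g unfolding gpos_def by (elim conjE bspec)
  have "st (\<Phi> (st (v False) \<otimes> v True)) = \<Phi> (st (v True) \<otimes> v False)" using g unfolding gpos_def by blast
  then have sF: "\<Phi> (st a) = st F" using a by (simp add: v_def F_def)
  have "(\<Oplus>i\<in>{False, True}. \<Oplus>j\<in>{False, True}. st (x i) \<otimes> (\<Phi> (st (v i) \<otimes> v j) \<otimes> x j)) =
      (st F \<otimes> \<Phi> \<one> \<otimes> F \<ominus> st F \<otimes> F) \<oplus> (W \<ominus> st F \<otimes> F)"
    using a c by (simp add: finsum_insert v_def x_def sF star_neg l_minus r_minus m_assoc minus_eq a_comm F_def[symmetric] W_def[symmetric])
  with g2 have p1: "positive A ((st F \<otimes> \<Phi> \<one> \<otimes> F \<ominus> st F \<otimes> F) \<oplus> (W \<ominus> st F \<otimes> F))" by simp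
  have "positive A (\<Phi> \<one>)" using cp_positive[OF \<Phi>] by simp
  then have "positive A (of_real 1 \<odot> \<one> \<ominus> \<Phi> \<one>)"
    using positive_nrm_minus[of "\<Phi> \<one>" 1] n by (auto simp: positive_closed positive_sa)
  \<comment> \<open>The inequality p1 carries the extra term F* \<Phi>(1) F - F* F, which is
    negative because \<Phi>(1) \<le> 1. Adding its opposite p2 leaves the claim.\<close>
  then have p2: "positive A (st F \<otimes> (\<one> \<ominus> \<Phi> \<one>) \<otimes> F)" using c by (intro positive_conj) auto
  have "st F \<otimes> (\<one> \<ominus> \<Phi> \<one>) \<otimes> F = st F \<otimes> F \<ominus> st F \<otimes> \<Phi> \<one> \<otimes> F"
    using c by (simp add: minus_eq l_distr r_distr l_minus r_minus m_assoc)
  moreover have "(z \<ominus> y) \<oplus> (w \<ominus> y) \<oplus> (y \<ominus> z) = w \<ominus> y" if "y \<in> carrier A" "z \<in> carrier A" "w \<in> carrier A" for w y z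
    using that by algebra
  ultimately show ?thesis using positive_add[OF p1 p2] c by (simp add: F_def[symmetric] W_def[symmetric])
qed

text \<open>By Kadison's inequality ||\<Phi> a||^2 \<le> ||\<Phi>(a* a)||, and a* a \<le> ||a||^2
  bounds this by ||a||^2 ||\<Phi>(1)||.\<close>

lemma cp_contractive:
  assumes \<Phi>: "completely_positive A \<Phi>" and n: "||\<Phi> \<one>|| \<le> 1" shows "contractive_map A A \<Phi>"
  unfolding contractive_map_def
proof
  fix a assume a: "a \<in> carrier A"
  note lin = \<Phi>[unfolded completely_positive_def, THEN conjunct1]
  have Fc: "\<Phi> a \<in> carrier A" "\<Phi> (st a \<otimes> a) \<in> carrier A" "\<Phi> \<one> \<in> carrier A" using a cp_closed[OF \<Phi>] by auto
  show "||\<Phi> a|| \<le> ||a||"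
  proof (rule power2_le_imp_le)
    have "||\<Phi> a||\<^sup>2 = ||st (\<Phi> a) \<otimes> \<Phi> a||" using Fc by (simp add: cstar)
    also have "\<dots> \<le> ||\<Phi> (st a \<otimes> a)||" using kadison[OF \<Phi> n a] Fc by (intro positive_nrm_mono) auto
    also have "\<dots> \<le> ||of_real ( ||a||\<^sup>2) \<odot> \<Phi> \<one>||"
    proof (rule positive_nrm_mono)
      show "positive A (\<Phi> (st a \<otimes> a))" using a by (intro cp_positive[OF \<Phi>]) auto
      have "positive A (of_real ( ||a||\<^sup>2) \<odot> \<one> \<ominus> st a \<otimes> a)"
        using a by (intro positive_nrm_minus) (auto simp: star_mult cstar)
      from cp_positive[OF \<Phi> this]
      show "positive A (of_real ( ||a||\<^sup>2) \<odot> \<Phi> \<one> \<ominus> \<Phi> (st a \<otimes> a))"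
        using a lin by (simp add: clinear_map_diff[OF lin seminormed_axioms]) (simp add: clinear_map_def)
    qed (use Fc in simp)
    also have "\<dots> \<le> ||a||\<^sup>2 * 1" using Fc n by (simp add: nrm_smult mult_left_le norm_power)
    finally show "||\<Phi> a||\<^sup>2 \<le> ||a||\<^sup>2" by simp
  qed (use a in simp)
qed

end

section \<open>The regular representation of a Fell bundle\<close>

lemma banach_space_cong:
  fixes V :: "('a, 'm) cnormed_scheme" and W :: "('a, 'k) cnormed_scheme"
  assumes b: "banach_space V"
    and e: "carrier W = carrier V" "add W = add V" "zero W = zero V" "smult W = smult V" "nrm W = nrm V"
  shows "banach_space W"
proof -
  interpret V: banach_space V by fact
  note m = module_cong[OF V.module_axioms e(1-4)]
  have nd: "ndist W = ndist V" by (intro ext) (simp add: ndist_def e m(2))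
  then have cs: "cauchy_seqs W = cauchy_seqs V" by (simp add: cauchy_seqs_def e)
  show ?thesis by (rule banach_space.intro[OF m(1)], unfold_locales)
      (use V.complete in \<open>auto simp: e nd cs V.nrm_eq_0 V.nrm_triangle V.nrm_smult\<close>)
qed

lemma (in prehilb) ext_op_adj:
  assumes T: "clinear_map H H T" "bounded_map H H T" and S: "clinear_map H H S" "bounded_map H H S"
    and e: "\<And>x y. \<lbrakk>x \<in> carrier H; y \<in> carrier H\<rbrakk> \<Longrightarrow> ip (T x) y = ip x (S y)"
  shows "ext_op H T \<in> carrier (adj_alg (completion H) (completion_ip D ip))"
    and "star (adj_alg (completion H) (completion_ip D ip)) (ext_op H T) = ext_op H S"
proof -
  interpret C: hilb D "completion H" "completion_ip D ip"
    by (rule hilb.intro[OF prehilb_completion H.banach_completion])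
  have Tc: "T x \<in> carrier H" "S x \<in> carrier H" if "x \<in> carrier H" for x
    using T S that by (auto simp: clinear_map_def)
  have eq: "completion_ip D ip (ext_op H T X) Y = completion_ip D ip X (ext_op H S Y)"
    if X: "X \<in> carrier (completion H)" and Y: "Y \<in> carrier (completion H)" for X Y
  proof -
    obtain x where x: "x \<in> cauchy_seqs H" "X = seq_class H x" using X by (rule H.completionE)
    obtain y where y: "y \<in> cauchy_seqs H" "Y = seq_class H y" using Y by (rule H.completionE)
    note c = H.cauchy_closed[OF x(1)] H.cauchy_closed[OF y(1)]
    note 1 = completion_ip_seq_class[OF H.cauchy_map[OF T x(1)] y(1)]
    note 2 = completion_ip_seq_class[OF x(1) H.cauchy_map[OF S y(1)]]
    have eq: "ip (T (x n)) (y n) = ip (x n) (S (y n))" for n using c e by simp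
    show ?thesis unfolding x(2) y(2) H.ext_op_seq_class[OF T x(1)] H.ext_op_seq_class[OF S y(1)]
      by (rule D.tends_unique[OF 1(2) 2(2)[folded eq]]) (use 1(1) 2(1) c Tc in simp_all)
  qed
  obtain C where C: "C \<ge> 0" "\<And>x. x \<in> carrier H \<Longrightarrow> ||T x||\<^sub>H \<le> C * ||x||\<^sub>H"
    using T(2) by (rule H.bounded_mapE) blast
  have b: "bounded_map (completion H) (completion H) (ext_op H T)"
    using H.ext_op_bound[OF T(1) C(2)] unfolding bounded_map_def by blast
  note a = C.adj_of_pair[OF H.ext_op_PiE[OF T] H.ext_op_PiE[OF S] eq b]
  show "ext_op H T \<in> carrier (adj_alg (completion H) (completion_ip D ip))" by (rule a(1))
  show "star (adj_alg (completion H) (completion_ip D ip)) (ext_op H T) = ext_op H S" by (rule a(3))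
qed

context group begin

lemma inv_cancel_left: "\<lbrakk>g \<in> carrier G; h \<in> carrier G\<rbrakk> \<Longrightarrow> inv g \<otimes> (g \<otimes> h) = h" by (simp add: m_assoc[symmetric])

lemma cancel_inv_left: "\<lbrakk>g \<in> carrier G; h \<in> carrier G\<rbrakk> \<Longrightarrow> g \<otimes> (inv g \<otimes> h) = h" by (simp add: m_assoc[symmetric])

end

context fell_bundle begin

lemma fib_seminormed: "g \<in> carrier G \<Longrightarrow> seminormed (fibre B g)"
  using fibre_banach banach_space_def seminormed_def
  by (metis banach_space.nrm_smult banach_space.nrm_triangle seminormed.intro seminormed_axioms.intro)

lemma bm_add_right: "\<lbrakk>g \<in> carrier G; h \<in> carrier G; a \<in> carrier (fibre B g); b \<in> carrier (fibre B h); c \<in> carrier (fibre B h)\<rbrakk>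
  \<Longrightarrow> bmult B a (b \<oplus>\<^sub>(fibre B h) c) = bmult B a b \<oplus>\<^sub>(fibre B (g \<otimes> h)) bmult B a c"
  using bmult_linear_right[of g h a] by (simp add: clinear_map_def)

lemma bm_smult_right: "\<lbrakk>g \<in> carrier G; h \<in> carrier G; a \<in> carrier (fibre B g); b \<in> carrier (fibre B h)\<rbrakk>
  \<Longrightarrow> bmult B a (z \<odot>\<^sub>(fibre B h) b) = z \<odot>\<^sub>(fibre B (g \<otimes> h)) bmult B a b"
  using bmult_linear_right[of g h a] by (simp add: clinear_map_def)

lemma bm_add_left: "\<lbrakk>g \<in> carrier G; h \<in> carrier G; a \<in> carrier (fibre B g); b \<in> carrier (fibre B g); c \<in> carrier (fibre B h)\<rbrakk>
  \<Longrightarrow> bmult B (a \<oplus>\<^sub>(fibre B g) b) c = bmult B a c \<oplus>\<^sub>(fibre B (g \<otimes> h)) bmult B b c"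
  using bmult_linear_left[of g h c] by (simp add: clinear_map_def)

lemma bm_smult_left: "\<lbrakk>g \<in> carrier G; h \<in> carrier G; a \<in> carrier (fibre B g); c \<in> carrier (fibre B h)\<rbrakk>
  \<Longrightarrow> bmult B (z \<odot>\<^sub>(fibre B g) a) c = z \<odot>\<^sub>(fibre B (g \<otimes> h)) bmult B a c"
  using bmult_linear_left[of g h c] by (simp add: clinear_map_def)

lemma bm_zero_right: "\<lbrakk>g \<in> carrier G; h \<in> carrier G; a \<in> carrier (fibre B g)\<rbrakk> \<Longrightarrow> bmult B a \<zero>\<^sub>(fibre B h) = \<zero>\<^sub>(fibre B (g \<otimes> h))"
  using seminormed.clinear_map_zero[OF fib_seminormed bmult_linear_right fib_seminormed, of h g a] by simp

lemma bm_zero_left: "\<lbrakk>g \<in> carrier G; h \<in> carrier G; a \<in> carrier (fibre B h)\<rbrakk> \<Longrightarrow> bmult B \<zero>\<^sub>(fibre B g) a = \<zero>\<^sub>(fibre B (g \<otimes> h))"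
  using seminormed.clinear_map_zero[OF fib_seminormed bmult_linear_left fib_seminormed, of g h a] by simp

end

context unital_fell_bundle begin

abbreviation "Be \<equiv> unit_fibre G B"

lemma be_mult: "a \<otimes>\<^sub>Be b = bmult B a b" and be_star: "star Be a = bstar B a"
  by (simp_all add: unit_fibre_def Let_def)

lemma unit_fibre_simps [simp]:
  "carrier (fibre B \<one>) = carrier Be" "add (fibre B \<one>) = add Be" "zero (fibre B \<one>) = zero Be"
  "smult (fibre B \<one>) = smult Be" "nrm (fibre B \<one>) = nrm Be" "one (fibre B \<one>) = one Be"
  by (simp_all add: unit_fibre_def Let_def)

lemma ucstar_Be: "ucstar Be"
proof -
  have b: "banach_space Be" by (rule banach_space_cong[OF fibre_banach[OF one_closed]]) simp_all
  interpret V: banach_space Be by (rule b)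
  have r: "ring Be"
  proof (rule ringI)
    show "abelian_group Be" by (rule V.abelian_group_axioms)
    show "monoid Be" by (rule monoidI)
        (use bmult_closed[of \<one> \<one>] bmult_assoc[of \<one> \<one> \<one>] unit_closed unit_left unit_right in \<open>auto simp: be_mult\<close>)
  qed (use bm_add_left[of \<one> \<one>] bm_add_right[of \<one> \<one>] in \<open>auto simp: be_mult\<close>)
  show ?thesis by (rule ucstar.intro[OF b r], unfold_locales)
      (use bm_smult_left[of \<one> \<one>] bm_smult_right[of \<one> \<one>] nrm_bmult[of \<one> \<one>] bstar_closed[of \<one>] bstar_bstar[of \<one>]
        bstar_bmult[of \<one> \<one>] bstar_add[of \<one>] bstar_smult[of \<one>] cstar_identity[of \<one>]
        in \<open>auto simp: be_mult be_star\<close>)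
qed

end

sublocale unital_fell_bundle \<subseteq> D: ucstar "unit_fibre G B"
  by (rule ucstar_Be)

context unital_fell_bundle begin

text \<open>The bundle axioms make 1 a unit only on \<open>B_e\<close>. The difference y = 1 x - x
  is annihilated by 1, whereas y y* lies in \<open>B_e\<close> and is fixed by 1; so y y* = (1 y) y*
  = 0, and the C*-identity gives y = 0.\<close>

lemma unit_left': assumes g: "g \<in> carrier G" and x: "x \<in> carrier (fibre B g)" shows "bmult B \<one>\<^sub>Be x = x"
proof -
  interpret V: banach_space "fibre B g" by (rule fibre_banach[OF g])
  have u: "\<one>\<^sub>Be \<in> carrier (fibre B \<one>)" by simp
  have ux: "bmult B \<one>\<^sub>Be x \<in> carrier (fibre B g)" using bmult_closed[OF one_closed g u x] g by simp
  define y where "y = bmult B \<one>\<^sub>Be x \<ominus>\<^sub>(fibre B g) x"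
  have y: "y \<in> carrier (fibre B g)" using ux x by (simp add: y_def)
  have "bmult B \<one>\<^sub>Be (bmult B \<one>\<^sub>Be x) = bmult B \<one>\<^sub>Be x"
    using bmult_assoc[OF one_closed one_closed g u u x] unit_left[of "\<one>\<^sub>Be"] by simp
  moreover have "bmult B \<one>\<^sub>Be y = bmult B \<one>\<^sub>Be (bmult B \<one>\<^sub>Be x) \<ominus>\<^sub>(fibre B g) bmult B \<one>\<^sub>Be x"
    using V.clinear_map_diff[OF bmult_linear_right[OF one_closed g u] fib_seminormed ux x] g by (simp add: y_def)
  ultimately have uy: "bmult B \<one>\<^sub>Be y = \<zero>\<^sub>(fibre B g)" using ux by simp
  have sy: "bstar B y \<in> carrier (fibre B (inv g))" using bstar_closed[OF g y] .
  have yy: "bmult B y (bstar B y) \<in> carrier Be" using bmult_closed[OF g inv_closed[OF g] y sy] g by simp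
  have "bmult B y (bstar B y) = bmult B \<one>\<^sub>Be (bmult B y (bstar B y))" using unit_left[OF yy] by simp
  also have "\<dots> = bmult B (bmult B \<one>\<^sub>Be y) (bstar B y)"
    using bmult_assoc[OF one_closed g inv_closed[OF g] u y sy] by simp
  also have "\<dots> = \<zero>\<^sub>Be" unfolding uy using bm_zero_left[OF g inv_closed[OF g] sy] g by simp
  finally have "bmult B (bstar B (bstar B y)) (bstar B y) = \<zero>\<^sub>Be" using bstar_bstar[OF g y] by simp
  then have "||y||\<^sub>(fibre B g)\<^sup>2 = 0" using cstar_identity[OF inv_closed[OF g] sy] nrm_bstar[OF g y] by simp
  then have "y = \<zero>\<^sub>(fibre B g)" using V.nrm_eq_0[OF y] by simp
  then show ?thesis using V.diff_eq_0_iff[OF ux x] by (simp add: y_def)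
qed

lemma unit_right': assumes g: "g \<in> carrier G" and x: "x \<in> carrier (fibre B g)" shows "bmult B x \<one>\<^sub>Be = x"
proof -
  have sx: "bstar B x \<in> carrier (fibre B (inv g))" by (rule bstar_closed[OF g x])
  have u: "\<one>\<^sub>Be \<in> carrier (fibre B \<one>)" by simp
  have "bstar B (bmult B \<one>\<^sub>Be (bstar B x)) = bmult B (bstar B (bstar B x)) (bstar B \<one>\<^sub>Be)"
    by (rule bstar_bmult[OF one_closed inv_closed[OF g] u sx])
  then show ?thesis using unit_left'[OF inv_closed[OF g] sx] bstar_bstar[OF g x] D.star_one by (simp add: be_star)
qed

end

lemma (in unital_fell_bundle) hilb_family_bundle:
  "hilb_family Be (carrier G) (fibre B) (\<lambda>a b. bmult B (bstar B a) b) (bmult B)"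
proof (rule hilb_family.intro[OF ucstar_Be], rule hilb_family_axioms.intro)
  fix g a b c d z assume g: "g \<in> carrier G"
  show "banach_space (fibre B g)" by (rule fibre_banach[OF g])
  assume a: "a \<in> carrier (fibre B g)"
  note sa = bstar_closed[OF g a]
  note ig = inv_closed[OF g]
  show "positive Be (bmult B (bstar B a) a)" by (rule bstar_bmult_positive[OF g a])
  show "||bmult B (bstar B a) a||\<^sub>Be = ||a||\<^sub>(fibre B g)\<^sup>2" using cstar_identity[OF g a] by simp
  { assume d: "d \<in> carrier Be"
    show "bmult B a d \<in> carrier (fibre B g)" using bmult_closed[OF g one_closed a] d g by simp }
  assume b: "b \<in> carrier (fibre B g)"
  show "bmult B (bstar B a) b \<in> carrier Be" using bmult_closed[OF ig g sa b] g by simp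
  show "bmult B (bstar B a) (z \<odot>\<^sub>(fibre B g) b) = z \<odot>\<^sub>Be bmult B (bstar B a) b"
    using bm_smult_right[OF ig g sa b] g by simp
  show "star Be (bmult B (bstar B a) b) = bmult B (bstar B b) a"
    using bstar_bmult[OF ig g sa b] bstar_bstar[OF g a] by (simp add: be_star)
  { assume d: "d \<in> carrier Be"
    show "bmult B (bstar B a) (bmult B b d) = bmult B (bstar B a) b \<otimes>\<^sub>Be d"
      using bmult_assoc[OF ig g one_closed sa b] d by (simp add: be_mult) }
  assume c: "c \<in> carrier (fibre B g)"
  show "bmult B (bstar B a) (b \<oplus>\<^sub>(fibre B g) c) = bmult B (bstar B a) b \<oplus>\<^sub>Be bmult B (bstar B a) c"
    using bm_add_right[OF ig g sa b c] g by simp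
qed

sublocale unital_fell_bundle \<subseteq> F: hilb_family "unit_fibre G B" "carrier G" "fibre B"
  "\<lambda>a b. bmult B (bstar B a) b" "bmult B" by (rule hilb_family_bundle)

lemma (in unital_fell_bundle) sections_eq: "sections G B = F.Sec"
  by (simp add: sections_def fam_sections_def section_inner_def fam_ip_def supp_def fam_supp_def)

lemma (in unital_fell_bundle) l2_eq: "l2 G B = completion F.Sec" by (simp add: l2_def sections_eq)

lemma (in unital_fell_bundle) l2_inner_eq: "l2_inner G B = completion_ip Be F.sip"
  by (intro ext) (simp add: l2_inner_def completion_ip_def section_inner_def fam_ip_def supp_def fam_supp_def)

sublocale unital_fell_bundle \<subseteq> P: prehilb "unit_fibre G B" F.Sec F.sip
  by (rule F.prehilb_Sec)

sublocale unital_fell_bundle \<subseteq> L: hilb "unit_fibre G B" "l2 G B" "l2_inner G B"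
  unfolding l2_eq l2_inner_eq by (rule hilb.intro[OF P.prehilb_completion P.H.banach_completion])

lemma (in unital_fell_bundle) adjointable_eq: "adjointable G B = L.Adj"
  by (simp add: adjointable_def adj_alg_def Let_def is_adjoint_def is_adj_def)

section \<open>Translation operators and the regular representation\<close>

definition translate :: "('g, 'm) monoid_scheme \<Rightarrow> ('g, 'b) bundle_data \<Rightarrow> 'g \<Rightarrow> 'b \<Rightarrow> ('g \<Rightarrow> 'b) \<Rightarrow> 'g \<Rightarrow> 'b" where
  "translate G B g b \<xi> = (\<lambda>h\<in>carrier G. bmult B b (\<xi> (inv\<^bsub>G\<^esub> g \<otimes>\<^sub>G h)))"

context unital_fell_bundle begin

abbreviation "tr \<equiv> translate G B"
abbreviation "lam \<equiv> regular_rep G B"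

lemma regular_rep_eq: "lam g b = ext_op F.Sec (tr g b)"
  by (simp add: regular_rep_def sections_eq translate_def[abs_def])

lemma tr_val_closed:
  assumes "g \<in> carrier G" "b \<in> carrier (fibre B g)" "\<xi> \<in> carrier F.Sec" "h \<in> carrier G"
  shows "bmult B b (\<xi> (inv g \<otimes> h)) \<in> carrier (fibre B h)"
  using bmult_closed[OF assms(1) _ assms(2) F.SecD(1)[OF assms(3)], of "inv g \<otimes> h"] assms
  by (simp add: cancel_inv_left)

lemma tr_closed:
  assumes g: "g \<in> carrier G" and b: "b \<in> carrier (fibre B g)" and x: "\<xi> \<in> carrier F.Sec"
  shows "tr g b \<xi> \<in> carrier F.Sec" unfolding translate_def
proof (rule F.SecI)
  show "finite ((\<lambda>k. g \<otimes> k) ` F.sp \<xi>)" using F.SecD(2)[OF x] by simp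
  fix h assume h: "h \<in> carrier G"
  show "bmult B b (\<xi> (inv g \<otimes> h)) \<in> carrier (fibre B h)" by (rule tr_val_closed[OF g b x h])
  assume "h \<notin> (\<lambda>k. g \<otimes> k) ` F.sp \<xi>"
  then have "inv g \<otimes> h \<notin> F.sp \<xi>" using g h cancel_inv_left[OF g h] by (metis image_eqI)
  then have "\<xi> (inv g \<otimes> h) = \<zero>\<^sub>(fibre B (inv g \<otimes> h))" using g h by (simp add: fam_supp_def)
  then show "bmult B b (\<xi> (inv g \<otimes> h)) = \<zero>\<^sub>(fibre B h)"
    using bm_zero_right[of g "inv g \<otimes> h" b] g h b by (simp add: cancel_inv_left)
qed

lemma tr_apply: "h \<in> carrier G \<Longrightarrow> tr g b \<xi> h = bmult B b (\<xi> (inv g \<otimes> h))" by (simp add: translate_def)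

lemma tr_linear:
  assumes g: "g \<in> carrier G" and b: "b \<in> carrier (fibre B g)"
  shows "clinear_map F.Sec F.Sec (tr g b)" unfolding clinear_map_def
proof (intro conjI ballI allI)
  show "tr g b \<in> carrier F.Sec \<rightarrow> carrier F.Sec" using tr_closed[OF g b] by auto
  fix x assume x: "x \<in> carrier F.Sec"
  { fix y assume y: "y \<in> carrier F.Sec"
    show "tr g b (x \<oplus>\<^sub>F.Sec y) = tr g b x \<oplus>\<^sub>F.Sec tr g b y"
    proof (rule F.Sec_eqI)
      fix h assume h: "h \<in> carrier G"
      have k: "inv g \<otimes> h \<in> carrier G" using g h by simp
      show "tr g b (x \<oplus>\<^sub>F.Sec y) h = (tr g b x \<oplus>\<^sub>F.Sec tr g b y) h"
        using bm_add_right[OF g k b F.SecD(1)[OF x k] F.SecD(1)[OF y k]] g h k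
        by (simp add: tr_apply cancel_inv_left)
    qed (intro tr_closed g b P.H.a_closed x y)+ }
  fix c
  show "tr g b (c \<odot>\<^sub>F.Sec x) = c \<odot>\<^sub>F.Sec tr g b x"
  proof (rule F.Sec_eqI)
    fix h assume h: "h \<in> carrier G"
    have k: "inv g \<otimes> h \<in> carrier G" using g h by simp
    show "tr g b (c \<odot>\<^sub>F.Sec x) h = (c \<odot>\<^sub>F.Sec tr g b x) h"
      using bm_smult_right[OF g k b F.SecD(1)[OF x k]] g h k by (simp add: tr_apply cancel_inv_left)
  qed (intro tr_closed g b P.H.smultC x)+
qed

lemma tr_comp:
  assumes g: "g \<in> carrier G" and h: "h \<in> carrier G" and a: "a \<in> carrier (fibre B g)" and b: "b \<in> carrier (fibre B h)"
    and x: "\<xi> \<in> carrier F.Sec"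
  shows "tr g a (tr h b \<xi>) = tr (g \<otimes> h) (bmult B a b) \<xi>"
proof (rule F.Sec_eqI)
  show "tr g a (tr h b \<xi>) \<in> carrier F.Sec" by (intro tr_closed g h a b x)
  show "tr (g \<otimes> h) (bmult B a b) \<xi> \<in> carrier F.Sec" by (intro tr_closed m_closed bmult_closed g h a b x)
  fix k assume k: "k \<in> carrier G"
  have gk: "inv g \<otimes> k \<in> carrier G" "inv h \<otimes> (inv g \<otimes> k) \<in> carrier G" using g h k by auto
  have "inv (g \<otimes> h) \<otimes> k = inv h \<otimes> (inv g \<otimes> k)" using g h k by (simp add: inv_mult_group m_assoc)
  then show "tr g a (tr h b \<xi>) k = tr (g \<otimes> h) (bmult B a b) \<xi> k"
    using k gk bmult_assoc[OF g h gk(2) a b F.SecD(1)[OF x gk(2)]] by (simp add: tr_apply)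
qed

lemma tr_unit:
  assumes x: "\<xi> \<in> carrier F.Sec" shows "tr \<one> \<one>\<^sub>Be \<xi> = \<xi>"
proof (rule F.Sec_eqI[OF _ x])
  show "tr \<one> \<one>\<^sub>Be \<xi> \<in> carrier F.Sec" using x by (intro tr_closed) auto
  fix h assume h: "h \<in> carrier G"
  show "tr \<one> \<one>\<^sub>Be \<xi> h = \<xi> h" using h unit_left'[OF h F.SecD(1)[OF x h]] by (simp add: tr_apply)
qed

lemma tr_add:
  assumes g: "g \<in> carrier G" and b: "b \<in> carrier (fibre B g)" and c: "c \<in> carrier (fibre B g)" and x: "\<xi> \<in> carrier F.Sec"
  shows "tr g (b \<oplus>\<^sub>(fibre B g) c) \<xi> = tr g b \<xi> \<oplus>\<^sub>F.Sec tr g c \<xi>"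
proof (rule F.Sec_eqI)
  interpret V: banach_space "fibre B g" by (rule fibre_banach[OF g])
  show "tr g (b \<oplus>\<^sub>(fibre B g) c) \<xi> \<in> carrier F.Sec" by (intro tr_closed g b c V.a_closed x)
  show "tr g b \<xi> \<oplus>\<^sub>F.Sec tr g c \<xi> \<in> carrier F.Sec" by (intro tr_closed g b c P.H.a_closed x)
  fix h assume h: "h \<in> carrier G"
  have k: "inv g \<otimes> h \<in> carrier G" using g h by simp
  show "tr g (b \<oplus>\<^sub>(fibre B g) c) \<xi> h = (tr g b \<xi> \<oplus>\<^sub>F.Sec tr g c \<xi>) h"
    using bm_add_left[OF g k b c F.SecD(1)[OF x k]] g h by (simp add: tr_apply cancel_inv_left)
qed

lemma tr_smult:
  assumes g: "g \<in> carrier G" and b: "b \<in> carrier (fibre B g)" and x: "\<xi> \<in> carrier F.Sec"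
  shows "tr g (z \<odot>\<^sub>(fibre B g) b) \<xi> = z \<odot>\<^sub>F.Sec tr g b \<xi>"
proof (rule F.Sec_eqI)
  interpret V: banach_space "fibre B g" by (rule fibre_banach[OF g])
  show "tr g (z \<odot>\<^sub>(fibre B g) b) \<xi> \<in> carrier F.Sec" by (intro tr_closed g b V.smultC x)
  show "z \<odot>\<^sub>F.Sec tr g b \<xi> \<in> carrier F.Sec" by (intro tr_closed g b P.H.smultC x)
  fix h assume h: "h \<in> carrier G"
  have k: "inv g \<otimes> h \<in> carrier G" using g h by simp
  show "tr g (z \<odot>\<^sub>(fibre B g) b) \<xi> h = (z \<odot>\<^sub>F.Sec tr g b \<xi>) h"
    using bm_smult_left[OF g k b F.SecD(1)[OF x k]] g h by (simp add: tr_apply cancel_inv_left)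
qed

text \<open>Substitute h = g k in the sum, which moves the support of the translated section back to
  that of \<xi>.\<close>

lemma tr_adjoint:
  assumes g: "g \<in> carrier G" and b: "b \<in> carrier (fibre B g)" and x: "\<xi> \<in> carrier F.Sec" and y: "\<eta> \<in> carrier F.Sec"
  shows "F.sip (tr g b \<xi>) \<eta> = F.sip \<xi> (tr (inv g) (bstar B b) \<eta>)"
proof -
  note ig = inv_closed[OF g] note sb = bstar_closed[OF g b]
  let ?F = "F.sp \<xi>" and ?h = "\<lambda>k. g \<otimes> k"
  have F: "finite ?F" "?F \<subseteq> carrier G" using F.SecD(2)[OF x] by (auto simp: fam_supp_def)
  have inj: "inj_on ?h ?F" using F(2)[THEN subsetD] g by (auto intro!: inj_onI)
  have "F.sp (tr g b \<xi>) \<subseteq> ?h ` ?F"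
  proof
    fix h assume "h \<in> F.sp (tr g b \<xi>)"
    then have h: "h \<in> carrier G" "bmult B b (\<xi> (inv g \<otimes> h)) \<noteq> \<zero>\<^sub>(fibre B h)" by (auto simp: fam_supp_def tr_apply)
    then have "\<xi> (inv g \<otimes> h) \<noteq> \<zero>\<^sub>(fibre B (inv g \<otimes> h))"
      using bm_zero_right[OF g _ b, of "inv g \<otimes> h"] g by (auto simp: cancel_inv_left)
    then have "inv g \<otimes> h \<in> ?F" using g h by (simp add: fam_supp_def)
    then show "h \<in> ?h ` ?F" using cancel_inv_left[OF g h(1)] by (metis image_eqI)
  qed
  then have "F.sip (tr g b \<xi>) \<eta> = (\<Oplus>\<^sub>Be h\<in>?h ` ?F. bmult B (bstar B (tr g b \<xi> h)) (\<eta> h))"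
    using F g by (intro F.sip_eq tr_closed g b x y) auto
  also have "\<dots> = (\<Oplus>\<^sub>Be k\<in>?F. bmult B (bstar B (tr g b \<xi> (g \<otimes> k))) (\<eta> (g \<otimes> k)))"
  proof (rule D.finsum_reindex[OF _ inj])
    have "bmult B (bstar B (tr g b \<xi> h)) (\<eta> h) \<in> carrier Be" if h: "h \<in> carrier G" for h
      by (rule F.q_closed[OF h F.SecD(1)[OF tr_closed[OF g b x] h] F.SecD(1)[OF y h]])
    then show "(\<lambda>h. bmult B (bstar B (tr g b \<xi> h)) (\<eta> h)) \<in> ?h ` ?F \<rightarrow> carrier Be" using F g by auto
  qed
  also have "\<dots> = (\<Oplus>\<^sub>Be k\<in>?F. bmult B (bstar B (\<xi> k)) (tr (inv g) (bstar B b) \<eta> k))"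
  proof (rule D.finsum_cong'[OF refl])
    show "(\<lambda>k. bmult B (bstar B (\<xi> k)) (tr (inv g) (bstar B b) \<eta> k)) \<in> ?F \<rightarrow> carrier Be"
      using F F.SecD(1)[OF x] F.SecD(1)[OF tr_closed[OF ig sb y]] F.q_closed by auto
    fix k assume "k \<in> ?F"
    then have k: "k \<in> carrier G" "g \<otimes> k \<in> carrier G" using F g by auto
    note xk = F.SecD(1)[OF x k(1)] and yk = F.SecD(1)[OF y k(2)]
    have "bstar B (bmult B b (\<xi> k)) = bmult B (bstar B (\<xi> k)) (bstar B b)" by (rule bstar_bmult[OF g k(1) b xk])
    then show "bmult B (bstar B (tr g b \<xi> (g \<otimes> k))) (\<eta> (g \<otimes> k)) = bmult B (bstar B (\<xi> k)) (tr (inv g) (bstar B b) \<eta> k)"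
      using k g bmult_assoc[OF inv_closed[OF k(1)] ig k(2) bstar_closed[OF k(1) xk] sb yk]
      by (simp add: tr_apply inv_cancel_left)
  qed
  also have "\<dots> = F.sip \<xi> (tr (inv g) (bstar B b) \<eta>)"
    using F by (intro F.sip_eq[symmetric] x tr_closed ig sb y) auto
  finally show ?thesis .
qed

text \<open>Since b* b \<le> ||b||^2 in \<open>B_e\<close>, one can write ||b||^2 - b* b = c* c. The
  squares of the translates of \<xi> by c and by b then add up to ||b||^2 times the square of \<xi>,
  and dropping a positive summand lowers the norm.\<close>

lemma tr_bound:
  assumes g: "g \<in> carrier G" and b: "b \<in> carrier (fibre B g)" and x: "\<xi> \<in> carrier F.Sec"
  shows "||tr g b \<xi>||\<^sub>F.Sec \<le> ||b||\<^sub>(fibre B g) * ||\<xi>||\<^sub>F.Sec"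
proof -
  note ig = inv_closed[OF g] note sb = bstar_closed[OF g b]
  interpret V: banach_space "fibre B g" by (rule fibre_banach[OF g])
  let ?n = "of_real ( ||b||\<^sub>(fibre B g)\<^sup>2)"
  define p where "p = bmult B (bstar B b) b"
  have p: "p \<in> carrier Be" using F.q_closed[OF g b b] by (simp add: p_def)
  have "positive Be (?n \<odot>\<^sub>Be \<one>\<^sub>Be \<ominus>\<^sub>Be p)"
    using F.q_star[OF g b b] F.q_nrm[OF g b] p by (intro D.positive_nrm_minus) (auto simp: p_def)
  then obtain c where c: "c \<in> carrier Be" "?n \<odot>\<^sub>Be \<one>\<^sub>Be \<ominus>\<^sub>Be p = star Be c \<otimes>\<^sub>Be c" by (auto simp: positive_def)
  have sq: "F.sip (tr h a \<xi>) (tr h a \<xi>) = F.sip \<xi> (tr \<one> (bmult B (bstar B a) a) \<xi>)"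
    if h: "h \<in> carrier G" and a: "a \<in> carrier (fibre B h)" for h a
    using tr_adjoint[OF h a x tr_closed[OF h a x]] tr_comp[OF inv_closed[OF h] h bstar_closed[OF h a] a x] h by simp
  have cc: "bmult B (bstar B c) c \<oplus>\<^sub>Be p = ?n \<odot>\<^sub>Be \<one>\<^sub>Be"
    using c(2) D.diff_add_cancel[of "?n \<odot>\<^sub>Be \<one>\<^sub>Be" p] p by (simp add: be_mult be_star)
  have cp: "bmult B (bstar B c) c \<in> carrier Be" using F.q_closed[of \<one> c c] c by simp
  have s: "F.sip (tr \<one> c \<xi>) (tr \<one> c \<xi>) \<oplus>\<^sub>Be F.sip (tr g b \<xi>) (tr g b \<xi>) = ?n \<odot>\<^sub>Be F.sip \<xi> \<xi>"
  proof -
    have "F.sip (tr \<one> c \<xi>) (tr \<one> c \<xi>) \<oplus>\<^sub>Be F.sip (tr g b \<xi>) (tr g b \<xi>) =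
      F.sip \<xi> (tr \<one> (bmult B (bstar B c) c) \<xi>) \<oplus>\<^sub>Be F.sip \<xi> (tr \<one> p \<xi>)"
      using sq[of \<one> c] sq[OF g b] c by (simp add: p_def)
    also have "\<dots> = F.sip \<xi> (tr \<one> (bmult B (bstar B c) c \<oplus>\<^sub>Be p) \<xi>)"
      using tr_add[of \<one> "bmult B (bstar B c) c" p \<xi>] cp p x
        P.ip_add[OF x tr_closed[of \<one> "bmult B (bstar B c) c", OF _ _ x] tr_closed[of \<one> p, OF _ _ x]]
      by (simp del: F.Sec_simps)
    also have "\<dots> = ?n \<odot>\<^sub>Be F.sip \<xi> \<xi>"
      unfolding cc using tr_smult[of \<one> "\<one>\<^sub>Be" \<xi> ?n] x by (simp add: tr_unit P.ip_smult del: F.Sec_simps)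
    finally show ?thesis .
  qed
  have tc: "tr \<one> c \<xi> \<in> carrier F.Sec" "tr g b \<xi> \<in> carrier F.Sec" using c g b x by (auto intro!: tr_closed)
  have "||F.sip (tr g b \<xi>) (tr g b \<xi>)||\<^sub>Be \<le> ||?n \<odot>\<^sub>Be F.sip \<xi> \<xi>||\<^sub>Be"
    unfolding s[symmetric] using P.ip_pos[OF tc(1)] P.ip_pos[OF tc(2)] D.npos_nrm_mono P.ip_closed tc
    by (subst D.a_comm) (auto simp: D.positive_iff_npos)
  also have "\<dots> = ( ||b||\<^sub>(fibre B g) * ||\<xi>||\<^sub>F.Sec)\<^sup>2"
    using x by (simp add: D.nrm_smult P.ip_closed norm_power power_mult_distrib)
  finally have "||tr g b \<xi>||\<^sub>F.Sec\<^sup>2 \<le> ( ||b||\<^sub>(fibre B g) * ||\<xi>||\<^sub>F.Sec)\<^sup>2" using P.nrm_ip[OF tc(2)] by simp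
  then show ?thesis by (rule power2_le_imp_le) (use V.nrm_nonneg[OF b] P.H.nrm_nonneg[OF x] in simp)
qed

lemma tr_bounded: "\<lbrakk>g \<in> carrier G; b \<in> carrier (fibre B g)\<rbrakk> \<Longrightarrow> bounded_map F.Sec F.Sec (tr g b)"
  using tr_bound unfolding bounded_map_def by blast

lemma lam_seq_class:
  "\<lbrakk>g \<in> carrier G; b \<in> carrier (fibre B g); x \<in> cauchy_seqs F.Sec\<rbrakk> \<Longrightarrow>
     lam g b (seq_class F.Sec x) = seq_class F.Sec (\<lambda>n. tr g b (x n))"
  unfolding regular_rep_eq by (rule P.H.ext_op_seq_class[OF tr_linear tr_bounded])

lemma lam_adj:
  assumes g: "g \<in> carrier G" and b: "b \<in> carrier (fibre B g)"
  shows "lam g b \<in> carrier L.Adj" "star L.Adj (lam g b) = lam (inv g) (bstar B b)"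
  using P.ext_op_adj[OF tr_linear[OF g b] tr_bounded[OF g b] tr_linear tr_bounded tr_adjoint[OF g b]]
    inv_closed[OF g] bstar_closed[OF g b] by (simp_all add: regular_rep_eq l2_eq l2_inner_eq)

lemma l2E:
  assumes "X \<in> carrier (l2 G B)" obtains x where "x \<in> cauchy_seqs F.Sec" "X = seq_class F.Sec x"
  using assms unfolding l2_eq by (rule P.H.completionE)

lemma lam_mult:
  assumes g: "g \<in> carrier G" and h: "h \<in> carrier G" and a: "a \<in> carrier (fibre B g)" and b: "b \<in> carrier (fibre B h)"
  shows "lam g a \<otimes>\<^sub>L.Adj lam h b = lam (g \<otimes> h) (bmult B a b)"
proof (rule L.adj_eqI)
  note ab = bmult_closed[OF g h a b] note gh = m_closed[OF g h]
  show "lam g a \<otimes>\<^sub>L.Adj lam h b \<in> carrier L.Adj" by (intro L.adj_mult lam_adj g h a b)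
  show "lam (g \<otimes> h) (bmult B a b) \<in> carrier L.Adj" by (rule lam_adj[OF gh ab])
  fix X assume X: "X \<in> carrier (l2 G B)"
  obtain x where x: "x \<in> cauchy_seqs F.Sec" "X = seq_class F.Sec x" using X by (rule l2E)
  note cx = P.H.cauchy_closed[OF x(1)]
  show "(lam g a \<otimes>\<^sub>L.Adj lam h b) X = lam (g \<otimes> h) (bmult B a b) X"
    using X by (simp add: x(2) lam_seq_class x(1) g h a b ab gh P.H.cauchy_map[OF tr_linear tr_bounded] tr_comp cx)
qed

lemma lam_add:
  assumes g: "g \<in> carrier G" and a: "a \<in> carrier (fibre B g)" and b: "b \<in> carrier (fibre B g)"
  shows "lam g (a \<oplus>\<^sub>(fibre B g) b) = lam g a \<oplus>\<^sub>L.Adj lam g b"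
proof (rule L.adj_eqI)
  interpret V: banach_space "fibre B g" by (rule fibre_banach[OF g])
  note ab = V.a_closed[OF a b]
  show "lam g (a \<oplus>\<^sub>(fibre B g) b) \<in> carrier L.Adj" by (rule lam_adj[OF g ab])
  show "lam g a \<oplus>\<^sub>L.Adj lam g b \<in> carrier L.Adj" by (intro L.adj_add lam_adj g a b)
  fix X assume X: "X \<in> carrier (l2 G B)"
  obtain x where x: "x \<in> cauchy_seqs F.Sec" "X = seq_class F.Sec x" using X by (rule l2E)
  note cx = P.H.cauchy_closed[OF x(1)]
  have "(lam g a \<oplus>\<^sub>L.Adj lam g b) X = seq_class F.Sec (\<lambda>n. tr g a (x n)) \<oplus>\<^sub>(completion F.Sec) seq_class F.Sec (\<lambda>n. tr g b (x n))"
    using X by (simp add: x(2) lam_seq_class x(1) g a b l2_eq)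
  also have "\<dots> = seq_class F.Sec (\<lambda>n. tr g a (x n) \<oplus>\<^sub>F.Sec tr g b (x n))"
    by (rule P.H.completion_add[OF P.H.cauchy_map[OF tr_linear[OF g a] tr_bounded[OF g a] x(1)]
          P.H.cauchy_map[OF tr_linear[OF g b] tr_bounded[OF g b] x(1)]])
  also have "\<dots> = lam g (a \<oplus>\<^sub>(fibre B g) b) X"
    by (simp add: x(2) lam_seq_class x(1) g ab tr_add[OF g a b cx] del: F.Sec_simps)
  finally show "lam g (a \<oplus>\<^sub>(fibre B g) b) X = (lam g a \<oplus>\<^sub>L.Adj lam g b) X" by simp
qed

lemma lam_smult:
  assumes g: "g \<in> carrier G" and a: "a \<in> carrier (fibre B g)"
  shows "lam g (c \<odot>\<^sub>(fibre B g) a) = c \<odot>\<^sub>L.Adj lam g a"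
proof (rule L.adj_eqI)
  interpret V: banach_space "fibre B g" by (rule fibre_banach[OF g])
  note ca = V.smultC[OF a, of c]
  show "lam g (c \<odot>\<^sub>(fibre B g) a) \<in> carrier L.Adj" by (rule lam_adj[OF g ca])
  show "c \<odot>\<^sub>L.Adj lam g a \<in> carrier L.Adj" by (intro L.adj_smult lam_adj g a)
  fix X assume X: "X \<in> carrier (l2 G B)"
  obtain x where x: "x \<in> cauchy_seqs F.Sec" "X = seq_class F.Sec x" using X by (rule l2E)
  note cx = P.H.cauchy_closed[OF x(1)]
  have "(c \<odot>\<^sub>L.Adj lam g a) X = c \<odot>\<^sub>(completion F.Sec) seq_class F.Sec (\<lambda>n. tr g a (x n))"
    using X by (simp add: x(2) lam_seq_class x(1) g a l2_eq)
  also have "\<dots> = seq_class F.Sec (\<lambda>n. c \<odot>\<^sub>F.Sec tr g a (x n))"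
    by (rule P.H.completion_smult[OF P.H.cauchy_map[OF tr_linear[OF g a] tr_bounded[OF g a] x(1)]])
  also have "\<dots> = lam g (c \<odot>\<^sub>(fibre B g) a) X"
    by (simp add: x(2) lam_seq_class x(1) g ca tr_smult[OF g a cx] del: F.Sec_simps)
  finally show "lam g (c \<odot>\<^sub>(fibre B g) a) X = (c \<odot>\<^sub>L.Adj lam g a) X" by simp
qed

lemma lam_one: "lam \<one> \<one>\<^sub>Be = \<one>\<^sub>L.Adj"
proof (rule L.adj_eqI[OF lam_adj(1) L.adj_one])
  fix X assume X: "X \<in> carrier (l2 G B)"
  obtain x where x: "x \<in> cauchy_seqs F.Sec" "X = seq_class F.Sec x" using X by (rule l2E)
  show "lam \<one> \<one>\<^sub>Be X = \<one>\<^sub>L.Adj X"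
    using X by (simp add: x(2) lam_seq_class x(1) tr_unit P.H.cauchy_closed[OF x(1)])
qed simp_all

end

section \<open>The reduced algebra and its conditional expectation\<close>

lemma (in seminormed) tends_finsum:
  assumes "finite I" "\<And>i. i \<in> I \<Longrightarrow> tends (\<lambda>n. f n i) (l i) F"
    "\<And>n i. i \<in> I \<Longrightarrow> f n i \<in> carrier V" "\<And>i. i \<in> I \<Longrightarrow> l i \<in> carrier V"
  shows "tends (\<lambda>n. \<Oplus>i\<in>I. f n i) (\<Oplus>i\<in>I. l i) F" using assms
proof (induction I rule: finite_induct)
  case (insert j I)
  have "tends (\<lambda>n. f n j \<oplus> (\<Oplus>i\<in>I. f n i)) (l j \<oplus> (\<Oplus>i\<in>I. l i)) F"
    using insert by (intro tends_add finsum_closed) auto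
  moreover have "(\<Oplus>i\<in>insert j I. f n i) = f n j \<oplus> (\<Oplus>i\<in>I. f n i)" for n
    using insert by (intro finsum_insert) auto
  moreover have "(\<Oplus>i\<in>insert j I. l i) = l j \<oplus> (\<Oplus>i\<in>I. l i)" using insert by (intro finsum_insert) auto
  ultimately show ?case by simp
qed simp

context unital_fell_bundle begin

abbreviation "RA \<equiv> reduced_algebra G B"

abbreviation "lam_gens \<equiv> {lam g b | g b. g \<in> carrier G \<and> b \<in> carrier (fibre B g)}"

lemma RA_carrier: "carrier RA = \<Inter>{S. lam_gens \<subseteq> S \<and> closed_star_subalgebra L.Adj S}"
  by (simp add: reduced_algebra_def generated_cstar_def adjointable_eq)

lemma RA_eq: "RA = L.Adj\<lparr>carrier := carrier RA\<rparr>"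
  by (simp add: reduced_algebra_def generated_cstar_def adjointable_eq)

lemma RA_ops: "mult RA = mult L.Adj" "add RA = add L.Adj" "zero RA = zero L.Adj" "one RA = one L.Adj"
  "smult RA = smult L.Adj" "nrm RA = nrm L.Adj" "star RA = star L.Adj"
  by (simp_all add: reduced_algebra_def generated_cstar_def adjointable_eq)

lemma RA_closed: "closed_star_subalgebra L.Adj (carrier RA)"
proof -
  interpret AA: ucstar L.Adj by (rule L.ucstar_adj)
  have "lam_gens \<subseteq> carrier L.Adj" using lam_adj(1) by blast
  then have "carrier L.Adj \<in> {S. lam_gens \<subseteq> S \<and> closed_star_subalgebra L.Adj S}"
    using AA.closed_star_subalgebra_carrier by simp
  then show ?thesis unfolding RA_carrier by (intro closed_star_subalgebra_Inter) auto
qed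

lemma RA_sub: "x \<in> carrier RA \<Longrightarrow> x \<in> carrier L.Adj" using RA_closed unfolding closed_star_subalgebra_def by blast

lemma lam_RA: "\<lbrakk>g \<in> carrier G; b \<in> carrier (fibre B g)\<rbrakk> \<Longrightarrow> lam g b \<in> carrier RA" unfolding RA_carrier by blast

lemma ucstar_RA: "ucstar RA" and RA_minus: "\<lbrakk>x \<in> carrier RA; y \<in> carrier RA\<rbrakk> \<Longrightarrow> x \<ominus>\<^sub>RA y = x \<ominus>\<^sub>L.Adj y"
proof -
  interpret AA: ucstar L.Adj by (rule L.ucstar_adj)
  have one: "\<one>\<^sub>L.Adj \<in> carrier RA" using lam_RA[of \<one> "\<one>\<^sub>Be"] lam_one by simp
  show "ucstar RA" using AA.ucstar_subalgebra(1)[OF RA_closed one] RA_eq by simp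
  show "\<lbrakk>x \<in> carrier RA; y \<in> carrier RA\<rbrakk> \<Longrightarrow> x \<ominus>\<^sub>RA y = x \<ominus>\<^sub>L.Adj y"
    using AA.ucstar_subalgebra(2)[OF RA_closed one, of x y] RA_eq by simp
qed

end

sublocale unital_fell_bundle \<subseteq> A: ucstar "reduced_algebra G B"
  by (rule ucstar_RA)

text \<open>Sums of generators already form the linear span, because a scalar multiple of a
  generator is again a generator.\<close>

inductive_set (in unital_fell_bundle) lam_span where
  gen: "\<lbrakk>g \<in> carrier G; b \<in> carrier (fibre B g)\<rbrakk> \<Longrightarrow> lam g b \<in> lam_span"
| add: "\<lbrakk>x \<in> lam_span; y \<in> lam_span\<rbrakk> \<Longrightarrow> x \<oplus>\<^sub>RA y \<in> lam_span"

context unital_fell_bundle begin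

lemma RA_lam_mult:
  "\<lbrakk>g \<in> carrier G; h \<in> carrier G; a \<in> carrier (fibre B g); b \<in> carrier (fibre B h)\<rbrakk>
    \<Longrightarrow> lam g a \<otimes>\<^sub>RA lam h b = lam (g \<otimes> h) (bmult B a b)" unfolding RA_ops by (rule lam_mult)

lemma RA_lam_star: "\<lbrakk>g \<in> carrier G; b \<in> carrier (fibre B g)\<rbrakk> \<Longrightarrow> star RA (lam g b) = lam (inv g) (bstar B b)"
  unfolding RA_ops by (rule lam_adj)

lemma RA_lam_add:
  "\<lbrakk>g \<in> carrier G; a \<in> carrier (fibre B g); b \<in> carrier (fibre B g)\<rbrakk>
    \<Longrightarrow> lam g (a \<oplus>\<^sub>(fibre B g) b) = lam g a \<oplus>\<^sub>RA lam g b" unfolding RA_ops by (rule lam_add)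

lemma RA_lam_smult:
  "\<lbrakk>g \<in> carrier G; a \<in> carrier (fibre B g)\<rbrakk> \<Longrightarrow> lam g (c \<odot>\<^sub>(fibre B g) a) = c \<odot>\<^sub>RA lam g a"
  unfolding RA_ops by (rule lam_smult)

lemma RA_lam_one: "lam \<one> \<one>\<^sub>Be = \<one>\<^sub>RA" unfolding RA_ops by (rule lam_one)

lemma RA_lam_linear: "g \<in> carrier G \<Longrightarrow> clinear_map (fibre B g) RA (lam g)"
  by (auto simp: clinear_map_def RA_lam_add RA_lam_smult lam_RA)

lemma lam_span_RA: "x \<in> lam_span \<Longrightarrow> x \<in> carrier RA" by (induction rule: lam_span.induct) (auto intro: lam_RA)

lemma lam_span_smult: "x \<in> lam_span \<Longrightarrow> c \<odot>\<^sub>RA x \<in> lam_span"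
proof (induction rule: lam_span.induct)
  case (gen g b)
  interpret V: banach_space "fibre B g" by (rule fibre_banach[OF gen(1)])
  show ?case using gen by (simp add: RA_lam_smult[symmetric] lam_span.gen)
next
  case (add x y)
  then show ?case by (simp add: A.smult_add_r lam_span_RA lam_span.add)
qed

lemma lam_span_star: "x \<in> lam_span \<Longrightarrow> star RA x \<in> lam_span"
proof (induction rule: lam_span.induct)
  case (gen g b)
  then show ?case by (simp add: RA_lam_star lam_span.gen bstar_closed)
next
  case (add x y)
  then show ?case by (simp add: A.star_add lam_span_RA lam_span.add)
qed

lemma lam_span_mult: assumes "x \<in> lam_span" "y \<in> lam_span" shows "x \<otimes>\<^sub>RA y \<in> lam_span" using assms(1)
proof (induction rule: lam_span.induct)
  case (gen g b)
  show ?case using assms(2)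
  proof (induction rule: lam_span.induct)
    case (gen h c)
    then show ?case using \<open>g \<in> carrier G\<close> \<open>b \<in> carrier (fibre B g)\<close>
      by (simp add: RA_lam_mult lam_span.gen bmult_closed)
  next
    case (add x y)
    then show ?case using lam_RA[OF gen] by (simp add: A.r_distr lam_span_RA lam_span.add)
  qed
next
  case (add x z)
  then show ?case using assms(2) by (simp add: A.l_distr lam_span_RA lam_span.add)
qed

text \<open>The limits of sequences from the span form a star subalgebra that contains the
  generators. It is closed by a diagonal choice with errors 1/(n+1), so it contains the generated
  C*-algebra.\<close>

lemma lam_span_dense:
  assumes "x \<in> carrier RA" shows "\<exists>s. (\<forall>n. s n \<in> lam_span) \<and> A.tends s x sequentially"
proof -
  interpret AA: ucstar L.Adj by (rule L.ucstar_adj)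
  define C where "C = {x \<in> carrier RA. \<exists>s. (\<forall>n. s n \<in> lam_span) \<and> A.tends s x sequentially}"
  have nd: "ndist L.Adj x y = ndist RA x y" if "x \<in> carrier RA" "y \<in> carrier RA" for x y
    using that RA_sub by (simp add: ndist_def RA_minus RA_ops)
  have CI: "x \<in> C" if "x \<in> carrier RA" "\<And>n. s n \<in> lam_span" "A.tends s x sequentially" for x s
    unfolding C_def by (rule CollectI, intro conjI exI[of _ s] allI) (rule that)+
  have gens: "lam_gens \<subseteq> C"
  proof
    fix x assume "x \<in> lam_gens"
    then obtain g b where gb: "g \<in> carrier G" "b \<in> carrier (fibre B g)" "x = lam g b" by blast
    then show "x \<in> C" using lam_RA[OF gb(1,2)] lam_span.gen[OF gb(1,2)] by (intro CI[of x "\<lambda>_. x"]) simp_all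
  qed
  have "closed_star_subalgebra L.Adj C" unfolding closed_star_subalgebra_def RA_ops[symmetric]
  proof (intro conjI ballI allI impI)
    show "C \<subseteq> carrier L.Adj" using RA_sub by (auto simp: C_def)
    interpret V: banach_space "fibre B \<one>" by (rule fibre_banach[OF one_closed])
    have "lam \<one> (0 \<odot>\<^sub>(fibre B \<one>) \<one>\<^sub>Be) = \<zero>\<^sub>RA" using RA_lam_smult[of \<one> "\<one>\<^sub>Be" 0] lam_RA[of \<one> "\<one>\<^sub>Be"] by simp
    moreover have "lam \<one> (0 \<odot>\<^sub>(fibre B \<one>) \<one>\<^sub>Be) \<in> C"
      using gens V.smultC[of "\<one>\<^sub>Be" 0] one_closed D.one_closed by fastforce
    ultimately show "\<zero>\<^sub>RA \<in> C" by simp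
    fix x assume x: "x \<in> C"
    then obtain s where s: "\<And>n. s n \<in> lam_span" "A.tends s x sequentially" and xc: "x \<in> carrier RA" by (auto simp: C_def)
    note sc = lam_span_RA[OF s(1)]
    { fix c show "c \<odot>\<^sub>RA x \<in> C"
        by (rule CI[OF A.smultC[OF xc] lam_span_smult[OF s(1)] A.tends_smult[OF s(2) sc xc]]) }
    show "star RA x \<in> C"
      by (rule CI[OF A.star_closed[OF xc] lam_span_star[OF s(1)] A.tends_star[OF s(2) sc xc]])
    fix y assume y: "y \<in> C"
    then obtain t where t: "\<And>n. t n \<in> lam_span" "A.tends t y sequentially" and yc: "y \<in> carrier RA" by (auto simp: C_def)
    note tc = lam_span_RA[OF t(1)]
    show "x \<oplus>\<^sub>RA y \<in> C"
      by (rule CI[OF A.a_closed[OF xc yc] lam_span.add[OF s(1) t(1)] A.tends_add[OF s(2) t(2) sc tc xc yc]])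
    show "x \<otimes>\<^sub>RA y \<in> C"
      by (rule CI[OF A.m_closed[OF xc yc] lam_span_mult[OF s(1) t(1)] A.tends_mult[OF s(2) t(2) sc tc xc yc]])
  next
    fix x l assume xl: "(\<forall>n. x n \<in> C) \<and> l \<in> carrier L.Adj \<and> (\<lambda>n. ndist L.Adj (x n) l) \<longlonglongrightarrow> 0"
    then have xc: "x n \<in> carrier RA" for n by (auto simp: C_def)
    have lc: "l \<in> carrier RA" using xl xc RA_closed unfolding closed_star_subalgebra_def by blast
    have xl': "A.tends x l sequentially" using xl nd[OF xc lc] by simp
    have "\<exists>y\<in>lam_span. ndist RA (x n) y < 1 / Suc n" for n
    proof -
      obtain s where s: "\<And>k. s k \<in> lam_span" "A.tends s (x n) sequentially" using xl by (auto simp: C_def)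
      from LIMSEQ_D[OF s(2), of "1 / Suc n"] obtain k where "norm (ndist RA (s k) (x n) - 0) < 1 / Suc n" by auto
      then show ?thesis using s(1) by (auto simp: A.ndist_sym)
    qed
    then obtain y where y: "\<And>n. y n \<in> lam_span" "\<And>n. ndist RA (x n) (y n) < 1 / Suc n" by metis
    have 1: "(\<lambda>n. 1 / real (Suc n)) \<longlonglongrightarrow> 0" by (rule LIMSEQ_Suc[OF lim_1_over_n])
    have "A.tends y l sequentially"
    proof (rule tendsto_0_le_add[OF 1 xl'])
      fix n show "ndist RA (y n) l \<le> 1 / real (Suc n) + ndist RA (x n) l"
        using A.ndist_triangle[OF lam_span_RA[OF y(1)] xc lc, of n n] y(2)[of n] A.ndist_sym[of "y n" "x n"] by linarith
    qed simp
    then show "l \<in> C" by (rule CI[OF lc y(1)])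
  qed
  then have "carrier RA \<subseteq> C" using gens unfolding RA_carrier by blast
  then show ?thesis using assms unfolding C_def by blast
qed

text \<open>Reduces statements that are additive and continuous in x to the generators. It carries
  the formula of \<open>Ex_conj\<close>, the uniqueness of the expectation and the convergence of
  the averaged maps.\<close>

lemma RA_induct [consumes 1, case_names gen add lim]:
  assumes x: "x \<in> carrier RA"
    and gen: "\<And>g b. \<lbrakk>g \<in> carrier G; b \<in> carrier (fibre B g)\<rbrakk> \<Longrightarrow> P (lam g b)"
    and add: "\<And>x y. \<lbrakk>x \<in> carrier RA; y \<in> carrier RA; P x; P y\<rbrakk> \<Longrightarrow> P (x \<oplus>\<^sub>RA y)"
    and lim: "\<And>s l. \<lbrakk>\<And>n. s n \<in> carrier RA; \<And>n. P (s n); l \<in> carrier RA; A.tends s l sequentially\<rbrakk> \<Longrightarrow> P l"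
  shows "P x"
proof -
  have sp: "P y" if "y \<in> lam_span" for y using that
    by (induction rule: lam_span.induct) (auto intro: gen add lam_span_RA)
  obtain s where s: "\<And>n. s n \<in> lam_span" "A.tends s x sequentially" using lam_span_dense[OF x] by blast
  show ?thesis by (rule lim[of s]) (use s sp lam_span_RA x in auto)
qed

section \<open>The conditional expectation as a coefficient at the unit vector over the neutral
  element\<close>

definition dsec where
  "dsec = (\<lambda>h\<in>carrier G. if h = \<one> then \<one>\<^sub>Be else \<zero>\<^sub>(fibre B h))"

definition delta where "delta = seq_class F.Sec (\<lambda>n. dsec)"

lemma fib_zero_closed: "g \<in> carrier G \<Longrightarrow> \<zero>\<^sub>(fibre B g) \<in> carrier (fibre B g)"
  using fib_seminormed[of g] by (simp add: seminormed_def module_def abelian_group_def abelian_monoid.zero_closed)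

lemma dsec_closed: "dsec \<in> carrier F.Sec"
  unfolding dsec_def by (rule F.SecI[where F = "{\<one>}"]) (auto simp: fib_zero_closed)

lemma tr_dsec:
  assumes g: "g \<in> carrier G" and b: "b \<in> carrier (fibre B g)" and h: "h \<in> carrier G"
  shows "tr g b dsec h = (if h = g then b else \<zero>\<^sub>(fibre B h))"
proof (cases "h = g")
  case True
  then show ?thesis using g b unit_right'[OF g b] by (simp add: tr_apply dsec_def)
next
  case False
  then have "inv g \<otimes> h \<noteq> \<one>" using g h by (metis cancel_inv_left r_one)
  then show ?thesis using g h False bm_zero_right[of g "inv g \<otimes> h" b] b
    by (simp add: tr_apply dsec_def cancel_inv_left)
qed

lemma sip_tr_dsec:
  assumes g: "g \<in> carrier G" and b: "b \<in> carrier (fibre B g)" and x: "\<xi> \<in> carrier F.Sec"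
  shows "F.sip \<xi> (tr g b dsec) = bmult B (bstar B (\<xi> g)) b"
proof -
  have "F.sp (tr g b dsec) \<subseteq> {g}" using tr_dsec[OF g b] by (auto simp: fam_supp_def split: if_splits)
  then have "F.sip \<xi> (tr g b dsec) = (\<Oplus>\<^sub>Be h\<in>{g}. bmult B (bstar B (\<xi> h)) (tr g b dsec h))"
    using g by (intro F.sip_eq2 x tr_closed g b dsec_closed) auto
  then show ?thesis using F.q_closed[OF g F.SecD(1)[OF x g] b] by (simp add: tr_dsec[OF g b g])
qed

lemma tr_unit_dsec: "tr \<one> \<one>\<^sub>Be dsec = dsec" by (rule tr_unit[OF dsec_closed])

lemma delta_closed: "delta \<in> carrier (l2 G B)"
  unfolding delta_def l2_eq by (intro P.H.seq_class_closed P.H.cauchy_const dsec_closed)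

lemma lam_delta: "\<lbrakk>g \<in> carrier G; b \<in> carrier (fibre B g)\<rbrakk> \<Longrightarrow> lam g b delta = seq_class F.Sec (\<lambda>n. tr g b dsec)"
  unfolding delta_def by (rule lam_seq_class) (auto intro: P.H.cauchy_const dsec_closed)

lemma nrm_delta: "||delta||\<^sub>(l2 G B) \<le> 1"
proof -
  have "F.sip dsec dsec = bmult B (bstar B (dsec \<one>)) \<one>\<^sub>Be"
    using sip_tr_dsec[of \<one> "\<one>\<^sub>Be" dsec] dsec_closed by (simp add: tr_unit_dsec)
  also have "\<dots> = star Be \<one>\<^sub>Be \<otimes>\<^sub>Be \<one>\<^sub>Be" by (simp only: dsec_def be_star be_mult) simp
  also have "\<dots> = \<one>\<^sub>Be" by simp
  finally have "||dsec||\<^sub>F.Sec\<^sup>2 \<le> 1" using P.nrm_ip[OF dsec_closed] D.nrm_one_le by simp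
  then have "||dsec||\<^sub>F.Sec \<le> 1" by (metis power2_le_imp_le power_one zero_le_one)
  then show ?thesis unfolding delta_def l2_eq using P.H.seq_class_const_nrm[OF dsec_closed] by simp
qed

text \<open>A concrete formula for the expectation, which \<open>expectation\<close> only describes
  by its properties and selects with SOME; see \<open>expectation_eq\<close>.\<close>

definition Ex where
  "Ex x = l2_inner G B delta (x delta)"

lemma RA_delta: "x \<in> carrier RA \<Longrightarrow> x delta \<in> carrier (l2 G B)" using L.adjD(4)[OF RA_sub delta_closed] .

lemma Ex_closed: "x \<in> carrier RA \<Longrightarrow> Ex x \<in> carrier Be"
  unfolding Ex_def by (intro L.ip_closed delta_closed RA_delta)

lemma Ex_lam:
  assumes g: "g \<in> carrier G" and b: "b \<in> carrier (fibre B g)"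
  shows "Ex (lam g b) = (if g = \<one> then b else \<zero>\<^sub>Be)"
proof -
  have "Ex (lam g b) = F.sip dsec (tr g b dsec)"
    unfolding Ex_def lam_delta[OF g b] unfolding delta_def l2_inner_eq
    by (intro P.completion_ip_const dsec_closed tr_closed g b)
  also have "\<dots> = bmult B (bstar B (dsec g)) b" by (rule sip_tr_dsec[OF g b dsec_closed])
  also have "\<dots> = (if g = \<one> then b else \<zero>\<^sub>Be)"
  proof (cases "g = \<one>")
    case True
    then have "bmult B (bstar B (dsec g)) b = star Be \<one>\<^sub>Be \<otimes>\<^sub>Be b" by (simp only: dsec_def be_star be_mult) simp
    then show ?thesis using True b by simp
  next
    case False
    then show ?thesis using g F.q_zero_left[OF g b] by (simp add: dsec_def)
  qed
  finally show ?thesis .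
qed

lemma Ex_add: "\<lbrakk>x \<in> carrier RA; y \<in> carrier RA\<rbrakk> \<Longrightarrow> Ex (x \<oplus>\<^sub>RA y) = Ex x \<oplus>\<^sub>Be Ex y"
  using delta_closed by (simp add: Ex_def RA_ops L.ip_add RA_delta)

lemma Ex_smult: "x \<in> carrier RA \<Longrightarrow> Ex (c \<odot>\<^sub>RA x) = c \<odot>\<^sub>Be Ex x"
  using delta_closed by (simp add: Ex_def RA_ops L.ip_smult RA_delta)

lemma Ex_linear: "clinear_map RA Be Ex" by (auto simp: clinear_map_def Ex_closed Ex_add Ex_smult)

lemma Ex_nrm: assumes "x \<in> carrier RA" shows "||Ex x||\<^sub>Be \<le> ||x||\<^sub>RA"
proof -
  have n0: "0 \<le> ||x||\<^sub>RA" using assms by simp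
  have d0: "0 \<le> ||delta||\<^sub>(l2 G B)" by (rule L.H.nrm_nonneg[OF delta_closed])
  have "||Ex x||\<^sub>Be \<le> ||delta||\<^sub>(l2 G B) * ||x delta||\<^sub>(l2 G B)"
    unfolding Ex_def by (intro L.ip_CS delta_closed RA_delta assms)
  also have "\<dots> \<le> 1 * ( ||x||\<^sub>RA * ||delta||\<^sub>(l2 G B))"
    using L.adjD(7)[OF RA_sub[OF assms] delta_closed] nrm_delta d0 L.H.nrm_nonneg[OF RA_delta[OF assms]] n0
    unfolding RA_ops by (intro mult_mono) auto
  also have "\<dots> \<le> ||x||\<^sub>RA" using nrm_delta n0 by (simp add: mult_left_le)
  finally show ?thesis .
qed

lemma Ex_star_mult: assumes "x \<in> carrier RA" "y \<in> carrier RA"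
  shows "Ex (star RA y \<otimes>\<^sub>RA x) = l2_inner G B (y delta) (x delta)" unfolding Ex_def RA_ops
  using L.adj_star(3)[OF RA_sub[OF assms(2)] delta_closed RA_delta[OF assms(1)]] delta_closed by simp

lemma Ex_star: assumes "x \<in> carrier RA" shows "Ex (star RA x) = star Be (Ex x)"
proof -
  have "Ex (star RA x) = l2_inner G B (x delta) delta"
    unfolding Ex_def RA_ops by (rule L.adj_star(3)[OF RA_sub[OF assms] delta_closed delta_closed, symmetric])
  then show ?thesis unfolding Ex_def by (simp add: L.ip_star delta_closed RA_delta[OF assms])
qed

lemma Ex_positive: assumes "positive RA x" shows "positive Be (Ex x)"
proof -
  obtain c where c: "c \<in> carrier RA" "x = star RA c \<otimes>\<^sub>RA c" using assms by (auto simp: positive_def)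
  then show ?thesis by (simp add: Ex_star_mult L.ip_pos RA_delta)
qed

text \<open>For x of degree h the product has degree g^-1 h g, which is neutral exactly when h is;
  so the formula holds on generators and extends by linearity and continuity. It yields the bimodule
  property (g neutral), faithfulness, and the behaviour of E under conjugation by u(g).\<close>

lemma Ex_conj:
  assumes g: "g \<in> carrier G" and a: "a \<in> carrier (fibre B g)" and b: "b \<in> carrier (fibre B g)" and x: "x \<in> carrier RA"
  shows "Ex (star RA (lam g a) \<otimes>\<^sub>RA x \<otimes>\<^sub>RA lam g b) = bmult B (bmult B (bstar B a) (Ex x)) b"
proof -
  note ig = inv_closed[OF g] note sa = bstar_closed[OF g a]
  note la = lam_RA[OF g a] note lb = lam_RA[OF g b]
  define f where "f d = bmult B (bmult B (bstar B a) d) b" for d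
  have sac: "bmult B (bstar B a) d \<in> carrier (fibre B (inv g))" if "d \<in> carrier Be" for d
    using bmult_closed[OF ig one_closed sa] that g by simp
  have fc: "f d \<in> carrier Be" if "d \<in> carrier Be" for d
    using bmult_closed[OF ig g sac[OF that] b] g by (simp add: f_def)
  have f_add: "f (d \<oplus>\<^sub>Be e) = f d \<oplus>\<^sub>Be f e" if "d \<in> carrier Be" "e \<in> carrier Be" for d e
    using bm_add_right[OF ig one_closed sa, of d e] bm_add_left[OF ig g sac[OF that(1)] sac[OF that(2)] b] that g
    by (simp add: f_def)
  have f_smult: "f (c \<odot>\<^sub>Be d) = c \<odot>\<^sub>Be f d" if "d \<in> carrier Be" for c d
    using bm_smult_right[OF ig one_closed sa, of d c] bm_smult_left[OF ig g sac[OF that] b] that g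
    by (simp add: f_def)
  have f_lin: "clinear_map Be Be f" by (auto simp: clinear_map_def fc f_add f_smult)
  have f_bd: "||f d||\<^sub>Be \<le> ( ||a||\<^sub>(fibre B g) * ||b||\<^sub>(fibre B g)) * ||d||\<^sub>Be" if d: "d \<in> carrier Be" for d
  proof -
    interpret V: banach_space "fibre B g" by (rule fibre_banach[OF g])
    have "||f d||\<^sub>Be \<le> ||bmult B (bstar B a) d||\<^sub>(fibre B (inv g)) * ||b||\<^sub>(fibre B g)"
      using nrm_bmult[OF ig g sac[OF d] b] g by (simp add: f_def)
    also have "\<dots> \<le> ( ||a||\<^sub>(fibre B g) * ||d||\<^sub>Be) * ||b||\<^sub>(fibre B g)"
      using nrm_bmult[OF ig one_closed sa, of d] d g nrm_bstar[OF g a] b by (intro mult_right_mono) auto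
    finally show ?thesis by (simp add: mult_ac)
  qed
  show ?thesis using x unfolding f_def[symmetric]
  proof (induction rule: RA_induct)
    case (gen h c)
    have hg: "h \<otimes> g \<in> carrier G" using gen g by simp
    have e: "star RA (lam g a) \<otimes>\<^sub>RA lam h c \<otimes>\<^sub>RA lam g b = lam (inv g \<otimes> h \<otimes> g) (f c)"
      using gen g a b sa bmult_closed[OF ig gen(1) sa gen(2)] by (simp add: RA_lam_star RA_lam_mult f_def)
    have fcc: "f c \<in> carrier (fibre B (inv g \<otimes> h \<otimes> g))"
      unfolding f_def using gen g b sa by (intro bmult_closed) auto
    have "inv g \<otimes> h \<otimes> g = \<one> \<longleftrightarrow> h = \<one>"
    proof
      assume "inv g \<otimes> h \<otimes> g = \<one>"
      then have "inv g \<otimes> (h \<otimes> g) = \<one>" using g gen by (simp add: m_assoc)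
      then have "h \<otimes> g = g" using g hg by (metis cancel_inv_left r_one)
      then show "h = \<one>" using g gen by simp
    qed (use g in simp)
    moreover have "f \<zero>\<^sub>Be = \<zero>\<^sub>Be" by (rule D.clinear_map_zero[OF f_lin D.seminormed_axioms])
    ultimately show ?case unfolding e using gen g fcc by (simp add: Ex_lam)
  next
    case (add x y)
    then show ?case using la lb by (simp add: A.l_distr A.r_distr Ex_add f_add Ex_closed)
  next
    case (lim s l)
    let ?h = "\<lambda>x. star RA (lam g a) \<otimes>\<^sub>RA x \<otimes>\<^sub>RA lam g b"
    have ht: "A.tends (\<lambda>n. ?h (s n)) (?h l) sequentially" using lim la lb by (intro A.tends_mult) auto
    have hc: "?h (s n) \<in> carrier RA" "?h l \<in> carrier RA" for n using lim la lb by auto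
    have t1: "D.tends (\<lambda>n. Ex (?h (s n))) (Ex (?h l)) sequentially"
      by (rule A.tends_Lipschitz[OF ht A.bounded_ndist[OF Ex_linear D.seminormed_axioms, of 1] D.seminormed_axioms])
        (use Ex_nrm hc in auto)
    have t2: "D.tends (\<lambda>n. Ex (s n)) (Ex l) sequentially"
      by (rule A.tends_Lipschitz[OF lim(3) A.bounded_ndist[OF Ex_linear D.seminormed_axioms, of 1] D.seminormed_axioms])
        (use Ex_nrm lim in auto)
    have t3: "D.tends (\<lambda>n. f (Ex (s n))) (f (Ex l)) sequentially"
      by (rule D.tends_Lipschitz[OF t2 D.bounded_ndist[OF f_lin D.seminormed_axioms f_bd] D.seminormed_axioms])
        (use lim Ex_closed in auto)
    show ?case by (rule D.tends_unique[OF t1]) (use t3 hc Ex_closed fc lim(1,2,4) in auto)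
  qed
qed

text \<open>If E(x* x) = 0, then by \<open>Ex_conj\<close> also E vanishes at the square of x
  \<open>lam g b\<close>, so x annihilates every vector \<open>lam g b delta\<close>. Hence each
  vector in the range of the adjoint of x is orthogonal to all of these, and they span a dense
  subspace.\<close>

lemma Ex_faithful:
  assumes x: "x \<in> carrier RA" and e: "Ex (star RA x \<otimes>\<^sub>RA x) = \<zero>\<^sub>Be"
  shows "x = \<zero>\<^sub>RA"
proof -
  have xx: "star RA x \<otimes>\<^sub>RA x \<in> carrier RA" using x by simp
  have kill: "x (lam g b delta) = \<zero>\<^sub>(l2 G B)" if g: "g \<in> carrier G" and b: "b \<in> carrier (fibre B g)" for g b
  proof -
    note lb = lam_RA[OF g b]
    have xl: "x \<otimes>\<^sub>RA lam g b \<in> carrier RA" using x lb by simp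
    have "star RA (x \<otimes>\<^sub>RA lam g b) \<otimes>\<^sub>RA (x \<otimes>\<^sub>RA lam g b) =
        star RA (lam g b) \<otimes>\<^sub>RA (star RA x \<otimes>\<^sub>RA x) \<otimes>\<^sub>RA lam g b" using x lb by (simp add: A.star_mult A.m_assoc)
    then have "l2_inner G B ((x \<otimes>\<^sub>RA lam g b) delta) ((x \<otimes>\<^sub>RA lam g b) delta) =
        bmult B (bmult B (bstar B b) \<zero>\<^sub>Be) b" using Ex_conj[OF g b b xx] Ex_star_mult[OF xl xl] e by simp
    also have "bmult B (bstar B b) \<zero>\<^sub>Be = \<zero>\<^sub>(fibre B (inv g))"
      using bm_zero_right[OF inv_closed[OF g] one_closed bstar_closed[OF g b]] g by simp
    also have "bmult B \<zero>\<^sub>(fibre B (inv g)) b = \<zero>\<^sub>Be" using bm_zero_left[OF inv_closed[OF g] g b] g by simp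
    finally have "||(x \<otimes>\<^sub>RA lam g b) delta||\<^sub>(l2 G B)\<^sup>2 = 0" using L.nrm_ip[OF RA_delta[OF xl]] by simp
    then have "(x \<otimes>\<^sub>RA lam g b) delta = \<zero>\<^sub>(l2 G B)" using L.nrm_eq_0[OF RA_delta[OF xl]] by simp
    then show ?thesis using delta_closed by (simp add: RA_ops)
  qed
  have sx: "star RA x \<in> carrier L.Adj" using RA_sub[of "star RA x"] x by simp
  have "star RA x = \<zero>\<^sub>RA" unfolding RA_ops(3)
  proof (rule L.adj_eqI[OF sx L.adj_zero])
    fix W assume W: "W \<in> carrier (l2 G B)"
    define Y where "Y = star RA x W"
    have Y: "Y \<in> carrier (l2 G B)" unfolding Y_def by (rule L.adjD(4)[OF sx W])
    have orth: "l2_inner G B Y (lam g b delta) = \<zero>\<^sub>Be" if g: "g \<in> carrier G" and b: "b \<in> carrier (fibre B g)" for g b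
      using L.adj_star(4)[OF RA_sub[OF x] W RA_delta[OF lam_RA[OF g b]]] kill[OF g b] W by (simp add: Y_def RA_ops)
    obtain y where y: "y \<in> cauchy_seqs F.Sec" "Y = seq_class F.Sec y" using Y by (rule l2E)
    note yc = P.H.cauchy_closed[OF y(1)]
    have orth2: "l2_inner G B Y (seq_class F.Sec (\<lambda>n. \<zeta>)) = \<zero>\<^sub>Be" if z: "\<zeta> \<in> carrier F.Sec" for \<zeta>
    proof -
      have sp: "finite (F.sp \<zeta>)" "\<And>h. h \<in> F.sp \<zeta> \<Longrightarrow> h \<in> carrier G" using F.SecD(2)[OF z] by (auto simp: fam_supp_def)
      note zh = F.SecD(1)[OF z]
      have t: "D.tends (\<lambda>n. bmult B (bstar B (y n h)) (\<zeta> h)) \<zero>\<^sub>Be sequentially" if h: "h \<in> F.sp \<zeta>" for h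
      proof -
        note hG = sp(2)[OF h]
        note tc = tr_closed[OF hG zh[OF hG] dsec_closed]
        show ?thesis using P.completion_ip_seq_class(2)[OF y(1) P.H.cauchy_const[OF tc]] orth[OF hG zh[OF hG]]
          unfolding lam_delta[OF hG zh[OF hG]] l2_inner_eq y(2)[symmetric]
          by (simp add: sip_tr_dsec[OF hG zh[OF hG] yc])
      qed
      have "D.tends (\<lambda>n. \<Oplus>\<^sub>Be h\<in>F.sp \<zeta>. bmult B (bstar B (y n h)) (\<zeta> h)) (\<Oplus>\<^sub>Be h\<in>F.sp \<zeta>. \<zero>\<^sub>Be) sequentially"
        by (rule D.tends_finsum[OF sp(1) t]) (auto intro!: F.q_closed F.SecD(1)[OF yc] zh sp(2))
      moreover have "F.sip (y n) \<zeta> = (\<Oplus>\<^sub>Be h\<in>F.sp \<zeta>. bmult B (bstar B (y n h)) (\<zeta> h))" for n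
        using sp by (intro F.sip_eq2 yc z) auto
      ultimately have t0: "D.tends (\<lambda>n. F.sip (y n) \<zeta>) \<zero>\<^sub>Be sequentially" by simp
      note i = P.completion_ip_seq_class[OF y(1) P.H.cauchy_const[OF z]]
      show ?thesis unfolding l2_inner_eq y(2) by (rule D.tends_unique[OF i(2) t0]) (use i(1) yc z in auto)
    qed
    have "||Y||\<^sub>(l2 G B)\<^sup>2 \<le> 0"
    proof (rule field_le_epsilon)
      fix e :: real assume e: "e > 0"
      define n where "n = ||Y||\<^sub>(l2 G B)"
      have n: "n \<ge> 0" unfolding n_def by (rule L.H.nrm_nonneg[OF Y])
      \<comment> \<open>Y is orthogonal to v, so ||Y||^2 is the norm of the inner product of Y with
        Y - v, at most n e/(n+1). The added 1 covers Y = 0.\<close>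
      obtain v where v: "v \<in> carrier F.Sec" "ndist (l2 G B) Y (seq_class F.Sec (\<lambda>n. v)) < e / (n + 1)"
        using P.H.completion_dense[of Y "e / (n + 1)"] Y e n unfolding l2_eq by auto
      let ?v = "seq_class F.Sec (\<lambda>n. v)"
      have vc: "?v \<in> carrier (l2 G B)" unfolding l2_eq by (intro P.H.seq_class_closed P.H.cauchy_const v)
      have "n\<^sup>2 = ||l2_inner G B Y (Y \<ominus>\<^sub>(l2 G B) ?v)||\<^sub>Be"
        using Y vc orth2[OF v(1)] L.nrm_ip[OF Y] by (simp add: L.ip_diff n_def D.minus_eq)
      also have "\<dots> \<le> n * (e / (n + 1))"
        using L.ip_CS[OF Y L.H.minus_closed[OF Y vc]] v(2) n Y vc mult_left_mono[of "||Y \<ominus>\<^sub>(l2 G B) ?v||\<^sub>(l2 G B)" "e / (n+1)" n]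
        by (simp add: L.H.ndist_eq n_def)
      also have "\<dots> \<le> e" using n e by (simp add: field_simps)
      finally show "||Y||\<^sub>(l2 G B)\<^sup>2 \<le> 0 + e" by (simp add: n_def)
    qed
    then have "||Y||\<^sub>(l2 G B) = 0" by simp
    then have "Y = \<zero>\<^sub>(l2 G B)" using L.nrm_eq_0[OF Y] by simp
    then show "star RA x W = \<zero>\<^sub>L.Adj W" using W by (simp add: Y_def)
  qed
  then show ?thesis using A.star_star[OF x] A.star_zero by simp
qed

lemma Ex_cond_exp: "faithful_cond_exp RA Be (lam \<one>) Ex" unfolding faithful_cond_exp_def
proof (intro conjI ballI impI)
  show "clinear_map RA Be Ex" by (rule Ex_linear)
  show "contractive_map RA Be Ex" using Ex_nrm by (simp add: contractive_map_def)
  show "positive RA x \<Longrightarrow> positive Be (Ex x)" for x by (rule Ex_positive)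
  show "\<lbrakk>x \<in> carrier RA; Ex (star RA x \<otimes>\<^sub>RA x) = \<zero>\<^sub>Be\<rbrakk> \<Longrightarrow> x = \<zero>\<^sub>RA" for x by (rule Ex_faithful)
  show "b \<in> carrier Be \<Longrightarrow> Ex (lam \<one> b) = b" for b using Ex_lam[of \<one> b] by simp
  fix b c x assume b: "b \<in> carrier Be" and c: "c \<in> carrier Be" and x: "x \<in> carrier RA"
  have sb: "bstar B b \<in> carrier (fibre B \<one>)" using D.star_closed[OF b] by (simp add: be_star)
  have "lam \<one> b = star RA (lam \<one> (bstar B b))"
    using RA_lam_star[OF one_closed sb] bstar_bstar[OF one_closed, of b] b by simp
  then show "Ex (lam \<one> b \<otimes>\<^sub>RA x \<otimes>\<^sub>RA lam \<one> c) = b \<otimes>\<^sub>Be Ex x \<otimes>\<^sub>Be c"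
    using Ex_conj[OF one_closed sb _ x, of c] c bstar_bstar[OF one_closed, of b] b by (simp add: be_mult)
qed

text \<open>\<open>Ex\<close> shows that the description in \<open>expectation\<close> can be
  satisfied. Any map satisfying it is linear, contractive and equal to \<open>Ex\<close> on
  generators, hence on the whole algebra.\<close>

lemma expectation_eq: assumes x: "x \<in> carrier RA" shows "expectation G B x = Ex x"
proof -
  let ?P = "\<lambda>E. faithful_cond_exp RA Be (lam \<one>) E \<and>
     (\<forall>g\<in>carrier G. \<forall>b\<in>carrier (fibre B g). E (lam g b) = (if g = \<one> then b else \<zero>\<^sub>Be))"
  have "?P Ex" using Ex_cond_exp Ex_lam by blast
  then have P: "?P (expectation G B)" unfolding expectation_def by (rule someI[of ?P])
  define E' where "E' = expectation G B"
  have E': "clinear_map RA Be E'" "contractive_map RA Be E'"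
    "\<And>g b. \<lbrakk>g \<in> carrier G; b \<in> carrier (fibre B g)\<rbrakk> \<Longrightarrow> E' (lam g b) = (if g = \<one> then b else \<zero>\<^sub>Be)"
    using P by (simp_all add: E'_def faithful_cond_exp_def)
  have Ec: "E' x \<in> carrier Be" if "x \<in> carrier RA" for x using E'(1) that by (auto simp: clinear_map_def)
  show ?thesis using x unfolding E'_def[symmetric]
  proof (induction rule: RA_induct)
    case (gen g b)
    then show ?case by (simp add: E'(3) Ex_lam)
  next
    case (add x y)
    then show ?case using E'(1) by (simp add: clinear_map_def Ex_add)
  next
    case (lim s l)
    have t1: "D.tends (\<lambda>n. E' (s n)) (E' l) sequentially"
      by (rule A.tends_Lipschitz[OF lim(3) A.bounded_ndist[OF E'(1) D.seminormed_axioms, of 1] D.seminormed_axioms])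
        (use E'(2) lim in \<open>auto simp: contractive_map_def\<close>)
    have t2: "D.tends (\<lambda>n. Ex (s n)) (Ex l) sequentially"
      by (rule A.tends_Lipschitz[OF lim(3) A.bounded_ndist[OF Ex_linear D.seminormed_axioms, of 1] D.seminormed_axioms])
        (use Ex_nrm lim in auto)
    show ?case by (rule D.tends_unique[OF t1]) (use t2 lim Ec Ex_closed in auto)
  qed
qed

end

section \<open>Positive functionals\<close>

text \<open>The complex numbers as a C*-algebra, so that GNS spaces become an instance of
  \<open>prehilb\<close>.\<close>

definition complex_cstar :: "complex cstar" where
  "complex_cstar = \<lparr>carrier = UNIV, mult = (*), one = 1, zero = 0, add = (+), smult = (*), nrm = cmod, star = cnj\<rparr>"

lemma complex_cstar_simps [simp]:
  "carrier complex_cstar = UNIV" "x \<otimes>\<^sub>complex_cstar y = x * y" "\<one>\<^sub>complex_cstar = 1"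
  "\<zero>\<^sub>complex_cstar = 0" "x \<oplus>\<^sub>complex_cstar y = x + y" "x \<odot>\<^sub>complex_cstar y = x * y"
  "||x||\<^sub>complex_cstar = cmod x" "star complex_cstar x = cnj x" by (simp_all add: complex_cstar_def)

lemma ucstar_complex: "ucstar complex_cstar"
proof -
  have ag: "abelian_group complex_cstar"
  proof (rule abelian_groupI)
    fix x assume "x \<in> carrier complex_cstar"
    show "\<exists>y\<in>carrier complex_cstar. y \<oplus>\<^sub>complex_cstar x = \<zero>\<^sub>complex_cstar" by (intro bexI[of _ "- x"]) auto
  qed auto
  have m: "module complex_field complex_cstar"
    by (rule moduleI[OF cring_complex_field ag]) (auto simp: algebra_simps)
  interpret S: seminormed complex_cstar
    by (rule seminormed.intro[OF m], unfold_locales) (auto simp: norm_triangle_ineq norm_mult)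
  have d: "ndist complex_cstar x y = cmod (x - y)" for x y by (simp add: S.ndist_eq S.minus_eq S.neg_eq)
  have b: "banach_space complex_cstar"
  proof
    fix s assume s: "s \<in> cauchy_seqs complex_cstar"
    have "Cauchy s"
    proof (rule metric_CauchyI)
      fix e :: real assume "e > 0"
      from S.cauchyD[OF s this] show "\<exists>M. \<forall>m\<ge>M. \<forall>n\<ge>M. dist (s m) (s n) < e" by (simp add: d dist_norm)
    qed
    then obtain l where "s \<longlonglongrightarrow> l" using Cauchy_convergent convergent_def by blast
    then have "(\<lambda>n. cmod (s n - l)) \<longlonglongrightarrow> 0" by (simp add: LIM_zero_iff tendsto_norm_zero_iff)
    then show "\<exists>l\<in>carrier complex_cstar. (\<lambda>n. ndist complex_cstar (s n) l) \<longlonglongrightarrow> 0" by (auto simp: d)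
  qed (auto simp: norm_triangle_ineq norm_mult)
  have r: "ring complex_cstar" by (rule ringI[OF ag]) (auto intro!: monoidI simp: algebra_simps)
  show ?thesis by (rule ucstar.intro[OF b r], unfold_locales) (auto simp: norm_mult power2_eq_square)
qed

lemma positive_complex: "\<lbrakk>Im z = 0; Re z \<ge> 0\<rbrakk> \<Longrightarrow> positive complex_cstar z" unfolding positive_def
  by (intro bexI[of _ "of_real (sqrt (Re z))"]) (auto simp: complex_eq_iff)

locale pos_functional = ucstar A for A :: "('a, 'm) cstar_scheme" (structure) +
  fixes \<psi> :: "'a \<Rightarrow> complex"
  assumes fn_add: "\<lbrakk>x \<in> carrier A; y \<in> carrier A\<rbrakk> \<Longrightarrow> \<psi> (x \<oplus> y) = \<psi> x + \<psi> y"
    and fn_smult: "x \<in> carrier A \<Longrightarrow> \<psi> (c \<odot> x) = c * \<psi> x"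
    and fn_pos: "positive A x \<Longrightarrow> Im (\<psi> x) = 0 \<and> Re (\<psi> x) \<ge> 0"
begin

lemma fn_diff: "\<lbrakk>x \<in> carrier A; y \<in> carrier A\<rbrakk> \<Longrightarrow> \<psi> (x \<ominus> y) = \<psi> x - \<psi> y"
  by (simp add: minus_eq neg_eq fn_add fn_smult)

lemma fn_zero [simp]: "\<psi> \<zero> = 0" using fn_smult[of \<zero> 0] by simp

lemma fn_finsum: "\<lbrakk>finite I; f \<in> I \<rightarrow> carrier A\<rbrakk> \<Longrightarrow> \<psi> (\<Oplus>i\<in>I. f i) = (\<Sum>i\<in>I. \<psi> (f i))"
proof (induction I rule: finite_induct)
  case (insert i I)
  then show ?case by (subst finsum_insert) (auto simp: fn_add finsum_closed)
qed simp

text \<open>Polarisation with the unit: \<psi> is real at the square of 1 + z, so the imaginary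
  parts at z and at its adjoint cancel. Applied to i z, this compares the real parts.\<close>

lemma fn_star: assumes z: "z \<in> carrier A" shows "\<psi> (st z) = cnj (\<psi> z)"
proof -
  have im: "Im (\<psi> z) + Im (\<psi> (st z)) = 0" if z: "z \<in> carrier A" for z
  proof -
    have "st (\<one> \<oplus> z) \<otimes> (\<one> \<oplus> z) = (\<one> \<oplus> z) \<oplus> (st z \<oplus> st z \<otimes> z)"
      using z by (simp add: star_add l_distr r_distr a_ac)
    then have "\<psi> (st (\<one> \<oplus> z) \<otimes> (\<one> \<oplus> z)) = (\<psi> \<one> + \<psi> z) + (\<psi> (st z) + \<psi> (st z \<otimes> z))" using z by (simp add: fn_add)
    moreover have "Im (\<psi> (st (\<one> \<oplus> z) \<otimes> (\<one> \<oplus> z))) = 0" "Im (\<psi> \<one>) = 0" "Im (\<psi> (st z \<otimes> z)) = 0"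
      using fn_pos z by (auto intro!: fn_pos[THEN conjunct1])
    ultimately show ?thesis by simp
  qed
  have "Im (\<psi> (\<i> \<odot> z)) + Im (\<psi> (st (\<i> \<odot> z))) = 0" using z by (intro im) auto
  then have "Re (\<psi> z) = Re (\<psi> (st z))" using z by (simp add: star_smult fn_smult)
  then show ?thesis using im[OF z] by (simp add: complex_eq_iff)
qed

abbreviation "gns \<equiv> gns_seminormed A \<psi>"

lemma gns_simps [simp]: "carrier gns = carrier A" "add gns = add A" "zero gns = zero A" "smult gns = smult A"
  "a_minus gns = a_minus A" "finsum gns = finsum A"
  by (simp_all add: gns_seminormed_def a_minus_def[abs_def] a_inv_def finsum_def)

lemma nrm_gns: "||x||\<^sub>gns = sqrt (Re (\<psi> (st x \<otimes> x)))" by (simp add: gns_seminormed_def)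

lemma fn_sq: "x \<in> carrier A \<Longrightarrow> \<psi> (st x \<otimes> x) = of_real (Re (\<psi> (st x \<otimes> x)))" "x \<in> carrier A \<Longrightarrow> 0 \<le> Re (\<psi> (st x \<otimes> x))"
  using fn_pos[of "st x \<otimes> x"] by (auto simp: complex_eq_iff)

lemma nrm_gns_sq: "x \<in> carrier A \<Longrightarrow> ||x||\<^sub>gns\<^sup>2 = Re (\<psi> (st x \<otimes> x))" by (simp add: nrm_gns fn_sq(2))

lemma module_gns: "module complex_field gns" by (rule module_cong(1)[OF module_axioms]) simp_all

lemma prehilb_gns: "prehilb complex_cstar gns (\<lambda>x y. \<psi> (st x \<otimes> y))"
proof (rule ucstar.prehilbI[OF ucstar_complex module_gns])
  fix x y z c assume x: "x \<in> carrier gns"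
  have cm: "cmod w = Re w" if "Im w = 0 \<and> 0 \<le> Re w" for w using that by (simp add: cmod_eq_Re)
  show "||x||\<^sub>gns = sqrt ||\<psi> (st x \<otimes> x)||\<^sub>complex_cstar"
    using x fn_pos[of "st x \<otimes> x"] by (simp add: nrm_gns cm positive_star_mult)
  show "positive complex_cstar (\<psi> (st x \<otimes> x))" using x fn_pos[of "st x \<otimes> x"] by (intro positive_complex) auto
  { fix d show "\<exists>z\<in>carrier gns. \<forall>y\<in>carrier gns. \<psi> (st y \<otimes> z) = \<psi> (st y \<otimes> x) \<otimes>\<^sub>complex_cstar d"
      using x by (intro bexI[of _ "d \<odot> x"]) (auto simp: smult_mult_r fn_smult) }
  assume y: "y \<in> carrier gns"
  show "\<psi> (st x \<otimes> (c \<odot>\<^sub>gns y)) = c \<odot>\<^sub>complex_cstar \<psi> (st x \<otimes> y)" using x y by (simp add: smult_mult_r fn_smult)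
  show "star complex_cstar (\<psi> (st x \<otimes> y)) = \<psi> (st y \<otimes> x)"
    using x y fn_star[of "st x \<otimes> y"] by (simp add: star_mult)
  assume z: "z \<in> carrier gns"
  show "\<psi> (st x \<otimes> (y \<oplus>\<^sub>gns z)) = \<psi> (st x \<otimes> y) \<oplus>\<^sub>complex_cstar \<psi> (st x \<otimes> z)"
    using x y z by (simp add: r_distr fn_add)
qed simp

end

sublocale pos_functional \<subseteq> N: prehilb complex_cstar "gns_seminormed A \<psi>" "\<lambda>x y. \<psi> (star A x \<otimes> y)"
  by (rule prehilb_gns)

context pos_functional begin

lemma fn_CS: "\<lbrakk>x \<in> carrier A; y \<in> carrier A\<rbrakk> \<Longrightarrow> cmod (\<psi> (st x \<otimes> y)) \<le> ||x||\<^sub>gns * ||y||\<^sub>gns"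
  using N.ip_CS[of x y] by simp

lemma gns_le: assumes x: "x \<in> carrier A" shows "||x||\<^sub>gns \<le> ||x|| * sqrt (Re (\<psi> \<one>))"
proof (rule power2_le_imp_le)
  have p1: "0 \<le> Re (\<psi> \<one>)" using fn_pos[of \<one>] by simp
  have "positive A (of_real ( ||x||\<^sup>2) \<odot> \<one> \<ominus> st x \<otimes> x)"
    using x by (intro positive_nrm_minus) (auto simp: star_mult cstar)
  from fn_pos[OF this] have "0 \<le> ||x||\<^sup>2 * Re (\<psi> \<one>) - Re (\<psi> (st x \<otimes> x))"
    using x by (simp add: fn_diff fn_smult del: of_real_power)
  then show "||x||\<^sub>gns\<^sup>2 \<le> ( ||x|| * sqrt (Re (\<psi> \<one>)))\<^sup>2" using x p1 by (simp add: nrm_gns_sq power_mult_distrib)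
  show "0 \<le> ||x|| * sqrt (Re (\<psi> \<one>))" using x p1 by simp
qed

lemma fn_le: assumes x: "x \<in> carrier A" shows "cmod (\<psi> x) \<le> ||x|| * Re (\<psi> \<one>)"
proof -
  have p1: "0 \<le> Re (\<psi> \<one>)" using fn_pos[of \<one>] by simp
  have "cmod (\<psi> x) \<le> ||\<one>||\<^sub>gns * ||x||\<^sub>gns" using fn_CS[of \<one> x] x by simp
  also have "\<dots> \<le> sqrt (Re (\<psi> \<one>)) * ( ||x|| * sqrt (Re (\<psi> \<one>)))"
    using gns_le[OF x] p1 x fn_sq(2)[OF x] by (intro mult_mono) (auto simp: nrm_gns)
  also have "\<dots> = ||x|| * Re (\<psi> \<one>)" using p1 by simp
  finally show ?thesis .
qed

text \<open>Kadison's inequality followed by the decrease of \<psi> on positive elements: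
  \<psi>(\<Phi>(x)* \<Phi>(x)) \<le> \<psi>(\<Phi>(x* x)) \<le> \<psi>(x* x).\<close>

lemma cp_gns_contractive:
  assumes \<Phi>: "completely_positive A \<Phi>" "||\<Phi> \<one>|| \<le> 1"
    and d: "\<And>a. positive A a \<Longrightarrow> Re (\<psi> (\<Phi> a)) \<le> Re (\<psi> a)"
    and x: "x \<in> carrier A"
  shows "||\<Phi> x||\<^sub>gns \<le> ||x||\<^sub>gns"
proof (rule power2_le_imp_le)
  have c: "\<Phi> x \<in> carrier A" "\<Phi> (st x \<otimes> x) \<in> carrier A" using x cp_closed[OF \<Phi>(1)] by auto
  have "0 \<le> Re (\<psi> (\<Phi> (st x \<otimes> x) \<ominus> st (\<Phi> x) \<otimes> \<Phi> x))" using fn_pos[OF kadison[OF \<Phi> x]] by simp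
  then have "Re (\<psi> (st (\<Phi> x) \<otimes> \<Phi> x)) \<le> Re (\<psi> (\<Phi> (st x \<otimes> x)))" using c by (simp add: fn_diff)
  also have "\<dots> \<le> Re (\<psi> (st x \<otimes> x))" using x by (intro d) auto
  finally show "||\<Phi> x||\<^sub>gns\<^sup>2 \<le> ||x||\<^sub>gns\<^sup>2" using x c by (simp add: nrm_gns_sq)
  show "0 \<le> ||x||\<^sub>gns" using N.H.nrm_nonneg[of x] x by simp
qed

end

text \<open>A \<open>state\<close> is normalised by its norm. For a positive functional on a unital
  algebra the norm is the value at 1, by Cauchy--Schwarz in the form \<open>fn_le\<close>.\<close>

lemma (in ucstar) state_pos_functional:
  assumes "state A \<psi>" shows "pos_functional A \<psi>" "\<psi> \<one> = 1"
proof -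
  show p: "pos_functional A \<psi>" using assms positive_closed by unfold_locales (auto simp: state_def)
  interpret pos_functional A \<psi> by (rule p)
  let ?S = "(\<lambda>x. cmod (\<psi> x)) ` {x \<in> carrier A. ||x|| \<le> 1}"
  have sup: "Sup ?S = 1" using assms by (simp add: state_def)
  have p1: "Im (\<psi> \<one>) = 0" "0 \<le> Re (\<psi> \<one>)" using fn_pos[of \<one>] by auto
  have le: "cmod (\<psi> x) \<le> Re (\<psi> \<one>)" if "x \<in> carrier A" "||x|| \<le> 1" for x
    using fn_le[OF that(1)] mult_right_mono[OF that(2) p1(2)] by simp
  then have b: "bdd_above ?S" by (auto intro!: bdd_aboveI2)
  have "Sup ?S \<le> Re (\<psi> \<one>)" using le by (intro cSUP_least) (auto intro!: exI[of _ \<zero>])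
  moreover have "cmod (\<psi> \<one>) \<le> Sup ?S" using nrm_one_le by (intro cSUP_upper[OF _ b]) auto
  moreover have "cmod (\<psi> \<one>) = Re (\<psi> \<one>)" using p1 by (simp add: cmod_eq_Re)
  ultimately show "\<psi> \<one> = 1" using sup p1 by (simp add: complex_eq_iff)
qed

section \<open>Filters and invariant means\<close>

text \<open>If any finitely many of the conditions d k x \<longlongrightarrow> 0 can be met together
  to any accuracy, the sets of solutions for a finite set K and an accuracy \<epsilon> form a filter
  base: enlarging K and shrinking \<epsilon> directs it. This is the net indexed by such
  pairs.\<close>

lemma net_filter:
  fixes d :: "'k \<Rightarrow> 'x \<Rightarrow> real"
  assumes ex: "\<And>K \<epsilon>. \<lbrakk>finite K; K \<subseteq> I; \<epsilon> > 0\<rbrakk> \<Longrightarrow> \<exists>x. P x \<and> (\<forall>k\<in>K. d k x < \<epsilon>)"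
    and nn: "\<And>k x. \<lbrakk>k \<in> I; P x\<rbrakk> \<Longrightarrow> 0 \<le> d k x"
  shows "\<exists>F. F \<noteq> bot \<and> eventually P F \<and> (\<forall>k\<in>I. ((\<lambda>x. d k x) \<longlongrightarrow> 0) F)"
proof -
  define J where "J = {(K, \<epsilon>). finite K \<and> K \<subseteq> I \<and> \<epsilon> > (0::real)}"
  define X where "X p = {x. P x \<and> (\<forall>k\<in>fst p. d k x < snd p)}" for p
  define F where "F = (INF p\<in>J. principal (X p))"
  have ev: "eventually Q F \<longleftrightarrow> (\<exists>p\<in>J. \<forall>x\<in>X p. Q x)" for Q unfolding F_def
  proof (subst eventually_INF_base)
    have "({}, 1) \<in> J" by (simp add: J_def)
    then show "J \<noteq> {}" by blast
    fix a b assume a: "a \<in> J" and b: "b \<in> J"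
    show "\<exists>x\<in>J. principal (X x) \<le> inf (principal (X a)) (principal (X b))"
      by (rule bexI[of _ "(fst a \<union> fst b, min (snd a) (snd b))"]) (use a b in \<open>auto simp: J_def X_def\<close>)
  qed (simp add: eventually_principal)
  have "F \<noteq> bot"
  proof
    assume "F = bot"
    then have "eventually (\<lambda>_. False) F" by simp
    then obtain p where p: "p \<in> J" "X p = {}" unfolding ev by blast
    then obtain x where "P x \<and> (\<forall>k\<in>fst p. d k x < snd p)" using ex[of "fst p" "snd p"] by (auto simp: J_def)
    then have "x \<in> X p" by (simp add: X_def)
    then show False using p by simp
  qed
  moreover have "eventually P F" unfolding ev by (rule bexI[of _ "({}, 1)"]) (auto simp: J_def X_def)
  moreover have "((\<lambda>x. d k x) \<longlongrightarrow> 0) F" if k: "k \<in> I" for k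
  proof (rule tendstoI)
    fix e :: real assume "e > 0"
    then show "\<forall>\<^sub>F x in F. dist (d k x) 0 < e"
      unfolding ev using k nn by (intro bexI[of _ "({k}, e)"]) (auto simp: J_def X_def)
  qed
  ultimately show ?thesis by blast
qed

text \<open>By Tychonoff the values of all the functions stay in a compact product of intervals, so
  they have a cluster point l there. Restricting F to the preimages of neighbourhoods of l makes all
  of them converge at once.\<close>

lemma subfilter_convergent:
  fixes m :: "'i \<Rightarrow> 'x \<Rightarrow> real"
  assumes F: "F \<noteq> bot" and b: "eventually (\<lambda>x. \<forall>i\<in>I. \<bar>m i x\<bar> \<le> M i) F"
  shows "\<exists>U\<le>F. U \<noteq> bot \<and> (\<forall>i\<in>I. \<exists>l. (m i \<longlongrightarrow> l) U)"
proof -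
  \<comment> \<open>Coordinates outside I are set to 0, so that the values stay in a compact set of
    functions on the whole type.\<close>
  define f where "f x i = (if i \<in> I then m i x else 0)" for x i
  define K where "K = (\<Pi>\<^sub>E i\<in>UNIV. if i \<in> I then {- M i..M i} else {0})"
  have "compactin (product_topology (\<lambda>_. euclidean) UNIV) K" by (auto simp: K_def compactin_PiE)
  then have "compact K" by (simp add: euclidean_product_topology)
  moreover have "eventually (\<lambda>y. y \<in> K) (filtermap f F)"
    using b unfolding eventually_filtermap by (rule eventually_mono) (auto simp: K_def f_def abs_le_iff minus_le_iff)
  ultimately obtain l where l: "inf (nhds l) (filtermap f F) \<noteq> bot"
    using F unfolding compact_filter by (metis filtermap_bot_iff)
  define U where "U = inf F (filtercomap f (nhds l))"
  have "U \<noteq> bot"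
  proof
    assume "U = bot"
    then have "eventually (\<lambda>_. False) (inf F (filtercomap f (nhds l)))" by (simp add: U_def)
    then obtain P Q where PQ: "eventually P F" "eventually Q (nhds l)" "\<And>x. \<lbrakk>P x; Q (f x)\<rbrakk> \<Longrightarrow> False"
      unfolding eventually_inf eventually_filtercomap by blast
    have "eventually (\<lambda>y. \<not> Q y) (filtermap f F)"
      unfolding eventually_filtermap using PQ(1) by (rule eventually_mono) (use PQ(3) in blast)
    with PQ(2) have "eventually (\<lambda>_. False) (inf (nhds l) (filtermap f F))" unfolding eventually_inf by blast
    then show False using l by (simp add: trivial_limit_def)
  qed
  moreover have "(m i \<longlongrightarrow> l i) U" if "i \<in> I" for i
  proof -
    have "(f \<longlongrightarrow> l) U" unfolding U_def by (rule filterlim_mono[OF filterlim_filtercomap order_refl inf_le2])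
    then have "((\<lambda>x. f x i) \<longlongrightarrow> l i) U"
      by (rule continuous_on_tendsto_compose[OF continuous_on_product_coordinates[of i]]) auto
    then show ?thesis using that by (simp add: f_def)
  qed
  ultimately show ?thesis unfolding U_def by (intro exI[of _ U]) (auto simp: U_def)
qed

section \<open>Almost invariant weights and invariant means\<close>

definition weight :: "('g, 'm) monoid_scheme \<Rightarrow> 'g set \<Rightarrow> ('g \<Rightarrow> real) \<Rightarrow> bool" where
  "weight G S f \<longleftrightarrow> finite S \<and> S \<subseteq> carrier G \<and> (\<forall>h. 0 \<le> f h) \<and> (\<forall>h. h \<notin> S \<longrightarrow> f h = 0) \<and> (\<Sum>h\<in>S. (f h)\<^sup>2) = 1"

text \<open>A matrix coefficient of the regular representation on \<ell>^2(G) at the unit vector f,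
  a positive definite function of g with value 1 at the neutral element. For real f, closeness to 1
  says that translation by g hardly moves f.\<close>

definition overlap :: "('g, 'm) monoid_scheme \<Rightarrow> 'g set \<Rightarrow> ('g \<Rightarrow> real) \<Rightarrow> 'g \<Rightarrow> real" where
  "overlap G S f g = (\<Sum>h\<in>S. f (g \<otimes>\<^sub>G h) * f h)"

context group begin

text \<open>Provides one finite set that carries f together with its translate, so that the two can
  be compared term by term.\<close>

lemma weight_shift:
  assumes w: "weight G S f" and g: "g \<in> carrier G"
  shows "\<exists>T. finite T \<and> T \<subseteq> carrier G \<and> S \<subseteq> T \<and> (\<lambda>h. g \<otimes> h) ` S \<subseteq> T \<and>
    (\<forall>\<phi>::'a\<Rightarrow>real. (\<Sum>k\<in>T. (f (inv g \<otimes> k))\<^sup>2 * \<phi> k) = (\<Sum>h\<in>S. (f h)\<^sup>2 * \<phi> (g \<otimes> h))) \<and>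
    (\<forall>\<phi>::'a\<Rightarrow>real. (\<Sum>k\<in>T. (f k)\<^sup>2 * \<phi> k) = (\<Sum>h\<in>S. (f h)\<^sup>2 * \<phi> h)) \<and>
    (\<Sum>k\<in>T. f (inv g \<otimes> k) * f k) = overlap G S f (inv g)"
proof -
  have S: "finite S" "S \<subseteq> carrier G" "\<And>h. h \<notin> S \<Longrightarrow> f h = 0" using w by (auto simp: weight_def)
  define T where "T = S \<union> (\<lambda>h. g \<otimes> h) ` S"
  have T: "finite T" "T \<subseteq> carrier G" "S \<subseteq> T" "(\<lambda>h. g \<otimes> h) ` S \<subseteq> T" using S g by (auto simp: T_def)
  have inj: "inj_on (\<lambda>h. g \<otimes> h) S" using S(2)[THEN subsetD] g by (auto intro!: inj_onI)
  have 1: "(\<Sum>k\<in>T. (f (inv g \<otimes> k))\<^sup>2 * \<phi> k) = (\<Sum>h\<in>S. (f h)\<^sup>2 * \<phi> (g \<otimes> h))" for \<phi> :: "'a \<Rightarrow> real"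
  proof -
    have "(\<Sum>k\<in>T. (f (inv g \<otimes> k))\<^sup>2 * \<phi> k) = (\<Sum>k\<in>(\<lambda>h. g \<otimes> h) ` S. (f (inv g \<otimes> k))\<^sup>2 * \<phi> k)"
    proof (rule sum.mono_neutral_right[OF T(1,4)])
      show "\<forall>k\<in>T - (\<lambda>h. g \<otimes> h) ` S. (f (inv g \<otimes> k))\<^sup>2 * \<phi> k = 0"
      proof
        fix k assume k: "k \<in> T - (\<lambda>h. g \<otimes> h) ` S"
        then have "inv g \<otimes> k \<notin> S" using cancel_inv_left[OF g, of k] T(2) by (metis DiffE image_eqI subsetD)
        then show "(f (inv g \<otimes> k))\<^sup>2 * \<phi> k = 0" using S(3) by simp
      qed
    qed
    also have "\<dots> = (\<Sum>h\<in>S. (f (inv g \<otimes> (g \<otimes> h)))\<^sup>2 * \<phi> (g \<otimes> h))" by (subst sum.reindex[OF inj]) simp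
    also have "\<dots> = (\<Sum>h\<in>S. (f h)\<^sup>2 * \<phi> (g \<otimes> h))"
      using S(2) g by (intro sum.cong refl) (auto simp: inv_cancel_left subset_iff)
    finally show ?thesis .
  qed
  have 2: "(\<Sum>k\<in>T. (f k)\<^sup>2 * \<phi> k) = (\<Sum>h\<in>S. (f h)\<^sup>2 * \<phi> h)" for \<phi> :: "'a \<Rightarrow> real"
    by (rule sum.mono_neutral_right[OF T(1,3)]) (use S(3) in auto)
  have 3: "(\<Sum>k\<in>T. f (inv g \<otimes> k) * f k) = overlap G S f (inv g)"
    unfolding overlap_def by (rule sum.mono_neutral_right[OF T(1,3)]) (use S(3) in auto)
  show ?thesis by (rule exI[of _ T]) (use T 1 2 3 in blast)
qed

lemma overlap_le_1:
  assumes w: "weight G S f" and g: "g \<in> carrier G" shows "overlap G S f g \<le> 1"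
proof -
  obtain T where T: "finite T"
    "\<forall>\<phi>::'a\<Rightarrow>real. (\<Sum>k\<in>T. (f (inv (inv g) \<otimes> k))\<^sup>2 * \<phi> k) = (\<Sum>h\<in>S. (f h)\<^sup>2 * \<phi> (inv g \<otimes> h))"
    "\<forall>\<phi>::'a\<Rightarrow>real. (\<Sum>k\<in>T. (f k)\<^sup>2 * \<phi> k) = (\<Sum>h\<in>S. (f h)\<^sup>2 * \<phi> h)"
    "(\<Sum>k\<in>T. f (inv (inv g) \<otimes> k) * f k) = overlap G S f (inv (inv g))"
    using weight_shift[OF w inv_closed[OF g]] by blast
  have n: "(\<Sum>k\<in>T. (f (g \<otimes> k))\<^sup>2) = 1" "(\<Sum>k\<in>T. (f k)\<^sup>2) = 1"
    using T(2)[rule_format, of "\<lambda>_. 1"] T(3)[rule_format, of "\<lambda>_. 1"] w g by (simp_all add: weight_def)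
  have "2 * overlap G S f g = (\<Sum>k\<in>T. 2 * (f (g \<otimes> k) * f k))" using T(4) g by (simp add: sum_distrib_left[symmetric])
  also have "\<dots> \<le> (\<Sum>k\<in>T. (f (g \<otimes> k))\<^sup>2 + (f k)\<^sup>2)"
  proof (rule sum_mono)
    fix k
    have "0 \<le> (f (g \<otimes> k) - f k)\<^sup>2" by simp
    then show "2 * (f (g \<otimes> k) * f k) \<le> (f (g \<otimes> k))\<^sup>2 + (f k)\<^sup>2" by (simp add: power2_diff)
  qed
  also have "\<dots> = 2" using n by (simp add: sum.distrib)
  finally show ?thesis by simp
qed

text \<open>The passage from almost invariant unit vectors f in \<ell>^2 to almost invariant
  densities f^2 in \<ell>^1. Factor the difference of squares as (a - f)(a + f). By Cauchy--Schwarz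
  its \<ell>^1 norm is at most the root of 2(1 - ov) times 2(1 + ov), and the second factor is at
  most 4.\<close>

lemma weight_translate_bound:
  assumes w: "weight G S f" and g: "g \<in> carrier G" and M: "\<And>h. h \<in> carrier G \<Longrightarrow> \<bar>\<phi> h\<bar> \<le> M"
  shows "\<bar>(\<Sum>h\<in>S. (f h)\<^sup>2 * \<phi> (g \<otimes> h)) - (\<Sum>h\<in>S. (f h)\<^sup>2 * \<phi> h)\<bar> \<le> M * (2 * sqrt (2 * (1 - overlap G S f (inv g))))"
proof -
  obtain T where T: "finite T" "T \<subseteq> carrier G"
    "\<And>\<phi>::'a\<Rightarrow>real. (\<Sum>k\<in>T. (f (inv g \<otimes> k))\<^sup>2 * \<phi> k) = (\<Sum>h\<in>S. (f h)\<^sup>2 * \<phi> (g \<otimes> h))"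
    "\<And>\<phi>::'a\<Rightarrow>real. (\<Sum>k\<in>T. (f k)\<^sup>2 * \<phi> k) = (\<Sum>h\<in>S. (f h)\<^sup>2 * \<phi> h)"
    "(\<Sum>k\<in>T. f (inv g \<otimes> k) * f k) = overlap G S f (inv g)" using weight_shift[OF w g] by blast
  define a where "a k = f (inv g \<otimes> k)" for k
  define ov where "ov = overlap G S f (inv g)"
  have ov: "ov \<le> 1" unfolding ov_def by (rule overlap_le_1[OF w inv_closed[OF g]])
  have M0: "0 \<le> M" using M[OF one_closed] by linarith
  have n: "(\<Sum>k\<in>T. (a k)\<^sup>2) = 1" "(\<Sum>k\<in>T. (f k)\<^sup>2) = 1" "(\<Sum>k\<in>T. a k * f k) = ov"
    using T(3)[of "\<lambda>_. 1"] T(4)[of "\<lambda>_. 1"] T(5) w by (simp_all add: weight_def a_def ov_def)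
  have d: "(\<Sum>k\<in>T. (a k - f k)\<^sup>2) = 2 * (1 - ov)" "(\<Sum>k\<in>T. (a k + f k)\<^sup>2) = 2 * (1 + ov)"
    using n by (simp_all add: power2_diff power2_sum sum.distrib sum_subtractf mult.assoc sum_distrib_left[symmetric])
  have "(\<Sum>k\<in>T. \<bar>a k - f k\<bar> * \<bar>a k + f k\<bar>)\<^sup>2 \<le> (\<Sum>k\<in>T. \<bar>a k - f k\<bar>\<^sup>2) * (\<Sum>k\<in>T. \<bar>a k + f k\<bar>\<^sup>2)"
    by (rule Cauchy_Schwarz_ineq_sum)
  also have "\<dots> = (2 * (1 - ov)) * (2 * (1 + ov))" using d by simp
  also have "\<dots> \<le> (2 * (1 - ov)) * 4" using ov by (intro mult_left_mono) auto
  finally have "(\<Sum>k\<in>T. \<bar>a k - f k\<bar> * \<bar>a k + f k\<bar>)\<^sup>2 \<le> (2 * sqrt (2 * (1 - ov)))\<^sup>2"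
    using ov by (simp add: power_mult_distrib)
  then have cs: "(\<Sum>k\<in>T. \<bar>a k - f k\<bar> * \<bar>a k + f k\<bar>) \<le> 2 * sqrt (2 * (1 - ov))"
    by (rule power2_le_imp_le) (use ov in simp)
  have "(\<Sum>h\<in>S. (f h)\<^sup>2 * \<phi> (g \<otimes> h)) - (\<Sum>h\<in>S. (f h)\<^sup>2 * \<phi> h) = (\<Sum>k\<in>T. ((a k)\<^sup>2 - (f k)\<^sup>2) * \<phi> k)"
    unfolding T(3)[symmetric] T(4)[symmetric] a_def by (simp add: sum_subtractf left_diff_distrib)
  also have "\<bar>\<dots>\<bar> \<le> (\<Sum>k\<in>T. \<bar>((a k)\<^sup>2 - (f k)\<^sup>2) * \<phi> k\<bar>)" by (rule sum_abs)
  also have "\<dots> \<le> (\<Sum>k\<in>T. M * (\<bar>a k - f k\<bar> * \<bar>a k + f k\<bar>))"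
  proof (rule sum_mono)
    fix k assume "k \<in> T"
    then have "\<bar>\<phi> k\<bar> \<le> M" using M T(2) by blast
    then have "\<bar>(a k)\<^sup>2 - (f k)\<^sup>2\<bar> * \<bar>\<phi> k\<bar> \<le> \<bar>(a k)\<^sup>2 - (f k)\<^sup>2\<bar> * M" by (intro mult_left_mono) auto
    moreover have "(a k)\<^sup>2 - (f k)\<^sup>2 = (a k - f k) * (a k + f k)" by (simp add: power2_eq_square algebra_simps)
    ultimately show "\<bar>((a k)\<^sup>2 - (f k)\<^sup>2) * \<phi> k\<bar> \<le> M * (\<bar>a k - f k\<bar> * \<bar>a k + f k\<bar>)"
      by (simp add: abs_mult mult_ac)
  qed
  also have "\<dots> \<le> M * (2 * sqrt (2 * (1 - ov)))"
    unfolding sum_distrib_left[symmetric] by (rule mult_left_mono[OF cs M0])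
  finally show ?thesis by (simp add: ov_def)
qed

text \<open>The densities f^2 define means on bounded functions. Along a filter of weights that
  become invariant, a subfilter makes the values at all bounded functions converge simultaneously,
  and the limit is an invariant mean.\<close>

theorem amenable_groupI:
  assumes ex: "\<And>K \<epsilon>. \<lbrakk>finite K; K \<subseteq> carrier G; \<epsilon> > 0\<rbrakk> \<Longrightarrow> \<exists>S f. weight G S f \<and> (\<forall>g\<in>K. 1 - \<epsilon> < overlap G S f g)"
  shows "amenable_group G"
proof -
  define P where "P p = weight G (fst p) (snd p)" for p :: "'a set \<times> ('a \<Rightarrow> real)"
  define d where "d g p = 1 - overlap G (fst p) (snd p) g" for g and p :: "'a set \<times> ('a \<Rightarrow> real)"
  have "\<exists>F. F \<noteq> bot \<and> eventually P F \<and> (\<forall>k\<in>carrier G. ((\<lambda>x. d k x) \<longlongrightarrow> 0) F)"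
  proof (rule net_filter)
    fix K and \<epsilon> :: real assume "finite K" "K \<subseteq> carrier G" "\<epsilon> > 0"
    then obtain S f where "weight G S f" "\<forall>g\<in>K. 1 - \<epsilon> < overlap G S f g" using ex by blast
    then show "\<exists>x. P x \<and> (\<forall>k\<in>K. d k x < \<epsilon>)" by (intro exI[of _ "(S, f)"]) (auto simp: P_def d_def)
  qed (auto simp: P_def d_def overlap_le_1)
  then obtain F where F: "F \<noteq> bot" "eventually P F" "\<And>k. k \<in> carrier G \<Longrightarrow> ((\<lambda>x. d k x) \<longlongrightarrow> 0) F" by blast
  define m where "m \<phi> p = (\<Sum>h\<in>fst p. (snd p h)\<^sup>2 * \<phi> h)" for \<phi> and p :: "'a set \<times> ('a \<Rightarrow> real)"
  define I where "I = {\<phi> :: 'a \<Rightarrow> real. bounded (\<phi> ` carrier G)}"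
  have "\<forall>\<phi>\<in>I. \<exists>M. \<forall>h\<in>carrier G. \<bar>\<phi> h\<bar> \<le> M" by (auto simp: I_def bounded_iff)
  then obtain M where M: "\<And>\<phi> h. \<lbrakk>\<phi> \<in> I; h \<in> carrier G\<rbrakk> \<Longrightarrow> \<bar>\<phi> h\<bar> \<le> M \<phi>" by metis
  have "\<bar>m \<phi> p\<bar> \<le> M \<phi>" if "\<phi> \<in> I" "P p" for \<phi> p
  proof -
    have p: "fst p \<subseteq> carrier G" "(\<Sum>h\<in>fst p. (snd p h)\<^sup>2) = 1" using that(2) by (auto simp: P_def weight_def)
    have "\<bar>m \<phi> p\<bar> \<le> (\<Sum>h\<in>fst p. \<bar>(snd p h)\<^sup>2 * \<phi> h\<bar>)" unfolding m_def by (rule sum_abs)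
    also have "\<dots> \<le> (\<Sum>h\<in>fst p. (snd p h)\<^sup>2 * M \<phi>)"
      using p M[OF that(1)] by (intro sum_mono) (auto simp: abs_mult intro!: mult_left_mono)
    also have "\<dots> = M \<phi>" using p by (simp add: sum_distrib_right[symmetric])
    finally show ?thesis .
  qed
  then have "eventually (\<lambda>p. \<forall>\<phi>\<in>I. \<bar>m \<phi> p\<bar> \<le> M \<phi>) F" using F(2) by (auto elim: eventually_mono)
  from subfilter_convergent[OF F(1) this] obtain U where U: "U \<le> F" "U \<noteq> bot" "\<forall>\<phi>\<in>I. \<exists>l. (m \<phi> \<longlongrightarrow> l) U" by blast
  have PU: "eventually P U" using F(2) U(1) by (rule filter_leD[rotated])
  have dU: "((\<lambda>x. d k x) \<longlongrightarrow> 0) U" if "k \<in> carrier G" for k using F(3)[OF that] U(1) by (rule tendsto_mono[rotated])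
  define \<mu> where "\<mu> \<phi> = Lim U (m \<phi>)" for \<phi>
  have lim: "(m \<phi> \<longlongrightarrow> \<mu> \<phi>) U" if b: "bounded (\<phi> ` carrier G)" for \<phi>
  proof -
    obtain l where l: "(m \<phi> \<longlongrightarrow> l) U" using U(3) b by (auto simp: I_def)
    then show ?thesis using tendsto_Lim[OF U(2) l] by (simp add: \<mu>_def)
  qed
  have uniq: "\<mu> \<phi> = l" if "(m \<phi> \<longlongrightarrow> l) U" for \<phi> l unfolding \<mu>_def using that tendsto_Lim[OF U(2)] by blast
  show ?thesis unfolding amenable_group_def
  proof (intro exI[of _ \<mu>] conjI allI impI ballI)
    fix \<phi> k :: "'a \<Rightarrow> real" assume "bounded (\<phi> ` carrier G) \<and> bounded (k ` carrier G)"
    then have "((\<lambda>p. m \<phi> p + m k p) \<longlongrightarrow> \<mu> \<phi> + \<mu> k) U" using lim by (intro tendsto_add) auto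
    moreover have "(\<lambda>p. m \<phi> p + m k p) = m (\<lambda>g. \<phi> g + k g)" by (auto simp: m_def sum.distrib distrib_left)
    ultimately show "\<mu> (\<lambda>g. \<phi> g + k g) = \<mu> \<phi> + \<mu> k" by (intro uniq) simp
  next
    fix c and \<phi> :: "'a \<Rightarrow> real" assume "bounded (\<phi> ` carrier G)"
    then have "((\<lambda>p. c * m \<phi> p) \<longlongrightarrow> c * \<mu> \<phi>) U" using lim by (intro tendsto_mult_left) auto
    moreover have "(\<lambda>p. c * m \<phi> p) = m (\<lambda>g. c * \<phi> g)" by (auto simp: m_def sum_distrib_left mult_ac)
    ultimately show "\<mu> (\<lambda>g. c * \<phi> g) = c * \<mu> \<phi>" by (intro uniq) simp
  next
    fix \<phi> :: "'a \<Rightarrow> real" assume \<phi>: "bounded (\<phi> ` carrier G) \<and> (\<forall>g\<in>carrier G. 0 \<le> \<phi> g)"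
    have "eventually (\<lambda>p. 0 \<le> m \<phi> p) U"
      using PU by eventually_elim (use \<phi> in \<open>auto simp: P_def weight_def m_def intro!: sum_nonneg\<close>)
    then show "0 \<le> \<mu> \<phi>" using lim \<phi> tendsto_lowerbound[OF _ _ U(2)] by blast
  next
    have "eventually (\<lambda>p. m (\<lambda>g. 1) p = 1) U" using PU by eventually_elim (auto simp: P_def weight_def m_def)
    then show "\<mu> (\<lambda>g. 1) = 1" by (intro uniq tendsto_eventually)
  next
    fix h and \<phi> :: "'a \<Rightarrow> real" assume h: "h \<in> carrier G" and b: "bounded (\<phi> ` carrier G)"
    have M': "\<And>h. h \<in> carrier G \<Longrightarrow> \<bar>\<phi> h\<bar> \<le> M \<phi>" using M b by (auto simp: I_def)
    have "((\<lambda>p. M \<phi> * (2 * sqrt (2 * d (inv h) p))) \<longlongrightarrow> M \<phi> * (2 * sqrt (2 * 0))) U"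
      by (intro tendsto_intros dU inv_closed h)
    then have z: "((\<lambda>p. M \<phi> * (2 * sqrt (2 * d (inv h) p))) \<longlongrightarrow> 0) U" by simp
    have "((\<lambda>p. m (\<lambda>g. \<phi> (h \<otimes> g)) p - m \<phi> p) \<longlongrightarrow> 0) U"
    proof (rule Lim_null_comparison[OF _ z])
      show "\<forall>\<^sub>F p in U. norm (m (\<lambda>g. \<phi> (h \<otimes> g)) p - m \<phi> p) \<le> M \<phi> * (2 * sqrt (2 * d (inv h) p))" using PU
      proof eventually_elim
        case (elim p)
        then show ?case using weight_translate_bound[of "fst p" "snd p" h \<phi> "M \<phi>"] h M' by (simp add: P_def m_def d_def)
      qed
    qed
    from tendsto_add[OF this lim[OF b]] show "\<mu> (\<lambda>g. \<phi> (h \<otimes> g)) = \<mu> \<phi>" by (intro uniq) simp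
  qed
qed

end

section \<open>Crossed product bundles with an invariant state\<close>

locale crossed = unital_fell_bundle G B for G (structure) and B +
  fixes u \<psi>
  assumes unitary: "unitary_section G B u"
    and invariant: "invariant_state G B (section_action B u) \<psi>"

sublocale crossed \<subseteq> S: pos_functional "unit_fibre G B" \<psi>
  using D.state_pos_functional(1) invariant by (simp add: invariant_state_def)

sublocale crossed \<subseteq> R: pos_functional "reduced_algebra G B" "\<lambda>x. \<psi> (Ex x)"
  by unfold_locales (auto simp: Ex_add Ex_smult Ex_closed S.fn_add S.fn_smult dest: Ex_positive S.fn_pos)

context crossed begin

lemma psi_one [simp]: "\<psi> \<one>\<^sub>Be = 1" using D.state_pos_functional(2) invariant by (simp add: invariant_state_def)

lemma u_closed: "s \<in> carrier G \<Longrightarrow> u s \<in> carrier (fibre B s)"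
  and u_right: "s \<in> carrier G \<Longrightarrow> bmult B (u s) (bstar B (u s)) = \<one>\<^sub>Be"
  and u_left: "s \<in> carrier G \<Longrightarrow> bmult B (bstar B (u s)) (u s) = \<one>\<^sub>Be"
  using unitary by (auto simp: unitary_section_def)

abbreviation "uu s \<equiv> lam s (u s)"
abbreviation "ras \<equiv> star RA"

lemma uu_closed: "s \<in> carrier G \<Longrightarrow> uu s \<in> carrier RA" by (simp add: lam_RA u_closed)

lemma uu_left: "s \<in> carrier G \<Longrightarrow> ras (uu s) \<otimes>\<^sub>RA uu s = \<one>\<^sub>RA"
  using bstar_closed[OF _ u_closed, of s] u_closed[of s]
  by (simp add: RA_lam_star RA_lam_mult u_left RA_lam_one)

lemma uu_right: "s \<in> carrier G \<Longrightarrow> uu s \<otimes>\<^sub>RA ras (uu s) = \<one>\<^sub>RA"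
  using bstar_closed[OF _ u_closed, of s] u_closed[of s]
  by (simp add: RA_lam_star RA_lam_mult u_right RA_lam_one)

text \<open>Invariance is given for conjugation in the other order; apply it to the element c =
  u(s)* e u(s), which \<open>section_action\<close> sends to e.\<close>

lemma psi_conj:
  assumes s: "s \<in> carrier G" and e: "e \<in> carrier Be"
  shows "\<psi> (bmult B (bmult B (bstar B (u s)) e) (u s)) = \<psi> e"
proof -
  note si = inv_closed[OF s] note us = u_closed[OF s] note su = bstar_closed[OF s us]
  have e1: "e \<in> carrier (fibre B \<one>)" using e by simp
  have c1: "bmult B (bstar B (u s)) e \<in> carrier (fibre B (inv s))" using bmult_closed[OF si one_closed su e1] s by simp
  define c where "c = bmult B (bmult B (bstar B (u s)) e) (u s)"
  have c: "c \<in> carrier Be" using bmult_closed[OF si s c1 us] s by (simp add: c_def)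
  have eu: "bmult B e (u s) \<in> carrier (fibre B s)" using bmult_closed[OF one_closed s e1 us] s by simp
  have "bmult B (u s) c = bmult B (bmult B (u s) (bmult B (bstar B (u s)) e)) (u s)"
    unfolding c_def by (rule bmult_assoc[OF s si s us c1 us, symmetric])
  also have "bmult B (u s) (bmult B (bstar B (u s)) e) = bmult B (bmult B (u s) (bstar B (u s))) e"
    by (rule bmult_assoc[OF s si one_closed us su e1, symmetric])
  also have "\<dots> = e" using u_right[OF s] unit_left[OF e] by simp
  finally have "bmult B (bmult B (u s) c) (bstar B (u s)) = bmult B e (bmult B (u s) (bstar B (u s)))"
    using bmult_assoc[OF one_closed s si e1 us su] by simp
  then have "section_action B u s c = e" using u_right[OF s] unit_right[OF e] by (simp add: section_action_def)
  moreover have "\<psi> (section_action B u s c) = \<psi> c" using invariant s c by (simp add: invariant_state_def)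
  ultimately show ?thesis by (simp add: c_def)
qed

lemma phi_conj:
  assumes s: "s \<in> carrier G" and x: "x \<in> carrier RA"
  shows "\<psi> (Ex (ras (uu s) \<otimes>\<^sub>RA x \<otimes>\<^sub>RA uu s)) = \<psi> (Ex x)"
  using Ex_conj[OF s u_closed[OF s] u_closed[OF s] x] psi_conj[OF s Ex_closed[OF x]] by simp

lemma phi_conj':
  assumes s: "s \<in> carrier G" and x: "x \<in> carrier RA"
  shows "\<psi> (Ex (uu s \<otimes>\<^sub>RA x \<otimes>\<^sub>RA ras (uu s))) = \<psi> (Ex x)"
proof -
  note c = uu_closed[OF s]
  have "ras (uu s) \<otimes>\<^sub>RA (uu s \<otimes>\<^sub>RA x \<otimes>\<^sub>RA ras (uu s)) \<otimes>\<^sub>RA uu s =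
    (ras (uu s) \<otimes>\<^sub>RA uu s) \<otimes>\<^sub>RA x \<otimes>\<^sub>RA (ras (uu s) \<otimes>\<^sub>RA uu s)" using c x by (simp add: A.m_assoc)
  then have "ras (uu s) \<otimes>\<^sub>RA (uu s \<otimes>\<^sub>RA x \<otimes>\<^sub>RA ras (uu s)) \<otimes>\<^sub>RA uu s = x" using x by (simp add: uu_left[OF s])
  then show ?thesis using phi_conj[OF s, of "uu s \<otimes>\<^sub>RA x \<otimes>\<^sub>RA ras (uu s)"] c x by simp
qed

lemma phi_one [simp]: "\<psi> (Ex \<one>\<^sub>RA) = 1" using Ex_lam[of \<one> "\<one>\<^sub>Be"] RA_lam_one by simp

text \<open>The left unitary cancels inside the square of the product, and the right one becomes a
  conjugation, under which \<psi> \<circ> E is invariant. Right multiplication by a unitary is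
  isometric in the GNS seminorm only because of this invariance.\<close>

lemma gns_uu:
  assumes s: "s \<in> carrier G" and t: "t \<in> carrier G" and x: "x \<in> carrier RA"
  shows "||uu s \<otimes>\<^sub>RA x \<otimes>\<^sub>RA ras (uu t)||\<^sub>R.gns = ||x||\<^sub>R.gns"
    and "||ras (uu s) \<otimes>\<^sub>RA x \<otimes>\<^sub>RA uu t||\<^sub>R.gns = ||x||\<^sub>R.gns"
proof -
  note c = uu_closed[OF s] uu_closed[OF t]
  have sx: "ras x \<otimes>\<^sub>RA x \<in> carrier RA" using x by simp
  have "ras (uu s \<otimes>\<^sub>RA x \<otimes>\<^sub>RA ras (uu t)) \<otimes>\<^sub>RA (uu s \<otimes>\<^sub>RA x \<otimes>\<^sub>RA ras (uu t)) =
    uu t \<otimes>\<^sub>RA (ras x \<otimes>\<^sub>RA ((ras (uu s) \<otimes>\<^sub>RA uu s) \<otimes>\<^sub>RA x)) \<otimes>\<^sub>RA ras (uu t)"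
    using c x by (simp add: A.star_mult A.m_assoc)
  then show "||uu s \<otimes>\<^sub>RA x \<otimes>\<^sub>RA ras (uu t)||\<^sub>R.gns = ||x||\<^sub>R.gns"
    using x phi_conj'[OF t sx] by (simp add: R.nrm_gns uu_left[OF s])
  have "ras (ras (uu s) \<otimes>\<^sub>RA x \<otimes>\<^sub>RA uu t) \<otimes>\<^sub>RA (ras (uu s) \<otimes>\<^sub>RA x \<otimes>\<^sub>RA uu t) =
    ras (uu t) \<otimes>\<^sub>RA (ras x \<otimes>\<^sub>RA ((uu s \<otimes>\<^sub>RA ras (uu s)) \<otimes>\<^sub>RA x)) \<otimes>\<^sub>RA uu t"
    using c x by (simp add: A.star_mult A.m_assoc)
  then show "||ras (uu s) \<otimes>\<^sub>RA x \<otimes>\<^sub>RA uu t||\<^sub>R.gns = ||x||\<^sub>R.gns"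
    using x phi_conj[OF t sx] by (simp add: R.nrm_gns uu_right[OF s])
qed

abbreviation "iota \<equiv> lam \<one>"

lemma iota_closed: "d \<in> carrier Be \<Longrightarrow> iota d \<in> carrier RA" by (simp add: lam_RA)

lemma iota_linear: "clinear_map Be RA iota" using RA_lam_linear[OF one_closed] by (simp add: clinear_map_def)

lemma iota_mult: "\<lbrakk>d \<in> carrier Be; e \<in> carrier Be\<rbrakk> \<Longrightarrow> iota d \<otimes>\<^sub>RA iota e = iota (d \<otimes>\<^sub>Be e)"
  using RA_lam_mult[of \<one> \<one> d e] by (simp add: be_mult)

lemma iota_star: "d \<in> carrier Be \<Longrightarrow> ras (iota d) = iota (star Be d)"
  using RA_lam_star[of \<one> d] by (simp add: be_star)

lemma Ex_iota: "d \<in> carrier Be \<Longrightarrow> Ex (iota d) = d" using Ex_lam[of \<one> d] by simp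

lemma gns_iota: "d \<in> carrier Be \<Longrightarrow> ||iota d||\<^sub>R.gns = ||d||\<^sub>S.gns"
  by (simp add: R.nrm_gns S.nrm_gns iota_star iota_mult Ex_iota)

lemma iota_positive: assumes "positive Be d" shows "positive RA (iota d)"
proof -
  obtain c where c: "c \<in> carrier Be" "d = star Be c \<otimes>\<^sub>Be c" using assms by (auto simp: positive_def)
  then have "iota d = ras (iota c) \<otimes>\<^sub>RA iota c" by (simp add: iota_star iota_mult)
  then show ?thesis using iota_closed[OF c(1)] by auto
qed

text \<open>The lower bound comes from the expectation: b* b is E applied to the square of
  \<open>lam g b\<close>, and E is contractive.\<close>

lemma lam_nrm: assumes g: "g \<in> carrier G" and b: "b \<in> carrier (fibre B g)"
  shows "||lam g b||\<^sub>RA = ||b||\<^sub>(fibre B g)"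
proof (rule antisym)
  interpret V: banach_space "fibre B g" by (rule fibre_banach[OF g])
  have "||lam g b||\<^sub>L.Adj \<le> ||b||\<^sub>(fibre B g)" using P.H.ext_op_bound[OF tr_linear[OF g b] tr_bound[OF g b]] b
    by (intro L.adj_nrm_le) (auto simp: regular_rep_eq l2_eq)
  then show "||lam g b||\<^sub>RA \<le> ||b||\<^sub>(fibre B g)" by (simp only: RA_ops)
  note lb = lam_RA[OF g b] note sb = bstar_closed[OF g b]
  have q: "bmult B (bstar B b) b \<in> carrier Be" by (rule F.q_closed[OF g b b])
  have "||b||\<^sub>(fibre B g)\<^sup>2 = ||Ex (ras (lam g b) \<otimes>\<^sub>RA lam g b)||\<^sub>Be"
    using g b sb q by (simp add: RA_lam_star RA_lam_mult Ex_iota F.q_nrm)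
  also have "\<dots> \<le> ||ras (lam g b) \<otimes>\<^sub>RA lam g b||\<^sub>RA" using lb by (intro Ex_nrm) auto
  also have "\<dots> = ||lam g b||\<^sub>RA\<^sup>2" by (rule A.cstar[OF lb])
  finally show "||b||\<^sub>(fibre B g) \<le> ||lam g b||\<^sub>RA" by (rule power2_le_imp_le) (use lb in simp)
qed

lemma uu_nrm: assumes s: "s \<in> carrier G" shows "||uu s||\<^sub>RA \<le> 1"
proof (rule power2_le_imp_le)
  show "||uu s||\<^sub>RA\<^sup>2 \<le> 1\<^sup>2" using A.cstar[OF uu_closed[OF s]] A.nrm_one_le uu_left[OF s] by simp
qed simp

text \<open>In the GNS space E is an orthogonal projection: x - E(x) is orthogonal to E(x), and the
  inequality is Pythagoras.\<close>

lemma Ex_gns: assumes x: "x \<in> carrier RA" shows "||Ex x||\<^sub>S.gns \<le> ||x||\<^sub>R.gns"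
proof (rule power2_le_imp_le)
  define d where "d = Ex x"
  have d: "d \<in> carrier Be" using Ex_closed[OF x] by (simp add: d_def)
  have id: "iota d \<in> carrier RA" by (rule iota_closed[OF d])
  define y where "y = x \<ominus>\<^sub>RA iota d"
  have y: "y \<in> carrier RA" using x id by (simp add: y_def)
  have "star Be d \<otimes>\<^sub>Be d \<in> carrier Be" using d by simp
  from unit_right[OF this] have e1: "Ex (ras (iota d) \<otimes>\<^sub>RA x) = star Be d \<otimes>\<^sub>Be d"
    using Ex_conj[OF one_closed _ _ x, of d "\<one>\<^sub>Be"] d id x
    by (simp add: RA_lam_one d_def[symmetric] be_mult be_star)
  have e2: "Ex (ras x \<otimes>\<^sub>RA iota d) = star Be d \<otimes>\<^sub>Be d"
    using Ex_star[of "ras (iota d) \<otimes>\<^sub>RA x"] x id d by (simp add: A.star_mult e1 D.star_mult)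
  have e3: "Ex (ras (iota d) \<otimes>\<^sub>RA iota d) = star Be d \<otimes>\<^sub>Be d" using d by (simp add: iota_star iota_mult Ex_iota)
  have "ras y \<otimes>\<^sub>RA y = (ras x \<otimes>\<^sub>RA x \<ominus>\<^sub>RA ras x \<otimes>\<^sub>RA iota d) \<ominus>\<^sub>RA
      (ras (iota d) \<otimes>\<^sub>RA x \<ominus>\<^sub>RA ras (iota d) \<otimes>\<^sub>RA iota d)"
    unfolding y_def A.star_diff[OF x id] using x id A.star_closed[OF x] A.star_closed[OF id] by algebra
  then have "\<psi> (Ex (ras y \<otimes>\<^sub>RA y)) = \<psi> (Ex (ras x \<otimes>\<^sub>RA x)) - \<psi> (star Be d \<otimes>\<^sub>Be d)"
    using x id by (simp add: R.fn_diff e1 e2 e3)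
  then have "Re (\<psi> (star Be d \<otimes>\<^sub>Be d)) \<le> Re (\<psi> (Ex (ras x \<otimes>\<^sub>RA x)))" using R.fn_sq(2)[OF y] by simp
  then show "||Ex x||\<^sub>S.gns\<^sup>2 \<le> ||x||\<^sub>R.gns\<^sup>2" using x d by (simp add: R.nrm_gns_sq S.nrm_gns_sq d_def)
  show "0 \<le> ||x||\<^sub>R.gns" using R.N.H.nrm_nonneg[of x] x by simp
qed

text \<open>A member \<xi> of the approximating net that handles u(g) for all g in K, and also u(1),
  provides a(h), the GNS norm of \<xi>(h). By Cauchy--Schwarz the sum of a(gh) a(h) is at least 1 -
  \<delta>, and normalising a to a unit vector f changes this only slightly because the sum N of the
  a(h)^2 is close to 1.\<close>

lemma weights_exist:
  assumes am: "cstar_amenable G B" and K: "finite K" "K \<subseteq> carrier G" and \<epsilon>: "\<epsilon> > 0"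
  shows "\<exists>S f. weight G S f \<and> (\<forall>g\<in>K. 1 - \<epsilon> < overlap G S f g)"
proof -
  define sp where "sp \<xi> = {g \<in> carrier G. \<xi> g \<noteq> \<zero>\<^sub>Be}" for \<xi>
  define Z where "Z g b \<xi> = (\<Oplus>\<^sub>(fibre B g)h\<in>sp \<xi>. bmult B (bmult B (bstar B (\<xi> (g \<otimes> h))) b) (\<xi> h))" for g b \<xi>
  have "\<exists>F :: ('a \<Rightarrow> 'c) filter. F \<noteq> bot \<and>
       (\<forall>\<^sub>F \<xi> in F. \<xi> \<in> carrier G \<rightarrow> carrier Be \<and> finite (sp \<xi>)) \<and>
       (\<forall>g\<in>carrier G. \<forall>b\<in>carrier (fibre B g). ((\<lambda>\<xi>. ndist (fibre B g) (Z g b \<xi>) b) \<longlongrightarrow> 0) F)"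
    using am unfolding cstar_amenable_def Let_def supp_def Z_def sp_def by (simp only: unit_fibre_simps) blast
  then obtain F :: "('a \<Rightarrow> 'c) filter" where F: "F \<noteq> bot"
    "\<forall>\<^sub>F \<xi> in F. \<xi> \<in> carrier G \<rightarrow> carrier Be \<and> finite (sp \<xi>)"
    "\<And>g b. \<lbrakk>g \<in> carrier G; b \<in> carrier (fibre B g)\<rbrakk> \<Longrightarrow> ((\<lambda>\<xi>. ndist (fibre B g) (Z g b \<xi>) b) \<longlongrightarrow> 0) F" by blast
  \<comment> \<open>Chosen so that (1 + \<delta>)(1 - \<epsilon>) < (1 + \<delta>)(1 - 2 \<delta>)
    \<le> 1 - \<delta>, which is the loss from normalising; the bound 1/2 keeps N positive.\<close>
  define \<delta> where "\<delta> = min (\<epsilon> / 3) (1 / 2)"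
  have \<delta>: "\<delta> > 0" "\<delta> \<le> 1 / 2" "2 * \<delta> < \<epsilon>" using \<epsilon> by (auto simp: \<delta>_def)
  have u1: "u \<one> = \<one>\<^sub>Be" using unitary by (simp add: unitary_section_def)
  have "\<forall>\<^sub>F \<xi> in F. ndist (fibre B g) (Z g (u g) \<xi>) (u g) < \<delta>" if "g \<in> insert \<one> K" for g
  proof -
    have g: "g \<in> carrier G" using that K by auto
    have "\<forall>\<^sub>F \<xi> in F. dist (ndist (fibre B g) (Z g (u g) \<xi>) (u g)) 0 < \<delta>"
      by (rule tendstoD[OF F(3)[OF g u_closed[OF g]] \<delta>(1)])
    then show ?thesis by (rule eventually_mono) simp
  qed
  then have "\<forall>\<^sub>F \<xi> in F. \<forall>g\<in>insert \<one> K. ndist (fibre B g) (Z g (u g) \<xi>) (u g) < \<delta>"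
    using K by (intro eventually_ball_finite) auto
  with F(2) have "\<forall>\<^sub>F \<xi> in F. (\<xi> \<in> carrier G \<rightarrow> carrier Be \<and> finite (sp \<xi>)) \<and>
    (\<forall>g\<in>insert \<one> K. ndist (fibre B g) (Z g (u g) \<xi>) (u g) < \<delta>)" by (rule eventually_conj)
  from eventually_happens'[OF F(1) this] obtain \<xi> where
    xi: "\<And>h. h \<in> carrier G \<Longrightarrow> \<xi> h \<in> carrier Be" and fin: "finite (sp \<xi>)"
    and close: "\<And>g. g \<in> insert \<one> K \<Longrightarrow> ndist (fibre B g) (Z g (u g) \<xi>) (u g) < \<delta>" by blast
  have spG: "h \<in> carrier G" if "h \<in> sp \<xi>" for h using that by (simp add: sp_def)
  define a where "a h = (if h \<in> sp \<xi> then ||\<xi> h||\<^sub>S.gns else 0)" for h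
  have a0: "0 \<le> a h" for h using S.N.H.nrm_nonneg[of "\<xi> h"] xi[OF spG] by (auto simp: a_def)
  have aG: "a h = ||\<xi> h||\<^sub>S.gns" if "h \<in> carrier G" for h
  proof (cases "h \<in> sp \<xi>")
    case False
    then have "\<xi> h = \<zero>\<^sub>Be" using that by (simp add: sp_def)
    then show ?thesis using False S.N.H.nrm_0 by (simp add: a_def)
  qed (simp add: a_def)
  define N where "N = (\<Sum>h\<in>sp \<xi>. (a h)\<^sup>2)"
  \<comment> \<open>\<psi> \<circ> E of this element is the GNS inner product of \<xi>(gh) with u(g)
    \<xi>(h) u(g)*. By invariance of \<psi> the second vector has the norm of \<xi>(h).\<close>
  define y where "y g h = ras (iota (\<xi> (g \<otimes> h))) \<otimes>\<^sub>RA (uu g \<otimes>\<^sub>RA iota (\<xi> h) \<otimes>\<^sub>RA ras (uu g))" for g h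
  have yc: "y g h \<in> carrier RA" if "g \<in> carrier G" "h \<in> carrier G" for g h
    using that by (simp add: y_def iota_closed xi uu_closed)
  \<comment> \<open>In \<open>B_g\<close> the approximating sum for u(g) is within \<delta> of u(g).
    Right multiplication by u(g)* and then \<psi> \<circ> E turn this into an estimate of complex
    numbers, since these maps are contractive.\<close>
  have close2: "cmod ((\<Sum>h\<in>sp \<xi>. \<psi> (Ex (y g h))) - 1) < \<delta>" if g': "g \<in> insert \<one> K" for g
  proof -
    have g: "g \<in> carrier G" using g' K by auto
    interpret V: banach_space "fibre B g" by (rule fibre_banach[OF g])
    note ug = u_closed[OF g] note U = uu_closed[OF g]
    let ?t = "\<lambda>h. bmult B (bmult B (bstar B (\<xi> (g \<otimes> h))) (u g)) (\<xi> h)"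
    have sc: "bstar B (\<xi> (g \<otimes> h)) \<in> carrier (fibre B \<one>)" if "h \<in> carrier G" for h
      using bstar_closed[OF one_closed, of "\<xi> (g \<otimes> h)"] xi g that by simp
    have sc2: "bmult B (bstar B (\<xi> (g \<otimes> h))) (u g) \<in> carrier (fibre B g)" if "h \<in> carrier G" for h
      using bmult_closed[OF one_closed g sc[OF that] ug] g by simp
    have tc: "?t h \<in> carrier (fibre B g)" if "h \<in> carrier G" for h
      using bmult_closed[OF g one_closed sc2[OF that], of "\<xi> h"] xi[OF that] g by simp
    have tP: "?t \<in> sp \<xi> \<rightarrow> carrier (fibre B g)" using tc spG by auto
    have Zc: "Z g (u g) \<xi> \<in> carrier (fibre B g)" unfolding Z_def by (rule V.finsum_closed[OF tP])
    have lt: "lam g (?t h) \<otimes>\<^sub>RA ras (uu g) = y g h" if h: "h \<in> carrier G" for h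
    proof -
      have xh: "\<xi> h \<in> carrier (fibre B \<one>)" "\<xi> (g \<otimes> h) \<in> carrier (fibre B \<one>)" using xi g h by simp_all
      have "lam g (?t h) = lam g (bmult B (bstar B (\<xi> (g \<otimes> h))) (u g)) \<otimes>\<^sub>RA iota (\<xi> h)"
        using RA_lam_mult[OF g one_closed sc2[OF h] xh(1)] g by simp
      also have "lam g (bmult B (bstar B (\<xi> (g \<otimes> h))) (u g)) = ras (iota (\<xi> (g \<otimes> h))) \<otimes>\<^sub>RA uu g"
        using RA_lam_mult[OF one_closed g sc[OF h] ug] RA_lam_star[OF one_closed xh(2)] g by simp
      finally show ?thesis using g h U by (simp add: y_def A.m_assoc iota_closed xi)
    qed
    have "lam g (Z g (u g) \<xi>) = (\<Oplus>\<^sub>RA h\<in>sp \<xi>. lam g (?t h))"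
      unfolding Z_def by (rule V.clinear_map_finsum[OF RA_lam_linear[OF g] A.seminormed_axioms fin tP])
    then have "lam g (Z g (u g) \<xi>) \<otimes>\<^sub>RA ras (uu g) = (\<Oplus>\<^sub>RA h\<in>sp \<xi>. lam g (?t h) \<otimes>\<^sub>RA ras (uu g))"
      using A.finsum_ldistr[OF fin, of "ras (uu g)" "\<lambda>h. lam g (?t h)"] U lam_RA[OF g tc] spG by auto
    also have "\<dots> = (\<Oplus>\<^sub>RA h\<in>sp \<xi>. y g h)" using lt spG yc g by (intro A.finsum_cong') auto
    finally have e: "lam g (Z g (u g) \<xi>) \<otimes>\<^sub>RA ras (uu g) = (\<Oplus>\<^sub>RA h\<in>sp \<xi>. y g h)" .
    have s: "\<psi> (Ex (\<Oplus>\<^sub>RA h\<in>sp \<xi>. y g h)) = (\<Sum>h\<in>sp \<xi>. \<psi> (Ex (y g h)))"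
      using yc g spG by (intro R.fn_finsum fin) auto
    let ?d = "Z g (u g) \<xi> \<ominus>\<^sub>(fibre B g) u g"
    have dc: "?d \<in> carrier (fibre B g)" using Zc ug by simp
    have "lam g ?d \<otimes>\<^sub>RA ras (uu g) = (\<Oplus>\<^sub>RA h\<in>sp \<xi>. y g h) \<ominus>\<^sub>RA \<one>\<^sub>RA"
      unfolding V.clinear_map_diff[OF RA_lam_linear[OF g] A.seminormed_axioms Zc ug] e[symmetric]
      using lam_RA[OF g Zc] U by (simp add: A.minus_eq A.l_distr A.l_minus uu_right[OF g])
    then have "(\<Sum>h\<in>sp \<xi>. \<psi> (Ex (y g h))) - 1 = \<psi> (Ex (lam g ?d \<otimes>\<^sub>RA ras (uu g)))"
      using yc g spG by (simp add: s[symmetric] R.fn_diff A.finsum_closed Pi_iff)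
    also have "cmod \<dots> \<le> ||lam g ?d \<otimes>\<^sub>RA ras (uu g)||\<^sub>RA"
      using R.fn_le[of "lam g ?d \<otimes>\<^sub>RA ras (uu g)"] lam_RA[OF g dc] U by simp
    also have "\<dots> \<le> ||lam g ?d||\<^sub>RA * ||ras (uu g)||\<^sub>RA" by (intro A.nrm_mult lam_RA[OF g dc] A.star_closed U)
    also have "\<dots> \<le> ||?d||\<^sub>(fibre B g)"
      using uu_nrm[OF g] U V.nrm_nonneg[OF dc] by (simp add: lam_nrm[OF g dc] mult_left_le)
    also have "\<dots> < \<delta>" using close[OF g'] Zc ug by (simp add: V.ndist_eq)
    finally show ?thesis .
  qed
  have term_le: "cmod (\<psi> (Ex (y g h))) \<le> a (g \<otimes> h) * a h" if g: "g \<in> carrier G" and h: "h \<in> carrier G" for g h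
    using R.fn_CS[OF iota_closed[OF xi], of "g \<otimes> h" "uu g \<otimes>\<^sub>RA iota (\<xi> h) \<otimes>\<^sub>RA ras (uu g)"]
      gns_uu(1)[OF g g iota_closed[OF xi[OF h]]] g h by (simp add: y_def gns_iota xi aG uu_closed iota_closed)
  \<comment> \<open>This is the case g = 1, included among the test elements for this purpose: as
    u(1) = 1, the sum in \<open>close2\<close> is exactly N.\<close>
  have "\<bar>N - 1\<bar> < \<delta>"
  proof -
    have "\<psi> (Ex (y \<one> h)) = of_real ((a h)\<^sup>2)" if h: "h \<in> carrier G" for h
    proof -
      have "y \<one> h = ras (iota (\<xi> h)) \<otimes>\<^sub>RA iota (\<xi> h)"
        using h iota_closed[OF xi[OF h]] by (simp add: y_def u1 RA_lam_one)
      then show ?thesis using R.fn_sq(1)[OF iota_closed[OF xi[OF h]]] R.nrm_gns_sq[OF iota_closed[OF xi[OF h]]]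
        by (simp add: gns_iota xi h aG)
    qed
    then have "(\<Sum>h\<in>sp \<xi>. \<psi> (Ex (y \<one> h))) = of_real N" using spG by (simp add: N_def)
    then have "cmod (of_real (N - 1)) < \<delta>" using close2[of \<one>] by simp
    then show ?thesis by (simp only: norm_of_real)
  qed
  then have N: "N > 0" "N < 1 + \<delta>" using \<delta> by linarith+
  define f where "f h = a h / sqrt N" for h
  have "weight G (sp \<xi>) f" unfolding weight_def
  proof (intro conjI allI impI)
    show "(\<Sum>h\<in>sp \<xi>. (f h)\<^sup>2) = 1"
      using N by (simp add: f_def power_divide sum_divide_distrib[symmetric] N_def[symmetric])
  qed (use fin a0 N in \<open>auto simp: f_def a_def sp_def\<close>)
  moreover have "1 - \<epsilon> < overlap G (sp \<xi>) f g" if g: "g \<in> K" for g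
  proof -
    have gG: "g \<in> carrier G" using g K by auto
    have "1 - \<delta> \<le> cmod (\<Sum>h\<in>sp \<xi>. \<psi> (Ex (y g h)))"
      using close2[of g] g norm_triangle_ineq2[of 1 "1 - (\<Sum>h\<in>sp \<xi>. \<psi> (Ex (y g h)))"]
      by (simp add: norm_minus_commute)
    also have "\<dots> \<le> (\<Sum>h\<in>sp \<xi>. a (g \<otimes> h) * a h)"
      using term_le[OF gG] spG by (intro order_trans[OF norm_sum] sum_mono) auto
    also have "\<dots> = N * overlap G (sp \<xi>) f g" using N by (simp add: overlap_def f_def sum_distrib_left)
    finally have le: "1 - \<delta> \<le> N * overlap G (sp \<xi>) f g" .
    have "0 \<le> overlap G (sp \<xi>) f g" using a0 N by (auto simp: overlap_def f_def intro!: sum_nonneg)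
    then have "N * overlap G (sp \<xi>) f g \<le> (1 + \<delta>) * overlap G (sp \<xi>) f g" using N by (intro mult_right_mono) auto
    then have 1: "1 - \<delta> \<le> (1 + \<delta>) * overlap G (sp \<xi>) f g" using le by linarith
    have "(1 + \<delta>) * (1 - \<epsilon>) < 1 - \<delta>"
    proof -
      have "(1 + \<delta>) * (1 - \<epsilon>) < (1 + \<delta>) * (1 - 2 * \<delta>)" using \<delta> by (intro mult_strict_left_mono) auto
      also have "\<dots> = 1 - \<delta> - 2 * \<delta> * \<delta>" by (simp add: algebra_simps)
      finally show ?thesis using \<delta> by (simp add: less_le_trans)
    qed
    then have "(1 + \<delta>) * (1 - \<epsilon>) < (1 + \<delta>) * overlap G (sp \<xi>) f g" using 1 by linarith
    then show ?thesis using \<delta> by simp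
  qed
  ultimately show ?thesis by blast
qed

end

section \<open>Averaging a completely positive map over the group\<close>

lemma (in abelian_monoid) finsum_pairs:
  assumes "finite I" "finite J" "\<And>i j. \<lbrakk>i \<in> I; j \<in> J\<rbrakk> \<Longrightarrow> f i j \<in> carrier G"
  shows "(\<Oplus>p\<in>I \<times> J. f (fst p) (snd p)) = (\<Oplus>i\<in>I. \<Oplus>j\<in>J. f i j)" using assms(1,3)
proof (induction I rule: finite_induct)
  case (insert i I)
  have e: "insert i I \<times> J = Pair i ` J \<union> I \<times> J" by auto
  have "(\<Oplus>p\<in>insert i I \<times> J. f (fst p) (snd p)) = (\<Oplus>p\<in>Pair i ` J. f (fst p) (snd p)) \<oplus> (\<Oplus>p\<in>I \<times> J. f (fst p) (snd p))"
    unfolding e using insert assms(2) by (intro finsum_Un_disjoint) auto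
  also have "(\<Oplus>p\<in>Pair i ` J. f (fst p) (snd p)) = (\<Oplus>j\<in>J. f i j)"
    using insert by (subst finsum_reindex) (auto simp: inj_on_def)
  also have "(\<Oplus>p\<in>I \<times> J. f (fst p) (snd p)) = (\<Oplus>i\<in>I. \<Oplus>j\<in>J. f i j)" using insert by simp
  finally show ?case using insert by (subst finsum_insert) (auto intro!: finsum_closed)
qed simp

lemma (in seminormed) finsum_smult_const:
  "\<lbrakk>finite I; v \<in> carrier V\<rbrakk> \<Longrightarrow> (\<Oplus>i\<in>I. c i \<odot> v) = (\<Sum>i\<in>I. c i) \<odot> v"
proof (induction I rule: finite_induct)
  case (insert i I)
  then show ?case by (subst finsum_insert) (auto simp: smult_add_l)
qed simp

lemma (in seminormed) clinear_map_finsum_maps: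
  assumes I: "finite I" and h: "\<And>i. i \<in> I \<Longrightarrow> clinear_map U V (h i)"
  shows "clinear_map U V (\<lambda>x. \<Oplus>i\<in>I. h i x)"
proof -
  have hc: "(\<lambda>i. h i x) \<in> I \<rightarrow> carrier V" if "x \<in> carrier U" for x using h that by (fastforce simp: clinear_map_def)
  show ?thesis unfolding clinear_map_def
  proof (intro conjI ballI allI funcsetI)
    fix x c assume x: "x \<in> carrier U"
    show "(\<Oplus>i\<in>I. h i x) \<in> carrier V" by (rule finsum_closed[OF hc[OF x]])
    show "(\<Oplus>i\<in>I. h i (c \<odot>\<^sub>U x)) = c \<odot> (\<Oplus>i\<in>I. h i x)"
      unfolding smult_finsum[OF I hc[OF x]] using h x hc[OF x] by (intro finsum_cong') (auto simp: clinear_map_def)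
    fix y assume y: "y \<in> carrier U"
    show "(\<Oplus>i\<in>I. h i (x \<oplus>\<^sub>U y)) = (\<Oplus>i\<in>I. h i x) \<oplus> (\<Oplus>i\<in>I. h i y)"
      unfolding finsum_addf[OF hc[OF x] hc[OF y], symmetric]
      using h x y hc[OF x] hc[OF y] by (intro finsum_cong') (auto simp: clinear_map_def)
  qed
qed

context crossed begin

lemma lam_triple:
  assumes g: "g \<in> carrier G" and h: "h \<in> carrier G" and k: "k \<in> carrier G"
    and a: "a \<in> carrier (fibre B g)" and b: "b \<in> carrier (fibre B h)" and c: "c \<in> carrier (fibre B k)"
  shows "\<exists>e\<in>carrier (fibre B (g \<otimes> h \<otimes> k)). lam g a \<otimes>\<^sub>RA lam h b \<otimes>\<^sub>RA lam k c = lam (g \<otimes> h \<otimes> k) e"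
  using bmult_closed[OF m_closed[OF g h] k bmult_closed[OF g h a b] c] RA_lam_mult[OF g h a b]
    RA_lam_mult[OF m_closed[OF g h] k bmult_closed[OF g h a b] c] by auto

lemma sandwich_up:
  assumes s: "s \<in> carrier G" and t: "t \<in> carrier G" and d: "d \<in> carrier Be"
  shows "\<exists>e\<in>carrier (fibre B (s \<otimes> inv t)). uu s \<otimes>\<^sub>RA iota d \<otimes>\<^sub>RA ras (uu t) = lam (s \<otimes> inv t) e"
  using lam_triple[OF s one_closed inv_closed[OF t] u_closed[OF s] _ bstar_closed[OF t u_closed[OF t]], of d] s t d
  by (simp add: RA_lam_star u_closed)

lemma sandwich_down:
  assumes s: "s \<in> carrier G" and t: "t \<in> carrier G" and g: "g \<in> carrier G" and b: "b \<in> carrier (fibre B g)"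
  shows "\<exists>e\<in>carrier (fibre B (inv s \<otimes> g \<otimes> t)). ras (uu s) \<otimes>\<^sub>RA lam g b \<otimes>\<^sub>RA uu t = lam (inv s \<otimes> g \<otimes> t) e"
  using lam_triple[OF inv_closed[OF s] g t bstar_closed[OF s u_closed[OF s]] b u_closed[OF t]] s
  by (simp add: RA_lam_star u_closed)

lemma sandwich_inverse:
  assumes s: "s \<in> carrier G" and t: "t \<in> carrier G" and x: "x \<in> carrier RA"
  shows "uu s \<otimes>\<^sub>RA (ras (uu s) \<otimes>\<^sub>RA x \<otimes>\<^sub>RA uu t) \<otimes>\<^sub>RA ras (uu t) = x"
proof -
  note c = uu_closed[OF s] uu_closed[OF t]
  have "uu s \<otimes>\<^sub>RA (ras (uu s) \<otimes>\<^sub>RA x \<otimes>\<^sub>RA uu t) \<otimes>\<^sub>RA ras (uu t) =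
    (uu s \<otimes>\<^sub>RA ras (uu s)) \<otimes>\<^sub>RA x \<otimes>\<^sub>RA (uu t \<otimes>\<^sub>RA ras (uu t))" using c x by (simp add: A.m_assoc)
  then show ?thesis using x by (simp add: uu_right[OF s] uu_right[OF t])
qed

lemma Ex_bimodule:
  assumes a: "a \<in> carrier Be" and b: "b \<in> carrier Be" and x: "x \<in> carrier RA"
  shows "Ex (ras (iota a) \<otimes>\<^sub>RA (x \<otimes>\<^sub>RA iota b)) = star Be a \<otimes>\<^sub>Be (Ex x \<otimes>\<^sub>Be b)"
proof -
  have "ras (iota a) \<otimes>\<^sub>RA (x \<otimes>\<^sub>RA iota b) = ras (iota a) \<otimes>\<^sub>RA x \<otimes>\<^sub>RA iota b"
    using a b x by (simp add: A.m_assoc iota_closed)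
  moreover have "star Be a \<otimes>\<^sub>Be (Ex x \<otimes>\<^sub>Be b) = star Be a \<otimes>\<^sub>Be Ex x \<otimes>\<^sub>Be b"
    using a b Ex_closed[OF x] by (simp add: D.m_assoc)
  ultimately show ?thesis using Ex_conj[OF one_closed _ _ x, of a b] a b by (simp add: be_mult be_star)
qed

text \<open>By the bimodule property the form of the new matrix at a column over \<open>B_e\<close>
  is E of the form of N at the same column viewed in the reduced algebra, and E is positive.\<close>

lemma Ex_gpos:
  assumes Q: "finite Q" and N: "gpos RA Q N"
  shows "gpos Be Q (\<lambda>q r. Ex (N q r))" unfolding gpos_def
proof (intro conjI ballI)
  have Nc: "N q r \<in> carrier RA" "ras (N q r) = N r q" if "q \<in> Q" "r \<in> Q" for q r
    using N that unfolding gpos_def by blast+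
  fix q r assume qr: "q \<in> Q" "r \<in> Q"
  show "Ex (N q r) \<in> carrier Be" by (rule Ex_closed[OF Nc(1)[OF qr]])
  show "star Be (Ex (N q r)) = Ex (N r q)" using Ex_star[OF Nc(1)[OF qr]] Nc(2)[OF qr] by simp
next
  have Nc: "N q r \<in> carrier RA" if "q \<in> Q" "r \<in> Q" for q r using N that unfolding gpos_def by blast
  fix x assume "x \<in> Q \<rightarrow> carrier Be"
  then have x: "x q \<in> carrier Be" "iota (x q) \<in> carrier RA" if "q \<in> Q" for q using that by (auto intro: iota_closed)
  let ?y = "\<lambda>q r. ras (iota (x q)) \<otimes>\<^sub>RA (N q r \<otimes>\<^sub>RA iota (x r))"
  have y: "?y q r \<in> carrier RA" if "q \<in> Q" "r \<in> Q" for q r using that Nc x by simp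
  have "positive RA (\<Oplus>\<^sub>RA q\<in>Q. \<Oplus>\<^sub>RA r\<in>Q. ?y q r)" using N x(2) unfolding gpos_def by (auto elim!: bspec)
  from Ex_positive[OF this] have p: "positive Be (Ex (\<Oplus>\<^sub>RA q\<in>Q. \<Oplus>\<^sub>RA r\<in>Q. ?y q r))" .
  have "Ex (\<Oplus>\<^sub>RA q\<in>Q. \<Oplus>\<^sub>RA r\<in>Q. ?y q r) = (\<Oplus>\<^sub>Be q\<in>Q. Ex (\<Oplus>\<^sub>RA r\<in>Q. ?y q r))"
    by (rule A.clinear_map_finsum[OF Ex_linear D.seminormed_axioms Q]) (use y in \<open>auto intro!: A.finsum_closed\<close>)
  also have "\<dots> = (\<Oplus>\<^sub>Be q\<in>Q. \<Oplus>\<^sub>Be r\<in>Q. star Be (x q) \<otimes>\<^sub>Be (Ex (N q r) \<otimes>\<^sub>Be x r))"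
  proof (rule D.finsum_cong'[OF refl])
    show "(\<lambda>q. \<Oplus>\<^sub>Be r\<in>Q. star Be (x q) \<otimes>\<^sub>Be (Ex (N q r) \<otimes>\<^sub>Be x r)) \<in> Q \<rightarrow> carrier Be"
      using x(1) Ex_closed[OF Nc] by (auto intro!: D.finsum_closed)
    fix q assume q: "q \<in> Q"
    have "Ex (\<Oplus>\<^sub>RA r\<in>Q. ?y q r) = (\<Oplus>\<^sub>Be r\<in>Q. Ex (?y q r))"
      by (rule A.clinear_map_finsum[OF Ex_linear D.seminormed_axioms Q]) (use y[OF q] in auto)
    also have "\<dots> = (\<Oplus>\<^sub>Be r\<in>Q. star Be (x q) \<otimes>\<^sub>Be (Ex (N q r) \<otimes>\<^sub>Be x r))"
      using x(1) Ex_closed[OF Nc] q by (intro D.finsum_cong') (auto simp: Ex_bimodule[OF _ _ Nc])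
    finally show "Ex (\<Oplus>\<^sub>RA r\<in>Q. ?y q r) = (\<Oplus>\<^sub>Be r\<in>Q. star Be (x q) \<otimes>\<^sub>Be (Ex (N q r) \<otimes>\<^sub>Be x r))" .
  qed
  finally show "positive Be (\<Oplus>\<^sub>Be q\<in>Q. \<Oplus>\<^sub>Be r\<in>Q. star Be (x q) \<otimes>\<^sub>Be (Ex (N q r) \<otimes>\<^sub>Be x r))" using p by simp
qed

end

section \<open>The averaged map for fixed weights and a fixed completely positive map\<close>

locale averaging = crossed G B u \<psi> for G (structure) and B u \<psi> +
  fixes X f \<Phi>
  assumes w: "weight G X f"
    and cp: "completely_positive (unit_fibre G B) \<Phi>"
    and contr: "contractive_map (unit_fibre G B) (unit_fibre G B) \<Phi>"
    and decr: "positive (unit_fibre G B) a \<Longrightarrow> Re (\<psi> (\<Phi> a)) \<le> Re (\<psi> a)"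
begin

lemma X: "finite X" "t \<in> X \<Longrightarrow> t \<in> carrier G" and f0: "0 \<le> f h" "h \<notin> X \<Longrightarrow> f h = 0" and f1: "(\<Sum>h\<in>X. (f h)\<^sup>2) = 1"
  using w by (auto simp: weight_def)

lemma XX: "finite (X \<times> X)" "p \<in> X \<times> X \<Longrightarrow> fst p \<in> carrier G" "p \<in> X \<times> X \<Longrightarrow> snd p \<in> carrier G" using X by auto

lemma f_le_1: "f t \<le> 1"
proof (cases "t \<in> X")
  case True
  then have "(f t)\<^sup>2 \<le> (\<Sum>h\<in>X. (f h)\<^sup>2)" using X(1) by (intro member_le_sum) auto
  then have "(f t)\<^sup>2 \<le> 1\<^sup>2" using f1 by simp
  then show ?thesis by (rule power2_le_imp_le) simp
qed (simp add: f0)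

lemma Phi_closed [simp]: "d \<in> carrier Be \<Longrightarrow> \<Phi> d \<in> carrier Be" by (rule D.cp_closed[OF cp])

lemma Phi_linear: "clinear_map Be Be \<Phi>" using cp by (simp add: completely_positive_def)

lemma Phi_one: "||\<Phi> \<one>\<^sub>Be||\<^sub>Be \<le> 1" using contr D.nrm_one_le by (force simp: contractive_map_def)

text \<open>For p = (s, t), \<open>co p\<close> extracts the coefficient of x at (s, t), and
  \<open>sw p\<close> puts an element of \<open>B_e\<close> back in that place with weight f(s)
  f(t). Then \<open>avg\<close> is the map \<Psi> of the overview, compressed to the finite set X by
  the weights.\<close>

definition "sw p d = of_real (f (fst p) * f (snd p)) \<odot>\<^sub>RA (uu (fst p) \<otimes>\<^sub>RA iota d \<otimes>\<^sub>RA ras (uu (snd p)))"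
definition "co p x = Ex (ras (uu (fst p)) \<otimes>\<^sub>RA x \<otimes>\<^sub>RA uu (snd p))"
definition "avg x = (\<Oplus>\<^sub>RA p\<in>X \<times> X. sw p (\<Phi> (co p x)))"

lemma sw_core: "\<lbrakk>p \<in> X \<times> X; d \<in> carrier Be\<rbrakk> \<Longrightarrow> uu (fst p) \<otimes>\<^sub>RA iota d \<otimes>\<^sub>RA ras (uu (snd p)) \<in> carrier RA"
  by (intro A.m_closed A.star_closed uu_closed iota_closed XX)

lemma sw_closed: "\<lbrakk>p \<in> X \<times> X; d \<in> carrier Be\<rbrakk> \<Longrightarrow> sw p d \<in> carrier RA"
  unfolding sw_def by (intro A.smultC sw_core)

lemma sw_linear: assumes p: "p \<in> X \<times> X" shows "clinear_map Be RA (sw p)"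
proof -
  note U = uu_closed[OF XX(2)[OF p]] uu_closed[OF XX(3)[OF p]]
  have "iota (d \<oplus>\<^sub>Be e) = iota d \<oplus>\<^sub>RA iota e" "iota (c \<odot>\<^sub>Be d) = c \<odot>\<^sub>RA iota d"
    if "d \<in> carrier Be" "e \<in> carrier Be" for d e c using iota_linear that unfolding clinear_map_def by blast+
  then show ?thesis unfolding clinear_map_def sw_def using U sw_core[OF p]
    by (auto simp: A.l_distr A.r_distr A.smult_add_r A.smult_mult A.smult_mult_l A.smult_mult_r iota_closed mult_ac)
qed

lemma co_core: "\<lbrakk>p \<in> X \<times> X; x \<in> carrier RA\<rbrakk> \<Longrightarrow> ras (uu (fst p)) \<otimes>\<^sub>RA x \<otimes>\<^sub>RA uu (snd p) \<in> carrier RA"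
  by (intro A.m_closed A.star_closed uu_closed XX)

lemma co_closed: "\<lbrakk>p \<in> X \<times> X; x \<in> carrier RA\<rbrakk> \<Longrightarrow> co p x \<in> carrier Be"
  unfolding co_def by (intro Ex_closed co_core)

lemma co_linear: assumes p: "p \<in> X \<times> X" shows "clinear_map RA Be (co p)"
proof -
  note U = uu_closed[OF XX(2)[OF p]] uu_closed[OF XX(3)[OF p]]
  show ?thesis unfolding clinear_map_def co_def using U co_core[OF p]
    by (auto simp: A.l_distr A.r_distr A.smult_mult_l A.smult_mult_r Ex_add Ex_smult Ex_closed)
qed

lemma term_closed: "\<lbrakk>p \<in> X \<times> X; x \<in> carrier RA\<rbrakk> \<Longrightarrow> sw p (\<Phi> (co p x)) \<in> carrier RA"
  by (intro sw_closed Phi_closed co_closed)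

lemma avg_linear: "clinear_map RA RA avg" unfolding avg_def[abs_def]
proof (rule A.clinear_map_finsum_maps[OF XX(1)])
  fix p assume p: "p \<in> X \<times> X"
  show "clinear_map RA RA (\<lambda>x. sw p (\<Phi> (co p x)))"
    using sw_linear[OF p] co_linear[OF p] Phi_linear co_closed[OF p] Phi_closed
    unfolding clinear_map_def by (simp add: Pi_iff)
qed

lemma avg_closed: "x \<in> carrier RA \<Longrightarrow> avg x \<in> carrier RA" using avg_linear by (auto simp: clinear_map_def)

text \<open>The argument of E has degree s^-1 g t, and E kills every degree but the neutral one.
  This is why each fibre meets only the pairs with s = g t.\<close>

lemma co_zero: assumes p: "p \<in> X \<times> X" and g: "g \<in> carrier G" and b: "b \<in> carrier (fibre B g)" and ne: "fst p \<noteq> g \<otimes> snd p"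
  shows "co p (lam g b) = \<zero>\<^sub>Be"
proof -
  note s = XX(2)[OF p] and t = XX(3)[OF p]
  have "inv (fst p) \<otimes> g \<otimes> snd p \<noteq> \<one>"
  proof
    assume "inv (fst p) \<otimes> g \<otimes> snd p = \<one>"
    then have "inv (fst p) \<otimes> (g \<otimes> snd p) = \<one>" using s t g by (simp add: m_assoc)
    then have "fst p = g \<otimes> snd p" using s t g by (metis inv_closed inv_equality inv_inv m_closed)
    then show False using ne by simp
  qed
  then show ?thesis using sandwich_down[OF s t g b] s t g by (auto simp: co_def Ex_lam)
qed

lemma term_zero: assumes "p \<in> X \<times> X" "g \<in> carrier G" "b \<in> carrier (fibre B g)" "fst p \<noteq> g \<otimes> snd p"
  shows "sw p (\<Phi> (co p (lam g b))) = \<zero>\<^sub>RA"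
  using co_zero[OF assms] D.clinear_map_zero[OF Phi_linear D.seminormed_axioms]
    D.clinear_map_zero[OF sw_linear[OF assms(1)] A.seminormed_axioms] by simp

lemma sum_pairs: "(\<Sum>p\<in>X \<times> X. if fst p = snd p then \<phi> (fst p) else (0::real)) = (\<Sum>s\<in>X. \<phi> s)"
proof -
  have "(\<Sum>p\<in>X \<times> X. if fst p = snd p then \<phi> (fst p) else 0) = (\<Sum>s\<in>X. \<Sum>t\<in>X. if s = t then \<phi> s else 0)"
    by (simp add: sum.cartesian_product case_prod_unfold)
  then show ?thesis using X(1) by simp
qed

lemma sw_nrm: assumes p: "p \<in> X \<times> X" and d: "d \<in> carrier Be"
  shows "||sw p d||\<^sub>RA \<le> f (fst p) * f (snd p) * ||d||\<^sub>Be"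
proof -
  note s = XX(2)[OF p] and t = XX(3)[OF p]
  note U = uu_closed[OF s] uu_closed[OF t] iota_closed[OF d]
  have "||uu (fst p) \<otimes>\<^sub>RA iota d \<otimes>\<^sub>RA ras (uu (snd p))||\<^sub>RA \<le> ||uu (fst p) \<otimes>\<^sub>RA iota d||\<^sub>RA * ||ras (uu (snd p))||\<^sub>RA"
    using U by (intro A.nrm_mult) auto
  also have "\<dots> \<le> ||uu (fst p) \<otimes>\<^sub>RA iota d||\<^sub>RA" using uu_nrm[OF t] U by (simp add: mult_left_le)
  also have "\<dots> \<le> ||uu (fst p)||\<^sub>RA * ||iota d||\<^sub>RA" using U by (intro A.nrm_mult) auto
  also have "\<dots> \<le> ||iota d||\<^sub>RA" using uu_nrm[OF s] U by (simp add: mult_left_le_one_le)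
  also have "\<dots> = ||d||\<^sub>Be" using lam_nrm[OF one_closed, of d] d by simp
  finally show ?thesis using f0(1) sw_core[OF p d] by (simp add: sw_def A.nrm_smult norm_mult mult_left_mono)
qed

text \<open>At x = 1 only the diagonal pairs contribute, each at most f(s)^2 in norm, and these
  squares add up to 1.\<close>

lemma avg_one: "||avg \<one>\<^sub>RA||\<^sub>RA \<le> 1"
proof -
  have "||avg \<one>\<^sub>RA||\<^sub>RA \<le> (\<Sum>p\<in>X \<times> X. ||sw p (\<Phi> (co p \<one>\<^sub>RA))||\<^sub>RA)"
    unfolding avg_def by (intro A.nrm_finsum_le XX(1)) (auto intro!: term_closed)
  also have "\<dots> \<le> (\<Sum>p\<in>X \<times> X. if fst p = snd p then (f (fst p))\<^sup>2 else 0)"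
  proof (rule sum_mono)
    fix p assume p: "p \<in> X \<times> X"
    show "||sw p (\<Phi> (co p \<one>\<^sub>RA))||\<^sub>RA \<le> (if fst p = snd p then (f (fst p))\<^sup>2 else 0)"
    proof (cases "fst p = snd p")
      case True
      then have e: "co p \<one>\<^sub>RA = \<one>\<^sub>Be"
        using Ex_iota[of "\<one>\<^sub>Be"] uu_closed[OF XX(3)[OF p]] by (simp add: co_def uu_left[OF XX(3)[OF p]] RA_lam_one)
      have "||sw p (\<Phi> (co p \<one>\<^sub>RA))||\<^sub>RA \<le> f (fst p) * f (snd p) * ||\<Phi> \<one>\<^sub>Be||\<^sub>Be"
        unfolding e by (intro sw_nrm p Phi_closed) simp
      also have "\<dots> \<le> f (fst p) * f (snd p)" using Phi_one f0(1) by (intro mult_left_le) auto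
      finally show ?thesis using True by (simp add: power2_eq_square)
    next
      case False
      then have "sw p (\<Phi> (co p \<one>\<^sub>RA)) = \<zero>\<^sub>RA"
        using term_zero[OF p one_closed, of "\<one>\<^sub>Be"] XX p by (simp add: RA_lam_one)
      then show ?thesis using False by simp
    qed
  qed
  also have "\<dots> = 1" using sum_pairs[of "\<lambda>s. (f s)\<^sup>2"] f1 by simp
  finally show ?thesis .
qed

lemma psi_sw:
  assumes p: "p \<in> X \<times> X" and d: "d \<in> carrier Be"
  shows "\<psi> (Ex (sw p d)) = (if fst p = snd p then of_real ((f (fst p))\<^sup>2) * \<psi> d else 0)"
proof (cases "fst p = snd p")
  case True
  then show ?thesis using phi_conj'[OF XX(2)[OF p] iota_closed[OF d]] sw_core[OF p d]
    by (simp add: sw_def R.fn_smult Ex_iota[OF d] power2_eq_square)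
next
  case False
  note s = XX(2)[OF p] and t = XX(3)[OF p]
  have "fst p \<otimes> inv (snd p) \<noteq> \<one>" using False s t by (metis inv_closed inv_equality inv_inv)
  then have "Ex (uu (fst p) \<otimes>\<^sub>RA iota d \<otimes>\<^sub>RA ras (uu (snd p))) = \<zero>\<^sub>Be"
    using sandwich_up[OF s t d] s t by (auto simp: Ex_lam)
  then show ?thesis using False sw_core[OF p d] by (simp add: sw_def R.fn_smult)
qed

text \<open>The terms with different s and t have nonneutral degree and vanish under E. On the
  diagonal \<Phi> decreases \<psi>, invariance removes both conjugations, and the squares f(s)^2 add
  up to 1.\<close>

lemma avg_decr: assumes x: "positive RA x" shows "Re (\<psi> (Ex (avg x))) \<le> Re (\<psi> (Ex x))"
proof -
  have xc: "x \<in> carrier RA" by (rule A.positive_closed[OF x])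
  have "\<psi> (Ex (avg x)) = (\<Sum>p\<in>X \<times> X. \<psi> (Ex (sw p (\<Phi> (co p x)))))"
    unfolding avg_def using XX(1) by (rule R.fn_finsum) (auto intro!: term_closed xc)
  then have "Re (\<psi> (Ex (avg x))) = (\<Sum>p\<in>X \<times> X. Re (\<psi> (Ex (sw p (\<Phi> (co p x))))))" by simp
  also have "\<dots> \<le> (\<Sum>p\<in>X \<times> X. if fst p = snd p then (f (fst p))\<^sup>2 * Re (\<psi> (Ex x)) else 0)"
  proof (rule sum_mono)
    fix p assume p: "p \<in> X \<times> X"
    show "Re (\<psi> (Ex (sw p (\<Phi> (co p x))))) \<le> (if fst p = snd p then (f (fst p))\<^sup>2 * Re (\<psi> (Ex x)) else 0)"
    proof (cases "fst p = snd p")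
      case True
      then have "positive Be (co p x)"
        using Ex_positive[OF A.positive_conj[OF x uu_closed[OF XX(3)[OF p]]]] by (simp add: co_def)
      then have "Re (\<psi> (\<Phi> (co p x))) \<le> Re (\<psi> (co p x))" by (rule decr)
      also have "\<psi> (co p x) = \<psi> (Ex x)" using phi_conj[OF XX(2)[OF p] xc] True by (simp add: co_def)
      finally have "(f (fst p))\<^sup>2 * Re (\<psi> (\<Phi> (co p x))) \<le> (f (fst p))\<^sup>2 * Re (\<psi> (Ex x))"
        by (intro mult_left_mono) auto
      then show ?thesis using True psi_sw[OF p Phi_closed[OF co_closed[OF p xc]]] by (simp del: of_real_power)
    next
      case False
      then show ?thesis using psi_sw[OF p Phi_closed[OF co_closed[OF p xc]]] by simp
    qed
  qed
  also have "\<dots> = Re (\<psi> (Ex x))" using sum_pairs[of "\<lambda>s. (f s)\<^sup>2 * Re (\<psi> (Ex x))"] f1 by (simp add: sum_distrib_right[symmetric])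
  finally show ?thesis .
qed

text \<open>Index rows by pairs (i, s). The matrix with entries u(s)* a_ij u(t) is again a Gram
  matrix, of the elements c_ki u(s). E and \<Phi> keep it positive, so its image is a Gram matrix of
  elements d k (i, s). Summing over s and t turns these into z_kj, the sum over t of f(t) d k (j, t)
  u(t)*, and \<open>avg (a i j)\<close> is the sum over k of z_ki* z_kj.\<close>

lemma avg_gram:
  assumes n: "mat_positive RA n a" shows "mat_positive RA n (\<lambda>i j. avg (a i j))"
proof -
  obtain c where c: "\<forall>i<n. \<forall>j<n. c i j \<in> carrier RA"
    "\<forall>i<n. \<forall>j<n. a i j = (\<Oplus>\<^sub>RA k\<in>{..<n}. ras (c k i) \<otimes>\<^sub>RA c k j)"
    using n unfolding mat_positive_def by (elim exE conjE)
  have ac: "a i j \<in> carrier RA" if "i < n" "j < n" for i j using that c by (auto intro!: A.finsum_closed)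
  define Q where "Q = {..<n} \<times> X"
  have Q: "finite Q" using X(1) by (simp add: Q_def)
  have QD: "fst q < n" "snd q \<in> X" "snd q \<in> carrier G" if "q \<in> Q" for q using that X(2) by (auto simp: Q_def)
  have "gpos RA Q (\<lambda>q r. ras (uu (snd q)) \<otimes>\<^sub>RA a (fst q) (fst r) \<otimes>\<^sub>RA uu (snd r))"
  proof (rule A.gram_gpos[OF Q finite_lessThan[of n], of "\<lambda>k q. c k (fst q) \<otimes>\<^sub>RA uu (snd q)"])
    fix k q assume "k \<in> {..<n}" "q \<in> Q"
    then show "c k (fst q) \<otimes>\<^sub>RA uu (snd q) \<in> carrier RA" using c(1) QD uu_closed by auto
  next
    fix q r assume q: "q \<in> Q" and r: "r \<in> Q"
    note U = uu_closed[OF QD(3)[OF q]] uu_closed[OF QD(3)[OF r]]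
    have cc: "c k (fst q) \<in> carrier RA" "c k (fst r) \<in> carrier RA" if "k < n" for k using c(1) QD(1) q r that by auto
    have "ras (uu (snd q)) \<otimes>\<^sub>RA a (fst q) (fst r) =
        (\<Oplus>\<^sub>RA k\<in>{..<n}. ras (uu (snd q)) \<otimes>\<^sub>RA (ras (c k (fst q)) \<otimes>\<^sub>RA c k (fst r)))"
      using c(2) QD(1) q r U cc by (subst A.finsum_rdistr[symmetric]) auto
    then have "ras (uu (snd q)) \<otimes>\<^sub>RA a (fst q) (fst r) \<otimes>\<^sub>RA uu (snd r) =
        (\<Oplus>\<^sub>RA k\<in>{..<n}. ras (uu (snd q)) \<otimes>\<^sub>RA (ras (c k (fst q)) \<otimes>\<^sub>RA c k (fst r)) \<otimes>\<^sub>RA uu (snd r))"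
      using U cc by (subst A.finsum_ldistr[symmetric]) auto
    also have "\<dots> = (\<Oplus>\<^sub>RA k\<in>{..<n}. ras (c k (fst q) \<otimes>\<^sub>RA uu (snd q)) \<otimes>\<^sub>RA (c k (fst r) \<otimes>\<^sub>RA uu (snd r)))"
      using U cc by (intro A.finsum_cong') (auto simp: A.star_mult A.m_assoc)
    finally show "ras (uu (snd q)) \<otimes>\<^sub>RA a (fst q) (fst r) \<otimes>\<^sub>RA uu (snd r) = \<dots>" .
  qed
  from D.cp_gram[OF cp Q Ex_gpos[OF Q this]] obtain d where
    d0: "\<forall>p<card Q. \<forall>q\<in>Q. d p q \<in> carrier Be" and
    d: "\<forall>q\<in>Q. \<forall>r\<in>Q. \<Phi> (Ex (ras (uu (snd q)) \<otimes>\<^sub>RA a (fst q) (fst r) \<otimes>\<^sub>RA uu (snd r))) =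
        (\<Oplus>\<^sub>Be p\<in>{..<card Q}. star Be (d p q) \<otimes>\<^sub>Be d p r)" by (elim exE conjE)
  have dc: "d p (i, t) \<in> carrier Be" if "p < card Q" "i < n" "t \<in> X" for p i t
    using d0 that by (auto simp: Q_def)
  \<comment> \<open>The product f(s) f(t) is split evenly between the two factors of the Gram form,
    so the weight of a pair becomes a positive matrix of rank one.\<close>
  define v where "v k j t = of_real (f t) \<odot>\<^sub>RA (iota (d k (j, t)) \<otimes>\<^sub>RA ras (uu t))" for k j t
  define z where "z k j = (\<Oplus>\<^sub>RA t\<in>X. v k j t)" for k j
  have vc: "v k j t \<in> carrier RA" if "k < card Q" "j < n" "t \<in> X" for k j t
    unfolding v_def using that by (intro A.smultC A.m_closed A.star_closed uu_closed iota_closed dc X(2))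
  have zc: "z k j \<in> carrier RA" if "k < card Q" "j < n" for k j
    unfolding z_def using vc that by (intro A.finsum_closed) auto
  have main: "avg (a i j) = (\<Oplus>\<^sub>RA k\<in>{..<card Q}. ras (z k i) \<otimes>\<^sub>RA z k j)" if i: "i < n" and j: "j < n" for i j
  proof -
    let ?w = "\<lambda>k p. ras (v k i (fst p)) \<otimes>\<^sub>RA v k j (snd p)"
    have wc: "?w k p \<in> carrier RA" if "k < card Q" "p \<in> X \<times> X" for k p using vc i j that by auto
    have "avg (a i j) = (\<Oplus>\<^sub>RA p\<in>X \<times> X. \<Oplus>\<^sub>RA k\<in>{..<card Q}. ?w k p)" unfolding avg_def
    proof (rule A.finsum_cong'[OF refl])
      show "(\<lambda>p. \<Oplus>\<^sub>RA k\<in>{..<card Q}. ?w k p) \<in> X \<times> X \<rightarrow> carrier RA" using wc by (auto intro!: A.finsum_closed)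
      fix p assume p: "p \<in> X \<times> X"
      note s = XX(2)[OF p] and t = XX(3)[OF p]
      have pX: "fst p \<in> X" "snd p \<in> X" using p by auto
      have D1: "d k (i, fst p) \<in> carrier Be" "d k (j, snd p) \<in> carrier Be" if "k < card Q" for k
        using dc that i j pX by auto
      have "\<Phi> (co p (a i j)) = (\<Oplus>\<^sub>Be k\<in>{..<card Q}. star Be (d k (i, fst p)) \<otimes>\<^sub>Be d k (j, snd p))"
        using d[rule_format, of "(i, fst p)" "(j, snd p)"] i j pX by (simp add: Q_def co_def)
      then have "sw p (\<Phi> (co p (a i j))) = (\<Oplus>\<^sub>RA k\<in>{..<card Q}. sw p (star Be (d k (i, fst p)) \<otimes>\<^sub>Be d k (j, snd p)))"
        using D.clinear_map_finsum[OF sw_linear[OF p] A.seminormed_axioms finite_lessThan[of "card Q"],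
          of "\<lambda>k. star Be (d k (i, fst p)) \<otimes>\<^sub>Be d k (j, snd p)"] D1 by (simp add: Pi_iff)
      also have "\<dots> = (\<Oplus>\<^sub>RA k\<in>{..<card Q}. ?w k p)"
      proof (rule A.finsum_cong'[OF refl])
        show "(\<lambda>k. ?w k p) \<in> {..<card Q} \<rightarrow> carrier RA" using wc p by auto
        fix k assume "k \<in> {..<card Q}"
        then have D2: "d k (i, fst p) \<in> carrier Be" "d k (j, snd p) \<in> carrier Be" using D1 by auto
        note U = uu_closed[OF s] uu_closed[OF t] iota_closed[OF D2(1)] iota_closed[OF D2(2)]
        show "sw p (star Be (d k (i, fst p)) \<otimes>\<^sub>Be d k (j, snd p)) = ?w k p"
          using U D2 by (simp add: sw_def v_def iota_mult[symmetric] iota_star[symmetric] A.star_smult A.star_mult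
            A.smult_mult_l A.smult_mult_r A.smult_mult A.m_assoc mult_ac)
      qed
      finally show "sw p (\<Phi> (co p (a i j))) = (\<Oplus>\<^sub>RA k\<in>{..<card Q}. ?w k p)" .
    qed
    also have "\<dots> = (\<Oplus>\<^sub>RA k\<in>{..<card Q}. \<Oplus>\<^sub>RA p\<in>X \<times> X. ?w k p)" using wc by (intro A.finsum_swap XX(1)) auto
    also have "\<dots> = (\<Oplus>\<^sub>RA k\<in>{..<card Q}. ras (z k i) \<otimes>\<^sub>RA z k j)"
    proof (rule A.finsum_cong'[OF refl])
      show "(\<lambda>k. ras (z k i) \<otimes>\<^sub>RA z k j) \<in> {..<card Q} \<rightarrow> carrier RA" using zc i j by auto
      fix k assume k: "k \<in> {..<card Q}"
      have V: "v k i \<in> X \<rightarrow> carrier RA" "v k j \<in> X \<rightarrow> carrier RA" using vc i j k by auto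
      have "(\<Oplus>\<^sub>RA p\<in>X \<times> X. ?w k p) = (\<Oplus>\<^sub>RA s\<in>X. \<Oplus>\<^sub>RA t\<in>X. ras (v k i s) \<otimes>\<^sub>RA v k j t)"
        using V by (intro A.finsum_pairs[of X X "\<lambda>s t. ras (v k i s) \<otimes>\<^sub>RA v k j t"] X(1)) auto
      also have "\<dots> = (\<Oplus>\<^sub>RA s\<in>X. ras (v k i s)) \<otimes>\<^sub>RA (\<Oplus>\<^sub>RA t\<in>X. v k j t)"
        using V by (intro A.finsum_mult_finsum[symmetric] X(1)) auto
      also have "(\<Oplus>\<^sub>RA s\<in>X. ras (v k i s)) = ras (z k i)"
        unfolding z_def by (rule A.star_finsum[OF X(1) V(1), symmetric])
      finally show "(\<Oplus>\<^sub>RA p\<in>X \<times> X. ?w k p) = ras (z k i) \<otimes>\<^sub>RA z k j" by (simp add: z_def)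
    qed
    finally show ?thesis .
  qed
  show ?thesis
    by (rule A.gpos_mat_positive, rule A.gram_gpos[OF finite_lessThan finite_lessThan[of "card Q"], of n z])
      (use zc main in auto)
qed

lemma avg_cp: "completely_positive RA avg" using avg_linear avg_gram by (simp add: completely_positive_def)

lemma avg_contractive: "contractive_map RA RA avg" by (rule A.cp_contractive[OF avg_cp avg_one])

lemma avg_gns: "x \<in> carrier RA \<Longrightarrow> ||avg x||\<^sub>R.gns \<le> ||x||\<^sub>R.gns"
  using R.cp_gns_contractive[OF avg_cp avg_one] avg_decr by blast

lemma sw_gns: assumes p: "p \<in> X \<times> X" and d: "d \<in> carrier Be"
  shows "||sw p d||\<^sub>R.gns = f (fst p) * f (snd p) * ||d||\<^sub>S.gns"
  using R.N.H.nrm_smult[of "uu (fst p) \<otimes>\<^sub>RA iota d \<otimes>\<^sub>RA ras (uu (snd p))" "of_real (f (fst p) * f (snd p))"]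
    sw_core[OF p d] gns_uu(1)[OF XX(2)[OF p] XX(3)[OF p] iota_closed[OF d]] gns_iota[OF d] f0(1)
  by (simp add: sw_def norm_mult)

text \<open>In the GNS seminorms \<open>co p\<close> is contractive, being an isometry followed by
  E, and \<open>sw p\<close> is an isometry multiplied by f(s) f(t) \<le> 1. So \<open>avg\<close>
  is a finite sum of contractive transports of \<Phi>.\<close>

lemma avg_totally_bounded:
  assumes tb: "totally_bounded_op S.gns \<Phi>" shows "totally_bounded_op R.gns avg"
proof (rule R.N.H.totally_bounded_op_finsum[OF S.N.H.seminormed_axioms tb _ XX(1), of co sw])
  fix p assume p: "p \<in> X \<times> X"
  { fix x assume x: "x \<in> carrier R.gns" "||x||\<^sub>R.gns \<le> 1"
    have "||co p x||\<^sub>S.gns \<le> ||x||\<^sub>R.gns"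
      using Ex_gns[OF co_core[OF p, of x]] gns_uu(2)[OF XX(2)[OF p] XX(3)[OF p], of x] x by (simp add: co_def)
    then show "co p x \<in> carrier S.gns \<and> ||co p x||\<^sub>S.gns \<le> 1" using x co_closed[OF p, of x] by simp }
  fix x assume x: "x \<in> carrier S.gns"
  show "sw p x \<in> carrier R.gns" using sw_closed[OF p] x by simp
  fix y assume y: "y \<in> carrier S.gns"
  have xy: "x \<in> carrier Be" "y \<in> carrier Be" "x \<ominus>\<^sub>Be y \<in> carrier Be" using x y by auto
  have "ndist R.gns (sw p x) (sw p y) = ||sw p (x \<ominus>\<^sub>Be y)||\<^sub>R.gns"
    using sw_closed[OF p] xy D.clinear_map_diff[OF sw_linear[OF p] A.seminormed_axioms xy(1,2)]
    by (simp add: R.N.H.ndist_eq)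
  also have "\<dots> \<le> 1 * ||x \<ominus>\<^sub>Be y||\<^sub>S.gns"
    unfolding sw_gns[OF p xy(3)] using f0(1) f_le_1 S.N.H.nrm_nonneg[of "x \<ominus>\<^sub>Be y"] xy
    by (intro mult_right_mono mult_le_one) auto
  finally show "ndist R.gns (sw p x) (sw p y) \<le> ndist S.gns x y" using xy by (simp add: S.N.H.ndist_eq)
qed (use avg_closed in \<open>auto simp: avg_def\<close>)

lemma overlap_pairs:
  assumes g: "g \<in> carrier G"
  shows "(\<Sum>p\<in>X \<times> X. if fst p = g \<otimes> snd p then f (fst p) * f (snd p) else 0) = overlap G X f g"
proof -
  have "(\<Sum>p\<in>X \<times> X. if fst p = g \<otimes> snd p then f (fst p) * f (snd p) else 0) =
      (\<Sum>s\<in>X. \<Sum>t\<in>X. if s = g \<otimes> t then f s * f t else 0)" by (simp add: sum.cartesian_product case_prod_unfold)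
  also have "\<dots> = (\<Sum>t\<in>X. \<Sum>s\<in>X. if s = g \<otimes> t then f s * f t else 0)" by (rule sum.swap)
  also have "\<dots> = overlap G X f g"
    unfolding overlap_def using X(1) f0(2) by (intro sum.cong refl) (simp add: sum.delta)
  finally show ?thesis .
qed

text \<open>With the identity in place of \<Phi> the result is \<open>overlap\<close> times
  \<open>lam g b\<close>: for s = g t the coefficient is put back exactly where it was taken from.
  The error made by \<Phi> is summed only over these pairs, whose weights total
  \<open>overlap\<close> \<le> 1, so \<delta> is not multiplied by the number of pairs.\<close>

lemma avg_lam_close:
  assumes g: "g \<in> carrier G" and b: "b \<in> carrier (fibre B g)"
    and \<delta>: "0 \<le> \<delta>" "\<And>p. p \<in> X \<times> X \<Longrightarrow> ||\<Phi> (co p (lam g b)) \<ominus>\<^sub>Be co p (lam g b)||\<^sub>S.gns \<le> \<delta>"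
  shows "||avg (lam g b) \<ominus>\<^sub>RA lam g b||\<^sub>R.gns \<le> \<delta> + (1 - overlap G X f g) * ||lam g b||\<^sub>R.gns"
proof -
  let ?L = "lam g b" and ?ov = "overlap G X f g"
  let ?k = "\<lambda>p. if fst p = g \<otimes> snd p then f (fst p) * f (snd p) else 0"
  have L: "?L \<in> carrier RA" by (rule lam_RA[OF g b])
  note cc = co_closed[OF _ L]
  have ov: "0 \<le> ?ov" "?ov \<le> 1" using f0(1) overlap_le_1[OF w g] by (auto simp: overlap_def intro!: sum_nonneg)
  have sc: "sw p (co p ?L) = of_real (?k p) \<odot>\<^sub>RA ?L" if p: "p \<in> X \<times> X" for p
  proof (cases "fst p = g \<otimes> snd p")
    case True
    note s = XX(2)[OF p] and t = XX(3)[OF p]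
    have "inv (fst p) \<otimes> g \<otimes> snd p = \<one>" using True s t g by (simp add: m_assoc)
    with sandwich_down[OF s t g b] obtain e where e: "e \<in> carrier Be" "ras (uu (fst p)) \<otimes>\<^sub>RA ?L \<otimes>\<^sub>RA uu (snd p) = iota e"
      by auto
    then have "iota (co p ?L) = ras (uu (fst p)) \<otimes>\<^sub>RA ?L \<otimes>\<^sub>RA uu (snd p)" by (simp add: co_def Ex_iota)
    then show ?thesis using sandwich_inverse[OF s t L] True by (simp add: sw_def)
  next
    case False
    then show ?thesis using co_zero[OF p g b] D.clinear_map_zero[OF sw_linear[OF p] A.seminormed_axioms] L by simp
  qed
  have "(\<Oplus>\<^sub>RA p\<in>X \<times> X. sw p (co p ?L)) = (\<Oplus>\<^sub>RA p\<in>X \<times> X. of_real (?k p) \<odot>\<^sub>RA ?L)"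
    using sc L by (intro A.finsum_cong') auto
  also have "\<dots> = of_real ?ov \<odot>\<^sub>RA ?L"
    using L overlap_pairs[OF g] by (subst A.finsum_smult_const[OF XX(1) L]) (simp only: of_real_sum[symmetric])
  finally have id: "(\<Oplus>\<^sub>RA p\<in>X \<times> X. sw p (co p ?L)) = of_real ?ov \<odot>\<^sub>RA ?L" .
  let ?e = "\<lambda>p. \<Phi> (co p ?L) \<ominus>\<^sub>Be co p ?L"
  have ec: "?e p \<in> carrier Be" if "p \<in> X \<times> X" for p using cc[OF that] by simp
  have eP: "(\<lambda>p. sw p (?e p)) \<in> X \<times> X \<rightarrow> carrier RA" using sw_closed ec by auto
  have "avg ?L = (\<Oplus>\<^sub>RA p\<in>X \<times> X. sw p (?e p) \<oplus>\<^sub>RA sw p (co p ?L))" unfolding avg_def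
  proof (rule A.finsum_cong'[OF refl])
    fix p assume p: "p \<in> X \<times> X"
    have "sw p (?e p \<oplus>\<^sub>Be co p ?L) = sw p (?e p) \<oplus>\<^sub>RA sw p (co p ?L)"
      using sw_linear[OF p] ec[OF p] cc[OF p] unfolding clinear_map_def by blast
    then show "sw p (\<Phi> (co p ?L)) = sw p (?e p) \<oplus>\<^sub>RA sw p (co p ?L)" using cc[OF p] by (simp add: D.diff_add_cancel)
  qed (use sw_closed ec cc in auto)
  also have "\<dots> = (\<Oplus>\<^sub>RA p\<in>X \<times> X. sw p (?e p)) \<oplus>\<^sub>RA of_real ?ov \<odot>\<^sub>RA ?L"
    unfolding id[symmetric] using eP sw_closed cc by (intro A.finsum_addf) auto
  finally have a: "avg ?L = (\<Oplus>\<^sub>RA p\<in>X \<times> X. sw p (?e p)) \<oplus>\<^sub>RA of_real ?ov \<odot>\<^sub>RA ?L" .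
  have Ec: "(\<Oplus>\<^sub>RA p\<in>X \<times> X. sw p (?e p)) \<in> carrier RA" by (rule A.finsum_closed[OF eP])
  have "||\<Oplus>\<^sub>R.gns p\<in>X \<times> X. sw p (?e p)||\<^sub>R.gns \<le> (\<Sum>p\<in>X \<times> X. ||sw p (?e p)||\<^sub>R.gns)"
    using eP by (intro R.N.H.nrm_finsum_le XX(1)) simp
  also have "\<dots> \<le> (\<Sum>p\<in>X \<times> X. ?k p * \<delta>)"
  proof (rule sum_mono)
    fix p assume p: "p \<in> X \<times> X"
    show "||sw p (?e p)||\<^sub>R.gns \<le> ?k p * \<delta>"
    proof (cases "fst p = g \<otimes> snd p")
      case True
      then show ?thesis unfolding sw_gns[OF p ec[OF p]] using \<delta>(2)[OF p] f0(1) by (auto intro!: mult_left_mono)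
    next
      case False
      then have "?e p = \<zero>\<^sub>Be"
        using co_zero[OF p g b] D.clinear_map_zero[OF Phi_linear D.seminormed_axioms] by simp
      then show ?thesis using False D.clinear_map_zero[OF sw_linear[OF p] A.seminormed_axioms] R.N.H.nrm_0 by simp
    qed
  qed
  also have "\<dots> = ?ov * \<delta>" by (simp only: sum_distrib_right[symmetric] overlap_pairs[OF g])
  also have "\<dots> \<le> \<delta>" using ov \<delta>(1) by (simp add: mult_left_le_one_le)
  finally have 1: "||\<Oplus>\<^sub>RA p\<in>X \<times> X. sw p (?e p)||\<^sub>R.gns \<le> \<delta>" by simp
  have "avg ?L \<ominus>\<^sub>RA ?L = (\<Oplus>\<^sub>RA p\<in>X \<times> X. sw p (?e p)) \<oplus>\<^sub>RA (of_real ?ov \<odot>\<^sub>RA ?L \<ominus>\<^sub>RA ?L)"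
    unfolding a using Ec L by (simp add: A.minus_eq A.a_assoc)
  also have "of_real ?ov \<odot>\<^sub>RA ?L \<ominus>\<^sub>RA ?L = of_real (?ov - 1) \<odot>\<^sub>RA ?L"
    using A.smult_diff_l[OF L, of "of_real ?ov" 1] L by simp
  finally have "||avg ?L \<ominus>\<^sub>RA ?L||\<^sub>R.gns \<le> ||\<Oplus>\<^sub>RA p\<in>X \<times> X. sw p (?e p)||\<^sub>R.gns + ||of_real (?ov - 1) \<odot>\<^sub>RA ?L||\<^sub>R.gns"
    using R.N.H.nrm_triangle[of "\<Oplus>\<^sub>RA p\<in>X \<times> X. sw p (?e p)" "of_real (?ov - 1) \<odot>\<^sub>RA ?L"] Ec L by simp
  moreover have "||of_real (?ov - 1) \<odot>\<^sub>RA ?L||\<^sub>R.gns = (1 - ?ov) * ||?L||\<^sub>R.gns"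
    using R.N.H.nrm_smult[of ?L "of_real (?ov - 1)"] L ov by (simp add: norm_of_real[symmetric] del: norm_of_real of_real_diff add: norm_of_real)
  ultimately show ?thesis using 1 by linarith
qed

end

section \<open>The Haagerup property of the bundle and of its reduced algebra\<close>

context crossed begin

lemma lam_inj:
  assumes g: "g \<in> carrier G" and a: "a \<in> carrier (fibre B g)" and b: "b \<in> carrier (fibre B g)" and e: "lam g a = lam g b"
  shows "a = b"
proof -
  interpret V: banach_space "fibre B g" by (rule fibre_banach[OF g])
  have "lam g (a \<ominus>\<^sub>(fibre B g) b) = lam g a \<ominus>\<^sub>RA lam g b"
    by (rule V.clinear_map_diff[OF RA_lam_linear[OF g] A.seminormed_axioms a b])
  also have "\<dots> = \<zero>\<^sub>RA" using lam_RA[OF g b] by (simp add: e)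
  finally have "||a \<ominus>\<^sub>(fibre B g) b||\<^sub>(fibre B g) = 0" using lam_nrm[OF g, of "a \<ominus>\<^sub>(fibre B g) b"] a b by simp
  then show ?thesis using a b by (simp add: V.nrm_eq_0 V.diff_eq_0_iff)
qed

abbreviation "Fs g \<equiv> fibre_seminormed B \<psi> g"

lemma Fs_simps [simp]: "carrier (Fs g) = carrier (fibre B g)" "add (Fs g) = add (fibre B g)" "zero (Fs g) = zero (fibre B g)"
  "smult (Fs g) = smult (fibre B g)" "a_minus (Fs g) = a_minus (fibre B g)"
  by (simp_all add: fibre_seminormed_def a_minus_def[abs_def] a_inv_def)

lemma Fs_nrm: "\<lbrakk>g \<in> carrier G; b \<in> carrier (fibre B g)\<rbrakk> \<Longrightarrow> ||b||\<^sub>(Fs g) = ||lam g b||\<^sub>R.gns"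
  using bstar_closed[of g b] F.q_closed[of g b b]
  by (simp add: fibre_seminormed_def R.nrm_gns RA_lam_star RA_lam_mult Ex_iota)

lemma Fs_seminormed: assumes g: "g \<in> carrier G" shows "seminormed (Fs g)"
proof -
  interpret V: banach_space "fibre B g" by (rule fibre_banach[OF g])
  have m: "module complex_field (Fs g)" by (rule module_cong(1)[OF V.module_axioms]) simp_all
  show ?thesis by (rule seminormed.intro[OF m], unfold_locales)
      (use g lam_RA[OF g] R.N.H.nrm_triangle R.N.H.nrm_smult in \<open>auto simp: Fs_nrm RA_lam_add RA_lam_smult\<close>)
qed

lemma Fs_ndist:
  assumes g: "g \<in> carrier G" and a: "a \<in> carrier (fibre B g)" and b: "b \<in> carrier (fibre B g)"
  shows "ndist (Fs g) a b = ndist R.gns (lam g a) (lam g b)"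
proof -
  interpret V: banach_space "fibre B g" by (rule fibre_banach[OF g])
  interpret W: seminormed "Fs g" by (rule Fs_seminormed[OF g])
  show ?thesis
    using a b lam_RA[OF g a] lam_RA[OF g b] V.clinear_map_diff[OF RA_lam_linear[OF g] A.seminormed_axioms a b]
    by (simp add: W.ndist_eq R.N.H.ndist_eq Fs_nrm[OF g])
qed

text \<open>What \<open>cstar_haagerup\<close> asks of a single map, with compactness expressed on
  the seminormed space, and with the contractivity in the GNS seminorm that extends convergence from
  generators to the whole algebra.\<close>

definition "good_map \<Psi> \<longleftrightarrow> completely_positive RA \<Psi> \<and> contractive_map RA RA \<Psi> \<and>
  (\<forall>a. positive RA a \<longrightarrow> Re (\<psi> (Ex (\<Psi> a))) \<le> Re (\<psi> (Ex a))) \<and>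
  (\<forall>x\<in>carrier RA. ||\<Psi> x||\<^sub>R.gns \<le> ||x||\<^sub>R.gns) \<and> totally_bounded_op R.gns \<Psi>"

definition "good_bundle_map T \<longleftrightarrow> bundle_map G B T \<and> positive_definite G B T \<and> contractive_map Be Be (T \<one>) \<and>
  (\<forall>b\<in>carrier Be. positive Be b \<longrightarrow> Re (\<psi> (T \<one> b)) \<le> Re (\<psi> b)) \<and>
  (\<forall>g\<in>carrier G. compact_op (fibre_hilbert B \<psi> g) (fibre_op B \<psi> T g)) \<and>
  vanishes_at_infinity G (\<lambda>g. op_norm (fibre_hilbert B \<psi> g) (fibre_op B \<psi> T g))"

end

section \<open>The bundle map induced by the averaged map\<close>

context averaging begin

text \<open>A term survives only if s = g t, and then its output has degree s t^-1 = g.\<close>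

lemma avg_lam_range:
  assumes g: "g \<in> carrier G" and b: "b \<in> carrier (fibre B g)"
  shows "\<exists>e\<in>carrier (fibre B g). lam g e = avg (lam g b)"
proof -
  interpret V: banach_space "fibre B g" by (rule fibre_banach[OF g])
  have z: "lam g \<zero>\<^sub>(fibre B g) = \<zero>\<^sub>RA" by (rule V.clinear_map_zero[OF RA_lam_linear[OF g] A.seminormed_axioms])
  have "\<exists>e\<in>carrier (fibre B g). sw p (\<Phi> (co p (lam g b))) = lam g e" if p: "p \<in> X \<times> X" for p
  proof (cases "fst p = g \<otimes> snd p")
    case True
    note s = XX(2)[OF p] and t = XX(3)[OF p]
    have "fst p \<otimes> inv (snd p) = g" using True t g by (simp add: m_assoc)
    with sandwich_up[OF s t Phi_closed[OF co_closed[OF p lam_RA[OF g b]]]]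
    obtain e where "e \<in> carrier (fibre B g)"
      "uu (fst p) \<otimes>\<^sub>RA iota (\<Phi> (co p (lam g b))) \<otimes>\<^sub>RA ras (uu (snd p)) = lam g e" by auto
    then show ?thesis
      by (intro bexI[of _ "of_real (f (fst p) * f (snd p)) \<odot>\<^sub>(fibre B g) e"]) (auto simp: sw_def RA_lam_smult[OF g])
  next
    case False
    then show ?thesis using term_zero[OF p g b] z by (intro bexI[of _ "\<zero>\<^sub>(fibre B g)"]) auto
  qed
  then obtain e where e: "\<And>p. p \<in> X \<times> X \<Longrightarrow> e p \<in> carrier (fibre B g)"
    "\<And>p. p \<in> X \<times> X \<Longrightarrow> sw p (\<Phi> (co p (lam g b))) = lam g (e p)" by metis
  have "lam g (\<Oplus>\<^sub>(fibre B g)p\<in>X \<times> X. e p) = (\<Oplus>\<^sub>RA p\<in>X \<times> X. lam g (e p))"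
    using e(1) by (intro V.clinear_map_finsum[OF RA_lam_linear[OF g] A.seminormed_axioms XX(1)]) auto
  also have "\<dots> = avg (lam g b)" unfolding avg_def using e lam_RA[OF g] by (intro A.finsum_cong') auto
  finally show ?thesis using e(1) by (intro bexI[of _ "\<Oplus>\<^sub>(fibre B g)p\<in>X \<times> X. e p"] V.finsum_closed) auto
qed

text \<open>The restriction of \<open>avg\<close> to the image of the fibre over g, pulled back
  along \<open>lam g\<close>. The choice is unique because \<open>lam g\<close> is
  injective.\<close>

definition "bm g b = (SOME e. e \<in> carrier (fibre B g) \<and> lam g e = avg (lam g b))"

lemma bm: assumes "g \<in> carrier G" "b \<in> carrier (fibre B g)"
  shows "bm g b \<in> carrier (fibre B g)" and "lam g (bm g b) = avg (lam g b)"
  using someI_ex[of "\<lambda>e. e \<in> carrier (fibre B g) \<and> lam g e = avg (lam g b)"] avg_lam_range[OF assms]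
  unfolding bm_def by blast+

lemma bm_linear: assumes g: "g \<in> carrier G" shows "clinear_map (fibre B g) (fibre B g) (bm g)"
proof -
  interpret V: banach_space "fibre B g" by (rule fibre_banach[OF g])
  show ?thesis unfolding clinear_map_def
  proof (intro conjI ballI allI funcsetI)
    fix a c assume a: "a \<in> carrier (fibre B g)"
    show "bm g a \<in> carrier (fibre B g)" by (rule bm(1)[OF g a])
    have "lam g (bm g (c \<odot>\<^sub>(fibre B g) a)) = lam g (c \<odot>\<^sub>(fibre B g) bm g a)"
      using g a bm(1)[OF g a] lam_RA[OF g a] avg_linear by (simp add: bm RA_lam_smult clinear_map_def)
    then show "bm g (c \<odot>\<^sub>(fibre B g) a) = c \<odot>\<^sub>(fibre B g) bm g a"
      by (rule lam_inj[OF g, rotated 2]) (use a bm(1)[OF g] in auto)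
    fix b assume b: "b \<in> carrier (fibre B g)"
    have "lam g (bm g (a \<oplus>\<^sub>(fibre B g) b)) = lam g (bm g a \<oplus>\<^sub>(fibre B g) bm g b)"
      using g a b bm(1)[OF g] lam_RA[OF g] avg_linear by (simp add: bm RA_lam_add clinear_map_def)
    then show "bm g (a \<oplus>\<^sub>(fibre B g) b) = bm g a \<oplus>\<^sub>(fibre B g) bm g b"
      by (rule lam_inj[OF g, rotated 2]) (use a b bm(1)[OF g] in auto)
  qed
qed

lemma bm_nrm: "\<lbrakk>g \<in> carrier G; b \<in> carrier (fibre B g)\<rbrakk> \<Longrightarrow> ||bm g b||\<^sub>(fibre B g) \<le> ||b||\<^sub>(fibre B g)"
  using avg_contractive lam_RA[of g b] by (simp add: lam_nrm[symmetric] bm contractive_map_def)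

text \<open>Without a pair satisfying s = g t every term of the average vanishes. Hence only the
  finitely many fibres over quotients s t^-1 are affected, which gives vanishing at
  infinity.\<close>

lemma bm_off_support:
  assumes g: "g \<in> carrier G" and b: "b \<in> carrier (fibre B g)" and ne: "g \<notin> (\<lambda>p. fst p \<otimes> inv (snd p)) ` (X \<times> X)"
  shows "bm g b = \<zero>\<^sub>(fibre B g)"
proof -
  interpret V: banach_space "fibre B g" by (rule fibre_banach[OF g])
  have "avg (lam g b) = \<zero>\<^sub>RA" unfolding avg_def
  proof (rule A.add.finprod_one_eqI)
    fix p assume p: "p \<in> X \<times> X"
    have "fst p \<noteq> g \<otimes> snd p"
    proof
      assume "fst p = g \<otimes> snd p"
      then have "g = fst p \<otimes> inv (snd p)" using XX(3)[OF p] g by (simp add: m_assoc)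
      then show False using ne p by blast
    qed
    then show "sw p (\<Phi> (co p (lam g b))) = \<zero>\<^sub>RA" by (rule term_zero[OF p g b])
  qed
  then have "lam g (bm g b) = lam g \<zero>\<^sub>(fibre B g)"
    using V.clinear_map_zero[OF RA_lam_linear[OF g] A.seminormed_axioms] by (simp add: bm[OF g b])
  then show ?thesis by (rule lam_inj[OF g bm(1)[OF g b] V.zero_closed])
qed

text \<open>The matrix with entries \<open>avg\<close> of l_i* l_j is positive by complete
  positivity, and its form at the column of the adjoints of the m_i has summands of degree
  \<gamma>_i \<gamma>_i^-1 \<gamma>_j \<gamma>_j^-1 = e. Under E these are the summands in the
  definition of positive definiteness.\<close>

lemma bm_positive_definite: "positive_definite G B bm" unfolding positive_definite_def
proof (intro allI impI)
  fix n :: nat and \<gamma> a b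
  assume "\<forall>i<n. \<gamma> i \<in> carrier G \<and> a i \<in> carrier (fibre B (\<gamma> i)) \<and> b i \<in> carrier (fibre B (\<gamma> i))"
  then have h: "\<gamma> i \<in> carrier G" "a i \<in> carrier (fibre B (\<gamma> i))" "b i \<in> carrier (fibre B (\<gamma> i))" if "i \<in> {..<n}" for i
    using that by auto
  define l where "l i = lam (\<gamma> i) (a i)" for i
  define m where "m i = lam (\<gamma> i) (b i)" for i
  have lc: "l i \<in> carrier RA" "m i \<in> carrier RA" if "i \<in> {..<n}" for i
    using h[OF that] by (auto simp: l_def m_def lam_RA)
  let ?t = "\<lambda>i j. bmult B (bmult B (b i) (bm (inv (\<gamma> i) \<otimes> \<gamma> j) (bmult B (bstar B (a i)) (a j)))) (bstar B (b j))"
  \<comment> \<open>The double adjoint of m_i matches the shape of the form in \<open>gpos\<close>,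
    whose left factor is the adjoint of a column entry.\<close>
  let ?y = "\<lambda>i j. ras (ras (m i)) \<otimes>\<^sub>RA (avg (ras (l i) \<otimes>\<^sub>RA l j) \<otimes>\<^sub>RA ras (m j))"
  have "gpos RA {..<n} (\<lambda>i j. ras (l i) \<otimes>\<^sub>RA l j)" using lc by (intro A.gpos_rank_one) auto
  from A.cp_gpos[OF avg_cp finite_lessThan this] have gp: "gpos RA {..<n} (\<lambda>i j. avg (ras (l i) \<otimes>\<^sub>RA l j))" .
  have xP: "(\<lambda>i. ras (m i)) \<in> {..<n} \<rightarrow> carrier RA" using lc by auto
  have "positive RA (\<Oplus>\<^sub>RA i\<in>{..<n}. \<Oplus>\<^sub>RA j\<in>{..<n}. ?y i j)"
    using gp[unfolded gpos_def, THEN conjunct2, THEN bspec, OF xP] .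
  from Ex_positive[OF this] have p: "positive Be (Ex (\<Oplus>\<^sub>RA i\<in>{..<n}. \<Oplus>\<^sub>RA j\<in>{..<n}. ?y i j))" .
  have yc: "?y i j \<in> carrier RA" if "i \<in> {..<n}" "j \<in> {..<n}" for i j using lc that avg_closed by auto
  have E: "Ex (?y i j) = ?t i j" "?t i j \<in> carrier Be" if i: "i \<in> {..<n}" and j: "j \<in> {..<n}" for i j
  proof -
    note hi = h[OF i] and hj = h[OF j]
    note ii = inv_closed[OF hi(1)] and ij = inv_closed[OF hj(1)]
    note k = m_closed[OF ii hj(1)]
    note c = bmult_closed[OF ii hj(1) bstar_closed[OF hi(1,2)] hj(2)]
    note t = bm(1)[OF k c]
    note bt = bmult_closed[OF hi(1) k hi(3) t] and bs = bstar_closed[OF hj(1,3)]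
    note tt = bmult_closed[OF m_closed[OF hi(1) k] ij bt bs]
    have e1: "\<gamma> i \<otimes> (inv (\<gamma> i) \<otimes> \<gamma> j) \<otimes> inv (\<gamma> j) = \<one>" using hi hj by (simp add: cancel_inv_left)
    show "?t i j \<in> carrier Be" using tt e1 by simp
    have "ras (l i) \<otimes>\<^sub>RA l j = lam (inv (\<gamma> i) \<otimes> \<gamma> j) (bmult B (bstar B (a i)) (a j))"
      unfolding l_def RA_lam_star[OF hi(1,2)] by (rule RA_lam_mult[OF ii hj(1) bstar_closed[OF hi(1,2)] hj(2)])
    then have "avg (ras (l i) \<otimes>\<^sub>RA l j) = lam (inv (\<gamma> i) \<otimes> \<gamma> j) (bm (inv (\<gamma> i) \<otimes> \<gamma> j) (bmult B (bstar B (a i)) (a j)))"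
      using bm(2)[OF k c] by simp
    moreover have "m i \<otimes>\<^sub>RA lam (inv (\<gamma> i) \<otimes> \<gamma> j) (bm (inv (\<gamma> i) \<otimes> \<gamma> j) (bmult B (bstar B (a i)) (a j))) \<otimes>\<^sub>RA ras (m j) = iota (?t i j)"
      unfolding m_def RA_lam_star[OF hj(1,3)] RA_lam_mult[OF hi(1) k hi(3) t] RA_lam_mult[OF m_closed[OF hi(1) k] ij bt bs] e1 ..
    ultimately have "?y i j = iota (?t i j)" using lc[OF i] lc[OF j] lam_RA[OF k t] by (simp add: A.m_assoc)
    then show "Ex (?y i j) = ?t i j" using tt e1 by (simp add: Ex_iota)
  qed
  have "Ex (\<Oplus>\<^sub>RA i\<in>{..<n}. \<Oplus>\<^sub>RA j\<in>{..<n}. ?y i j) = (\<Oplus>\<^sub>Be i\<in>{..<n}. Ex (\<Oplus>\<^sub>RA j\<in>{..<n}. ?y i j))"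
    by (rule A.clinear_map_finsum[OF Ex_linear D.seminormed_axioms finite_lessThan]) (use yc in \<open>auto intro!: A.finsum_closed\<close>)
  also have "\<dots> = (\<Oplus>\<^sub>Be i\<in>{..<n}. \<Oplus>\<^sub>Be j\<in>{..<n}. ?t i j)"
  proof (rule D.finsum_cong'[OF refl])
    show "(\<lambda>i. \<Oplus>\<^sub>Be j\<in>{..<n}. ?t i j) \<in> {..<n} \<rightarrow> carrier Be" using E(2) by (auto intro!: D.finsum_closed)
    fix i assume i: "i \<in> {..<n}"
    have "Ex (\<Oplus>\<^sub>RA j\<in>{..<n}. ?y i j) = (\<Oplus>\<^sub>Be j\<in>{..<n}. Ex (?y i j))"
      by (rule A.clinear_map_finsum[OF Ex_linear D.seminormed_axioms finite_lessThan]) (use yc[OF i] in auto)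
    also have "\<dots> = (\<Oplus>\<^sub>Be j\<in>{..<n}. ?t i j)" using E[OF i] by (intro D.finsum_cong') auto
    finally show "Ex (\<Oplus>\<^sub>RA j\<in>{..<n}. ?y i j) = (\<Oplus>\<^sub>Be j\<in>{..<n}. ?t i j)" .
  qed
  finally show "positive Be (\<Oplus>\<^sub>Be i\<in>{..<n}. \<Oplus>\<^sub>Be j\<in>{..<n}. ?t i j)" using p by simp
qed

lemma bm_Fs: assumes g: "g \<in> carrier G" shows "clinear_map (Fs g) (Fs g) (bm g)" and "bounded_map (Fs g) (Fs g) (bm g)"
  using bm_linear[OF g] avg_gns lam_RA[OF g]
  by (auto simp: clinear_map_def bounded_map_def Fs_nrm[OF g] bm[OF g] intro!: exI[of _ 1])

text \<open>A net for \<open>avg\<close> consists of elements of the reduced algebra that need not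
  come from the fibre over g. This is where \<open>totally_bounded_opI\<close> is applied with an
  ambient space different from V.\<close>

lemma bm_totally_bounded:
  assumes tb: "totally_bounded_op R.gns avg" and g: "g \<in> carrier G" shows "totally_bounded_op (Fs g) (bm g)"
proof -
  interpret W: seminormed "Fs g" by (rule Fs_seminormed[OF g])
  show ?thesis
  proof (rule W.totally_bounded_opI[OF _ R.N.H.seminormed_axioms, of _ "lam g"])
    fix \<epsilon> :: real assume "\<epsilon> > 0"
    from tb[unfolded totally_bounded_op_def, rule_format, OF this] obtain K where
      K0: "finite K" "K \<subseteq> {x \<in> carrier R.gns. ||x||\<^sub>R.gns \<le> 1}"
      "\<forall>x\<in>carrier R.gns. ||x||\<^sub>R.gns \<le> 1 \<longrightarrow> (\<exists>k\<in>K. ndist R.gns (avg x) (avg k) < \<epsilon>)" by (elim exE conjE)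
    then have K: "finite K" "K \<subseteq> carrier RA"
      "\<And>x. \<lbrakk>x \<in> carrier RA; ||x||\<^sub>R.gns \<le> 1\<rbrakk> \<Longrightarrow> \<exists>k\<in>K. ndist R.gns (avg x) (avg k) < \<epsilon>" by auto
    show "\<exists>K. finite K \<and> K \<subseteq> carrier R.gns \<and>
        (\<forall>x\<in>carrier (Fs g). ||x||\<^sub>(Fs g) \<le> 1 \<longrightarrow> (\<exists>k\<in>K. ndist R.gns (lam g (bm g x)) k < \<epsilon>))"
    proof (intro exI[of _ "avg ` K"] conjI ballI impI)
      fix x assume "x \<in> carrier (Fs g)" "||x||\<^sub>(Fs g) \<le> 1"
      then show "\<exists>k\<in>avg ` K. ndist R.gns (lam g (bm g x)) k < \<epsilon>"
        using K(3)[of "lam g x"] lam_RA[OF g] by (simp add: bm[OF g] Fs_nrm[OF g])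
    qed (use K avg_closed in auto)
  qed (use g bm lam_RA Fs_ndist in auto)
qed

lemma good_avg: assumes "totally_bounded_op S.gns \<Phi>" shows "good_map avg"
  using avg_cp avg_contractive avg_decr avg_gns avg_totally_bounded[OF assms] by (simp add: good_map_def)

lemma good_bm: assumes tb: "totally_bounded_op S.gns \<Phi>" shows "good_bundle_map bm" unfolding good_bundle_map_def
proof (intro conjI ballI impI)
  have "\<exists>C. \<forall>x\<in>carrier (fibre B g). ||bm g x||\<^sub>(fibre B g) \<le> C * ||x||\<^sub>(fibre B g)" if "g \<in> carrier G" for g
    using bm_nrm[OF that] by (intro exI[of _ 1]) simp
  then show "bundle_map G B bm" using bm_linear by (simp add: bundle_map_def bounded_map_def)
  show "positive_definite G B bm" by (rule bm_positive_definite)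
  show "contractive_map Be Be (bm \<one>)" using bm_nrm[OF one_closed] by (simp add: contractive_map_def)
  \<comment> \<open>On the neutral fibre E inverts \<open>lam\<close>, which transfers the decrease
    of \<psi> from \<open>avg\<close> to the bundle map.\<close>
  have bm1: "bm \<one> b = Ex (avg (iota b))" if "b \<in> carrier Be" for b
    using bm[OF one_closed, of b] that by (simp add: Ex_iota flip: bm)
  fix b assume b: "b \<in> carrier Be" "positive Be b"
  then show "Re (\<psi> (bm \<one> b)) \<le> Re (\<psi> b)" using avg_decr[OF iota_positive[OF b(2)]] by (simp add: bm1 Ex_iota)
next
  fix g assume g: "g \<in> carrier G"
  show "compact_op (fibre_hilbert B \<psi> g) (fibre_op B \<psi> bm g)"
    unfolding fibre_hilbert_def fibre_op_def seminormed.compact_op_completion_iff[OF Fs_seminormed[OF g] bm_Fs[OF g]]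
    by (rule bm_totally_bounded[OF avg_totally_bounded[OF tb] g])
next
  let ?D = "(\<lambda>p. fst p \<otimes> inv (snd p)) ` (X \<times> X)"
  have z: "op_norm (fibre_hilbert B \<psi> g) (fibre_op B \<psi> bm g) = 0" if g: "g \<in> carrier G" and ne: "g \<notin> ?D" for g
  proof -
    interpret V: banach_space "fibre B g" by (rule fibre_banach[OF g])
    interpret W: seminormed "Fs g" by (rule Fs_seminormed[OF g])
    interpret C: banach_space "completion (Fs g)" by (rule W.banach_completion)
    have "||ext_op (Fs g) (bm g) Y||\<^sub>(completion (Fs g)) = 0" if Y: "Y \<in> carrier (completion (Fs g))" for Y
    proof -
      \<comment> \<open>The extension is computed on the chosen representative, and every term of
        that sequence is sent to zero.\<close>
      have "bm g (rep Y n) = \<zero>\<^sub>(Fs g)" for n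
        using bm_off_support[OF g _ ne] W.cauchy_closed[OF W.rep_completion(1)[OF Y]] by simp
      then have "ext_op (Fs g) (bm g) Y = \<zero>\<^sub>(completion (Fs g))" using Y by (simp add: ext_op_def W.completion_zero)
      then show ?thesis using C.nrm_0 by simp
    qed
    then have "(\<lambda>Y. ||ext_op (Fs g) (bm g) Y||\<^sub>(completion (Fs g))) ` {Y \<in> carrier (completion (Fs g)). ||Y||\<^sub>(completion (Fs g)) \<le> 1} = {0}"
      using C.zero_closed C.nrm_0 by (auto simp: image_iff intro!: exI[of _ "\<zero>\<^sub>(completion (Fs g))"])
    then show ?thesis by (simp add: op_norm_def fibre_hilbert_def fibre_op_def)
  qed
  show "vanishes_at_infinity G (\<lambda>g. op_norm (fibre_hilbert B \<psi> g) (fibre_op B \<psi> bm g))"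
    unfolding vanishes_at_infinity_def
  proof (intro allI impI)
    fix \<epsilon> :: real assume "\<epsilon> > 0"
    then have "{g \<in> carrier G. \<epsilon> \<le> \<bar>op_norm (fibre_hilbert B \<psi> g) (fibre_op B \<psi> bm g)\<bar>} \<subseteq> ?D" using z by force
    then show "finite {g \<in> carrier G. \<epsilon> \<le> \<bar>op_norm (fibre_hilbert B \<psi> g) (fibre_op B \<psi> bm g)\<bar>}"
      by (rule finite_subset) (simp add: X(1))
  qed
qed

end

section \<open>Simultaneous approximation and assembly of the nets\<close>

context crossed begin

text \<open>Strong convergence is applied to the classes of the finitely many elements of C.
  Compactness on the completion is translated back to total boundedness on \<open>B_e\<close> with
  the GNS seminorm.\<close>

lemma approximating_maps:
  assumes h: "cstar_haagerup Be \<psi>" and C: "finite C" "C \<subseteq> carrier Be" and \<delta>: "\<delta> > 0"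
  shows "\<exists>\<Phi>. completely_positive Be \<Phi> \<and> contractive_map Be Be \<Phi> \<and> (\<forall>a. positive Be a \<longrightarrow> Re (\<psi> (\<Phi> a)) \<le> Re (\<psi> a)) \<and>
    totally_bounded_op S.gns \<Phi> \<and> (\<forall>c\<in>C. ||\<Phi> c \<ominus>\<^sub>Be c||\<^sub>S.gns < \<delta>)"
proof -
  let ?c = "\<lambda>v. seq_class S.gns (\<lambda>n. v)"
  let ?P = "\<lambda>\<Phi>. completely_positive Be \<Phi> \<and> contractive_map Be Be \<Phi> \<and>
    (\<forall>a\<in>carrier Be. positive Be a \<longrightarrow> Re (\<psi> (\<Phi> a)) \<le> Re (\<psi> a)) \<and> compact_op (completion S.gns) (ext_op S.gns \<Phi>)"
  from h obtain F where F: "F \<noteq> bot" "eventually ?P F"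
    "\<And>Y. Y \<in> carrier (completion S.gns) \<Longrightarrow> ((\<lambda>\<Phi>. ndist (completion S.gns) (ext_op S.gns \<Phi> Y) Y) \<longlongrightarrow> 0) F"
    unfolding cstar_haagerup_def gns_space_def gns_op_def by blast
  have "\<forall>\<^sub>F \<Phi> in F. ndist (completion S.gns) (ext_op S.gns \<Phi> (?c c)) (?c c) < \<delta>" if "c \<in> C" for c
  proof -
    have "?c c \<in> carrier (completion S.gns)"
      using that C(2) by (intro S.N.H.seq_class_closed S.N.H.cauchy_const) auto
    from tendstoD[OF F(3)[OF this] \<delta>] show ?thesis by (rule eventually_mono) simp
  qed
  then have "\<forall>\<^sub>F \<Phi> in F. \<forall>c\<in>C. ndist (completion S.gns) (ext_op S.gns \<Phi> (?c c)) (?c c) < \<delta>"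
    using C(1) by (intro eventually_ball_finite) auto
  with F(2) have "\<forall>\<^sub>F \<Phi> in F. ?P \<Phi> \<and> (\<forall>c\<in>C. ndist (completion S.gns) (ext_op S.gns \<Phi> (?c c)) (?c c) < \<delta>)"
    by (rule eventually_conj)
  from eventually_happens'[OF F(1) this] obtain \<Phi> where P: "?P \<Phi>"
    and d: "\<And>c. c \<in> C \<Longrightarrow> ndist (completion S.gns) (ext_op S.gns \<Phi> (?c c)) (?c c) < \<delta>" by blast
  have dec: "Re (\<psi> (\<Phi> a)) \<le> Re (\<psi> a)" if "positive Be a" for a using P D.positive_closed[OF that] that by blast
  have "||\<Phi> \<one>\<^sub>Be||\<^sub>Be \<le> 1" using P D.nrm_one_le by (force simp: contractive_map_def)
  then have "||\<Phi> x||\<^sub>S.gns \<le> 1 * ||x||\<^sub>S.gns" if "x \<in> carrier Be" for x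
    using S.cp_gns_contractive[of \<Phi> x] P dec that by simp
  then have b: "bounded_map S.gns S.gns \<Phi>" unfolding bounded_map_def by (intro exI[of _ 1]) auto
  have l: "clinear_map S.gns S.gns \<Phi>" using P by (simp add: completely_positive_def clinear_map_def)
  have "||\<Phi> c \<ominus>\<^sub>Be c||\<^sub>S.gns < \<delta>" if "c \<in> C" for c
    using d[OF that] S.N.H.ndist_ext_op_const[OF l b, of c] C(2) that P D.cp_closed[of \<Phi> c]
    by (auto simp: S.N.H.ndist_eq subset_iff)
  moreover have "totally_bounded_op S.gns \<Phi>" using P S.N.H.compact_op_completion_iff[OF l b] by simp
  ultimately show ?thesis using P dec by blast
qed

text \<open>The weights are chosen first, invariant enough under the degrees occurring in K. They
  fix the finite set of coefficients that \<Phi> must nearly preserve. One choice of weights and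
  \<Phi> serves both the reduced algebra and the bundle, since T is the restriction of \<Psi> to the
  fibres.\<close>

lemma approximation:
  assumes am: "cstar_amenable G B" and h: "cstar_haagerup Be \<psi>" and \<epsilon>: "\<epsilon> > 0"
    and K: "finite K" "K \<subseteq> (SIGMA g:carrier G. carrier (fibre B g))"
  shows "\<exists>\<Psi> T. good_map \<Psi> \<and> good_bundle_map T \<and>
    (\<forall>k\<in>K. lam (fst k) (T (fst k) (snd k)) = \<Psi> (lam (fst k) (snd k)) \<and>
       ndist R.gns (\<Psi> (lam (fst k) (snd k))) (lam (fst k) (snd k)) < \<epsilon>)"
proof -
  have KD: "fst k \<in> carrier G" "snd k \<in> carrier (fibre B (fst k))" if "k \<in> K" for k using K(2) that by auto
  let ?L = "\<lambda>k. lam (fst k) (snd k)"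
  have L: "?L k \<in> carrier RA" if "k \<in> K" for k using KD[OF that] by (rule lam_RA)
  \<comment> \<open>A common bound for the GNS norms of the elements to be approximated. The weights
    may lose \<epsilon>/(2(M + 1)), so that multiplied by M the loss stays below \<epsilon>/2; the
    added 1 covers M = 0.\<close>
  define M where "M = (\<Sum>k\<in>K. ||?L k||\<^sub>R.gns)"
  have nn: "0 \<le> ||?L k||\<^sub>R.gns" if "k \<in> K" for k using R.N.H.nrm_nonneg[of "?L k"] L[OF that] by simp
  have M: "0 \<le> M" "\<And>k. k \<in> K \<Longrightarrow> ||?L k||\<^sub>R.gns \<le> M"
    unfolding M_def using nn K(1) by (auto intro!: sum_nonneg member_le_sum)
  have "finite (fst ` K)" "fst ` K \<subseteq> carrier G" "\<epsilon> / (2 * (M + 1)) > 0" using K(1) KD(1) M(1) \<epsilon> by auto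
  from weights_exist[OF am this] obtain X f where
    X: "weight G X f" "\<And>g. g \<in> fst ` K \<Longrightarrow> 1 - \<epsilon> / (2 * (M + 1)) < overlap G X f g" by blast
  \<comment> \<open>All coefficients of the given elements at pairs from the finite support of the
    weights; it is finite, so a single \<Phi> handles it.\<close>
  define C where "C = (\<lambda>(k, p). Ex (ras (uu (fst p)) \<otimes>\<^sub>RA ?L k \<otimes>\<^sub>RA uu (snd p))) ` (K \<times> (X \<times> X))"
  have XG: "finite X" "X \<subseteq> carrier G" using X(1) by (auto simp: weight_def)
  have "finite C" using K(1) XG by (simp add: C_def)
  moreover have "C \<subseteq> carrier Be" using L XG(2) by (auto simp: C_def intro!: Ex_closed A.m_closed A.star_closed uu_closed)
  ultimately obtain \<Phi> where \<Phi>: "completely_positive Be \<Phi>" "contractive_map Be Be \<Phi>"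
    "\<And>a. positive Be a \<Longrightarrow> Re (\<psi> (\<Phi> a)) \<le> Re (\<psi> a)" "totally_bounded_op S.gns \<Phi>"
    "\<And>c. c \<in> C \<Longrightarrow> ||\<Phi> c \<ominus>\<^sub>Be c||\<^sub>S.gns < \<epsilon> / 2"
    using approximating_maps[OF h, of C "\<epsilon> / 2"] \<epsilon> by (metis half_gt_zero)
  interpret V: averaging G B u \<psi> X f \<Phi> by unfold_locales (use X(1) \<Phi> in auto)
  show ?thesis
  proof (intro exI conjI ballI)
    show "good_map V.avg" by (rule V.good_avg[OF \<Phi>(4)])
    show "good_bundle_map V.bm" by (rule V.good_bm[OF \<Phi>(4)])
    fix k assume k: "k \<in> K"
    show "lam (fst k) (V.bm (fst k) (snd k)) = V.avg (?L k)" by (rule V.bm(2)[OF KD[OF k]])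
    have "||\<Phi> (V.co p (?L k)) \<ominus>\<^sub>Be V.co p (?L k)||\<^sub>S.gns \<le> \<epsilon> / 2" if "p \<in> X \<times> X" for p
    proof -
      have "V.co p (?L k) \<in> C" unfolding C_def V.co_def using k that by (intro image_eqI[of _ _ "(k, p)"]) auto
      then show ?thesis using \<Phi>(5) by (simp add: less_imp_le)
    qed
    from V.avg_lam_close[OF KD[OF k] _ this]
    have "||V.avg (?L k) \<ominus>\<^sub>RA ?L k||\<^sub>R.gns \<le> \<epsilon> / 2 + (1 - overlap G X f (fst k)) * ||?L k||\<^sub>R.gns" using \<epsilon> by simp
    also have "(1 - overlap G X f (fst k)) * ||?L k||\<^sub>R.gns \<le> \<epsilon> / (2 * (M + 1)) * M"
      using X(2)[of "fst k"] k M nn[OF k] \<epsilon> by (intro mult_mono) auto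
    also have "\<dots> < \<epsilon> / 2" using M(1) \<epsilon> by (simp add: field_simps)
    finally show "ndist R.gns (V.avg (?L k)) (?L k) < \<epsilon>"
      using L[OF k] V.avg_closed[OF L[OF k]] by (simp add: R.N.H.ndist_eq)
  qed
qed

text \<open>The net is indexed by finite sets of pairs (g, b). The degree has to be kept with b
  because the fibres need not be disjoint. Since \<open>lam g\<close> is isometric for the GNS
  seminorms, approximation in the reduced algebra is approximation in the fibre.\<close>

lemma bundle_haagerup:
  assumes am: "cstar_amenable G B" and h: "cstar_haagerup Be \<psi>" shows "bundle_haagerup G B \<psi>"
proof -
  let ?I = "SIGMA g:carrier G. carrier (fibre B g)"
  have "\<exists>F. F \<noteq> bot \<and> eventually good_bundle_map F \<and>
      (\<forall>k\<in>?I. ((\<lambda>T. ndist (Fs (fst k)) (T (fst k) (snd k)) (snd k)) \<longlongrightarrow> 0) F)"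
  proof (rule net_filter)
    fix K :: "('a \<times> 'c) set" and \<epsilon> :: real assume K: "finite K" "K \<subseteq> ?I" "\<epsilon> > 0"
    from approximation[OF am h K(3,1,2)] obtain \<Psi> T where T: "good_bundle_map T"
      "\<And>k. k \<in> K \<Longrightarrow> lam (fst k) (T (fst k) (snd k)) = \<Psi> (lam (fst k) (snd k))"
      "\<And>k. k \<in> K \<Longrightarrow> ndist R.gns (\<Psi> (lam (fst k) (snd k))) (lam (fst k) (snd k)) < \<epsilon>" by blast
    show "\<exists>T. good_bundle_map T \<and> (\<forall>k\<in>K. ndist (Fs (fst k)) (T (fst k) (snd k)) (snd k) < \<epsilon>)"
    proof (intro exI[of _ T] conjI T(1) ballI)
      fix k assume k: "k \<in> K"
      then have "fst k \<in> carrier G" "snd k \<in> carrier (fibre B (fst k))" using K(2) by auto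
      moreover from this have "T (fst k) (snd k) \<in> carrier (fibre B (fst k))"
        using T(1) by (auto simp: good_bundle_map_def bundle_map_def clinear_map_def)
      ultimately show "ndist (Fs (fst k)) (T (fst k) (snd k)) (snd k) < \<epsilon>"
        using T(2,3)[OF k] by (simp add: Fs_ndist)
    qed
  next
    fix k T assume "k \<in> ?I"
    then have "fst k \<in> carrier G" by auto
    then show "0 \<le> ndist (Fs (fst k)) (T (fst k) (snd k)) (snd k)" by (intro seminormed.ndist_nonneg Fs_seminormed)
  qed
  then obtain F where F: "F \<noteq> bot" "eventually good_bundle_map F"
    "\<And>k. k \<in> ?I \<Longrightarrow> ((\<lambda>T. ndist (Fs (fst k)) (T (fst k) (snd k)) (snd k)) \<longlongrightarrow> 0) F" by blast
  have "((\<lambda>T. ndist (Fs g) (T g b) b) \<longlongrightarrow> 0) F" if "g \<in> carrier G" "b \<in> carrier (fibre B g)" for g b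
    using F(3)[of "(g, b)"] that by simp
  then show ?thesis unfolding bundle_haagerup_def using F(1,2) unfolding good_bundle_map_def by blast
qed

lemma reduced_haagerup:
  assumes am: "cstar_amenable G B" and h: "cstar_haagerup Be \<psi>"
  shows "cstar_haagerup RA (\<lambda>x. \<psi> (expectation G B x))"
proof -
  let ?I = "SIGMA g:carrier G. carrier (fibre B g)"
  let ?L = "\<lambda>k. lam (fst k) (snd k)"
  have "\<exists>F. F \<noteq> bot \<and> eventually good_map F \<and> (\<forall>k\<in>?I. ((\<lambda>\<Psi>. ndist R.gns (\<Psi> (?L k)) (?L k)) \<longlongrightarrow> 0) F)"
  proof (rule net_filter)
    fix K and \<epsilon> :: real assume K: "finite K" "K \<subseteq> ?I" "\<epsilon> > 0"
    from approximation[OF am h K(3,1,2)]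
    show "\<exists>\<Psi>. good_map \<Psi> \<and> (\<forall>k\<in>K. ndist R.gns (\<Psi> (?L k)) (?L k) < \<epsilon>)" by blast
  qed (rule R.N.H.ndist_nonneg)
  then obtain F where F: "F \<noteq> bot" "eventually good_map F"
    "\<And>k. k \<in> ?I \<Longrightarrow> ((\<lambda>\<Psi>. ndist R.gns (\<Psi> (?L k)) (?L k)) \<longlongrightarrow> 0) F" by blast
  have gD: "clinear_map RA RA \<Psi>" "\<And>x. x \<in> carrier RA \<Longrightarrow> \<Psi> x \<in> carrier RA"
    "\<And>x. x \<in> carrier RA \<Longrightarrow> ||\<Psi> x||\<^sub>R.gns \<le> ||x||\<^sub>R.gns" if "good_map \<Psi>" for \<Psi>
    using that A.cp_closed[of \<Psi>] by (auto simp: good_map_def completely_positive_def)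
  \<comment> \<open>The filter controls generators only. Sums follow from linearity; norm limits
    follow because the maps are contractive in the GNS seminorm and this seminorm is at most the
    norm.\<close>
  have conv: "((\<lambda>\<Psi>. ndist R.gns (\<Psi> x) x) \<longlongrightarrow> 0) F" if "x \<in> carrier RA" for x using that
  proof (induction x rule: RA_induct)
    case (gen g b)
    then show ?case using F(3)[of "(g, b)"] by simp
  next
    case (add x y)
    show ?case
    proof (rule Lim_null_comparison[OF _ tendsto_add_zero[OF add(3,4)]])
      show "\<forall>\<^sub>F \<Psi> in F. norm (ndist R.gns (\<Psi> (x \<oplus>\<^sub>RA y)) (x \<oplus>\<^sub>RA y)) \<le> ndist R.gns (\<Psi> x) x + ndist R.gns (\<Psi> y) y"
        using F(2)
      proof eventually_elim
        case (elim \<Psi>)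
        note c = gD(2)[OF elim add(1)] gD(2)[OF elim add(2)] add(1,2)
        have "\<Psi> (x \<oplus>\<^sub>RA y) = \<Psi> x \<oplus>\<^sub>RA \<Psi> y" using gD(1)[OF elim] add(1,2) by (simp add: clinear_map_def)
        then have "\<Psi> (x \<oplus>\<^sub>RA y) \<ominus>\<^sub>RA (x \<oplus>\<^sub>RA y) = (\<Psi> x \<ominus>\<^sub>RA x) \<oplus>\<^sub>RA (\<Psi> y \<ominus>\<^sub>RA y)"
          using c by (simp add: A.minus_eq A.minus_add A.a_ac)
        then show ?case using c gD(2)[OF elim, of "x \<oplus>\<^sub>RA y"] R.N.H.nrm_triangle[of "\<Psi> x \<ominus>\<^sub>RA x" "\<Psi> y \<ominus>\<^sub>RA y"]
            R.N.H.nrm_nonneg[of "(\<Psi> x \<ominus>\<^sub>RA x) \<oplus>\<^sub>RA (\<Psi> y \<ominus>\<^sub>RA y)"] by (simp add: R.N.H.ndist_eq)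
      qed
    qed
  next
    case (lim s l)
    show ?case
    proof (rule tendstoI)
      fix e :: real assume e: "e > 0"
      from order_tendstoD(2)[OF lim(3), of "e / 4"] e obtain n where n: "ndist RA (s n) l < e / 4"
        by (auto simp: eventually_sequentially)
      have sl: "||l \<ominus>\<^sub>RA s n||\<^sub>R.gns < e / 4"
        using R.gns_le[of "l \<ominus>\<^sub>RA s n"] n lim(1,2) A.nrm_diff_sym[of l "s n"] by (simp add: A.ndist_eq)
      have "\<forall>\<^sub>F \<Psi> in F. dist (ndist R.gns (\<Psi> (s n)) (s n)) 0 < e / 4" using e by (intro tendstoD lim(4)) simp
      with F(2) show "\<forall>\<^sub>F \<Psi> in F. dist (ndist R.gns (\<Psi> l) l) 0 < e"
      proof eventually_elim
        case (elim \<Psi>)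
        note c = gD(2)[OF elim(1) lim(1)[of n]] gD(2)[OF elim(1) lim(2)] lim(1)[of n] lim(2)
        have "ndist R.gns (\<Psi> l) (\<Psi> (s n)) = ||\<Psi> (l \<ominus>\<^sub>RA s n)||\<^sub>R.gns"
          using c A.clinear_map_diff[OF gD(1)[OF elim(1)] A.seminormed_axioms lim(2) lim(1)[of n]] by (simp add: R.N.H.ndist_eq)
        also have "\<dots> \<le> ||l \<ominus>\<^sub>RA s n||\<^sub>R.gns" using c by (intro gD(3)[OF elim(1)]) simp
        finally have 1: "ndist R.gns (\<Psi> l) (\<Psi> (s n)) < e / 4" using sl by simp
        have 2: "ndist R.gns (s n) l < e / 4" using sl c R.N.H.ndist_sym[of l "s n"] by (simp add: R.N.H.ndist_eq)
        have "ndist R.gns (\<Psi> l) l \<le> ndist R.gns (\<Psi> l) (\<Psi> (s n)) + (ndist R.gns (\<Psi> (s n)) (s n) + ndist R.gns (s n) l)"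
          using R.N.H.ndist_triangle[of "\<Psi> l" "\<Psi> (s n)" l] R.N.H.ndist_triangle[of "\<Psi> (s n)" "s n" l] c by simp
        then show ?case using 1 2 elim(2) R.N.H.ndist_nonneg e by simp
      qed
    qed
  qed
  let ?\<phi> = "\<lambda>x. \<psi> (expectation G B x)"
  \<comment> \<open>\<open>expectation\<close> is known to agree with \<open>Ex\<close> only on the
    reduced algebra, so the two GNS records are different terms. Their seminorms and distances agree
    there, and the results about R are moved to Q.\<close>
  interpret Q: pos_functional RA ?\<phi>
    by unfold_locales (auto simp: expectation_eq R.fn_add R.fn_smult R.fn_pos A.positive_closed)
  have qn: "||x||\<^sub>Q.gns = ||x||\<^sub>R.gns" if "x \<in> carrier RA" for x
    using that by (simp add: Q.nrm_gns R.nrm_gns expectation_eq)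
  have qd: "ndist Q.gns = ndist R.gns" by (intro ext) (simp add: ndist_def qn)
  have good: "clinear_map Q.gns Q.gns \<Psi>" "\<forall>x\<in>carrier Q.gns. ||\<Psi> x||\<^sub>Q.gns \<le> ||x||\<^sub>Q.gns"
    "compact_op (completion Q.gns) (ext_op Q.gns \<Psi>)" if g: "good_map \<Psi>" for \<Psi>
  proof -
    show l: "clinear_map Q.gns Q.gns \<Psi>" using gD(1)[OF g] by (simp add: clinear_map_def)
    show c: "\<forall>x\<in>carrier Q.gns. ||\<Psi> x||\<^sub>Q.gns \<le> ||x||\<^sub>Q.gns" using gD(2,3)[OF g] by (simp add: qn)
    then have b: "bounded_map Q.gns Q.gns \<Psi>" by (auto simp: bounded_map_def intro!: exI[of _ 1])
    have ball: "{x \<in> carrier Q.gns. ||x||\<^sub>Q.gns \<le> 1} = {x \<in> carrier R.gns. ||x||\<^sub>R.gns \<le> 1}" using qn by auto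
    have "totally_bounded_op R.gns \<Psi>" using g by (simp add: good_map_def)
    then have "totally_bounded_op Q.gns \<Psi>" unfolding totally_bounded_op_def ball qd by (simp add: qn)
    then show "compact_op (completion Q.gns) (ext_op Q.gns \<Psi>)" using Q.N.H.compact_op_completion_iff[OF l b] by simp
  qed
  show ?thesis unfolding cstar_haagerup_def gns_space_def gns_op_def
  proof (intro exI[of _ F] conjI ballI F(1))
    show "\<forall>\<^sub>F \<Psi> in F. completely_positive RA \<Psi> \<and> contractive_map RA RA \<Psi> \<and>
        (\<forall>a\<in>carrier RA. positive RA a \<longrightarrow> Re (?\<phi> (\<Psi> a)) \<le> Re (?\<phi> a)) \<and> compact_op (completion Q.gns) (ext_op Q.gns \<Psi>)"
      using F(2)
    proof eventually_elim
      case (elim \<Psi>)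
      then show ?case using gD(2)[OF elim] good(3)[OF elim] by (auto simp: good_map_def expectation_eq)
    qed
    fix Y assume "Y \<in> carrier (completion Q.gns)"
    then show "((\<lambda>\<Psi>. ndist (completion Q.gns) (ext_op Q.gns \<Psi> Y) Y) \<longlongrightarrow> 0) F"
      by (rule Q.N.H.tendsto_ext_op[rotated 2])
        (use good conv in \<open>auto simp: qd intro: eventually_mono[OF F(2)]\<close>)
  qed
qed

end

theorem theorem5p4:
  fixes G :: "('g, 'm) monoid_scheme" and B :: "('g, 'b) bundle_data"
    and u :: "'g \<Rightarrow> 'b" and \<psi> :: "'b \<Rightarrow> complex"
  assumes "unital_fell_bundle G B"
    and "unitary_section G B u"
    and "cstar_amenable G B"
    and "invariant_state G B (section_action B u) \<psi>"
    and "cstar_haagerup (unit_fibre G B) \<psi>"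
  shows "amenable_group G \<and> bundle_haagerup G B \<psi> \<and>
    cstar_haagerup (reduced_algebra G B) (\<lambda>x. \<psi> (expectation G B x))"
proof -
  interpret crossed G B u \<psi>
    using assms by (intro crossed.intro crossed_axioms.intro)
  have "amenable_group G" by (rule amenable_groupI) (rule weights_exist[OF assms(3)])
  then show ?thesis using bundle_haagerup reduced_haagerup assms(3,5) by blast
qed

end
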